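(* Let $(W_t)_{t\ge0}$ be a Brownian motion in $\mathbb{R}^d$ independent of a process $(U_t)_{t\ge0}$ in $[0,\infty)$ with nondecreasing càdlàg paths, $U_0=0$ and $U_t>0$ for all $t>0$. Let $\Omega\subset\mathbb{R}^d$ be a bounded open interval when $d=1$, or a bounded connected $C^{1,1}$ open set when $d\ge2$. Suppose that for every $\delta>0$, $$\mathbb{P}(U_t>\delta)=o\big(\mathbb{E}[\sqrt{U_t}\,\mathbf{1}_{\{U_t\le\delta\}}]\big)\quad\text{as }t\downarrow0,$$ and that for all $\delta_1,\delta_2>0$, $$\lim_{t\downarrow0}\frac{\mathbb{E}[\sqrt{U_t}\,\mathbf{1}_{\{U_t\le\delta_1\}}]}{\mathbb{E}[\sqrt{U_t}\,\mathbf{1}_{\{U_t\le\delta_2\}}]}=1.$$ Then for every $\delta>0$, $$\lim_{t\downarrow0}\frac{|\Omega|-\tilde Q^{W\circ U}_\Omega(t)}{\mathbb{E}[\sqrt{U_t}\,\mathbf{1}_{\{U_t\le\delta\}}]}=\frac{2|\partial\Omega|}{\sqrt\pi} \quad\text{and}\quad \lim_{t\downarrow0}\frac{|\Omega|-\mathbb{H}^{W\circ U}_\Omega(t)}{\mathbb{E}[\sqrt{U_t}\,\mathbf{1}_{\{U_t\le\delta\}}]}=\frac{|\partial\Omega|}{\sqrt\pi}.$$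
   Context: Brownian motion: $(W_t)$ is normalized so that $\mathbb{E}_0[e^{-i\langle\xi,W_t\rangle}]=e^{-t|\xi|^2}$ (generator $\Delta$). Under $\mathbb{P}_x$ (the product of the law of $W$ started at $x$ and the law of the independent process $U$) $W_0=x$; $\mathbb{P},\mathbb{E}$ without subscript refer to the law of $U$. Heat contents: $\tau^W_\Omega=\inf\{t>0: W_t\in\Omega^c\}$. The killed process is $W^\Omega_t=W_t$ for $t<\tau^W_\Omega$ and $W^\Omega_t=\partial$ (a cemetery state, not in $\Omega$) for $t\ge\tau^W_\Omega$. The spectral heat content of the time-changed killed process $(W^\Omega_{U_t})$ is $\tilde Q^{W\circ U}_\Omega(t)=\int_\Omega\mathbb{P}_x(\tau^{W^\Omega\circ U}_\Omega>t)\,dx$, where $\tau^{W^\Omega\circ U}_\Omega=\inf\{t>0: W^\Omega_{U_t}\notin\Omega\}$. The regular heat content is $\mathbb{H}^{W\circ U}_\Omega(t)=\int_\Omega\mathbb{P}_x(W_{U_t}\in\Omega)\,dx$. $|\Omega|$ is $d$-dimensional Lebesgue measure and $|\partial\Omega|$ is the $(d-1)$-dimensional measure of the boundary (number of boundary points when $d=1$). *)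

theory Defs
  imports "HOL-Probability.Probability" "HOL-Library.Landau_Symbols"
begin

section \<open>Processes\<close>

text \<open>
  Brownian motion with generator the Laplacian, under a law \<open>N\<close> that starts it at \<open>x\<close>.  The last
  condition is the normalisation \<open>E exp (- i \<langle>\<xi>, W\<^sub>t\<rangle>) = exp (- t \<bar>\<xi>\<bar>\<^sup>2)\<close>, stated for all increments, so
  it makes them stationary and Gaussian with covariance \<open>2 (t - s) I\<close>.
\<close>

definition brownian_motion ::
    "'w measure \<Rightarrow> 'a::euclidean_space \<Rightarrow> (real \<Rightarrow> 'w \<Rightarrow> 'a) \<Rightarrow> bool" where
  "brownian_motion N x W \<longleftrightarrow>
     prob_space N \<and>
     (\<forall>t\<ge>0. W t \<in> borel_measurable N) \<and>
     (AE \<omega> in N. W 0 \<omega> = x) \<and>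
     (\<forall>\<omega>\<in>space N. continuous_on {0..} (\<lambda>t. W t \<omega>)) \<and>
     (\<forall>(n::nat) T. 0 \<le> T 0 \<and> (\<forall>i<n. T i \<le> T (Suc i)) \<longrightarrow>
        prob_space.indep_vars N (\<lambda>_. borel) (\<lambda>i \<omega>. W (T (Suc i)) \<omega> - W (T i) \<omega>) {..<n}) \<and>
     (\<forall>s t. 0 \<le> s \<and> s \<le> t \<longrightarrow>
        (\<forall>\<xi>. (CLINT \<omega>|N. exp (- (\<i> * complex_of_real (\<xi> \<bullet> (W t \<omega> - W s \<omega>)))))
            = complex_of_real (exp (- ((t - s) * (norm \<xi>)\<^sup>2)))))"

definition cadlag :: "(real \<Rightarrow> real) \<Rightarrow> bool" where
  "cadlag u \<longleftrightarrow>
     (\<forall>t\<ge>0. continuous (at_right t) u) \<and>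
     (\<forall>t>0. \<exists>l. (u \<longlongrightarrow> l) (at_left t))"

definition time_change :: "'u measure \<Rightarrow> (real \<Rightarrow> 'u \<Rightarrow> real) \<Rightarrow> bool" where
  "time_change M U \<longleftrightarrow>
     prob_space M \<and>
     (\<forall>t\<ge>0. U t \<in> borel_measurable M) \<and>
     (\<forall>\<omega>\<in>space M.
        (\<forall>t\<ge>0. 0 \<le> U t \<omega>) \<and>
        mono_on {0..} (\<lambda>t. U t \<omega>) \<and>
        cadlag (\<lambda>t. U t \<omega>) \<and>
        U 0 \<omega> = 0 \<and>
        (\<forall>t>0. 0 < U t \<omega>))"

definition truncated_sqrt_mean ::
    "'u measure \<Rightarrow> (real \<Rightarrow> 'u \<Rightarrow> real) \<Rightarrow> real \<Rightarrow> real \<Rightarrow> real" where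
  "truncated_sqrt_mean M U \<delta> t = (LINT \<omega>|M. sqrt (U t \<omega>) * indicator {..\<delta>} (U t \<omega>))"


section \<open>Heat contents\<close>

text \<open>The value is \<open>\<infinity>\<close> for a path that never leaves.\<close>

definition exit_time :: "'b set \<Rightarrow> (real \<Rightarrow> 'b) \<Rightarrow> ereal" where
  "exit_time D w = Inf {ereal t |t. 0 < t \<and> w t \<notin> D}"

text \<open>\<open>None\<close> is the cemetery state; accordingly \<open>\<Omega>\<close>, as a subset of the enlarged state space, is
  \<open>Some ` \<Omega>\<close>.\<close>

definition killed :: "'a set \<Rightarrow> (real \<Rightarrow> 'a) \<Rightarrow> real \<Rightarrow> 'a option" where
  "killed \<Omega> w t = (if ereal t < exit_time \<Omega> w then Some (w t) else None)"

text \<open>In both heat contents, \<open>N x\<close> is the law under which \<open>W\<close> starts at \<open>x\<close>, \<open>M\<close> is the law of \<open>U\<close>,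
  and the product \<open>N x \<Otimes>\<^sub>M M\<close> is the joint law of the independent pair.\<close>

definition spectral_heat_content ::
    "('a::euclidean_space \<Rightarrow> 'w measure) \<Rightarrow> (real \<Rightarrow> 'w \<Rightarrow> 'a) \<Rightarrow> 'u measure \<Rightarrow> (real \<Rightarrow> 'u \<Rightarrow> real) \<Rightarrow>
     'a set \<Rightarrow> real \<Rightarrow> real" where
  "spectral_heat_content N W M U \<Omega> t =
     (LINT x:\<Omega>|lborel.
        \<P>(p in N x \<Otimes>\<^sub>M M.
           exit_time (Some ` \<Omega>) (\<lambda>s. killed \<Omega> (\<lambda>r. W r (fst p)) (U s (snd p))) > ereal t))"

definition regular_heat_content ::
    "('a::euclidean_space \<Rightarrow> 'w measure) \<Rightarrow> (real \<Rightarrow> 'w \<Rightarrow> 'a) \<Rightarrow> 'u measure \<Rightarrow> (real \<Rightarrow> 'u \<Rightarrow> real) \<Rightarrow>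
     'a set \<Rightarrow> real \<Rightarrow> real" where
  "regular_heat_content N W M U \<Omega> t =
     (LINT x:\<Omega>|lborel. \<P>(p in N x \<Otimes>\<^sub>M M. W (U t (snd p)) (fst p) \<in> \<Omega>))"


section \<open>Domains and the measure of the boundary\<close>

text \<open>
  \<open>C\<^sup>1\<^sup>,\<^sup>1\<close> open sets with localisation radius \<open>R\<close> and constant \<open>\<Lambda>\<close>.  An orthonormal coordinate system
  centred at a boundary point \<open>z\<close> enters through its last axis \<open>\<nu>\<close>; the hyperplane \<open>H\<close> orthogonal to
  \<open>\<nu>\<close> plays the role of \<open>\<real>\<^sup>d\<^sup>-\<^sup>1\<close>, and only the values of \<open>\<phi>\<close> on \<open>H\<close> matter.  \<open>g\<close> is the gradient
  of \<open>\<phi>\<close>.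
\<close>

definition C11_graph :: "real \<Rightarrow> 'a::euclidean_space set \<Rightarrow> ('a \<Rightarrow> real) \<Rightarrow> bool" where
  "C11_graph \<Lambda> H \<phi> \<longleftrightarrow>
     \<phi> 0 = 0 \<and>
     (\<exists>g. (\<forall>y\<in>H. g y \<in> H \<and> (\<phi> has_derivative (\<lambda>h. g y \<bullet> h)) (at y within H)) \<and>
          g 0 = 0 \<and>
          (\<forall>y\<in>H. norm (g y) \<le> \<Lambda>) \<and>
          (\<forall>y\<in>H. \<forall>y'\<in>H. norm (g y - g y') \<le> \<Lambda> * norm (y - y')))"

definition C11_open_set :: "'a::euclidean_space set \<Rightarrow> bool" where
  "C11_open_set \<Omega> \<longleftrightarrow>
     open \<Omega> \<and>
     (\<exists>R>0. \<exists>\<Lambda>>0. \<forall>z\<in>frontier \<Omega>. \<exists>\<nu> \<phi>.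
        norm \<nu> = 1 \<and>
        C11_graph \<Lambda> {h. h \<bullet> \<nu> = 0} \<phi> \<and>
        \<Omega> \<inter> ball z R =
          {y. (y - z) \<bullet> \<nu> > \<phi> ((y - z) - ((y - z) \<bullet> \<nu>) *\<^sub>R \<nu>)} \<inter> ball z R)"

text \<open>
  \<open>k\<close>-dimensional Hausdorff measure, normalised by the volume of the \<open>k\<close>-dimensional unit ball so
  that it is surface area on \<open>k\<close>-dimensional submanifolds.  Covering sets must be bounded because
  \<^const>\<open>diameter\<close> is meaningless otherwise, and the empty set is given weight \<open>0\<close> explicitly
  because \<open>0 ^ 0 = 1\<close>.
\<close>

definition hausdorff_premeasure :: "nat \<Rightarrow> real \<Rightarrow> 'a::euclidean_space set \<Rightarrow> ennreal" where
  "hausdorff_premeasure k \<epsilon> A =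
     (INF C \<in> {C :: nat \<Rightarrow> 'a set. A \<subseteq> (\<Union>i. C i) \<and> (\<forall>i. bounded (C i) \<and> diameter (C i) \<le> \<epsilon>)}.
        \<Sum>i. if C i = {} then 0 else ennreal (unit_ball_vol (real k) * (diameter (C i) / 2) ^ k))"

definition hausdorff_measure :: "nat \<Rightarrow> 'a::euclidean_space set \<Rightarrow> ennreal" where
  "hausdorff_measure k A = (SUP \<epsilon>\<in>{0<..}. hausdorff_premeasure k \<epsilon> A)"

definition boundary_measure :: "'a::euclidean_space set \<Rightarrow> real" where
  "boundary_measure \<Omega> =
     (if DIM('a) = 1 then real (card (frontier \<Omega>))
      else enn2real (hausdorff_measure (DIM('a) - 1) (frontier \<Omega>)))"

end

theory Submission imports Defs begin

text \<open>
  A bounded \<open>C\<^sup>1\<^sup>,\<^sup>1\<close> set looks like a half-space near each of its boundary points, and within a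
  short time \<open>u\<close> Brownian motion travels a distance of order \<open>\<surd>u\<close>. Heat is therefore lost only
  from a layer of that width along the boundary. Let \<open>x\<close> be at distance \<open>r\<close> from the complement,
  let \<open>z\<close> be the nearest boundary point and \<open>\<nu>\<close> the inner normal there. Up to errors that vanish
  relative to \<open>\<surd>u\<close>, the path from \<open>x\<close> leaves \<open>\<Omega>\<close> before time \<open>u\<close> when the maximum of its component
  along \<open>- \<nu>\<close> exceeds \<open>r\<close>, and it lies outside at time \<open>u\<close> when the final value of that component
  exceeds \<open>r\<close>. The generator is the Laplacian, so that component has variance \<open>2u\<close>: with a
  standard normal \<open>Z\<close> its final value is distributed as \<open>\<surd>(2u) Z\<close>, and by the reflection principle
  its maximum is distributed as \<open>\<surd>(2u) \<bar>Z\<bar>\<close>. This is \<open>brownian_boundary_layer_profile\<close>.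

  Integrating over \<open>\<Omega>\<close> and exchanging the two integrals turns \<open>P(\<surd>u Y > dist(x, - \<Omega>))\<close> into the
  expected volume of the set of points of \<open>\<Omega>\<close> within \<open>\<surd>u Y\<close> of the complement. A tube of small
  width \<open>r\<close> has volume \<open>r \<bar>\<partial>\<Omega>\<bar>\<close> to first order, so the loss is \<open>\<surd>u \<bar>\<partial>\<Omega>\<bar> E[max 0 Y]\<close> to first order
  (\<open>boundary_layer_integral_tendsto\<close>). The two constants come from \<open>E[\<surd>2 \<bar>Z\<bar>] = 2 / \<surd>\<pi>\<close> and
  \<open>E[max 0 (\<surd>2 Z)] = 1 / \<surd>\<pi>\<close>.

  That the volume of the tube is governed by the Hausdorff measure of the boundary is
  \<open>inner_tube_content_tendsto\<close>. Hausdorff measure charges a covering set as if it were a ball of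
  the same diameter. In one direction, the part of the tube belonging to a covering set projects
  along \<open>\<nu>\<close> onto a subset of a hyperplane of nearly the same diameter; the isodiametric
  inequality, which follows from the inequality of Prekopa and Leindler, bounds its area by that
  of the ball. In the other direction, Vitali's lemma fills the boundary with disjoint small
  balls, and over each of them the tube contains a sheared cylinder whose base is a slightly
  smaller disc.

  It remains to pass to the time change. As \<open>U\<close> is nondecreasing and right-continuous, the
  time-changed killed process has not exited by time \<open>t\<close> precisely when \<open>W\<close> stays in \<open>\<Omega>\<close> on the
  interval from \<open>0\<close> (excluded) to \<open>U\<^sub>t\<close> (\<open>time_changed_killed_alive_iff\<close>). By independence the
  deficit in either heat content is \<open>E[g(U\<^sub>t)]\<close>, where \<open>g(u)\<close> is the heat lost by \<open>W\<close> at time \<open>u\<close>.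
  Here \<open>g\<close> is bounded and \<open>g(u) \<sim> c \<surd>u\<close> at \<open>0\<close>. On \<open>{U\<^sub>t \<le> d}\<close> with \<open>d\<close> small this gives \<open>c\<close> times
  the truncated mean of \<open>\<surd>U\<^sub>t\<close>, the tail hypothesis makes the rest negligible, and the ratio
  hypothesis makes the truncation level immaterial (\<open>time_change_asymptotics\<close>).

  Since nothing relates the laws \<open>N x\<close> for different starting points, the probabilities are first
  transported to \<open>N 0\<close>, where the path started at \<open>x\<close> is realised as \<open>x + (W\<^sub>r - W\<^sub>0)\<close>. Both have
  the same finite-dimensional laws, hence the same law (\<open>brownian_path_law\<close>), and the translated
  form depends measurably on \<open>x\<close>.
\<close>

section \<open>The isodiametric inequality\<close>

lemma ennreal_mult_less_mult:
  fixes a b c d :: ennreal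
  assumes "a < c" "b < d"
  shows "a * b < c * d"
proof (cases "d = top")
  case True
  then show ?thesis using assms
    by (metis ennreal_mult_eq_top_iff ennreal_mult_less_top order_less_le_trans not_less_zero
        top.not_eq_extremum top_greatest)
next
  case False
  then have "a * d < c * d"
    using assms by (intro ennreal_mult_strict_right_mono) (auto simp: less_top dest: le_less_trans[OF zero_le])
  moreover have "a * b \<le> a * d" using assms by (intro mult_left_mono) auto
  ultimately show ?thesis by (rule le_less_trans[rotated])
qed

text \<open>
  Inner regularity is available for finite measures, hence the cut-off to a large ball.
\<close>
lemma lborel_inner_compact_approx:
  fixes A :: "'a::euclidean_space set"
  assumes "A \<in> sets borel" "c < emeasure lborel A"
  shows "\<exists>K. compact K \<and> K \<subseteq> A \<and> c < emeasure lborel K"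
proof -
  have "emeasure lborel A = (SUP n. emeasure lborel (A \<inter> cball 0 (real n)))"
  proof -
    have "range (\<lambda>n. A \<inter> cball 0 (real n)) \<subseteq> sets lborel" using assms by auto
    moreover have "incseq (\<lambda>n. A \<inter> cball 0 (real n))" by (auto simp: incseq_def)
    moreover have "(\<Union>i. A \<inter> cball 0 (real i)) = A" 
      by (auto simp: real_arch_simple)
    ultimately show ?thesis using SUP_emeasure_incseq[of "\<lambda>n. A \<inter> cball 0 (real n)" lborel] by simp
  qed
  with assms(2) obtain n where n: "c < emeasure lborel (A \<inter> cball 0 (real n))"
    by (auto simp: less_SUP_iff)
  define B where "B = A \<inter> cball 0 (real n)"
  have B: "B \<in> sets borel" using assms by (auto simp: B_def)
  \<comment> \<open>The Lebesgue measure concentrated on \<open>B\<close> is a finite Borel measure on the whole space.\<close>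
  define D where "D = density lborel (indicator B :: 'a \<Rightarrow> ennreal)"
  have eD: "emeasure D X = emeasure lborel (B \<inter> X)" if "X \<in> sets borel" for X
    using that B unfolding D_def by (simp add: emeasure_restricted)
  have fin: "emeasure lborel B < \<infinity>"
    by (rule emeasure_bounded_finite) (auto simp: B_def)
  have "emeasure D B = (SUP K\<in>{K. K \<subseteq> B \<and> compact K}. emeasure D K)"
    using eD[of UNIV] fin B by (intro inner_regular) (auto simp: D_def)
  moreover have "emeasure D B = emeasure lborel B" using eD[of B] B by simp
  ultimately have "c < (SUP K\<in>{K. K \<subseteq> B \<and> compact K}. emeasure D K)"
    using n by (simp add: B_def)
  then obtain K where "K \<subseteq> B" "compact K" "c < emeasure D K"
    unfolding less_SUP_iff by blast
  moreover have "emeasure D K = emeasure lborel K"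
    using eD[of K] \<open>K \<subseteq> B\<close> \<open>compact K\<close> by (simp add: Int_absorb1 borel_compact)
  ultimately show ?thesis by (auto simp: B_def)
qed

lemma emeasure_lborel_half_diff:
  fixes B :: "real set" and s a :: real
  assumes "B \<in> sets borel" "\<bar>s\<bar> = 2"
  shows "2 * emeasure lborel ((\<lambda>b. a + b / s) ` B) = emeasure lborel B"
proof -
  have s: "s \<noteq> 0" using assms by auto
  have "lborel = density (distr lborel borel (\<lambda>x. - s * a + s *\<^sub>R x)) (\<lambda>_. \<bar>s\<bar> ^ DIM(real))"
    by (rule lborel_affine) (use s in auto)
  then have "emeasure lborel B = emeasure (density (distr lborel borel (\<lambda>x. - s * a + s *\<^sub>R x)) (\<lambda>_. \<bar>s\<bar> ^ DIM(real))) B"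
    by simp
  also have "\<dots> = 2 * emeasure lborel ((\<lambda>x. - s * a + s * x) -` B)"
    using assms by (simp add: emeasure_density nn_integral_cmult emeasure_distr)
  also have "(\<lambda>x. - s * a + s * x) -` B = (\<lambda>b. a + b / s) ` B"
    using s by (auto simp: image_iff field_simps intro!: bexI[of _ "- s * a + s * _"])
  finally show ?thesis by simp
qed

text \<open>
  The halved translates \<open>(min A - B) / 2\<close> and \<open>(A - min B) / 2\<close> both lie in \<open>C\<close>; the first is to
  the left of the second, and they meet in one point. The combination \<open>(a - b) / 2\<close> in place of
  \<open>(a + b) / 2\<close> is what the isodiametric inequality needs: it maps pairs from one set of diameter
  \<open>D\<close> into the centred ball of radius \<open>D / 2\<close>.
\<close>
lemma brunn_minkowski_real_compact:
  fixes A B C :: "real set"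
  assumes "compact A" "compact B" "A \<noteq> {}" "B \<noteq> {}" "C \<in> sets borel"
    and C: "\<And>a b. a \<in> A \<Longrightarrow> b \<in> B \<Longrightarrow> (a - b) / 2 \<in> C"
  shows "emeasure lborel A + emeasure lborel B \<le> 2 * emeasure lborel C"
proof -
  obtain a0 where a0: "a0 \<in> A" "\<And>a. a \<in> A \<Longrightarrow> a0 \<le> a"
    using compact_attains_inf[OF assms(1,3)] by blast
  obtain b0 where b0: "b0 \<in> B" "\<And>b. b \<in> B \<Longrightarrow> b0 \<le> b"
    using compact_attains_inf[OF assms(2,4)] by blast
  let ?E1 = "(\<lambda>b. a0 / 2 + b / (-2)) ` (B - {b0})"
  let ?E2 = "(\<lambda>a. - b0 / 2 + a / 2) ` A"
  have bs: "A \<in> sets borel" "B \<in> sets borel" using assms by (auto intro: borel_compact)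
  have "compact ?E2" using assms by (intro compact_continuous_image continuous_intros) auto
  then have m2: "?E2 \<in> sets borel" by (rule borel_compact)
  have "compact ((\<lambda>b. a0 / 2 + b / (-2)) ` B)" 
    using assms by (intro compact_continuous_image continuous_intros) auto
  moreover have "?E1 = (\<lambda>b. a0 / 2 + b / (-2)) ` B - {(a0 - b0)/2}" by (auto simp: field_simps)
  ultimately have m1: "?E1 \<in> sets borel" by (metis borel_compact borel_singleton sets.Diff sets.empty_sets)
  have "emeasure lborel B = emeasure lborel (B - {b0})"
    using bs b0(1) by (subst emeasure_Diff) auto
  also have "\<dots> = 2 * emeasure lborel ?E1"
    by (rule emeasure_lborel_half_diff[symmetric]) (use bs in auto)
  finally have 1: "emeasure lborel B = 2 * emeasure lborel ?E1" .
  have 2: "emeasure lborel A = 2 * emeasure lborel ?E2"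
    by (rule emeasure_lborel_half_diff[symmetric]) (use bs in auto)
  have dis: "?E1 \<inter> ?E2 = {}"
  proof -
    { fix a b assume ab: "a \<in> A" "b \<in> B" "b \<noteq> b0" "a0 / 2 + b / (-2) = - b0 / 2 + a / 2"
      have "b > b0" "a \<ge> a0" using ab a0(2)[of a] b0(2)[of b] by auto
      with ab(4) have False by (simp add: field_simps) }
    then show ?thesis by fastforce
  qed
  have sub: "?E1 \<union> ?E2 \<subseteq> C"
    using C[OF a0(1)] C[OF _ b0(1)] by (auto simp: field_simps)
  have "emeasure lborel A + emeasure lborel B = 2 * (emeasure lborel ?E1 + emeasure lborel ?E2)"
    unfolding 1 2 by (simp add: algebra_simps)
  also have "emeasure lborel ?E1 + emeasure lborel ?E2 = emeasure lborel (?E1 \<union> ?E2)"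
    using m1 m2 dis by (intro plus_emeasure) auto
  also have "\<dots> \<le> emeasure lborel C" using sub assms(5) by (intro emeasure_mono) auto
  finally show ?thesis by (auto simp: mult_left_mono)
qed

text \<open>
  Compact approximation from inside. The alternative \<open>c = 0\<close> takes care of sets of measure \<open>0\<close>,
  which contain no compact set of larger measure but do contain a point.
\<close>
lemma brunn_minkowski_real:
  fixes A B C :: "real set"
  assumes "A \<in> sets borel" "B \<in> sets borel" "A \<noteq> {}" "B \<noteq> {}" "C \<in> sets borel"
    and C: "\<And>a b. a \<in> A \<Longrightarrow> b \<in> B \<Longrightarrow> (a - b) / 2 \<in> C"
  shows "emeasure lborel A + emeasure lborel B \<le> 2 * emeasure lborel C"
proof -
  have inner: "\<exists>K. compact K \<and> K \<noteq> {} \<and> K \<subseteq> X \<and> c \<le> emeasure lborel K"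
    if X: "X \<in> sets borel" "X \<noteq> {}" "c < emeasure lborel X \<or> c = 0" for X :: "real set" and c
  proof (cases "c < emeasure lborel X")
    case True
    then obtain K where "compact K" "K \<subseteq> X" "c < emeasure lborel K"
      using lborel_inner_compact_approx[OF X(1) True] by blast
    then show ?thesis by (intro exI[of _ K]) auto
  next
    case False
    obtain x where "x \<in> X" using X(2) by auto
    with False X show ?thesis by (intro exI[of _ "{x}"]) auto
  qed
  have key: "c + d \<le> 2 * emeasure lborel C"
    if c: "c < emeasure lborel A \<or> c = 0" and d: "d < emeasure lborel B \<or> d = 0" for c d
  proof -
    obtain K L where "compact K" "K \<noteq> {}" "K \<subseteq> A" "c \<le> emeasure lborel K"
      and "compact L" "L \<noteq> {}" "L \<subseteq> B" "d \<le> emeasure lborel L"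
      using inner[OF assms(1,3) c] inner[OF assms(2,4) d] by blast
    moreover have "emeasure lborel K + emeasure lborel L \<le> 2 * emeasure lborel C"
      using calculation assms(5) C by (intro brunn_minkowski_real_compact) auto
    ultimately show ?thesis by (meson add_mono order_trans)
  qed
  have lim: "e + d \<le> r" if "\<And>c. c < e \<or> c = 0 \<Longrightarrow> c + d \<le> r" for d e r :: ennreal
  proof (cases "e = 0")
    case True
    then show ?thesis using that by simp
  next
    case False
    then have "0 \<in> {..<e}" by (simp add: zero_less_iff_neq_zero)
    then have "e = Sup {..<e}" "{..<e} \<noteq> {}" by auto
    then have "e + d = (SUP c\<in>{..<e}. c + d)"
      using ennreal_SUP_add_left[of "{..<e}" "\<lambda>x. x" d] by simp
    then show ?thesis using that by (simp add: SUP_le_iff)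
  qed
  have "emeasure lborel A + d \<le> 2 * emeasure lborel C" if d: "d < emeasure lborel B \<or> d = 0" for d
    by (rule lim) (rule key[OF _ d])
  then have "emeasure lborel B + emeasure lborel A \<le> 2 * emeasure lborel C"
    by (intro lim[of "emeasure lborel B"]) (simp add: add.commute[of _ "emeasure lborel A"])
  then show ?thesis by (simp add: add.commute)
qed

text \<open>
  With both suprema equal to \<open>1\<close>, all superlevel sets of \<open>f\<close> and \<open>g\<close> at levels below \<open>1\<close> are
  nonempty, and the hypothesis sends pairs of points from them to the superlevel set of \<open>h\<close> at the
  same level. The one-dimensional Brunn-Minkowski inequality applies level by level, and the layer
  cake formula adds the levels up.
\<close>
lemma prekopa_leindler_real_normalized:
  fixes f g h :: "real \<Rightarrow> ennreal"
  assumes [measurable]: "f \<in> borel_measurable borel" "g \<in> borel_measurable borel" "h \<in> borel_measurable borel"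
    and f: "(SUP x. f x) = 1" and g: "(SUP x. g x) = 1"
    and h: "\<And>x y. f x * g y \<le> (h ((x - y) / 2))\<^sup>2"
  shows "(\<integral>\<^sup>+x. f x \<partial>lborel) + (\<integral>\<^sup>+x. g x \<partial>lborel) \<le> 2 * (\<integral>\<^sup>+x. h x \<partial>lborel)"
proof -
  have layer: "(\<integral>\<^sup>+l. emeasure lborel {x. ennreal l < k x} * indicator {0<..<1} l \<partial>lborel) = (\<integral>\<^sup>+x. min 1 (k x) \<partial>lborel)"
    if [measurable]: "k \<in> borel_measurable borel" for k :: "real \<Rightarrow> ennreal"
  proof -
    have "(\<integral>\<^sup>+l. emeasure lborel {x. ennreal l < k x} * indicator {0<..<1} l \<partial>lborel)
       = (\<integral>\<^sup>+l. (\<integral>\<^sup>+x. indicator {x. ennreal l < k x} x * indicator {0<..<1} l \<partial>lborel) \<partial>lborel)"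
      by (intro nn_integral_cong) (auto simp: nn_integral_multc)
    also have "\<dots> = (\<integral>\<^sup>+x. (\<integral>\<^sup>+l. indicator {x. ennreal l < k x} x * indicator {0<..<1} l \<partial>lborel) \<partial>lborel)"
      by (rule lborel_pair.Fubini') measurable
    also have "\<dots> = (\<integral>\<^sup>+x. min 1 (k x) \<partial>lborel)"
    proof (intro nn_integral_cong)
      fix x
      obtain c where c: "c \<ge> 0" "min 1 (k x) = ennreal c" "c \<le> 1"
        using ennreal_cases[of "min 1 (k x)"]
        by (metis ennreal_1 ennreal_le_iff min.cobounded1 min.cobounded2 neq_top_trans ennreal_one_neq_top zero_le_one)
      have "(indicator {x. ennreal l < k x} x * indicator {0<..<1} l :: ennreal) = indicator {0<..<c} l" for l
      proof (cases "0 < l \<and> l < 1")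
        case True
        then have "ennreal l < k x \<longleftrightarrow> ennreal l < min 1 (k x)" by (simp add: ennreal_less_one_iff)
        then have "ennreal l < k x \<longleftrightarrow> l < c" using c True by (simp add: ennreal_less_iff)
        then show ?thesis using True by (auto simp: indicator_def)
      next
        case False
        then show ?thesis using c by (auto simp: indicator_def)
      qed
      then have "(\<integral>\<^sup>+l. indicator {x. ennreal l < k x} x * indicator {0<..<1} l \<partial>lborel) = (\<integral>\<^sup>+l. indicator {0<..<c} l \<partial>lborel)"
        by simp
      also have "\<dots> = min 1 (k x)" using c by simp
      finally show "(\<integral>\<^sup>+l. indicator {x. ennreal l < k x} x * indicator {0<..<1} l \<partial>lborel) = min 1 (k x)" .
    qed
    finally show ?thesis .
  qed
  have le1: "f x \<le> 1" "g x \<le> 1" for x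
    using f g by (metis SUP_upper UNIV_I)+
  have "(\<integral>\<^sup>+x. f x \<partial>lborel) + (\<integral>\<^sup>+x. g x \<partial>lborel) = (\<integral>\<^sup>+x. min 1 (f x) \<partial>lborel) + (\<integral>\<^sup>+x. min 1 (g x) \<partial>lborel)"
    using le1 by (simp add: min_absorb2)
  also have "\<dots> = (\<integral>\<^sup>+l. emeasure lborel {x. ennreal l < f x} * indicator {0<..<1} l
       + emeasure lborel {x. ennreal l < g x} * indicator {0<..<1} l \<partial>lborel)"
    by (simp add: layer[symmetric] nn_integral_add)
  also have "\<dots> \<le> (\<integral>\<^sup>+l. 2 * (emeasure lborel {x. ennreal l < h x} * indicator {0<..<1} l) \<partial>lborel)"
  proof (intro nn_integral_mono)
    fix l :: real
    show "emeasure lborel {x. ennreal l < f x} * indicator {0<..<1} l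
       + emeasure lborel {x. ennreal l < g x} * indicator {0<..<1} l
       \<le> 2 * (emeasure lborel {x. ennreal l < h x} * indicator {0<..<1} l)"
    proof (cases "0 < l \<and> l < 1")
      case True
      then have "ennreal l < (SUP x. f x)" "ennreal l < (SUP x. g x)" by (auto simp: f g ennreal_less_one_iff)
      then have ne: "{x. ennreal l < f x} \<noteq> {}" "{x. ennreal l < g x} \<noteq> {}" by (auto simp: less_SUP_iff)
      have "ennreal l < h ((x - y) / 2)" if "ennreal l < f x" "ennreal l < g y" for x y
      proof (rule ccontr)
        assume "\<not> ennreal l < h ((x - y) / 2)"
        then have "(h ((x - y) / 2))\<^sup>2 \<le> ennreal l * ennreal l" 
          by (auto simp: power2_eq_square not_less intro: mult_mono)
        also have "\<dots> < f x * g y"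
          using that by (intro ennreal_mult_less_mult)
        finally show False using h[of x y] by simp
      qed
      then have "emeasure lborel {x. ennreal l < f x} + emeasure lborel {x. ennreal l < g x} \<le> 2 * emeasure lborel {x. ennreal l < h x}"
        using ne by (intro brunn_minkowski_real) auto
      then show ?thesis using True by simp
    qed auto
  qed
  also have "\<dots> = 2 * (\<integral>\<^sup>+x. min 1 (h x) \<partial>lborel)"
    by (simp add: nn_integral_cmult layer)
  also have "\<dots> \<le> 2 * (\<integral>\<^sup>+x. h x \<partial>lborel)"
    by (intro mult_left_mono nn_integral_mono) auto
  finally show ?thesis .
qed

text \<open>
  Dividing \<open>f\<close>, \<open>g\<close>, \<open>h\<close> by \<open>sup f\<close>, \<open>sup g\<close> and the geometric mean of the two reduces to the
  normalised case. The additive inequality obtained there implies the multiplicative one by the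
  inequality of the arithmetic and geometric means.
\<close>
lemma prekopa_leindler_real_bounded:
  fixes f g h :: "real \<Rightarrow> ennreal"
  assumes [measurable]: "f \<in> borel_measurable borel" "g \<in> borel_measurable borel" "h \<in> borel_measurable borel"
    and f: "\<And>x. f x \<le> of_nat n" and g: "\<And>x. g x \<le> of_nat n"
    and h: "\<And>x y. f x * g y \<le> (h ((x - y) / 2))\<^sup>2"
  shows "(\<integral>\<^sup>+x. f x \<partial>lborel) * (\<integral>\<^sup>+x. g x \<partial>lborel) \<le> (\<integral>\<^sup>+x. h x \<partial>lborel)\<^sup>2"
proof (cases "(SUP x. f x) = 0 \<or> (SUP x. g x) = 0")
  case True
  then have "(\<forall>x. f x = 0) \<or> (\<forall>x. g x = 0)"
    by (metis SUP_upper UNIV_I le_zero_eq)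
  then show ?thesis by auto
next
  case False
  have "(SUP x. f x) \<le> of_nat n" "(SUP x. g x) \<le> of_nat n" using f g by (auto simp: SUP_le_iff)
  then have "(SUP x. f x) < top" "(SUP x. g x) < top"
    by (auto intro: le_less_trans simp: of_nat_less_top)
  with False obtain a b :: real where a: "a > 0" "(SUP x. f x) = ennreal a" and b: "b > 0" "(SUP x. g x) = ennreal b"
    by (metis ennreal_0 ennreal_cases less_irrefl order_le_less top.not_eq_extremum)
  define c where "c = sqrt (a * b)"
  have c: "c > 0" "c * c = a * b" using a b by (auto simp: c_def)
  have SUP1: "(SUP x. k x * ennreal (1 / r)) = 1" if "(SUP x. k x) = ennreal r" "r > 0" for k :: "real \<Rightarrow> ennreal" and r
    using that by (simp add: SUP_mult_right_ennreal[symmetric] ennreal_mult'[symmetric] del: ennreal_1 flip: ennreal_1)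
  have "(\<integral>\<^sup>+x. f x * ennreal (1 / a) \<partial>lborel) + (\<integral>\<^sup>+x. g x * ennreal (1 / b) \<partial>lborel) \<le> 2 * (\<integral>\<^sup>+x. h x * ennreal (1 / c) \<partial>lborel)"
  proof (rule prekopa_leindler_real_normalized)
    fix x y
    have "f x * ennreal (1 / a) * (g y * ennreal (1 / b)) = f x * g y * ennreal (1 / (a * b))"
    proof -
      have "f x * ennreal (1 / a) * (g y * ennreal (1 / b)) = f x * g y * (ennreal (1 / a) * ennreal (1 / b))"
        by (simp only: ac_simps)
      then show ?thesis using a b by (simp add: ennreal_mult'[symmetric])
    qed
    also have "\<dots> \<le> (h ((x - y) / 2))\<^sup>2 * ennreal (1 / (a * b))" by (intro mult_right_mono h) auto
    also have "\<dots> = (h ((x - y) / 2) * ennreal (1 / c))\<^sup>2"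
      using c by (simp add: power_mult_distrib) (simp add: power2_eq_square ennreal_mult'[symmetric])
    finally show "f x * ennreal (1 / a) * (g y * ennreal (1 / b)) \<le> (h ((x - y) / 2) * ennreal (1 / c))\<^sup>2" .
  qed (use SUP1 a b in auto)
  then have le: "(\<integral>\<^sup>+x. f x \<partial>lborel) * ennreal (1 / a) + (\<integral>\<^sup>+x. g x \<partial>lborel) * ennreal (1 / b) \<le> 2 * ((\<integral>\<^sup>+x. h x \<partial>lborel) * ennreal (1 / c))"
    by (simp add: nn_integral_multc)
  show ?thesis
  proof (cases "(\<integral>\<^sup>+x. h x \<partial>lborel)")
    case top
    then show ?thesis by (simp add: power2_eq_square ennreal_top_mult)
  next
    case (real H)
    have "(\<integral>\<^sup>+x. f x \<partial>lborel) * ennreal (1 / a) + (\<integral>\<^sup>+x. g x \<partial>lborel) * ennreal (1 / b) < top"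
      using le real by (rule_tac le_less_trans[OF le]) (simp add: ennreal_mult_less_top)
    then have "(\<integral>\<^sup>+x. f x \<partial>lborel) < top" "(\<integral>\<^sup>+x. g x \<partial>lborel) < top"
      using a b by (auto simp: ennreal_mult_less_top)
    then obtain F G where F: "F \<ge> 0" "(\<integral>\<^sup>+x. f x \<partial>lborel) = ennreal F" and G: "G \<ge> 0" "(\<integral>\<^sup>+x. g x \<partial>lborel) = ennreal G"
      by (metis ennreal_cases less_irrefl)
    have "ennreal (F / a + G / b) \<le> ennreal (2 * (H / c))"
      using le F G real a b c by (simp add: ennreal_mult'[symmetric] ennreal_plus[symmetric] ennreal_numeral[symmetric] del: ennreal_plus ennreal_numeral)
    then have "F / a + G / b \<le> 2 * (H / c)"
      using real c by (subst (asm) ennreal_le_iff) auto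
    then have "(F / a + G / b)\<^sup>2 \<le> (2 * (H / c))\<^sup>2"
      using F G a b by (intro power_mono) auto
    moreover have "4 * ((F / a) * (G / b)) \<le> (F / a + G / b)\<^sup>2"
      using sum_squares_bound[of "F/a" "G/b"] by (simp add: power2_sum)
    ultimately have "4 * ((F / a) * (G / b)) \<le> 4 * (H\<^sup>2 / (c * c))"
      by (simp add: power2_eq_square)
    then have "F * G \<le> H\<^sup>2" using a b unfolding c(2) by (simp add: field_simps)
    then show ?thesis using F G real by (simp add: ennreal_mult'[symmetric] power2_eq_square)
  qed
qed

lemma prekopa_leindler_real:
  fixes f g h :: "real \<Rightarrow> ennreal"
  assumes [measurable]: "f \<in> borel_measurable borel" "g \<in> borel_measurable borel" "h \<in> borel_measurable borel"
    and h: "\<And>x y. f x * g y \<le> (h ((x - y) / 2))\<^sup>2"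
  shows "(\<integral>\<^sup>+x. f x \<partial>lborel) * (\<integral>\<^sup>+x. g x \<partial>lborel) \<le> (\<integral>\<^sup>+x. h x \<partial>lborel)\<^sup>2"
proof -
  have trunc: "(\<integral>\<^sup>+x. k x \<partial>lborel) = (SUP n::nat. (\<integral>\<^sup>+x. min (k x) (of_nat n) \<partial>lborel))"
    if [measurable]: "k \<in> borel_measurable borel" for k :: "real \<Rightarrow> ennreal"
  proof -
    have "(SUP n::nat. min (k x) (of_nat n)) = k x" for x
      by (simp add: inf_min[symmetric] inf_SUP[symmetric] ennreal_SUP_of_nat_eq_top)
    then show ?thesis
      by (subst nn_integral_monotone_convergence_SUP[symmetric])
        (auto simp: incseq_def le_fun_def intro!: min.coboundedI2)
  qed
  have "(\<integral>\<^sup>+x. min (f x) (of_nat m) \<partial>lborel) * (\<integral>\<^sup>+x. min (g x) (of_nat n) \<partial>lborel) \<le> (\<integral>\<^sup>+x. h x \<partial>lborel)\<^sup>2" for m n :: nat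
  proof (rule prekopa_leindler_real_bounded[where n="max m n"])
    fix x y
    show "min (f x) (of_nat m) * min (g y) (of_nat n) \<le> (h ((x - y) / 2))\<^sup>2"
      by (rule order_trans[OF mult_mono h]) auto
  qed (auto intro!: min.coboundedI2 simp: of_nat_mono)
  then show ?thesis
    unfolding trunc[of f, simplified] trunc[of g, simplified] SUP_mult_left_ennreal SUP_mult_right_ennreal
    by (simp add: SUP_le_iff)
qed

text \<open>
  Induction on the dimension. For fixed remaining coordinates the one-dimensional inequality holds
  along the new coordinate, and it says precisely that the slice integrals satisfy the hypothesis
  of the inequality in one dimension less.
\<close>
lemma prekopa_leindler_PiM:
  fixes f h :: "('i \<Rightarrow> real) \<Rightarrow> ennreal"
  assumes "finite J"
    and "f \<in> borel_measurable (Pi\<^sub>M J (\<lambda>_. lborel))" "h \<in> borel_measurable (Pi\<^sub>M J (\<lambda>_. lborel))"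
    and "\<And>x y. x \<in> space (Pi\<^sub>M J (\<lambda>_. lborel :: real measure)) \<Longrightarrow> y \<in> space (Pi\<^sub>M J (\<lambda>_. lborel :: real measure)) \<Longrightarrow>
       f x * f y \<le> (h (\<lambda>i\<in>J. (x i - y i) / 2))\<^sup>2"
  shows "(\<integral>\<^sup>+x. f x \<partial>Pi\<^sub>M J (\<lambda>_. lborel)) \<le> (\<integral>\<^sup>+x. h x \<partial>Pi\<^sub>M J (\<lambda>_. lborel))"
  using assms
proof (induction J arbitrary: f h rule: finite_induct)
  case empty
  interpret product_sigma_finite "\<lambda>_::'i. lborel :: real measure" ..
  have "f (\<lambda>x. undefined) * f (\<lambda>x. undefined) \<le> (h (\<lambda>x. undefined))\<^sup>2"
    using empty.prems(3)[of "\<lambda>x. undefined" "\<lambda>x. undefined"] by (simp add: space_PiM restrict_def)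
  then have "f (\<lambda>x. undefined) \<le> h (\<lambda>x. undefined)"
    by (metis ennreal_mult_less_mult not_less power2_eq_square)
  then show ?case by (simp add: nn_integral_empty)
next
  case (insert i J)
  interpret product_sigma_finite "\<lambda>_::'i. lborel :: real measure" ..
  note [measurable] = insert.prems(1,2)
  let ?P = "\<lambda>J. Pi\<^sub>M J (\<lambda>_::'i. lborel :: real measure)"
  have upd [measurable]: "(\<lambda>(x, s). x(i := s)) \<in> ?P J \<Otimes>\<^sub>M lborel \<rightarrow>\<^sub>M ?P (insert i J)"
    by (rule measurable_add_dim)
  have slice: "(\<lambda>s. k (x(i := s))) \<in> borel_measurable borel" 
    if "k \<in> borel_measurable (?P (insert i J))" "x \<in> space (?P J)" for k :: "('i \<Rightarrow> real) \<Rightarrow> ennreal" and x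
    using that insert.hyps by measurable
  have "(\<integral>\<^sup>+x. (\<integral>\<^sup>+s. f (x(i := s)) \<partial>lborel) \<partial>?P J) \<le> (\<integral>\<^sup>+x. (\<integral>\<^sup>+s. h (x(i := s)) \<partial>lborel) \<partial>?P J)"
  proof (rule insert.IH)
    fix x y assume x: "x \<in> space (?P J)" and y: "y \<in> space (?P J)"
    let ?z = "\<lambda>j\<in>J. (x j - y j) / 2"
    have z: "?z \<in> space (?P J)" by (simp add: space_PiM)
    show "(\<integral>\<^sup>+s. f (x(i := s)) \<partial>lborel) * (\<integral>\<^sup>+s. f (y(i := s)) \<partial>lborel) \<le> (\<integral>\<^sup>+s. h (?z(i := s)) \<partial>lborel)\<^sup>2"
    proof (rule prekopa_leindler_real)
      fix s t
      have "x(i := s) \<in> space (?P (insert i J))" "y(i := t) \<in> space (?P (insert i J))"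
        using x y by (auto simp: space_PiM PiE_iff extensional_def)
      from insert.prems(3)[OF this] 
      have "f (x(i := s)) * f (y(i := t)) \<le> (h (\<lambda>j\<in>insert i J. ((x(i := s)) j - (y(i := t)) j) / 2))\<^sup>2" .
      moreover have "(\<lambda>j\<in>insert i J. ((x(i := s)) j - (y(i := t)) j) / 2) = ?z(i := (s - t) / 2)"
        using insert.hyps by (auto simp: fun_eq_iff)
      ultimately show "f (x(i := s)) * f (y(i := t)) \<le> (h (?z(i := (s - t) / 2)))\<^sup>2" by simp
    qed (use slice x y z insert.prems in auto)
  qed measurable
  then show ?case using insert.hyps insert.prems by (simp add: product_nn_integral_insert)
qed

text \<open>
  Apply the previous inequality to the indicators of \<open>A\<close> and of the ball of radius \<open>D / 2\<close>: half
  the difference of two points of \<open>A\<close> lies in that ball.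
\<close>
lemma isodiametric_PiM:
  fixes A :: "('i \<Rightarrow> real) set"
  assumes "finite J" and A: "A \<in> sets (Pi\<^sub>M J (\<lambda>_. lborel))" and "D > 0"
    and D: "\<And>x y. x \<in> A \<Longrightarrow> y \<in> A \<Longrightarrow> sqrt (\<Sum>i\<in>J. (x i - y i)\<^sup>2) \<le> D"
  shows "emeasure (Pi\<^sub>M J (\<lambda>_. lborel)) A \<le> ennreal (unit_ball_vol (real (card J)) * (D / 2) ^ card J)"
proof -
  let ?P = "Pi\<^sub>M J (\<lambda>_::'i. lborel :: real measure)"
  let ?B = "{f. sqrt (\<Sum>i\<in>J. (f i)\<^sup>2) \<le> D / 2} \<inter> space ?P"
  have [measurable]: "?B \<in> sets ?P" 
  proof -
    have "{f\<in>space ?P. sqrt (\<Sum>i\<in>J. (f i)\<^sup>2) \<le> D / 2} \<in> sets ?P" by measurable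
    then show ?thesis by (simp add: Int_def conj_commute)
  qed
  note A[measurable]
  have "(\<integral>\<^sup>+x. indicator A x \<partial>?P) \<le> (\<integral>\<^sup>+x. indicator ?B x \<partial>?P)"
  proof (rule prekopa_leindler_PiM[OF \<open>finite J\<close>])
    fix x y
    show "indicator A x * indicator A y \<le> (indicator ?B (\<lambda>i\<in>J. (x i - y i) / 2) :: ennreal)\<^sup>2"
    proof (cases "x \<in> A \<and> y \<in> A")
      case True
      have "sqrt (\<Sum>i\<in>J. ((x i - y i) / 2)\<^sup>2) = sqrt (\<Sum>i\<in>J. (x i - y i)\<^sup>2) / 2"
        by (simp add: power_divide sum_divide_distrib[symmetric] real_sqrt_divide)
      then have "(\<lambda>i\<in>J. (x i - y i) / 2) \<in> ?B" using D[of x y] True by (simp add: space_PiM)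
      then show ?thesis by (auto simp: indicator_def)
    qed (auto simp: indicator_def)
  qed measurable
  then show ?thesis using emeasure_cball_aux[of J "D / 2"] assms by simp
qed

section \<open>Area in a hyperplane\<close>

lemma nn_integral_lborel_affine:
  fixes f :: "'a::euclidean_space \<Rightarrow> ennreal"
  assumes [measurable]: "f \<in> borel_measurable borel" and "c \<noteq> 0"
  shows "(\<integral>\<^sup>+x. f x \<partial>lborel) = ennreal (\<bar>c\<bar> ^ DIM('a)) * (\<integral>\<^sup>+x. f (t + c *\<^sub>R x) \<partial>lborel)"
proof -
  have "(lborel :: 'a measure) = density (distr lborel borel (\<lambda>x. t + c *\<^sub>R x)) (\<lambda>_. \<bar>c\<bar> ^ DIM('a))"
    using assms by (intro lborel_affine) auto
  then have "(\<integral>\<^sup>+x. f x \<partial>lborel) = (\<integral>\<^sup>+x. f x \<partial>density (distr lborel borel (\<lambda>x. t + c *\<^sub>R x)) (\<lambda>_. \<bar>c\<bar> ^ DIM('a)))"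
    by simp
  also have "\<dots> = ennreal (\<bar>c\<bar> ^ DIM('a)) * (\<integral>\<^sup>+x. f (t + c *\<^sub>R x) \<partial>lborel)"
    using assms by (simp add: nn_integral_density nn_integral_distr nn_integral_cmult)
  finally show ?thesis .
qed

lemma nn_integral_lborel_shift:
  fixes f :: "'a::euclidean_space \<Rightarrow> ennreal"
  assumes "f \<in> borel_measurable borel" and "\<bar>c\<bar> = 1"
  shows "(\<integral>\<^sup>+x. f (t + c *\<^sub>R x) \<partial>lborel) = (\<integral>\<^sup>+x. f x \<partial>lborel)"
  using nn_integral_lborel_affine[of f c t] assms by auto

text \<open>
  Weil's uniqueness argument for Haar measure: computing the integral of \<open>1\<^sub>A(T x) 1\<^sub>B(T x + y)\<close>
  over \<open>x\<close> and \<open>y\<close> in both orders, with translations in between, gives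
  \<open>\<bar>T\<^sup>-\<^sup>1 A\<bar> \<bar>B\<bar> = \<bar>A\<bar> \<bar>T\<^sup>-\<^sup>1 B\<bar>\<close>. For the unit ball \<open>B\<close>, which an isometry preserves, the factor
  cancels.
\<close>
lemma linear_isometric_involution_preserves_lborel:
  fixes T :: "'a::euclidean_space \<Rightarrow> 'a"
  assumes lin: "linear T" and iso: "\<And>x. norm (T x) = norm x" and inv: "\<And>x. T (T x) = x"
    and A[measurable]: "A \<in> sets borel"
  shows "emeasure lborel {x. T x \<in> A} = emeasure lborel A"
proof -
  have "continuous_on UNIV T" using lin by (simp add: linear_continuous_on linear_conv_bounded_linear)
  then have [measurable]: "T \<in> borel_measurable borel" by (rule borel_measurable_continuous_onI)
  let ?B = "ball (0::'a) 1"
  have [measurable]: "?B \<in> sets borel" by simp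
  have TB: "{x. T x \<in> ?B} = ?B" by (auto simp: iso)
  have "emeasure lborel {x. T x \<in> A} * emeasure lborel ?B
      = (\<integral>\<^sup>+x. indicator A (T x) * (\<integral>\<^sup>+y. indicator ?B (T x + 1 *\<^sub>R y) \<partial>lborel) \<partial>lborel)"
  proof -
    have "(\<integral>\<^sup>+y. indicator ?B (T x + 1 *\<^sub>R y) \<partial>lborel) = emeasure lborel ?B" for x
      by (subst nn_integral_lborel_shift) (auto intro!: borel_measurable_indicator)
    moreover have "(\<integral>\<^sup>+x. indicator A (T x) \<partial>lborel) = (\<integral>\<^sup>+x. indicator {x. T x \<in> A} x \<partial>lborel)"
      by (simp add: indicator_def)
    ultimately show ?thesis by (simp add: nn_integral_multc)
  qed
  also have "\<dots> = (\<integral>\<^sup>+x. (\<integral>\<^sup>+y. indicator A (T x) * indicator ?B (T x + y) \<partial>lborel) \<partial>lborel)"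
    by (intro nn_integral_cong, subst nn_integral_cmult[symmetric]) simp_all
  also have "\<dots> = (\<integral>\<^sup>+y. (\<integral>\<^sup>+x. indicator A (T x) * indicator ?B (T x + y) \<partial>lborel) \<partial>lborel)"
    by (rule lborel_pair.Fubini') measurable
  also have "\<dots> = (\<integral>\<^sup>+y. (\<integral>\<^sup>+x. indicator A (T x - y) * indicator ?B (T x) \<partial>lborel) \<partial>lborel)"
  proof (rule nn_integral_cong)
    fix y
    have "(\<integral>\<^sup>+x. indicator A (T x) * indicator ?B (T x + y) \<partial>lborel)
        = (\<integral>\<^sup>+x. indicator A (T (- T y + 1 *\<^sub>R x)) * indicator ?B (T (- T y + 1 *\<^sub>R x) + y) \<partial>lborel)"
      by (rule nn_integral_lborel_shift[symmetric]) auto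
    then show "(\<integral>\<^sup>+x. indicator A (T x) * indicator ?B (T x + y) \<partial>lborel)
        = (\<integral>\<^sup>+x. indicator A (T x - y) * indicator ?B (T x) \<partial>lborel)"
      using lin inv by (simp add: linear_add linear_neg linear_diff)
  qed
  also have "\<dots> = (\<integral>\<^sup>+x. (\<integral>\<^sup>+y. indicator A (T x - y) * indicator ?B (T x) \<partial>lborel) \<partial>lborel)"
    by (rule lborel_pair.Fubini') measurable
  also have "\<dots> = (\<integral>\<^sup>+x. (\<integral>\<^sup>+y. indicator A (T x + (-1) *\<^sub>R y) \<partial>lborel) * indicator ?B (T x) \<partial>lborel)"
    by (simp add: nn_integral_multc)
  also have "\<dots> = emeasure lborel A * (\<integral>\<^sup>+x. indicator {x. T x \<in> ?B} x \<partial>lborel)"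
  proof -
    have "(\<integral>\<^sup>+y. indicator A (T x + (-1) *\<^sub>R y) \<partial>lborel) = emeasure lborel A" for x
      by (subst nn_integral_lborel_shift) auto
    moreover have "(\<lambda>x. indicator ?B (T x) :: ennreal) = indicator {x. T x \<in> ?B}"
      by (simp add: indicator_def fun_eq_iff)
    moreover have "{x. T x \<in> ?B} \<in> sets lborel" by measurable
    ultimately show ?thesis by (simp add: nn_integral_cmult)
  qed
  also have "(\<integral>\<^sup>+x. indicator {x. T x \<in> ?B} x \<partial>lborel) = emeasure lborel ?B"
    unfolding TB by simp
  finally have eq: "emeasure lborel {x. T x \<in> A} * emeasure lborel ?B = emeasure lborel A * emeasure lborel ?B" .
  have "emeasure lborel ?B \<noteq> 0" "emeasure lborel ?B \<noteq> top"
    by (simp_all add: emeasure_ball ennreal_eq_0_iff not_le)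
  then show ?thesis using eq by (metis mult_divide_eq_ennreal)
qed

text \<open>
  The reflection in the hyperplane that bisects \<open>e\<close> and \<open>\<nu>\<close>.
\<close>
lemma ex_isometric_involution:
  fixes e \<nu> :: "'a::euclidean_space"
  assumes "norm e = 1" "norm \<nu> = 1"
  shows "\<exists>T. linear T \<and> (\<forall>x. norm (T x) = norm x) \<and> (\<forall>x. T (T x) = x) \<and> T e = \<nu>"
proof (cases "e = \<nu>")
  case True
  then show ?thesis by (intro exI[of _ id]) (auto simp: linear_id)
next
  case False
  define w where "w = e - \<nu>"
  define T where "T x = x - (2 * (x \<bullet> w) / (w \<bullet> w)) *\<^sub>R w" for x
  have w: "w \<bullet> w \<noteq> 0" using False by (simp add: w_def)
  have "linear T" by (intro linearI) (auto simp: T_def inner_add_left algebra_simps add_divide_distrib)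
  moreover have Tw: "T x \<bullet> w = - (x \<bullet> w)" for x
    using w by (simp add: T_def inner_diff_left)
  then have "T (T x) = x" for x
    unfolding T_def[of "T x"] by (simp add: Tw) (simp add: T_def)
  moreover have "(T x) \<bullet> (T x) = x \<bullet> x" for x
  proof -
    have "T x \<bullet> T x = T x \<bullet> x - (2 * (x \<bullet> w) / (w \<bullet> w)) * (T x \<bullet> w)"
      by (simp add: T_def[of x] inner_diff_left inner_diff_right)
    also have "T x \<bullet> x = x \<bullet> x - (2 * (x \<bullet> w) / (w \<bullet> w)) * (x \<bullet> w)"
      by (simp add: T_def inner_diff_left inner_diff_right inner_commute)
    finally show ?thesis by (simp add: Tw)
  qed
  then have "norm (T x) = norm x" for x by (simp add: norm_eq_sqrt_inner)
  moreover have "T e = \<nu>"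
  proof -
    have "e \<bullet> e = 1" "\<nu> \<bullet> \<nu> = 1" using assms by (simp_all add: dot_square_norm)
    then have "2 * (e \<bullet> w) = w \<bullet> w" by (simp add: w_def inner_diff_left inner_diff_right inner_commute)
    then have "2 * (e \<bullet> w) / (w \<bullet> w) = 1" using divide_self[OF w] by (simp only:)
    then have "T e = e - 1 *\<^sub>R w" unfolding T_def by (simp only:)
    then show ?thesis by (simp add: w_def)
  qed
  ultimately show ?thesis by blast
qed

text \<open>
  For a unit vector \<open>\<nu>\<close> this is the orthogonal projection onto the hyperplane orthogonal to \<open>\<nu>\<close>.
\<close>
definition tangential :: "'a::real_inner \<Rightarrow> 'a \<Rightarrow> 'a" where
  "tangential \<nu> x = x - (x \<bullet> \<nu>) *\<^sub>R \<nu>"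

text \<open>
  \<open>\<kappa>\<close> is \<open>(d-1)\<close>-dimensional Lebesgue measure of the projection onto the hyperplane orthogonal to
  \<open>\<nu>\<close>. It is obtained by reflecting \<open>\<nu>\<close> onto a coordinate axis and integrating over the other
  coordinates. The three properties are Cavalieri's principle for a layer of height \<open>h\<close> above a
  graph, the isodiametric inequality and the area of a disc.
\<close>
lemma ex_hyperplane_measure:
  fixes \<nu> :: "'a::euclidean_space"
  assumes "norm \<nu> = 1"
  shows "\<exists>\<kappa>. 
    (\<forall>E \<phi> h. E \<in> sets borel \<longrightarrow> \<phi> \<in> borel_measurable borel \<longrightarrow> 0 \<le> h \<longrightarrow>
       emeasure lborel {x. tangential \<nu> x \<in> E \<and> \<phi> (tangential \<nu> x) < x \<bullet> \<nu> \<and> x \<bullet> \<nu> < \<phi> (tangential \<nu> x) + h} = \<kappa> E * ennreal h) \<and>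
    (\<forall>E D. E \<in> sets borel \<longrightarrow> 0 < D \<longrightarrow> (\<forall>x\<in>E. \<forall>y\<in>E. dist x y \<le> D) \<longrightarrow>
       \<kappa> E \<le> ennreal (unit_ball_vol (real (DIM('a) - 1)) * (D / 2) ^ (DIM('a) - 1))) \<and>
    (\<forall>r>0. \<kappa> (cball 0 r) = ennreal (unit_ball_vol (real (DIM('a) - 1)) * r ^ (DIM('a) - 1)))"
proof -
  obtain e :: 'a where e: "e \<in> Basis" using nonempty_Basis by blast
  obtain T where T: "linear T" "\<And>x. norm (T x) = norm x" "\<And>x. T (T x) = x" "T e = \<nu>"
    using ex_isometric_involution[of e \<nu>] e assms by auto
  define J where "J = (Basis :: 'a set) - {e}"
  have J: "finite J" "e \<notin> J" "insert e J = Basis" "card J = DIM('a) - 1" using e by (auto simp: J_def)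
  interpret product_sigma_finite "\<lambda>_::'a. lborel :: real measure" ..
  let ?PJ = "Pi\<^sub>M J (\<lambda>_. lborel :: real measure)"
  let ?P = "Pi\<^sub>M (insert e J) (\<lambda>_. lborel :: real measure)"
  let ?vec = "\<lambda>f. \<Sum>b\<in>J. f b *\<^sub>R b"
  have "continuous_on UNIV T" using T(1) by (simp add: linear_continuous_on linear_conv_bounded_linear)
  then have Tm[measurable]: "T \<in> borel_measurable borel" by (rule borel_measurable_continuous_onI)
  have vm[measurable]: "?vec \<in> borel_measurable ?PJ" by measurable
  define \<kappa> where "\<kappa> E = emeasure ?PJ {f\<in>space ?PJ. T (?vec f) \<in> E}" for E
  have Tinner: "T x \<bullet> T y = x \<bullet> y" for x y
  proof -
    have "(norm (T x + T y))\<^sup>2 = (norm (x + y))\<^sup>2" using T by (metis linear_add)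
    then show ?thesis using T(2) by (simp add: power2_norm_eq_inner[symmetric] dot_norm)
  qed
  have Tnu: "T x \<bullet> \<nu> = x \<bullet> e" for x using Tinner[of x e] T(4) by simp
  have nsq: "(norm x)\<^sup>2 = (\<Sum>b\<in>Basis. (x \<bullet> b)\<^sup>2)" for x :: 'a
    unfolding power2_norm_eq_inner by (subst euclidean_inner) (simp add: power2_eq_square)
  have vecb: "?vec f \<bullet> b = f b" if "b \<in> J" for f b
    using that J by (simp add: inner_sum_left inner_Basis J_def if_distrib cong: if_cong)
  have vece: "?vec f \<bullet> e = 0" for f
    using e by (auto simp: inner_sum_left inner_Basis J_def intro!: sum.neutral)
  have tanm[measurable]: "tangential \<nu> \<in> borel_measurable borel" unfolding tangential_def by measurable
  have 1: "emeasure lborel {x. tangential \<nu> x \<in> E \<and> \<phi> (tangential \<nu> x) < x \<bullet> \<nu> \<and> x \<bullet> \<nu> < \<phi> (tangential \<nu> x) + h} = \<kappa> E * ennreal h"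
    if [measurable]: "E \<in> sets borel" "\<phi> \<in> borel_measurable borel" and h: "0 \<le> h" for E \<phi> h
  proof -
    let ?X = "{x. tangential \<nu> x \<in> E \<and> \<phi> (tangential \<nu> x) < x \<bullet> \<nu> \<and> x \<bullet> \<nu> < \<phi> (tangential \<nu> x) + h}"
    have [measurable]: "?X \<in> sets borel" by measurable
    have "emeasure lborel ?X = emeasure lborel {x. T x \<in> ?X}"
      using T by (intro linear_isometric_involution_preserves_lborel[symmetric]) auto
    also have "\<dots> = (\<integral>\<^sup>+x. indicator ?X (T x) \<partial>lborel)"
    proof -
      have "(\<integral>\<^sup>+x. indicator ?X (T x) \<partial>lborel) = (\<integral>\<^sup>+x. indicator {x. T x \<in> ?X} x \<partial>lborel)"
        by (simp add: indicator_def)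
      moreover have "{x. T x \<in> ?X} \<in> sets lborel" by measurable
      ultimately show ?thesis by (simp only: nn_integral_indicator)
    qed
    also have "\<dots> = (\<integral>\<^sup>+f. indicator ?X (T (\<Sum>b\<in>insert e J. f b *\<^sub>R b)) \<partial>?P)"
      by (subst lborel_eq, subst nn_integral_distr) (auto simp: J(3))
    also have "\<dots> = (\<integral>\<^sup>+f. (\<integral>\<^sup>+s. indicator ?X (T (\<Sum>b\<in>insert e J. (f(e := s)) b *\<^sub>R b)) \<partial>lborel) \<partial>?PJ)"
      using J by (intro product_nn_integral_insert) auto
    also have "\<dots> = (\<integral>\<^sup>+f. indicator {f\<in>space ?PJ. T (?vec f) \<in> E} f * ennreal h \<partial>?PJ)"
    proof (rule nn_integral_cong)
      fix f assume f: "f \<in> space ?PJ"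
      have X: "T (\<Sum>b\<in>insert e J. (f(e := s)) b *\<^sub>R b) \<in> ?X \<longleftrightarrow> T (?vec f) \<in> E \<and> s \<in> {\<phi> (T (?vec f))<..<\<phi> (T (?vec f)) + h}" for s
      proof -
        have "(\<Sum>b\<in>insert e J. (f(e := s)) b *\<^sub>R b) = s *\<^sub>R e + ?vec f"
          using J(1,2) by (subst sum.insert) (auto intro!: sum.cong)
        then have eq: "T (\<Sum>b\<in>insert e J. (f(e := s)) b *\<^sub>R b) = s *\<^sub>R \<nu> + T (?vec f)"
          using T by (simp add: linear_add linear_scale)
        have "(s *\<^sub>R \<nu> + T (?vec f)) \<bullet> \<nu> = s"
          using assms by (simp add: inner_add_left Tnu vece dot_square_norm)
        moreover from this have "tangential \<nu> (s *\<^sub>R \<nu> + T (?vec f)) = T (?vec f)" by (simp add: tangential_def)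
        ultimately show ?thesis unfolding eq by simp
      qed
      show "(\<integral>\<^sup>+s. indicator ?X (T (\<Sum>b\<in>insert e J. (f(e := s)) b *\<^sub>R b)) \<partial>lborel) = indicator {f\<in>space ?PJ. T (?vec f) \<in> E} f * ennreal h"
      proof (cases "T (?vec f) \<in> E")
        case True
        then have "(\<integral>\<^sup>+s. indicator ?X (T (\<Sum>b\<in>insert e J. (f(e := s)) b *\<^sub>R b)) \<partial>lborel) = (\<integral>\<^sup>+s. indicator {\<phi> (T (?vec f))<..<\<phi> (T (?vec f)) + h} s \<partial>lborel)"
          unfolding indicator_def X by simp
        then show ?thesis using True f h by simp
      next
        case False
        then show ?thesis unfolding indicator_def X by simp
      qed
    qed
    also have "\<dots> = \<kappa> E * ennreal h" by (simp add: nn_integral_multc \<kappa>_def)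
    finally show ?thesis .
  qed
  have 2: "\<kappa> E \<le> ennreal (unit_ball_vol (real (DIM('a) - 1)) * (D / 2) ^ (DIM('a) - 1))"
    if [measurable]: "E \<in> sets borel" and D: "0 < D" "\<And>x y. x \<in> E \<Longrightarrow> y \<in> E \<Longrightarrow> dist x y \<le> D" for E D
  proof -
    have "emeasure ?PJ {f\<in>space ?PJ. T (?vec f) \<in> E} \<le> ennreal (unit_ball_vol (real (card J)) * (D / 2) ^ card J)"
    proof (rule isodiametric_PiM[OF J(1)])
      show "{f\<in>space ?PJ. T (?vec f) \<in> E} \<in> sets ?PJ" by measurable
      show "0 < D" by (rule D(1))
      fix f g assume fg: "f \<in> {f\<in>space ?PJ. T (?vec f) \<in> E}" "g \<in> {f\<in>space ?PJ. T (?vec f) \<in> E}"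
      have "(dist (T (?vec f)) (T (?vec g)))\<^sup>2 = (norm (?vec f - ?vec g))\<^sup>2"
        by (simp only: dist_norm linear_diff[OF T(1), symmetric] T(2))
      also have "\<dots> = (\<Sum>b\<in>Basis. ((?vec f - ?vec g) \<bullet> b)\<^sup>2)"
        by (rule nsq)
      also have "\<dots> = (\<Sum>b\<in>J. (f b - g b)\<^sup>2)"
        using J(1,2) by (subst J(3)[symmetric]) (simp add: inner_diff_left vece vecb)
      finally have s: "(dist (T (?vec f)) (T (?vec g)))\<^sup>2 = (\<Sum>b\<in>J. (f b - g b)\<^sup>2)" .
      have "sqrt (\<Sum>b\<in>J. (f b - g b)\<^sup>2) = dist (T (?vec f)) (T (?vec g))"
        unfolding s[symmetric] by simp
      then show "sqrt (\<Sum>b\<in>J. (f b - g b)\<^sup>2) \<le> D" using D(2) fg by simp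
    qed
    then show ?thesis by (simp add: \<kappa>_def J(4))
  qed
  have 3: "\<kappa> (cball 0 r) = ennreal (unit_ball_vol (real (DIM('a) - 1)) * r ^ (DIM('a) - 1))" if "r > 0" for r
  proof -
    have "norm (T (?vec f)) = sqrt (\<Sum>b\<in>J. (f b)\<^sup>2)" for f
    proof -
      have "(norm (?vec f))\<^sup>2 = (\<Sum>b\<in>Basis. ((?vec f) \<bullet> b)\<^sup>2)"
        by (rule nsq)
      also have "\<dots> = (\<Sum>b\<in>J. (f b)\<^sup>2)"
        using J(1,2) by (subst J(3)[symmetric]) (simp add: vece vecb)
      finally have s: "(norm (?vec f))\<^sup>2 = (\<Sum>b\<in>J. (f b)\<^sup>2)" .
      show ?thesis unfolding s[symmetric] T(2) by simp
    qed
    then have "{f\<in>space ?PJ. T (?vec f) \<in> cball 0 r} = {f. sqrt (\<Sum>b\<in>J. (f b)\<^sup>2) \<le> r} \<inter> space ?PJ"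
      by auto
    then show ?thesis unfolding \<kappa>_def using emeasure_cball_aux[OF J(1) that] J(4) by simp
  qed
  show ?thesis using 1 2 3 by (intro exI[of _ \<kappa>]) auto
qed

lemma tangential_simps:
  assumes "norm \<nu> = 1"
  shows "tangential \<nu> x \<bullet> \<nu> = 0" "tangential \<nu> (tangential \<nu> x) = tangential \<nu> x"
    "tangential \<nu> (x - y) = tangential \<nu> x - tangential \<nu> y" "norm (tangential \<nu> x) \<le> norm x"
proof -
  have n: "\<nu> \<bullet> \<nu> = 1" using assms by (simp add: dot_square_norm)
  show 1: "tangential \<nu> x \<bullet> \<nu> = 0" by (simp add: tangential_def inner_diff_left n)
  show "tangential \<nu> (tangential \<nu> x) = tangential \<nu> x" using 1 by (simp add: tangential_def[of \<nu> "tangential \<nu> x"])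
  show "tangential \<nu> (x - y) = tangential \<nu> x - tangential \<nu> y" by (simp add: tangential_def algebra_simps inner_diff_left)
  have "(norm x)\<^sup>2 = (norm (tangential \<nu> x))\<^sup>2 + (x \<bullet> \<nu>)\<^sup>2"
    unfolding power2_norm_eq_inner
    by (simp add: tangential_def inner_diff_left inner_diff_right n inner_commute power2_eq_square)
  then have "(norm (tangential \<nu> x))\<^sup>2 \<le> (norm x)\<^sup>2" by simp
  then show "norm (tangential \<nu> x) \<le> norm x" by (simp add: power2_le_iff_abs_le)
qed

section \<open>Graph charts and the inner tube\<close>

text \<open>
  The consequence of the \<open>C\<^sup>1\<^sup>,\<^sup>1\<close> condition that the volume estimates use: near \<open>z\<close> the set lies
  above the graph of \<open>\<phi>\<close>, and on the disc of radius \<open>D\<close> about \<open>z\<close> in the tangent hyperplane the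
  slope of \<open>\<phi>\<close> is at most \<open>\<Lambda> D\<close>.
\<close>
definition graph_chart :: "'a::euclidean_space set \<Rightarrow> real \<Rightarrow> real \<Rightarrow> 'a \<Rightarrow> 'a \<Rightarrow> ('a \<Rightarrow> real) \<Rightarrow> bool" where
  "graph_chart \<Omega> R \<Lambda> z \<nu> \<phi> \<longleftrightarrow> norm \<nu> = 1 \<and> \<phi> 0 = 0 \<and>
     (\<forall>y\<in>ball z R. y \<in> \<Omega> \<longleftrightarrow> \<phi> (tangential \<nu> (y - z)) < (y - z) \<bullet> \<nu>) \<and>
     (\<forall>D y y'. y \<bullet> \<nu> = 0 \<longrightarrow> y' \<bullet> \<nu> = 0 \<longrightarrow> norm y \<le> D \<longrightarrow> norm y' \<le> D \<longrightarrow> \<bar>\<phi> y - \<phi> y'\<bar> \<le> \<Lambda> * D * norm (y - y'))"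

text \<open>
  The gradient vanishes at \<open>0\<close> and is \<open>\<Lambda>\<close>-Lipschitz, so it is bounded by \<open>\<Lambda> D\<close> on the disc of
  radius \<open>D\<close>, and the mean value inequality applies there by convexity.
\<close>
lemma C11_graph_lipschitz:
  fixes \<nu> :: "'a::euclidean_space"
  assumes "C11_graph \<Lambda> {h. h \<bullet> \<nu> = 0} \<phi>" "y \<bullet> \<nu> = 0" "y' \<bullet> \<nu> = 0" "norm y \<le> D" "norm y' \<le> D"
  shows "\<bar>\<phi> y - \<phi> y'\<bar> \<le> \<Lambda> * D * norm (y - y')"
proof -
  let ?H = "{h. h \<bullet> \<nu> = 0}"
  obtain g where g: "\<And>y. y \<in> ?H \<Longrightarrow> (\<phi> has_derivative (\<lambda>h. g y \<bullet> h)) (at y within ?H)"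
    "g 0 = 0" "\<And>y. y \<in> ?H \<Longrightarrow> norm (g y) \<le> \<Lambda>" "\<And>y y'. y \<in> ?H \<Longrightarrow> y' \<in> ?H \<Longrightarrow> norm (g y - g y') \<le> \<Lambda> * norm (y - y')"
    using assms(1) unfolding C11_graph_def by blast
  have L: "0 \<le> \<Lambda>" using g(3)[of 0] by (simp add: g(2))
  have "convex ?H" by (simp add: convex_def inner_add_left)
  then have conv: "convex (?H \<inter> cball 0 D)" by (intro convex_Int) auto
  have "norm (\<phi> y - \<phi> y') \<le> \<Lambda> * D * norm (y - y')"
  proof (rule differentiable_bound[OF conv])
    fix x assume x: "x \<in> ?H \<inter> cball 0 D"
    show "(\<phi> has_derivative (\<lambda>h. g x \<bullet> h)) (at x within ?H \<inter> cball 0 D)"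
      using g(1)[of x] x by (auto intro: has_derivative_subset)
    have "norm (g x) \<le> \<Lambda> * norm x" using g(4)[of x 0] x g(2) by simp
    also have "\<dots> \<le> \<Lambda> * D" using x L by (intro mult_left_mono) auto
    finally have "norm (g x) \<le> \<Lambda> * D" .
    then have "norm (g x) * norm h \<le> \<Lambda> * D * norm h" for h :: 'a
      by (rule mult_right_mono) simp
    then have "norm (g x \<bullet> h) \<le> \<Lambda> * D * norm h" for h
      using Cauchy_Schwarz_ineq2[of "g x" h] by (metis order_trans real_norm_def)
    then show "onorm (\<lambda>h. g x \<bullet> h) \<le> \<Lambda> * D" by (intro onorm_le) simp
  qed (use assms in auto)
  then show ?thesis by simp
qed

lemma C11_open_set_charts:
  fixes \<Omega> :: "'a::euclidean_space set"
  assumes "C11_open_set \<Omega>"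
  shows "\<exists>R>0. \<exists>\<Lambda>>0. \<forall>z\<in>frontier \<Omega>. \<exists>\<nu> \<phi>. graph_chart \<Omega> R \<Lambda> z \<nu> \<phi>"
proof -
  obtain R \<Lambda> where R: "R > 0" "\<Lambda> > 0" and ch: "\<And>z. z\<in>frontier \<Omega> \<Longrightarrow> \<exists>\<nu> \<phi>.
        norm \<nu> = 1 \<and>
        C11_graph \<Lambda> {h. h \<bullet> \<nu> = 0} \<phi> \<and>
        \<Omega> \<inter> ball z R =
          {y. (y - z) \<bullet> \<nu> > \<phi> ((y - z) - ((y - z) \<bullet> \<nu>) *\<^sub>R \<nu>)} \<inter> ball z R"
    using assms unfolding C11_open_set_def by blast
  have "\<exists>\<nu> \<phi>. graph_chart \<Omega> R \<Lambda> z \<nu> \<phi>" if z: "z \<in> frontier \<Omega>" for z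
  proof -
    obtain \<nu> \<phi> where *: "norm \<nu> = 1" "C11_graph \<Lambda> {h. h \<bullet> \<nu> = 0} \<phi>"
      "\<Omega> \<inter> ball z R = {y. (y - z) \<bullet> \<nu> > \<phi> ((y - z) - ((y - z) \<bullet> \<nu>) *\<^sub>R \<nu>)} \<inter> ball z R"
      using ch[OF z] by blast
    have "y \<in> \<Omega> \<longleftrightarrow> \<phi> (tangential \<nu> (y - z)) < (y - z) \<bullet> \<nu>" if "y \<in> ball z R" for y
      using *(3) that unfolding tangential_def by blast
    moreover have "\<phi> 0 = 0" using *(2) by (simp add: C11_graph_def)
    ultimately have "graph_chart \<Omega> R \<Lambda> z \<nu> \<phi>"
      unfolding graph_chart_def using *(1) C11_graph_lipschitz[OF *(2)] by blast
    then show ?thesis by blast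
  qed
  with R show ?thesis by blast
qed

lemma graph_chart_measurable:
  fixes \<Omega> :: "'a::euclidean_space set"
  assumes "graph_chart \<Omega> R \<Lambda> z \<nu> \<phi>" "\<Lambda> > 0"
  shows "(\<lambda>y. \<phi> (tangential \<nu> y)) \<in> borel_measurable borel"
proof (rule borel_measurable_continuous_onI)
  have \<nu>: "norm \<nu> = 1" and lip: "\<And>D y y'. y \<bullet> \<nu> = 0 \<Longrightarrow> y' \<bullet> \<nu> = 0 \<Longrightarrow> norm y \<le> D \<Longrightarrow> norm y' \<le> D \<Longrightarrow> \<bar>\<phi> y - \<phi> y'\<bar> \<le> \<Lambda> * D * norm (y - y')"
    using assms unfolding graph_chart_def by blast+
  have "continuous_on (ball 0 D) (\<lambda>y. \<phi> (tangential \<nu> y))" for D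
  proof (rule continuous_on_subset)
    show "ball 0 D \<subseteq> cball 0 (max D 1)" by auto
    have "(max D 1 * \<Lambda>)-lipschitz_on (cball 0 (max D 1)) (\<lambda>y. \<phi> (tangential \<nu> y))"
    proof (rule lipschitz_onI)
      fix x y :: 'a assume xy: "x \<in> cball 0 (max D 1)" "y \<in> cball 0 (max D 1)"
      have "\<bar>\<phi> (tangential \<nu> x) - \<phi> (tangential \<nu> y)\<bar> \<le> \<Lambda> * max D 1 * norm (tangential \<nu> x - tangential \<nu> y)"
        using xy tangential_simps(1)[OF \<nu>] order_trans[OF tangential_simps(4)[OF \<nu>]] by (intro lip) auto
      also have "\<dots> \<le> \<Lambda> * max D 1 * norm (x - y)"
        unfolding tangential_simps(3)[OF \<nu>, symmetric] using assms(2) by (intro mult_left_mono tangential_simps \<nu>) auto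
      finally show "dist (\<phi> (tangential \<nu> x)) (\<phi> (tangential \<nu> y)) \<le> max D 1 * \<Lambda> * dist x y"
        by (simp add: dist_norm mult.commute)
    qed (use assms in auto)
    then show "continuous_on (cball 0 (max D 1)) (\<lambda>y. \<phi> (tangential \<nu> y))"
      by (rule lipschitz_on_continuous_on)
  qed
  then have "continuous (at x) (\<lambda>y. \<phi> (tangential \<nu> y))" for x
    by (intro continuous_on_interior[of "ball 0 (norm x + 1)"]) (auto simp: interior_open)
  then show "continuous_on UNIV (\<lambda>y. \<phi> (tangential \<nu> y))"
    by (simp add: continuous_at_imp_continuous_on)
qed

lemma emeasure_lborel_translate:
  fixes S :: "'a::euclidean_space set"
  assumes [measurable]: "S \<in> sets borel"
  shows "emeasure lborel {x. x - z \<in> S} = emeasure lborel S"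
proof -
  have "(\<integral>\<^sup>+x. indicator S (- z + 1 *\<^sub>R x) \<partial>lborel) = emeasure lborel S"
    by (subst nn_integral_lborel_shift) auto
  moreover have "(\<lambda>x. indicator S (- z + 1 *\<^sub>R x) :: ennreal) = indicator {x. x - z \<in> S}"
    by (auto simp: indicator_def fun_eq_iff)
  moreover have "{x. x - z \<in> S} \<in> sets lborel" by measurable
  ultimately show ?thesis by (metis nn_integral_indicator)
qed

definition inner_tube :: "'a::metric_space set \<Rightarrow> real \<Rightarrow> 'a set" where
  "inner_tube \<Omega> r = {x\<in>\<Omega>. infdist x (- \<Omega>) < r}"

text \<open>
  The part of the tube near a set \<open>C\<close> of diameter at most \<open>D\<close> projects along \<open>\<nu>\<close> into a set of
  diameter at most \<open>D + 2r\<close>, whose area is bounded by the isodiametric inequality. Over it the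
  tube is contained in a layer of height \<open>(1 + \<Lambda>(D + 2r)) r\<close> above the graph: moving by less than
  \<open>r\<close> to a point of the complement changes the height by less than \<open>r\<close>, and the graph by at most
  its slope times \<open>r\<close>.
\<close>
lemma graph_chart_tube_upper:
  fixes \<Omega> :: "'a::euclidean_space set"
  assumes ch: "graph_chart \<Omega> R \<Lambda> z \<nu> \<phi>" and \<Lambda>: "\<Lambda> > 0" and z: "z \<in> C" and D: "\<And>x y. x \<in> C \<Longrightarrow> y \<in> C \<Longrightarrow> dist x y \<le> D" "D > 0"
    and r: "r > 0" "D + 2 * r < R" and "open \<Omega>"
  shows "emeasure lborel {x\<in>\<Omega>. (\<exists>c\<in>C. dist x c < r) \<and> (\<exists>y. y \<notin> \<Omega> \<and> dist x y < r)}
     \<le> ennreal (unit_ball_vol (real (DIM('a) - 1)) * ((D + 2 * r) / 2) ^ (DIM('a) - 1) * (1 + \<Lambda> * (D + 2 * r)) * r)"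
proof -
  have \<nu>: "norm \<nu> = 1" and lip: "\<And>D y y'. y \<bullet> \<nu> = 0 \<Longrightarrow> y' \<bullet> \<nu> = 0 \<Longrightarrow> norm y \<le> D \<Longrightarrow> norm y' \<le> D \<Longrightarrow> \<bar>\<phi> y - \<phi> y'\<bar> \<le> \<Lambda> * D * norm (y - y')"
    and mem: "\<And>y. y \<in> ball z R \<Longrightarrow> y \<in> \<Omega> \<longleftrightarrow> \<phi> (tangential \<nu> (y - z)) < (y - z) \<bullet> \<nu>"
    using ch unfolding graph_chart_def by blast+
  note tan = tangential_simps[OF \<nu>]
  obtain \<kappa> where k1: "\<And>E \<phi> h. E \<in> sets borel \<Longrightarrow> \<phi> \<in> borel_measurable borel \<Longrightarrow> 0 \<le> h \<Longrightarrow>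
       emeasure lborel {x. tangential \<nu> x \<in> E \<and> \<phi> (tangential \<nu> x) < x \<bullet> \<nu> \<and> x \<bullet> \<nu> < \<phi> (tangential \<nu> x) + h} = \<kappa> E * ennreal h"
    and k2: "\<And>E D. E \<in> sets borel \<Longrightarrow> 0 < D \<Longrightarrow> (\<forall>x\<in>E. \<forall>y\<in>E. dist x y \<le> D) \<Longrightarrow>
       \<kappa> E \<le> ennreal (unit_ball_vol (real (DIM('a) - 1)) * (D / 2) ^ (DIM('a) - 1))"
    using ex_hyperplane_measure[OF \<nu>] by blast
  define V where "V = (\<Union>c\<in>C. ball c r)"
  \<comment> \<open>The closure makes the projected set measurable and does not change its diameter.\<close>
  define E where "E = closure ((\<lambda>x. tangential \<nu> (x - z)) ` V)"
  define h where "h = (1 + \<Lambda> * (D + 2 * r)) * r"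
  have h: "h \<ge> 0" using \<Lambda> D r by (simp add: h_def)
  define Z where "Z = {x. tangential \<nu> x \<in> E \<and> \<phi> (tangential \<nu> (tangential \<nu> x)) < x \<bullet> \<nu> \<and> x \<bullet> \<nu> < \<phi> (tangential \<nu> (tangential \<nu> x)) + h}"
  have pm[measurable]: "(\<lambda>y. \<phi> (tangential \<nu> y)) \<in> borel_measurable borel"
    by (rule graph_chart_measurable[OF ch \<Lambda>])
  have tm[measurable]: "tangential \<nu> \<in> borel_measurable borel" unfolding tangential_def by measurable
  have Em[measurable]: "E \<in> sets borel" by (simp add: E_def)
  have Zm[measurable]: "Z \<in> sets borel" unfolding Z_def tan(2) by measurable
  have VD: "dist x y < D + 2 * r" if xy: "x \<in> V" "y \<in> V" for x y
  proof -
    obtain c d where "c \<in> C" "d \<in> C" "dist c x < r" "dist d y < r" using xy by (auto simp: V_def)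
    then show ?thesis using D(1)[of c d] dist_triangle[of x y c] dist_triangle[of c y d] by (auto simp: dist_commute)
  qed
  have ED: "dist x y \<le> D + 2 * r" if xy: "x \<in> E" "y \<in> E" for x y
  proof -
    have "dist x y \<le> D + 2 * r" if xy: "x \<in> (\<lambda>x. tangential \<nu> (x - z)) ` V" "y \<in> (\<lambda>x. tangential \<nu> (x - z)) ` V" for x y
    proof -
      obtain x' y' where x': "x' \<in> V" "y' \<in> V" "x = tangential \<nu> (x' - z)" "y = tangential \<nu> (y' - z)" using xy by auto
      then have "x - y = tangential \<nu> (x' - y')" by (simp add: tan(3))
      then have "dist x y \<le> dist x' y'" using tan(4) by (simp add: dist_norm)
      then show ?thesis using VD[of x' y'] x' by simp
    qed
    then have "(\<lambda>x. tangential \<nu> (x - z)) ` V \<times> (\<lambda>x. tangential \<nu> (x - z)) ` V \<subseteq> {p. dist (fst p) (snd p) \<le> D + 2 * r}"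
      by auto
    moreover have "closed {p::'a\<times>'a. dist (fst p) (snd p) \<le> D + 2 * r}"
      by (intro closed_Collect_le continuous_intros)
    ultimately have "E \<times> E \<subseteq> {p. dist (fst p) (snd p) \<le> D + 2 * r}"
      unfolding E_def closure_Times[symmetric] by (rule closure_minimal)
    then show ?thesis using xy by auto
  qed
  let ?X = "{x\<in>\<Omega>. (\<exists>c\<in>C. dist x c < r) \<and> (\<exists>y. y \<notin> \<Omega> \<and> dist x y < r)}"
  have sub: "?X \<subseteq> {x. x - z \<in> Z}"
  proof
    fix x assume "x \<in> ?X"
    then obtain c y where x: "x \<in> \<Omega>" "c \<in> C" "dist x c < r" "y \<notin> \<Omega>" "dist x y < r" by blast
    have "x \<in> V" using x by (auto simp: V_def dist_commute)
    then have E: "tangential \<nu> (x - z) \<in> E"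
      unfolding E_def by (intro subsetD[OF closure_subset] imageI)
    have xz: "dist x z < D + r" using x D(1)[of c z] z dist_triangle[of x z c] by auto
    have yz: "dist y z < D + 2 * r" using xz x(5) dist_triangle[of y z x] by (auto simp: dist_commute)
    have px: "\<phi> (tangential \<nu> (x - z)) < (x - z) \<bullet> \<nu>" using mem[of x] x xz r by (auto simp: dist_commute)
    have py: "(y - z) \<bullet> \<nu> \<le> \<phi> (tangential \<nu> (y - z))" using mem[of y] x yz r by (auto simp: dist_commute)
    have "\<bar>\<phi> (tangential \<nu> (y - z)) - \<phi> (tangential \<nu> (x - z))\<bar> \<le> \<Lambda> * (D + 2 * r) * norm (tangential \<nu> (y - z) - tangential \<nu> (x - z))"
    proof (rule lip)
      show "norm (tangential \<nu> (y - z)) \<le> D + 2 * r" "norm (tangential \<nu> (x - z)) \<le> D + 2 * r"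
        using tan(4)[of "y - z"] tan(4)[of "x - z"] xz yz r by (auto simp: dist_norm)
    qed (simp_all only: tan(1))
    also have "norm (tangential \<nu> (y - z) - tangential \<nu> (x - z)) \<le> r"
      using tan(4)[of "y - x"] x(5) by (simp add: tan(3)[symmetric] dist_norm norm_minus_commute)
    finally have a: "\<phi> (tangential \<nu> (y - z)) - \<phi> (tangential \<nu> (x - z)) \<le> \<Lambda> * (D + 2 * r) * r"
      using \<Lambda> D(2) r by (simp add: mult_left_mono)
    have "(x - y) \<bullet> \<nu> \<le> norm (x - y)" using norm_cauchy_schwarz[of "x - y" \<nu>] \<nu> by simp
    then have "(x - z) \<bullet> \<nu> - (y - z) \<bullet> \<nu> < r" using x(5) by (simp add: inner_diff_left dist_norm)
    with a py have "(x - z) \<bullet> \<nu> < \<phi> (tangential \<nu> (x - z)) + h" by (simp add: h_def algebra_simps)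
    with E px show "x \<in> {x. x - z \<in> Z}" by (simp add: Z_def tan(2))
  qed
  have "emeasure lborel ?X \<le> emeasure lborel {x. x - z \<in> Z}"
    using sub by (intro emeasure_mono) auto
  also have "\<dots> = emeasure lborel Z" by (rule emeasure_lborel_translate) simp
  also have "\<dots> = \<kappa> E * ennreal h" unfolding Z_def by (rule k1) (use h in auto)
  also have "\<dots> \<le> ennreal (unit_ball_vol (real (DIM('a) - 1)) * ((D + 2 * r) / 2) ^ (DIM('a) - 1)) * ennreal h"
    using ED D r by (intro mult_right_mono k2) auto
  also have "\<dots> = ennreal (unit_ball_vol (real (DIM('a) - 1)) * ((D + 2 * r) / 2) ^ (DIM('a) - 1) * (1 + \<Lambda> * (D + 2 * r)) * r)"
    using h D r by (simp add: ennreal_mult'[symmetric] h_def mult.assoc)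
  finally show ?thesis .
qed

text \<open>
  The set \<open>Y\<close> is the sheared cylinder of height \<open>r\<close> over the disc of radius \<open>(1 - \<epsilon>)\<rho>\<close>. Its points
  are closer than \<open>r\<close> to the graph point below them, which lies outside \<open>\<Omega>\<close>; and since the slope
  is at most \<open>\<epsilon>\<close>, that graph point is within \<open>(1 + \<epsilon>)(1 - \<epsilon>)\<rho> \<le> \<rho>\<close> of \<open>z\<close>.
\<close>
lemma graph_chart_tube_lower:
  fixes \<Omega> :: "'a::euclidean_space set"
  assumes ch: "graph_chart \<Omega> R \<Lambda> z \<nu> \<phi>" and \<Lambda>: "\<Lambda> > 0" and \<epsilon>: "0 < \<epsilon>" "\<epsilon> < 1" and \<rho>: "0 < \<rho>" "\<Lambda> * \<rho> \<le> \<epsilon>" "2 * \<rho> < R" 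
    and r: "0 < r" "r \<le> \<rho>" 
  shows "\<exists>Y\<in>sets borel. Y \<subseteq> inner_tube \<Omega> r \<and> (\<forall>x\<in>Y. \<exists>p\<in>cball z \<rho>. dist x p < r) \<and>
     emeasure lborel Y = ennreal (unit_ball_vol (real (DIM('a) - 1)) * ((1 - \<epsilon>) * \<rho>) ^ (DIM('a) - 1) * r)"
proof -
  have \<nu>: "norm \<nu> = 1" and \<phi>0: "\<phi> 0 = 0" and lip: "\<And>D y y'. y \<bullet> \<nu> = 0 \<Longrightarrow> y' \<bullet> \<nu> = 0 \<Longrightarrow> norm y \<le> D \<Longrightarrow> norm y' \<le> D \<Longrightarrow> \<bar>\<phi> y - \<phi> y'\<bar> \<le> \<Lambda> * D * norm (y - y')"
    and mem: "\<And>y. y \<in> ball z R \<Longrightarrow> y \<in> \<Omega> \<longleftrightarrow> \<phi> (tangential \<nu> (y - z)) < (y - z) \<bullet> \<nu>"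
    using ch unfolding graph_chart_def by blast+
  note tan = tangential_simps[OF \<nu>]
  obtain \<kappa> where k1: "\<And>E \<phi> h. E \<in> sets borel \<Longrightarrow> \<phi> \<in> borel_measurable borel \<Longrightarrow> 0 \<le> h \<Longrightarrow>
       emeasure lborel {x. tangential \<nu> x \<in> E \<and> \<phi> (tangential \<nu> x) < x \<bullet> \<nu> \<and> x \<bullet> \<nu> < \<phi> (tangential \<nu> x) + h} = \<kappa> E * ennreal h"
    and k3: "\<And>r. r > 0 \<Longrightarrow> \<kappa> (cball 0 r) = ennreal (unit_ball_vol (real (DIM('a) - 1)) * r ^ (DIM('a) - 1))"
    using ex_hyperplane_measure[OF \<nu>] by blast
  have pm[measurable]: "(\<lambda>y. \<phi> (tangential \<nu> y)) \<in> borel_measurable borel"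
    by (rule graph_chart_measurable[OF ch \<Lambda>])
  have tm[measurable]: "tangential \<nu> \<in> borel_measurable borel" unfolding tangential_def by measurable
  define E where "E = cball (0::'a) ((1 - \<epsilon>) * \<rho>)"
  have Em[measurable]: "E \<in> sets borel" by (simp add: E_def)
  define Z where "Z = {x. tangential \<nu> x \<in> E \<and> \<phi> (tangential \<nu> (tangential \<nu> x)) < x \<bullet> \<nu> \<and> x \<bullet> \<nu> < \<phi> (tangential \<nu> (tangential \<nu> x)) + r}"
  have Zm[measurable]: "Z \<in> sets borel" unfolding Z_def tan(2) by measurable
  define Y where "Y = {x. x - z \<in> Z}"
  have Ym: "Y \<in> sets borel" unfolding Y_def by measurable
  have key: "x \<in> inner_tube \<Omega> r \<and> (\<exists>p\<in>cball z \<rho>. dist x p < r)" if x: "x \<in> Y" for x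
  proof -
    define b where "b = tangential \<nu> (x - z)"
    have b: "norm b \<le> (1 - \<epsilon>) * \<rho>" "\<phi> b < (x - z) \<bullet> \<nu>" "(x - z) \<bullet> \<nu> < \<phi> b + r"
      using x by (auto simp: Y_def Z_def E_def b_def tan(2))
    have b0: "b \<bullet> \<nu> = 0" "tangential \<nu> b = b" unfolding b_def by (simp_all only: tan(1,2))
    \<comment> \<open>The graph point vertically below \<open>x\<close>.\<close>
    define p where "p = z + b + \<phi> b *\<^sub>R \<nu>"
    have "(1 - \<epsilon>) * \<rho> \<le> 1 * \<rho>" using \<epsilon> \<rho> by (intro mult_right_mono) auto
    then have b1: "norm b \<le> \<rho>" using b(1) by simp
    have "\<bar>\<phi> b\<bar> \<le> \<Lambda> * \<rho> * norm b" using lip[of b 0 \<rho>] b0 b1 \<phi>0 \<rho> by simp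
    also have "\<dots> \<le> \<epsilon> * norm b" using \<rho> by (intro mult_right_mono) auto
    finally have "norm (b + \<phi> b *\<^sub>R \<nu>) \<le> (1 + \<epsilon>) * norm b"
      using norm_triangle_ineq[of b "\<phi> b *\<^sub>R \<nu>"] \<nu> by (simp add: algebra_simps)
    also have "\<dots> \<le> (1 + \<epsilon>) * ((1 - \<epsilon>) * \<rho>)" using b \<epsilon> by (intro mult_left_mono) auto
    also have "\<dots> \<le> \<rho>" using \<rho> \<epsilon> by (simp add: algebra_simps)
    finally have pz: "norm (p - z) \<le> \<rho>" by (simp add: p_def)
    have xp: "x = p + ((x - z) \<bullet> \<nu> - \<phi> b) *\<^sub>R \<nu>"
      by (simp add: p_def b_def tangential_def algebra_simps)
    then have "dist x p = norm (((x - z) \<bullet> \<nu> - \<phi> b) *\<^sub>R \<nu>)" by (metis add_diff_cancel_left' dist_norm)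
    then have dxp: "dist x p < r" using b \<nu> by simp
    have "dist x z < R" using dxp pz r \<rho> dist_triangle[of x z p] by (simp add: dist_norm)
    then have x\<Omega>: "x \<in> \<Omega>" using mem[of x] b by (simp add: dist_commute b_def)
    have n1: "\<nu> \<bullet> \<nu> = 1" using \<nu> by (simp add: dot_square_norm)
    have pd: "p - z = b + \<phi> b *\<^sub>R \<nu>" by (simp add: p_def)
    have "(p - z) \<bullet> \<nu> = \<phi> b" unfolding pd by (simp add: inner_add_left b0 n1)
    moreover from this have "tangential \<nu> (p - z) = b" by (simp add: tangential_def pd)
    moreover have "p \<in> ball z R" using pz \<rho> by (simp add: dist_norm norm_minus_commute)
    ultimately have "p \<notin> \<Omega>" using mem[of p] by simp
    then have "infdist x (- \<Omega>) \<le> dist x p" by (intro infdist_le) auto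
    with dxp x\<Omega> pz show ?thesis by (auto simp: inner_tube_def dist_norm norm_minus_commute intro!: bexI[of _ p])
  qed
  have "emeasure lborel Y = emeasure lborel Z" unfolding Y_def by (rule emeasure_lborel_translate) simp
  also have "\<dots> = \<kappa> E * ennreal r" unfolding Z_def by (rule k1) (use r in auto)
  also have "\<dots> = ennreal (unit_ball_vol (real (DIM('a) - 1)) * ((1 - \<epsilon>) * \<rho>) ^ (DIM('a) - 1) * r)"
    unfolding E_def using \<epsilon> \<rho> r by (subst k3) (auto simp: ennreal_mult'[symmetric])
  finally show ?thesis using Ym key by blast
qed

section \<open>Minkowski content and Hausdorff measure of the boundary\<close>

text \<open>
  A covering by balls indexed by a set \<open>I\<close> of naturals, padded with empty sets, which weigh
  nothing.
\<close>
lemma hausdorff_premeasure_le_suminf: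
  fixes S :: "'a::euclidean_space set"
  assumes "S \<subseteq> (\<Union>n\<in>I. cball (a n) (r n))" and "\<And>n. n \<in> I \<Longrightarrow> 0 \<le> r n \<and> 2 * r n \<le> \<delta>" and "0 \<le> \<delta>"
    and f: "\<And>n. n \<in> I \<Longrightarrow> unit_ball_vol (real k) * r n ^ k \<le> f n" "\<And>n. 0 \<le> f n" "summable f"
  shows "hausdorff_premeasure k \<delta> S \<le> ennreal (suminf f)"
proof -
  define C where "C n = (if n \<in> I then cball (a n) (r n) else {})" for n :: nat
  have "hausdorff_premeasure k \<delta> S \<le> (\<Sum>i. if C i = {} then 0 else ennreal (unit_ball_vol (real k) * (diameter (C i) / 2) ^ k))"
    unfolding hausdorff_premeasure_def
  proof (rule INF_lower, safe)
    fix x assume "x \<in> S"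
    then obtain n where "n \<in> I" "x \<in> cball (a n) (r n)" using assms(1) by blast
    then show "x \<in> \<Union> (range C)" unfolding C_def by (intro UN_I[of n]) auto
  next
    fix i show "bounded (C i)" "diameter (C i) \<le> \<delta>"
      using assms(2)[of i] assms(3) by (auto simp: C_def diameter_cball)
  qed
  also have "\<dots> \<le> (\<Sum>i. ennreal (f i))"
  proof (rule suminf_le)
    fix i
    show "(if C i = {} then 0 else ennreal (unit_ball_vol (real k) * (diameter (C i) / 2) ^ k)) \<le> ennreal (f i)"
      using assms(2)[of i] f(1)[of i] by (auto simp: C_def diameter_cball intro!: ennreal_leI)
  qed auto
  also have "\<dots> = ennreal (suminf f)" using f by (intro suminf_ennreal2) auto
  finally show ?thesis .
qed

lemma open_inner_tube:
  fixes \<Omega> :: "'a::euclidean_space set"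
  assumes "open \<Omega>"
  shows "open (inner_tube \<Omega> r)"
proof -
  have "open ({x. infdist x (- \<Omega>) < r})" by (intro open_Collect_less continuous_intros)
  then show ?thesis using assms unfolding inner_tube_def by (simp add: Collect_conj_eq open_Int)
qed

lemma emeasure_inner_tube:
  fixes \<Omega> :: "'a::euclidean_space set"
  assumes "bounded \<Omega>"
  shows "emeasure lborel (inner_tube \<Omega> r) = ennreal (measure lborel (inner_tube \<Omega> r))"
proof -
  have "bounded (inner_tube \<Omega> r)" using assms by (rule bounded_subset) (auto simp: inner_tube_def)
  then show ?thesis using emeasure_bounded_finite by (intro emeasure_eq_ennreal_measure) (simp add: less_top)
qed

text \<open>
  If the tube has volume at most \<open>c r\<close> for arbitrarily small \<open>r\<close>, then the cylinders over finitely
  many disjoint balls centred on the boundary have total base area at most \<open>c\<close>: disjoint compact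
  balls are a positive distance apart, so for small \<open>r\<close> the cylinders, which stay within \<open>r\<close> of
  their balls, are disjoint subsets of the tube.
\<close>
lemma disjoint_balls_content_le:
  fixes \<Omega> :: "'a::euclidean_space set" and F :: "('a \<times> real) set"
  assumes R: "\<Lambda> > 0" and charts: "\<And>z. z \<in> frontier \<Omega> \<Longrightarrow> \<exists>\<nu> \<phi>. graph_chart \<Omega> R \<Lambda> z \<nu> \<phi>"
    and \<Omega>: "open \<Omega>" "bounded \<Omega>"
    and freq: "frequently (\<lambda>r. measure lborel (inner_tube \<Omega> r) \<le> c * r) (at_right 0)"
    and \<epsilon>: "0 < \<epsilon>" "\<epsilon> < 1" and F: "finite F"
    and Fz: "\<And>i. i \<in> F \<Longrightarrow> fst i \<in> frontier \<Omega> \<and> 0 < snd i \<and> \<Lambda> * snd i \<le> \<epsilon> \<and> 2 * snd i < R"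
    and disj: "pairwise (\<lambda>i j. disjnt (cball (fst i) (snd i)) (cball (fst j) (snd j))) F"
  shows "(\<Sum>i\<in>F. unit_ball_vol (real (DIM('a) - 1)) * ((1 - \<epsilon>) * snd i) ^ (DIM('a) - 1)) \<le> c"
proof (rule ccontr)
  let ?g = "\<lambda>i::'a\<times>real. unit_ball_vol (real (DIM('a) - 1)) * ((1 - \<epsilon>) * snd i) ^ (DIM('a) - 1)"
  assume "\<not> (\<Sum>i\<in>F. ?g i) \<le> c"
  then have big: "c < (\<Sum>i\<in>F. ?g i)" by simp
  have g0: "0 \<le> ?g i" if "i \<in> F" for i using \<epsilon> Fz[OF that] by simp
  have ev1: "eventually (\<lambda>r. r \<le> snd i) (at_right 0)" if "i \<in> F" for i
    using Fz[OF that] by (auto simp: eventually_at_right_field intro!: exI[of _ "snd i"])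
  have ev2: "eventually (\<lambda>r. \<forall>x\<in>cball (fst i) (snd i). \<forall>y\<in>cball (fst j) (snd j). 2 * r \<le> dist x y) (at_right 0)"
    if "i \<in> F" "j \<in> F" "i \<noteq> j" for i j
  proof -
    have "cball (fst i) (snd i) \<inter> cball (fst j) (snd j) = {}"
      using disj that by (auto simp: pairwise_def disjnt_def)
    then obtain d where d: "d > 0" "\<forall>x\<in>cball (fst i) (snd i). \<forall>y\<in>cball (fst j) (snd j). d \<le> dist x y"
      using separate_compact_closed[of "cball (fst i) (snd i)" "cball (fst j) (snd j)"] by auto
    have "\<forall>x\<in>cball (fst i) (snd i). \<forall>y\<in>cball (fst j) (snd j). 2 * r \<le> dist x y" if "r < d / 2" for r
      using d(2) that by (smt (verit) field_sum_of_halves)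
    then show ?thesis using d(1) unfolding eventually_at_right_field by (intro exI[of _ "d / 2"]) auto
  qed
  have ev2': "eventually (\<lambda>r. i \<noteq> j \<longrightarrow> (\<forall>x\<in>cball (fst i) (snd i). \<forall>y\<in>cball (fst j) (snd j). 2 * r \<le> dist x y)) (at_right 0)"
    if "i \<in> F" "j \<in> F" for i j
    using ev2[OF that] by (cases "i = j") auto
  have e1: "eventually (\<lambda>r. \<forall>i\<in>F. r \<le> snd i) (at_right 0)"
    using F ev1 by (intro eventually_ball_finite) auto
  have e2: "eventually (\<lambda>r. \<forall>i\<in>F. \<forall>j\<in>F. i \<noteq> j \<longrightarrow> (\<forall>x\<in>cball (fst i) (snd i). \<forall>y\<in>cball (fst j) (snd j). 2 * r \<le> dist x y)) (at_right 0)"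
    using F ev2' by (intro eventually_ball_finite ballI) auto
  have "eventually (\<lambda>r::real. 0 < r) (at_right 0)" by (rule eventually_at_right_less)
  with e1 e2 have "eventually (\<lambda>r. \<not> measure lborel (inner_tube \<Omega> r) \<le> c * r) (at_right 0)"
  proof eventually_elim
    case (elim r)
    have "\<forall>i\<in>F. \<exists>Y. Y\<in>sets borel \<and> Y \<subseteq> inner_tube \<Omega> r \<and> (\<forall>x\<in>Y. \<exists>p\<in>cball (fst i) (snd i). dist x p < r) \<and>
      emeasure lborel Y = ennreal (?g i * r)"
    proof
      fix i assume i: "i \<in> F"
      obtain \<nu> \<phi> where "graph_chart \<Omega> R \<Lambda> (fst i) \<nu> \<phi>" using charts Fz[OF i] by blast
      from graph_chart_tube_lower[OF this R \<epsilon>, of "snd i" r] Fz[OF i] elim i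
      show "\<exists>Y. Y\<in>sets borel \<and> Y \<subseteq> inner_tube \<Omega> r \<and> (\<forall>x\<in>Y. \<exists>p\<in>cball (fst i) (snd i). dist x p < r) \<and>
        emeasure lborel Y = ennreal (?g i * r)" by blast
    qed
    from bchoice[OF this] obtain Y where Y: "\<And>i. i \<in> F \<Longrightarrow> Y i \<in> sets borel" "\<And>i. i \<in> F \<Longrightarrow> Y i \<subseteq> inner_tube \<Omega> r"
      "\<And>i x. i \<in> F \<Longrightarrow> x \<in> Y i \<Longrightarrow> \<exists>p\<in>cball (fst i) (snd i). dist x p < r"
      "\<And>i. i \<in> F \<Longrightarrow> emeasure lborel (Y i) = ennreal (?g i * r)"
      by blast
    have "disjoint_family_on Y F"
      unfolding disjoint_family_on_def
    proof (intro ballI impI)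
      fix i j assume ij: "i \<in> F" "j \<in> F" "i \<noteq> j"
      { fix x assume x: "x \<in> Y i" "x \<in> Y j"
        obtain p q where p: "p \<in> cball (fst i) (snd i)" "dist x p < r" and q: "q \<in> cball (fst j) (snd j)" "dist x q < r"
          using Y(3)[OF ij(1) x(1)] Y(3)[OF ij(2) x(2)] by blast
        have "2 * r \<le> dist p q" using elim(2) ij p q by blast
        also have "dist p q \<le> dist x p + dist x q" by (metis dist_commute dist_triangle)
        finally have False using p q by simp }
      then show "Y i \<inter> Y j = {}" by blast
    qed
    have "ennreal ((\<Sum>i\<in>F. ?g i) * r) = (\<Sum>i\<in>F. ennreal (?g i * r))"
      using g0 elim(3) by (subst sum_ennreal) (auto simp: sum_distrib_right intro!: mult_nonneg_nonneg)
    also have "\<dots> = (\<Sum>i\<in>F. emeasure lborel (Y i))" by (simp add: Y(4))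
    also have "\<dots> = emeasure lborel (\<Union>i\<in>F. Y i)"
      using Y(1) F \<open>disjoint_family_on Y F\<close> by (intro sum_emeasure) auto
    also have "\<dots> \<le> emeasure lborel (inner_tube \<Omega> r)"
      using Y(2) open_inner_tube[OF \<Omega>(1)] by (intro emeasure_mono) auto
    also have "\<dots> = ennreal (measure lborel (inner_tube \<Omega> r))" by (rule emeasure_inner_tube[OF \<Omega>(2)])
    finally have "(\<Sum>i\<in>F. ?g i) * r \<le> measure lborel (inner_tube \<Omega> r)" by (simp add: ennreal_le_iff)
    moreover have "c * r < (\<Sum>i\<in>F. ?g i) * r" using big elim(3) by (intro mult_strict_right_mono)
    ultimately show ?case by linarith
  qed
  then show False using freq by (simp add: frequently_def)
qed

text \<open>
  Vitali's lemma yields disjoint balls centred on the boundary whose fivefold enlargements cover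
  it. Their radii are summable in the \<open>(d-1)\<close>-st power by the preceding bound, so enlarging only
  the balls beyond a large index \<open>N\<close> costs an arbitrarily small amount. The first \<open>N\<close> balls
  together with the enlarged later ones still cover the boundary.
\<close>
lemma hausdorff_premeasure_le_inner_content:
  fixes \<Omega> :: "'a::euclidean_space set"
  assumes R: "R > 0" "\<Lambda> > 0" and charts: "\<And>z. z \<in> frontier \<Omega> \<Longrightarrow> \<exists>\<nu> \<phi>. graph_chart \<Omega> R \<Lambda> z \<nu> \<phi>"
    and \<Omega>: "open \<Omega>" "bounded \<Omega>"
    and freq: "frequently (\<lambda>r. measure lborel (inner_tube \<Omega> r) \<le> c * r) (at_right 0)"
    and \<epsilon>: "0 < \<epsilon>" "\<epsilon> < 1" and \<delta>: "\<delta> > 0"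
  shows "hausdorff_premeasure (DIM('a) - 1) \<delta> (frontier \<Omega>) \<le> ennreal (c / (1 - \<epsilon>) ^ (DIM('a) - 1))"
proof -
  let ?k = "DIM('a) - 1"
  let ?w = "unit_ball_vol (real ?k)"
  let ?c = "c / (1 - \<epsilon>) ^ ?k"
  \<comment> \<open>The three bounds: an enlarged ball has diameter at most \<open>10 \<rho>0 \<le> \<delta>\<close>, the slope over a
     ball is at most \<open>\<epsilon>\<close>, and each ball lies well inside its chart.\<close>
  define \<rho>0 where "\<rho>0 = min (\<delta> / 10) (min (\<epsilon> / \<Lambda>) (R / 3))"
  have \<rho>0: "\<rho>0 > 0" "10 * \<rho>0 \<le> \<delta>" "\<Lambda> * \<rho>0 \<le> \<epsilon>" "2 * \<rho>0 < R"
  proof -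
    show "\<rho>0 > 0" using R \<epsilon> \<delta> by (simp add: \<rho>0_def)
    show "10 * \<rho>0 \<le> \<delta>" by (simp add: \<rho>0_def min_le_iff_disj)
    have "\<Lambda> * \<rho>0 \<le> \<Lambda> * (\<epsilon> / \<Lambda>)" using R by (intro mult_left_mono) (auto simp: \<rho>0_def)
    then show "\<Lambda> * \<rho>0 \<le> \<epsilon>" using R by simp
    have "\<rho>0 \<le> R / 3" unfolding \<rho>0_def by linarith
    then show "2 * \<rho>0 < R" using R by simp
  qed
  define K where "K = {(z, \<rho>). z \<in> frontier \<Omega> \<and> 0 < \<rho> \<and> \<rho> \<le> \<rho>0}"
  have K0: "0 < snd i \<and> snd i \<le> \<rho>0" if "i \<in> K" for i using that by (auto simp: K_def)
  obtain C where C: "countable C" "C \<subseteq> K"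
     "pairwise (\<lambda>i j. disjnt (cball (fst i) (snd i)) (cball (fst j) (snd j))) C"
     "\<And>i. i \<in> K \<Longrightarrow> \<exists>j. j \<in> C \<and> \<not> disjnt (cball (fst i) (snd i)) (cball (fst j) (snd j)) \<and>
                        cball (fst i) (snd i) \<subseteq> ball (fst j) (5 * snd j)"
    by (rule Vitali_covering_lemma_cballs_balls[of K snd \<rho>0 fst]) (use K0 in blast)+
  have CK: "fst i \<in> frontier \<Omega> \<and> 0 < snd i \<and> snd i \<le> \<rho>0" if "i \<in> C" for i
    using C(2) that by (auto simp: K_def)
  have fin: "(\<Sum>i\<in>F. ?w * snd i ^ ?k) \<le> ?c" if F: "finite F" "F \<subseteq> C" for F
  proof -
    have "(\<Sum>i\<in>F. ?w * ((1 - \<epsilon>) * snd i) ^ ?k) \<le> c"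
    proof (rule disjoint_balls_content_le[OF R(2) charts \<Omega> freq \<epsilon> F(1)])
      fix i assume iF: "i \<in> F"
      then have i: "fst i \<in> frontier \<Omega>" "0 < snd i" "snd i \<le> \<rho>0" using CK[OF subsetD[OF F(2) iF]] by auto
      then have "\<Lambda> * snd i \<le> \<Lambda> * \<rho>0" using R by (intro mult_left_mono) auto
      then show "fst i \<in> frontier \<Omega> \<and> 0 < snd i \<and> \<Lambda> * snd i \<le> \<epsilon> \<and> 2 * snd i < R"
        using i \<rho>0 by linarith
    qed (use pairwise_subset[OF C(3) F(2)] in auto)
    also have "(\<Sum>i\<in>F. ?w * ((1 - \<epsilon>) * snd i) ^ ?k) = (1 - \<epsilon>) ^ ?k * (\<Sum>i\<in>F. ?w * snd i ^ ?k)"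
      by (simp add: power_mult_distrib sum_distrib_left mult_ac)
    finally show ?thesis using \<epsilon> by (simp add: field_simps)
  qed
  define I where "I = to_nat_on C ` C"
  define e where "e = from_nat_into C"
  have eC: "e n \<in> C" if "n \<in> I" for n using that C(1) by (auto simp: I_def e_def)
  have inj: "inj_on e I" using C(1) by (auto simp: I_def e_def inj_on_def)
  have eI: "\<exists>n\<in>I. e n = j" if "j \<in> C" for j using that C(1) by (auto simp: I_def e_def)
  define f where "f n = (if n \<in> I then ?w * snd (e n) ^ ?k else 0)" for n
  have f0: "f n \<ge> 0" for n using CK[OF eC, of n] by (auto simp: f_def)
  have fsum: "sum f {..<n} \<le> ?c" for n
  proof -
    have "sum f {..<n} = (\<Sum>m\<in>{..<n} \<inter> I. ?w * snd (e m) ^ ?k)"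
      unfolding f_def by (rule sum.inter_restrict[symmetric]) simp
    also have "\<dots> = (\<Sum>i\<in>e ` ({..<n} \<inter> I). ?w * snd i ^ ?k)"
      using inj by (subst sum.reindex) (auto simp: inj_on_def)
    also have "\<dots> \<le> ?c" using eC by (intro fin) auto
    finally show ?thesis .
  qed
  have fs: "summable f" by (rule summableI_nonneg_bounded[of f ?c]) (use f0 fsum in auto)
  have fle: "suminf f \<le> ?c" using fs fsum by (intro suminf_le_const) auto
  have bound: "hausdorff_premeasure ?k \<delta> (frontier \<Omega>) \<le> ennreal (?c + \<eta>)" if \<eta>: "\<eta> > 0" for \<eta>
  proof -
    \<comment> \<open>The enlargement multiplies the tail of the series by \<open>5\<close> to the power \<open>d - 1\<close>.\<close>
    obtain N where N: "norm (\<Sum>i. f (i + N)) < \<eta> / 5 ^ ?k"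
      using suminf_exist_split[OF _ fs, of "\<eta> / 5 ^ ?k"] \<eta> by auto
    define r where "r n = (if n < N then snd (e n) else 5 * snd (e n))" for n
    define g where "g n = (if n < N then f n else 5 ^ ?k * f n)" for n
    have gs: "summable g"
      using fs by (subst summable_iff_shift[of g N, symmetric]) (simp add: g_def summable_mult summable_ignore_initial_segment)
    have "suminf g = (\<Sum>i. g (i + N)) + sum g {..<N}" using gs by (rule suminf_split_initial_segment)
    also have "(\<Sum>i. g (i + N)) = 5 ^ ?k * (\<Sum>i. f (i + N))"
      using fs by (simp add: g_def suminf_mult summable_ignore_initial_segment)
    also have "\<dots> \<le> 5 ^ ?k * (\<eta> / 5 ^ ?k)" using N by (intro mult_left_mono) auto
    also have "sum g {..<N} = sum f {..<N}" by (simp add: g_def)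
    also have "\<dots> \<le> ?c" by (rule fsum)
    finally have gle: "suminf g \<le> ?c + \<eta>" by simp
    have "hausdorff_premeasure ?k \<delta> (frontier \<Omega>) \<le> ennreal (suminf g)"
    proof (rule hausdorff_premeasure_le_suminf)
      show "frontier \<Omega> \<subseteq> (\<Union>n\<in>I. cball (fst (e n)) (r n))"
      proof
        fix x assume x: "x \<in> frontier \<Omega>"
        define B where "B = (\<Union>n\<in>{..<N} \<inter> I. cball (fst (e n)) (snd (e n)))"
        show "x \<in> (\<Union>n\<in>I. cball (fst (e n)) (r n))"
        proof (cases "x \<in> B")
          case True
          then show ?thesis by (auto simp: B_def r_def)
        next
          case False
          have "closed B" unfolding B_def by (intro closed_UN) auto
          then obtain d where d: "d > 0" "ball x d \<subseteq> - B"
            using False by (metis ComplI open_Compl open_contains_ball)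
          \<comment> \<open>A small ball about \<open>x\<close> misses the first \<open>N\<close> balls, so the selected ball that it
             meets comes later, and the enlargement of that ball contains \<open>x\<close>.\<close>
          define \<rho> where "\<rho> = min (d / 2) \<rho>0"
          have \<rho>: "0 < \<rho>" "\<rho> < d" "\<rho> \<le> \<rho>0" using d \<rho>0 by (auto simp: \<rho>_def)
          then have "(x, \<rho>) \<in> K" using x by (simp add: K_def)
          from C(4)[OF this] obtain j where j: "j \<in> C" "\<not> disjnt (cball x \<rho>) (cball (fst j) (snd j))" "cball x \<rho> \<subseteq> ball (fst j) (5 * snd j)"
            by auto
          obtain n where n: "n \<in> I" "e n = j" using eI[OF j(1)] by blast
          have "\<not> n < N"
          proof
            assume "n < N"
            then have "cball (fst j) (snd j) \<subseteq> B" using n by (auto simp: B_def)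
            moreover have "cball x \<rho> \<subseteq> ball x d" using \<rho> by auto
            ultimately show False using j(2) d(2) by (auto simp: disjnt_def)
          qed
          moreover have "x \<in> ball (fst j) (5 * snd j)" using j(3) \<rho>(1) by (meson centre_in_cball less_imp_le subsetD)
          ultimately show ?thesis using n by (auto simp: r_def intro!: bexI[of _ n])
        qed
      qed
    next
      fix n assume n: "n \<in> I"
      show "0 \<le> r n \<and> 2 * r n \<le> \<delta>" using CK[OF eC[OF n]] \<rho>0 by (auto simp: r_def)
      show "?w * r n ^ ?k \<le> g n" using n by (auto simp: r_def g_def f_def power_mult_distrib)
    next
      fix n show "0 \<le> g n" using f0[of n] by (simp add: g_def)
    qed (use \<delta> gs in auto)
    also have "\<dots> \<le> ennreal (?c + \<eta>)" using gle by (rule ennreal_leI)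
    finally show ?thesis .
  qed
  have "((\<lambda>\<eta>. ennreal (?c + \<eta>)) \<longlongrightarrow> ennreal (?c + 0)) (at_right 0)"
    by (intro tendsto_intros)
  then show ?thesis
    using bound by (intro tendsto_lowerbound[of _ _ "at_right (0::real)"]) (auto simp: eventually_at_right_less eventually_at_filter)
qed

lemma hausdorff_measure_le_inner_content:
  fixes \<Omega> :: "'a::euclidean_space set"
  assumes R: "R > 0" "\<Lambda> > 0" and charts: "\<And>z. z \<in> frontier \<Omega> \<Longrightarrow> \<exists>\<nu> \<phi>. graph_chart \<Omega> R \<Lambda> z \<nu> \<phi>"
    and \<Omega>: "open \<Omega>" "bounded \<Omega>"
    and freq: "frequently (\<lambda>r. measure lborel (inner_tube \<Omega> r) \<le> c * r) (at_right 0)"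
  shows "hausdorff_measure (DIM('a) - 1) (frontier \<Omega>) \<le> ennreal c"
proof -
  let ?k = "DIM('a) - 1"
  have le: "hausdorff_measure ?k (frontier \<Omega>) \<le> ennreal (c / (1 - \<epsilon>) ^ ?k)" if "0 < \<epsilon>" "\<epsilon> < 1" for \<epsilon>
    unfolding hausdorff_measure_def
    using hausdorff_premeasure_le_inner_content[OF R charts \<Omega> freq that] by (intro SUP_least) auto
  have "((\<lambda>\<epsilon>. ennreal (c / (1 - \<epsilon>) ^ ?k)) \<longlongrightarrow> ennreal (c / (1 - 0) ^ ?k)) (at_right 0)"
    by (intro tendsto_intros) auto
  moreover have "eventually (\<lambda>\<epsilon>. hausdorff_measure ?k (frontier \<Omega>) \<le> ennreal (c / (1 - \<epsilon>) ^ ?k)) (at_right 0)"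
    unfolding eventually_at_right_field using le by (intro exI[of _ 1]) auto
  ultimately show ?thesis by (auto dest: tendsto_lowerbound)
qed

text \<open>
  The open ball of radius \<open>dist x z\<close> about \<open>x\<close> is contained in \<open>\<Omega>\<close>, so a nearest point \<open>z\<close> of the
  complement is also in the closure of \<open>\<Omega>\<close>.
\<close>
lemma nearest_complement_point:
  fixes \<Omega> :: "'a::euclidean_space set"
  assumes "open \<Omega>" "bounded \<Omega>" "x \<in> \<Omega>"
  obtains z where "z \<in> frontier \<Omega>" "z \<notin> \<Omega>" "dist x z = infdist x (- \<Omega>)"
proof -
  have ne: "- \<Omega> \<noteq> {}" using assms(2) not_bounded_UNIV by (metis Compl_UNIV_eq double_complement)
  obtain z where z: "z \<in> - \<Omega>" "infdist x (- \<Omega>) = dist x z"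
    using infdist_attains_inf[of "- \<Omega>" x] assms(1) ne by auto
  have pos: "dist x z > 0" using z assms by auto
  have "z islimpt \<Omega> \<or> z \<in> closure \<Omega>"
  proof -
    have "ball x (dist x z) \<subseteq> \<Omega>"
    proof
      fix y assume y: "y \<in> ball x (dist x z)"
      show "y \<in> \<Omega>"
      proof (rule ccontr)
        assume "y \<notin> \<Omega>"
        then have "infdist x (- \<Omega>) \<le> dist x y" by (intro infdist_le) auto
        then show False using y z by simp
      qed
    qed
    then have "closure (ball x (dist x z)) \<subseteq> closure \<Omega>" by (rule closure_mono)
    then show ?thesis using pos by (auto simp: closure_ball)
  qed
  then have "z \<in> closure \<Omega>" by (auto simp: closure_def)
  then have "z \<in> frontier \<Omega>" using z(1) assms(1) by (simp add: frontier_def interior_open)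
  then show ?thesis using that z by auto
qed

lemma ex_larger_diameter:
  fixes D \<delta> \<eta> w :: real
  assumes "D < \<delta>" "0 < \<eta>"
  shows "\<exists>D'>D. D' < \<delta> \<and> w * (D' / 2) ^ k < w * (D / 2) ^ k + \<eta>"
proof -
  have "((\<lambda>d. w * (d / 2) ^ k) \<longlongrightarrow> w * (D / 2) ^ k) (at_right D)"
    by (intro tendsto_intros) auto
  then have "eventually (\<lambda>d. w * (d / 2) ^ k < w * (D / 2) ^ k + \<eta>) (at_right D)"
    using assms by (intro order_tendstoD) auto
  moreover have "eventually (\<lambda>d. d < \<delta>) (at_right D)"
    using assms by (auto simp: eventually_at_right_field intro!: exI[of _ \<delta>])
  moreover have "eventually (\<lambda>d. D < d) (at_right D)" by (rule eventually_at_right_less)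
  ultimately have "eventually (\<lambda>d. D < d \<and> d < \<delta> \<and> w * (d / 2) ^ k < w * (D / 2) ^ k + \<eta>) (at_right D)"
    by eventually_elim auto
  then show ?thesis using eventually_happens'[of "at_right D"] by auto
qed

text \<open>
  A covering of the boundary is thickened to an open one at the cost of a little diameter, and by
  compactness finitely many of its sets suffice. Each of them contributes to the tube at most its
  area times \<open>r\<close>, up to a factor that tends to a number at most \<open>1 + 2\<Lambda>\<delta>\<close> as \<open>r\<close> tends to \<open>0\<close>.
\<close>
lemma inner_content_le_hausdorff_premeasure:
  fixes \<Omega> :: "'a::euclidean_space set"
  assumes R: "R > 0" "\<Lambda> > 0" and charts: "\<And>z. z \<in> frontier \<Omega> \<Longrightarrow> \<exists>\<nu> \<phi>. graph_chart \<Omega> R \<Lambda> z \<nu> \<phi>"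
    and \<Omega>: "open \<Omega>" "bounded \<Omega>" and \<delta>: "0 < \<delta>" "2 * \<delta> < R"
    and H: "hausdorff_premeasure (DIM('a) - 1) \<delta> (frontier \<Omega>) < ennreal h"
  shows "eventually (\<lambda>r. measure lborel (inner_tube \<Omega> r) \<le> (1 + \<Lambda> * (2 * \<delta>)) * h * r) (at_right 0)"
proof -
  let ?k = "DIM('a) - 1"
  let ?w = "unit_ball_vol (real ?k)"
  let ?S = "frontier \<Omega>"
  obtain C :: "nat \<Rightarrow> 'a set" where C: "?S \<subseteq> (\<Union>i. C i)" "\<And>i. bounded (C i)" "\<And>i. diameter (C i) \<le> \<delta>"
    and Ch: "(\<Sum>i. if C i = {} then 0 else ennreal (?w * (diameter (C i) / 2) ^ ?k)) < ennreal h"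
    using H unfolding hausdorff_premeasure_def INF_less_iff by auto
  define t where "t i = (if C i = {} then 0 else ?w * (diameter (C i) / 2) ^ ?k)" for i
  have t0: "0 \<le> t i" for i using C(2) by (auto simp: t_def diameter_ge_0)
  have te: "(\<Sum>i. ennreal (t i)) < ennreal h"
  proof -
    have "(\<lambda>i. ennreal (t i)) = (\<lambda>i. if C i = {} then 0 else ennreal (?w * (diameter (C i) / 2) ^ ?k))"
      by (auto simp: t_def)
    then show ?thesis using Ch by simp
  qed
  have ts: "summable t" using te t0 by (intro summable_suminf_not_top) (auto simp: less_top[symmetric] dest: less_trans[OF _ ennreal_less_top])
  define s where "s = suminf t"
  have sh: "s < h" using te t0 ts suminf_nonneg[OF ts t0] by (simp add: suminf_ennreal2 s_def ennreal_less_iff)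
  have h0: "0 < h" using sh suminf_nonneg[OF ts t0] by (simp add: s_def)
  define \<eta> where "\<eta> = h - s"
  have \<eta>: "\<eta> > 0" using sh by (simp add: \<eta>_def)
  \<comment> \<open>The losses \<open>\<eta> / 4 \<sdot> 2\<^sup>-\<^sup>i\<close> add up to \<open>\<eta> / 2\<close>, half of the slack between the sum of the
     weights and \<open>h\<close>.\<close>
  have "\<exists>D'>diameter (C i). D' < 2 * \<delta> \<and> ?w * (D' / 2) ^ ?k < ?w * (diameter (C i) / 2) ^ ?k + \<eta> / 4 * (1 / 2) ^ i" for i
    using C(3)[of i] \<delta> \<eta> by (intro ex_larger_diameter) auto
  then obtain D where D: "\<And>i. diameter (C i) < D i" "\<And>i. D i < 2 * \<delta>"
    "\<And>i. ?w * (D i / 2) ^ ?k < ?w * (diameter (C i) / 2) ^ ?k + \<eta> / 4 * (1 / 2) ^ i"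
    by metis
  have D0: "0 < D i" for i using D(1)[of i] diameter_ge_0[OF C(2), of i] by linarith
  define O' where "O' i = (\<Union>c\<in>C i. ball c ((D i - diameter (C i)) / 2))" for i
  have OD: "dist x y \<le> D i" if xy: "x \<in> O' i" "y \<in> O' i" for x y i
  proof -
    obtain c d where c: "c \<in> C i" "dist c x < (D i - diameter (C i)) / 2" and d: "d \<in> C i" "dist d y < (D i - diameter (C i)) / 2"
      using xy by (auto simp: O'_def)
    have "dist c d \<le> diameter (C i)" using diameter_bounded_bound[OF C(2)] c d by blast
    moreover have "dist x y \<le> dist c x + dist c d + dist d y"
      using dist_triangle[of x y c] dist_triangle[of c y d] by (simp add: dist_commute)
    moreover define e where "e = (D i - diameter (C i)) / 2"
    moreover from this have "D i = diameter (C i) + 2 * e" by (simp add: field_simps)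
    ultimately show ?thesis using c d by (simp only: e_def[symmetric])
  qed
  have "compact ?S" using \<Omega> by (simp add: compact_frontier_bounded)
  moreover have "?S \<subseteq> (\<Union>i\<in>{i. C i \<noteq> {}}. O' i)"
  proof
    fix x assume "x \<in> ?S"
    then obtain i where "x \<in> C i" using C(1) by blast
    moreover from this have "x \<in> O' i" using D(1)[of i] by (auto simp: O'_def intro!: bexI[of _ x])
    ultimately show "x \<in> (\<Union>i\<in>{i. C i \<noteq> {}}. O' i)" by blast
  qed
  ultimately obtain F0 where F0: "F0 \<subseteq> {i. C i \<noteq> {}}" "finite F0" "?S \<subseteq> (\<Union>i\<in>F0. O' i)"
    using compactE_image[of ?S "{i. C i \<noteq> {}}" O'] by (metis O'_def open_UN open_ball)
  \<comment> \<open>Sets that miss the boundary are dropped, since a chart is centred at a boundary point of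
     each.\<close>
  define F where "F = {i\<in>F0. O' i \<inter> ?S \<noteq> {}}"
  have F: "finite F" "F \<subseteq> {i. C i \<noteq> {}}" "?S \<subseteq> (\<Union>i\<in>F. O' i)"
    using F0(1,2) unfolding F_def by (simp, blast) (use F0(3) in blast)
  have sumF: "(\<Sum>i\<in>F. ?w * (D i / 2) ^ ?k) < h"
  proof -
    have "(\<Sum>i\<in>F. ?w * (D i / 2) ^ ?k) \<le> (\<Sum>i\<in>F. t i + \<eta> / 4 * (1 / 2) ^ i)"
      using F(2) D(3) by (intro sum_mono) (auto simp: t_def less_imp_le)
    also have "\<dots> = sum t F + \<eta> / 4 * (\<Sum>i\<in>F. (1 / 2) ^ i)" by (simp add: sum.distrib sum_distrib_left)
    also have "\<dots> \<le> s + \<eta> / 4 * 2"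
    proof (rule add_mono)
      show "sum t F \<le> s" unfolding s_def by (intro sum_le_suminf ts F t0)
      have "(\<Sum>i\<in>F. (1 / 2 :: real) ^ i) \<le> (\<Sum>i. (1 / 2) ^ i)" by (intro sum_le_suminf summable_geometric F) auto
      also have "\<dots> = 2" by (subst suminf_geometric) auto
      finally show "\<eta> / 4 * (\<Sum>i\<in>F. (1 / 2) ^ i) \<le> \<eta> / 4 * 2" using \<eta> by (intro mult_left_mono) auto
    qed
    also have "\<dots> < h" using sh by (simp add: \<eta>_def field_simps)
    finally show ?thesis .
  qed
  define G where "G r = (\<Sum>i\<in>F. ?w * ((D i + 2 * r) / 2) ^ ?k * (1 + \<Lambda> * (D i + 2 * r)))" for r
  have "(G \<longlongrightarrow> (\<Sum>i\<in>F. ?w * ((D i + 2 * 0) / 2) ^ ?k * (1 + \<Lambda> * (D i + 2 * 0)))) (at_right 0)"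
    unfolding G_def by (intro tendsto_intros) auto
  moreover have "(\<Sum>i\<in>F. ?w * ((D i + 2 * 0) / 2) ^ ?k * (1 + \<Lambda> * (D i + 2 * 0))) < (1 + \<Lambda> * (2 * \<delta>)) * h"
  proof -
    have "(\<Sum>i\<in>F. ?w * ((D i + 2 * 0) / 2) ^ ?k * (1 + \<Lambda> * (D i + 2 * 0))) \<le> (\<Sum>i\<in>F. ?w * (D i / 2) ^ ?k * (1 + \<Lambda> * (2 * \<delta>)))"
      using D D0 R by (intro sum_mono mult_left_mono) (auto simp: less_imp_le intro!: mult_nonneg_nonneg zero_le_power)
    also have "\<dots> = (1 + \<Lambda> * (2 * \<delta>)) * (\<Sum>i\<in>F. ?w * (D i / 2) ^ ?k)" by (simp add: sum_distrib_left mult.commute)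
    also have "\<dots> < (1 + \<Lambda> * (2 * \<delta>)) * h" using sumF R \<delta> by (intro mult_strict_left_mono) (auto simp: add_pos_nonneg)
    finally show ?thesis .
  qed
  ultimately have "eventually (\<lambda>r. G r < (1 + \<Lambda> * (2 * \<delta>)) * h) (at_right 0)"
    by (rule order_tendstoD)
  moreover have "eventually (\<lambda>r. 2 * \<delta> + 2 * r < R) (at_right 0)"
    using \<delta> by (auto simp: eventually_at_right_field field_simps intro!: exI[of _ "(R - 2 * \<delta>) / 2"])
  moreover have "eventually (\<lambda>r::real. 0 < r) (at_right 0)" by (rule eventually_at_right_less)
  ultimately show ?thesis
  proof eventually_elim
    case (elim r)
    define X where "X i = {x\<in>\<Omega>. (\<exists>c\<in>O' i. dist x c < r) \<and> (\<exists>y. y \<notin> \<Omega> \<and> dist x y < r)}" for i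
    have X: "emeasure lborel (X i) \<le> ennreal (?w * ((D i + 2 * r) / 2) ^ ?k * (1 + \<Lambda> * (D i + 2 * r)) * r)" if i: "i \<in> F" for i
    proof -
      obtain z where z: "z \<in> O' i" "z \<in> ?S" using i by (auto simp: F_def)
      obtain \<nu> \<phi> where "graph_chart \<Omega> R \<Lambda> z \<nu> \<phi>" using charts[OF z(2)] by blast
      from graph_chart_tube_upper[OF this R(2) z(1) OD D0 elim(3) _ \<Omega>(1)] show ?thesis
        unfolding X_def using D(2)[of i] elim by force
    qed
    have Xm: "X i \<in> sets lborel" for i
    proof -
      have "X i = \<Omega> \<inter> (\<Union>c\<in>O' i. ball c r) \<inter> (\<Union>y\<in>-\<Omega>. ball y r)" by (auto simp: X_def dist_commute)
      also have "open \<dots>" using \<Omega> by (intro open_Int open_UN ballI open_ball) auto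
      finally show ?thesis by simp
    qed
    have "inner_tube \<Omega> r \<subseteq> (\<Union>i\<in>F. X i)"
    proof
      fix x assume x: "x \<in> inner_tube \<Omega> r"
      then have x\<Omega>: "x \<in> \<Omega>" by (simp add: inner_tube_def)
      obtain z where z: "z \<in> ?S" "z \<notin> \<Omega>" "dist x z = infdist x (- \<Omega>)"
        using nearest_complement_point[OF \<Omega> x\<Omega>] .
      then have "dist x z < r" using x by (simp add: inner_tube_def)
      moreover obtain i where "i \<in> F" "z \<in> O' i" using F(3) z(1) by blast
      ultimately show "x \<in> (\<Union>i\<in>F. X i)" using z(2) x\<Omega> by (auto simp: X_def)
    qed
    then have "emeasure lborel (inner_tube \<Omega> r) \<le> emeasure lborel (\<Union>i\<in>F. X i)"
      using Xm F by (intro emeasure_mono) auto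
    also have "\<dots> \<le> (\<Sum>i\<in>F. emeasure lborel (X i))" using Xm F by (intro emeasure_subadditive_finite) auto
    also have "\<dots> \<le> (\<Sum>i\<in>F. ennreal (?w * ((D i + 2 * r) / 2) ^ ?k * (1 + \<Lambda> * (D i + 2 * r)) * r))"
      using X by (intro sum_mono) auto
    also have "\<dots> = ennreal (G r * r)"
      using elim(3) D0 R unfolding G_def sum_distrib_right
      by (intro sum_ennreal mult_nonneg_nonneg zero_le_power add_nonneg_nonneg) (auto simp: less_imp_le)
    finally have "measure lborel (inner_tube \<Omega> r) \<le> G r * r"
      unfolding emeasure_inner_tube[OF \<Omega>(2)]
      using elim(3) D0 R by (subst (asm) ennreal_le_iff) (auto simp: G_def less_imp_le intro!: mult_nonneg_nonneg sum_nonneg)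
    also have "\<dots> \<le> (1 + \<Lambda> * (2 * \<delta>)) * h * r" using elim by (intro mult_right_mono) auto
    finally show ?case .
  qed
qed

lemma hausdorff_premeasure_compact_finite:
  fixes S :: "'a::euclidean_space set"
  assumes "compact S" "0 < \<delta>"
  shows "hausdorff_premeasure k \<delta> S < top"
proof -
  obtain Z where Z: "Z \<subseteq> S" "finite Z" "S \<subseteq> (\<Union>z\<in>Z. ball z (\<delta> / 2))"
    using compactE_image[OF assms(1), of S "\<lambda>z. ball z (\<delta> / 2)"] assms(2) by force
  define e where "e = from_nat_into Z"
  define C where "C n = (if n \<in> to_nat_on Z ` Z then ball (e n) (\<delta> / 2) else {})" for n
  have "hausdorff_premeasure k \<delta> S \<le> (\<Sum>i. if C i = {} then 0 else ennreal (unit_ball_vol (real k) * (diameter (C i) / 2) ^ k))"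
    unfolding hausdorff_premeasure_def
  proof (rule INF_lower, safe)
    fix x assume "x \<in> S"
    then obtain z where z: "z \<in> Z" "x \<in> ball z (\<delta> / 2)" using Z by blast
    then have "x \<in> C (to_nat_on Z z)" using Z(2) by (auto simp: C_def e_def countable_finite)
    then show "x \<in> \<Union> (range C)" by blast
  next
    fix i show "bounded (C i)" "diameter (C i) \<le> \<delta>"
      using assms(2) by (auto simp: C_def diameter_ball)
  qed
  also have "\<dots> = (\<Sum>i\<in>to_nat_on Z ` Z. if C i = {} then 0 else ennreal (unit_ball_vol (real k) * (diameter (C i) / 2) ^ k))"
    using Z(2) by (intro suminf_finite) (auto simp: C_def)
  also have "\<dots> < top" using Z(2) by simp
  finally show ?thesis .
qed

text \<open>
  By the two comparisons the volume of the tube divided by \<open>r\<close> is eventually below every number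
  above the Hausdorff measure, and it cannot be at most a number below the Hausdorff measure for
  arbitrarily small \<open>r\<close>. Finiteness of the Hausdorff measure follows from the two comparisons
  combined: a premeasure at one scale bounds the content, which bounds the measure.
\<close>
lemma inner_tube_content_tendsto:
  fixes \<Omega> :: "'a::euclidean_space set"
  assumes "bounded \<Omega>" "C11_open_set \<Omega>"
  shows "((\<lambda>r. measure lborel (inner_tube \<Omega> r) / r) \<longlongrightarrow> enn2real (hausdorff_measure (DIM('a) - 1) (frontier \<Omega>))) (at_right 0)"
proof -
  let ?k = "DIM('a) - 1"
  let ?a = "\<lambda>r. measure lborel (inner_tube \<Omega> r)"
  obtain R \<Lambda> where R: "R > 0" "\<Lambda> > 0" and charts: "\<And>z. z \<in> frontier \<Omega> \<Longrightarrow> \<exists>\<nu> \<phi>. graph_chart \<Omega> R \<Lambda> z \<nu> \<phi>"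
    using C11_open_set_charts[OF assms(2)] by blast
  have \<Omega>: "open \<Omega>" "bounded \<Omega>" using assms by (auto simp: C11_open_set_def)
  define H where "H = hausdorff_measure ?k (frontier \<Omega>)"
  have pre: "hausdorff_premeasure ?k \<delta> (frontier \<Omega>) \<le> H" if "\<delta> > 0" for \<delta>
    unfolding H_def hausdorff_measure_def using that by (intro SUP_upper) auto
  have lower: "H \<le> ennreal c" if "frequently (\<lambda>r. ?a r \<le> c * r) (at_right 0)" for c
    unfolding H_def by (rule hausdorff_measure_le_inner_content[OF R charts \<Omega> that])
  have "hausdorff_premeasure ?k (R / 3) (frontier \<Omega>) < top"
    using \<Omega> R by (intro hausdorff_premeasure_compact_finite compact_frontier_bounded) auto
  then obtain p where "p \<ge> 0" "hausdorff_premeasure ?k (R / 3) (frontier \<Omega>) = ennreal p"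
    by (cases "hausdorff_premeasure ?k (R / 3) (frontier \<Omega>)") auto
  then obtain h where "hausdorff_premeasure ?k (R / 3) (frontier \<Omega>) < ennreal h"
    by (metis ennreal_less_iff less_add_one)
  from inner_content_le_hausdorff_premeasure[OF R charts \<Omega> _ _ this] R
  have "eventually (\<lambda>r. ?a r \<le> (1 + \<Lambda> * (2 * (R / 3))) * h * r) (at_right 0)" by simp
  then have "H \<le> ennreal ((1 + \<Lambda> * (2 * (R / 3))) * h)"
    by (intro lower eventually_frequently) auto
  then obtain m where m: "m \<ge> 0" "H = ennreal m"
    by (cases H) (auto simp: top_unique)
  have "((\<lambda>r. ?a r / r) \<longlongrightarrow> m) (at_right 0)"
  proof (rule order_tendstoI)
    fix a assume a: "a < m"
    show "eventually (\<lambda>r. a < ?a r / r) (at_right 0)"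
    proof (cases "a < 0")
      case True
      have "eventually (\<lambda>r::real. 0 < r) (at_right 0)" by (rule eventually_at_right_less)
      then show ?thesis
      proof eventually_elim
        case (elim r)
        have "0 \<le> ?a r / r" using elim by simp
        then show ?case using True by linarith
      qed
    next
      case False
      have "\<not> frequently (\<lambda>r. ?a r \<le> a * r) (at_right 0)"
      proof
        assume "frequently (\<lambda>r. ?a r \<le> a * r) (at_right 0)"
        from lower[OF this] show False using m a False by (simp add: ennreal_le_iff)
      qed
      then have "eventually (\<lambda>r. a * r < ?a r) (at_right 0)" by (simp add: frequently_def not_le)
      moreover have "eventually (\<lambda>r::real. 0 < r) (at_right 0)" by (rule eventually_at_right_less)
      ultimately show ?thesis by eventually_elim (simp add: field_simps)
    qed
  next
    fix a assume a: "m < a"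
    define h where "h = (m + a) / 2"
    have h: "m < h" "h < a" "0 < h" using a m by (auto simp: h_def)
    have "((\<lambda>\<delta>. (1 + \<Lambda> * (2 * \<delta>)) * h) \<longlongrightarrow> (1 + \<Lambda> * (2 * 0)) * h) (at_right 0)"
      by (intro tendsto_intros)
    then have "eventually (\<lambda>\<delta>. (1 + \<Lambda> * (2 * \<delta>)) * h < a) (at_right 0)"
      using h by (intro order_tendstoD) auto
    moreover have "eventually (\<lambda>\<delta>. 2 * \<delta> < R) (at_right 0)"
      using R by (auto simp: eventually_at_right_field field_simps intro!: exI[of _ "R / 2"])
    moreover have "eventually (\<lambda>\<delta>::real. 0 < \<delta>) (at_right 0)" by (rule eventually_at_right_less)
    ultimately have "eventually (\<lambda>\<delta>. (1 + \<Lambda> * (2 * \<delta>)) * h < a \<and> 2 * \<delta> < R \<and> 0 < \<delta>) (at_right 0)"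
      by eventually_elim auto
    then obtain \<delta> where \<delta>: "(1 + \<Lambda> * (2 * \<delta>)) * h < a" "2 * \<delta> < R" "0 < \<delta>"
      using eventually_happens'[of "at_right (0::real)"] by auto
    have "hausdorff_premeasure ?k \<delta> (frontier \<Omega>) < ennreal h"
      using pre[OF \<delta>(3)] m h by (simp add: ennreal_less_iff le_less_trans)
    from inner_content_le_hausdorff_premeasure[OF R charts \<Omega> \<delta>(3,2) this]
    have "eventually (\<lambda>r. ?a r \<le> (1 + \<Lambda> * (2 * \<delta>)) * h * r) (at_right 0)" .
    moreover have "eventually (\<lambda>r::real. 0 < r) (at_right 0)" by (rule eventually_at_right_less)
    ultimately show "eventually (\<lambda>r. ?a r / r < a) (at_right 0)"
    proof eventually_elim
      case (elim r)
      have "?a r / r \<le> (1 + \<Lambda> * (2 * \<delta>)) * h" using elim by (simp add: pos_divide_le_eq)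
      then show ?case using \<delta>(1) by linarith
    qed
  qed
  then show ?thesis using m unfolding H_def by simp
qed

section \<open>Characteristic functions and the law of Brownian paths\<close>

lemma nn_integral_exp_neg_norm_sq:
  "(\<integral>\<^sup>+x. ennreal (exp (- (norm (x::'a::euclidean_space))\<^sup>2)) \<partial>lborel) = ennreal (sqrt pi ^ DIM('a))"
proof -
  have one: "(\<integral>\<^sup>+x. ennreal (exp (- (x::real)\<^sup>2)) \<partial>lborel) = ennreal (sqrt pi)"
  proof -
    have nd: "normal_density 0 (1 / sqrt 2) x = exp (- x\<^sup>2) / sqrt pi" for x :: real
      by (simp add: normal_density_def power_divide)
    have "(\<integral>\<^sup>+x. ennreal (exp (- (x::real)\<^sup>2)) \<partial>lborel) = (\<integral>\<^sup>+x. ennreal (sqrt pi) * ennreal (normal_density 0 (1 / sqrt 2) x) \<partial>lborel)"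
      by (intro nn_integral_cong) (simp add: nd ennreal_mult'[symmetric])
    also have "\<dots> = ennreal (sqrt pi) * (\<integral>\<^sup>+x. ennreal (normal_density 0 (1 / sqrt 2) x) \<partial>lborel)"
      by (rule nn_integral_cmult) simp
    also have "(\<integral>\<^sup>+x. ennreal (normal_density 0 (1 / sqrt 2) x) \<partial>lborel) = ennreal (\<integral>x. normal_density 0 (1 / sqrt 2) x \<partial>lborel)"
      by (rule nn_integral_eq_integral) (auto intro: integrable_normal_density)
    also have "(\<integral>x. normal_density 0 (1 / sqrt 2) x \<partial>lborel) = 1" by (rule integral_normal_density) simp
    finally show ?thesis by simp
  qed
  have "(norm x)\<^sup>2 = (\<Sum>b\<in>Basis. (x \<bullet> b)\<^sup>2)" for x :: 'a
    unfolding power2_norm_eq_inner by (subst euclidean_inner) (simp add: power2_eq_square)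
  then have "ennreal (exp (- (norm x)\<^sup>2)) = (\<Prod>b\<in>Basis. ennreal (exp (- (x \<bullet> b)\<^sup>2)))" for x :: 'a
    by (simp add: sum_negf[symmetric] exp_sum prod_ennreal)
  then have "(\<integral>\<^sup>+x. ennreal (exp (- (norm (x::'a))\<^sup>2)) \<partial>lborel) = (\<integral>\<^sup>+x. (\<Prod>b\<in>Basis. ennreal (exp (- ((x::'a) \<bullet> b)\<^sup>2))) \<partial>lborel)"
    by simp
  also have "\<dots> = (\<Prod>b\<in>(Basis::'a set). (\<integral>\<^sup>+x. ennreal (exp (- (x::real)\<^sup>2)) \<partial>lborel))"
    by (rule nn_integral_lborel_prod) auto
  finally show ?thesis
    by (simp add: one ennreal_power)
qed

text \<open>
  Convolution with a narrow Gaussian approximates a bounded continuous function \<open>\<phi>\<close> pointwise. By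
  Fubini its integral against \<open>\<mu>\<close> involves \<open>\<mu>\<close> only through the Gaussian averages in the
  hypothesis, so \<open>\<mu>\<close> and \<open>\<nu>\<close> integrate \<open>\<phi>\<close> equally; distance functions then give equality on open
  sets.
\<close>
lemma gaussian_smoothing_determines_measure:
  fixes \<mu> \<nu> :: "'a::euclidean_space measure"
  assumes \<mu>: "prob_space \<mu>" "sets \<mu> = sets borel" and \<nu>: "prob_space \<nu>" "sets \<nu> = sets borel"
    and eq: "\<And>n y. n > (0::nat) \<Longrightarrow> (\<integral>\<^sup>+x. ennreal (exp (- (real n * (norm (x - y))\<^sup>2))) \<partial>\<mu>) = (\<integral>\<^sup>+x. ennreal (exp (- (real n * (norm (x - y))\<^sup>2))) \<partial>\<nu>)"
  shows "\<mu> = \<nu>"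
proof -
  let ?c = "ennreal (sqrt pi ^ DIM('a))"
  have cont: "(\<integral>\<^sup>+x. ennreal (\<phi> x) \<partial>\<mu>) = (\<integral>\<^sup>+x. ennreal (\<phi> x) \<partial>\<nu>)"
    if \<phi>: "continuous_on UNIV \<phi>" "\<And>x. 0 \<le> \<phi> x" "\<And>x. \<phi> x \<le> 1" for \<phi> :: "'a \<Rightarrow> real"
  proof -
    have [measurable]: "\<phi> \<in> borel_measurable borel" using \<phi>(1) by (rule borel_measurable_continuous_onI)
    \<comment> \<open>\<open>K n\<close> is \<open>\<phi>\<close> convolved with a Gaussian of width of order \<open>1 / \<surd>n\<close>, up to the constant
       \<open>?c\<close>.\<close>
    define K where "K n x = (\<integral>\<^sup>+z. ennreal (\<phi> (x + (1 / sqrt (real n)) *\<^sub>R z)) * ennreal (exp (- (norm z)\<^sup>2)) \<partial>lborel)" for n :: nat and x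
    have Kalt: "K n x = ennreal (sqrt (real n) ^ DIM('a)) * (\<integral>\<^sup>+y. ennreal (\<phi> y) * ennreal (exp (- (real n * (norm (x - y))\<^sup>2))) \<partial>lborel)" if "n > 0" for n x
    proof -
      have "(\<integral>\<^sup>+y. ennreal (\<phi> y) * ennreal (exp (- (real n * (norm (x - y))\<^sup>2))) \<partial>lborel)
         = ennreal (\<bar>1 / sqrt (real n)\<bar> ^ DIM('a)) * (\<integral>\<^sup>+z. ennreal (\<phi> (x + (1 / sqrt (real n)) *\<^sub>R z)) * ennreal (exp (- (real n * (norm (x - (x + (1 / sqrt (real n)) *\<^sub>R z)))\<^sup>2))) \<partial>lborel)"
        using that by (intro nn_integral_lborel_affine) auto
      also have "\<dots> = ennreal (\<bar>1 / sqrt (real n)\<bar> ^ DIM('a)) * K n x"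
        using that by (simp add: K_def power_divide)
      finally have e: "(\<integral>\<^sup>+y. ennreal (\<phi> y) * ennreal (exp (- (real n * (norm (x - y))\<^sup>2))) \<partial>lborel) = ennreal (\<bar>1 / sqrt (real n)\<bar> ^ DIM('a)) * K n x" .
      have "sqrt (real n) ^ DIM('a) * \<bar>1 / sqrt (real n)\<bar> ^ DIM('a) = 1"
        using that by (simp add: power_mult_distrib[symmetric])
      then show ?thesis unfolding e mult.assoc[symmetric] by (simp add: ennreal_mult'[symmetric])
    qed
    have lim: "(\<lambda>n. K n x) \<longlonglongrightarrow> ennreal (\<phi> x) * ?c" for x
    proof -
      have "(\<lambda>n. K n x) \<longlonglongrightarrow> (\<integral>\<^sup>+z. ennreal (\<phi> x) * ennreal (exp (- (norm (z::'a))\<^sup>2)) \<partial>lborel)"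
        unfolding K_def
      proof (rule nn_integral_dominated_convergence[where w="\<lambda>z. ennreal (exp (- (norm z)\<^sup>2))"])
        show "AE z in lborel. ennreal (\<phi> (x + (1 / sqrt (real n)) *\<^sub>R z)) * ennreal (exp (- (norm z)\<^sup>2)) \<le> ennreal (exp (- (norm z)\<^sup>2))" for n
        proof (intro AE_I2)
          fix z
          have "ennreal (\<phi> (x + (1 / sqrt (real n)) *\<^sub>R z)) * ennreal (exp (- (norm z)\<^sup>2)) \<le> 1 * ennreal (exp (- (norm z)\<^sup>2))"
            using \<phi> by (intro mult_right_mono) (auto simp: ennreal_le_1)
          then show "ennreal (\<phi> (x + (1 / sqrt (real n)) *\<^sub>R z)) * ennreal (exp (- (norm z)\<^sup>2)) \<le> ennreal (exp (- (norm z)\<^sup>2))" by simp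
        qed
        show "(\<integral>\<^sup>+z. ennreal (exp (- (norm (z::'a))\<^sup>2)) \<partial>lborel) < \<infinity>"
          by (simp add: nn_integral_exp_neg_norm_sq)
        show "AE z in lborel. (\<lambda>n. ennreal (\<phi> (x + (1 / sqrt (real n)) *\<^sub>R z)) * ennreal (exp (- (norm z)\<^sup>2))) \<longlonglongrightarrow> ennreal (\<phi> x) * ennreal (exp (- (norm z)\<^sup>2))"
        proof (intro AE_I2)
          fix z :: 'a
          have "(\<lambda>n. 1 / sqrt (real n)) \<longlonglongrightarrow> 0" 
            by (intro tendsto_divide_0[OF tendsto_const] filterlim_at_top_imp_at_infinity filterlim_compose[OF sqrt_at_top] filterlim_real_sequentially)
          then have "(\<lambda>n. x + (1 / sqrt (real n)) *\<^sub>R z) \<longlonglongrightarrow> x + 0 *\<^sub>R z" by (intro tendsto_intros)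
          then have "(\<lambda>n. \<phi> (x + (1 / sqrt (real n)) *\<^sub>R z)) \<longlonglongrightarrow> \<phi> x"
            using \<phi>(1) by (intro continuous_on_tendsto_compose[OF \<phi>(1)]) auto
          then have "(\<lambda>n. ennreal (\<phi> (x + (1 / sqrt (real n)) *\<^sub>R z) * exp (- (norm z)\<^sup>2))) \<longlonglongrightarrow> ennreal (\<phi> x * exp (- (norm z)\<^sup>2))"
            by (intro tendsto_intros)
          then show "(\<lambda>n. ennreal (\<phi> (x + (1 / sqrt (real n)) *\<^sub>R z)) * ennreal (exp (- (norm z)\<^sup>2))) \<longlonglongrightarrow> ennreal (\<phi> x) * ennreal (exp (- (norm z)\<^sup>2))"
            using \<phi> by (simp add: ennreal_mult')
        qed
      qed auto
      then show ?thesis by (simp add: nn_integral_cmult nn_integral_exp_neg_norm_sq)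
    qed
    have Kle: "K n x \<le> ?c" for n x
    proof -
      have "K n x \<le> (\<integral>\<^sup>+z. 1 * ennreal (exp (- (norm (z::'a))\<^sup>2)) \<partial>lborel)"
        unfolding K_def using \<phi> by (intro nn_integral_mono mult_right_mono) (auto simp: ennreal_le_1)
      then show ?thesis by (simp add: nn_integral_exp_neg_norm_sq)
    qed
    have limI: "(\<lambda>n. \<integral>\<^sup>+x. K n x \<partial>\<rho>) \<longlonglongrightarrow> (\<integral>\<^sup>+x. ennreal (\<phi> x) \<partial>\<rho>) * ?c"
      if \<rho>: "prob_space \<rho>" and [measurable_cong]: "sets \<rho> = sets borel" for \<rho> :: "'a measure"
    proof -
      interpret prob_space \<rho> by fact
      have [measurable]: "K n \<in> borel_measurable borel" for n unfolding K_def by measurable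
      have "(\<lambda>n. \<integral>\<^sup>+x. K n x \<partial>\<rho>) \<longlonglongrightarrow> (\<integral>\<^sup>+x. ennreal (\<phi> x) * ?c \<partial>\<rho>)"
        by (rule nn_integral_dominated_convergence[where w="\<lambda>_. ?c"]) (use lim Kle in \<open>auto simp: emeasure_space_1\<close>)
      then show ?thesis by (simp add: nn_integral_multc)
    qed
    have Kint: "(\<integral>\<^sup>+x. K n x \<partial>\<rho>) = ennreal (sqrt (real n) ^ DIM('a)) * (\<integral>\<^sup>+y. ennreal (\<phi> y) * (\<integral>\<^sup>+x. ennreal (exp (- (real n * (norm (x - y))\<^sup>2))) \<partial>\<rho>) \<partial>lborel)"
      if \<rho>: "prob_space \<rho>" and [measurable_cong]: "sets \<rho> = sets borel" and n: "n > 0" for \<rho> :: "'a measure" and n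
    proof -
      interpret prob_space \<rho> by fact
      interpret pair_sigma_finite \<rho> lborel ..
      have "(\<integral>\<^sup>+x. K n x \<partial>\<rho>) = ennreal (sqrt (real n) ^ DIM('a)) * (\<integral>\<^sup>+x. (\<integral>\<^sup>+y. ennreal (\<phi> y) * ennreal (exp (- (real n * (norm (x - y))\<^sup>2))) \<partial>lborel) \<partial>\<rho>)"
        by (simp add: Kalt[OF n] nn_integral_cmult)
      also have "(\<integral>\<^sup>+x. (\<integral>\<^sup>+y. ennreal (\<phi> y) * ennreal (exp (- (real n * (norm (x - y))\<^sup>2))) \<partial>lborel) \<partial>\<rho>)
         = (\<integral>\<^sup>+y. (\<integral>\<^sup>+x. ennreal (\<phi> y) * ennreal (exp (- (real n * (norm (x - y))\<^sup>2))) \<partial>\<rho>) \<partial>lborel)"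
        by (rule Fubini'[symmetric]) measurable
      also have "\<dots> = (\<integral>\<^sup>+y. ennreal (\<phi> y) * (\<integral>\<^sup>+x. ennreal (exp (- (real n * (norm (x - y))\<^sup>2))) \<partial>\<rho>) \<partial>lborel)"
        by (intro nn_integral_cong nn_integral_cmult) measurable
      finally show ?thesis .
    qed
    have "(\<integral>\<^sup>+x. K n x \<partial>\<mu>) = (\<integral>\<^sup>+x. K n x \<partial>\<nu>)" if "n > 0" for n
      by (simp add: Kint[OF \<mu> that] Kint[OF \<nu> that] eq[OF that])
    then have "eventually (\<lambda>n. (\<integral>\<^sup>+x. K n x \<partial>\<nu>) = (\<integral>\<^sup>+x. K n x \<partial>\<mu>)) sequentially"
      by (intro eventually_sequentiallyI[of 1]) auto
    from Lim_transform_eventually[OF limI[OF \<nu>] this]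
    have "(\<integral>\<^sup>+x. ennreal (\<phi> x) \<partial>\<mu>) * ?c = (\<integral>\<^sup>+x. ennreal (\<phi> x) \<partial>\<nu>) * ?c"
      using limI[OF \<mu>] by (metis LIMSEQ_unique)
    moreover have "?c \<noteq> 0" "?c \<noteq> top" by (auto simp: ennreal_eq_0_iff not_le)
    ultimately show ?thesis by (metis mult_divide_eq_ennreal)
  qed
  have op: "emeasure \<mu> G = emeasure \<nu> G" if G: "open G" for G
  proof (cases "G = UNIV")
    case True
    then show ?thesis using prob_space.emeasure_space_1[OF \<mu>(1)] prob_space.emeasure_space_1[OF \<nu>(1)]
      sets_eq_imp_space_eq[OF \<mu>(2)] sets_eq_imp_space_eq[OF \<nu>(2)] by simp
  next
    case False
    define \<phi> where "\<phi> m x = min 1 (real m * infdist x (- G))" for m :: nat and x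
    have c\<phi>: "continuous_on UNIV (\<phi> m)" for m unfolding \<phi>_def by (intro continuous_intros)
    have sup: "(SUP m. ennreal (\<phi> m x)) = indicator G x" for x
    proof (cases "x \<in> G")
      case True
      have "infdist x (- G) > 0"
        using True G False infdist_pos_not_in_closed[of "- G" x] by auto
      then obtain m :: nat where "1 < real m * infdist x (- G)" using reals_Archimedean3 by blast
      then have "\<phi> m x = 1" by (simp add: \<phi>_def)
      then have "1 \<le> (SUP m. ennreal (\<phi> m x))" by (intro SUP_upper2[of m]) auto
      moreover have "(SUP m. ennreal (\<phi> m x)) \<le> 1" by (intro SUP_least) (auto simp: \<phi>_def ennreal_le_1)
      ultimately show ?thesis using True by simp
    next
      case False
      then have "infdist x (- G) = 0" by simp
      then show ?thesis using False by (simp add: \<phi>_def)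
    qed
    have *: "emeasure \<rho> G = (SUP m. \<integral>\<^sup>+x. ennreal (\<phi> m x) \<partial>\<rho>)" if [measurable_cong]: "sets \<rho> = sets borel" for \<rho> :: "'a measure"
    proof -
      have [measurable]: "\<phi> m \<in> borel_measurable borel" for m using c\<phi> by (rule borel_measurable_continuous_onI)
      have "G \<in> sets \<rho>" using G that by simp
      then have "emeasure \<rho> G = (\<integral>\<^sup>+x. (SUP m. ennreal (\<phi> m x)) \<partial>\<rho>)" unfolding sup by simp
      also have "\<dots> = (SUP m. \<integral>\<^sup>+x. ennreal (\<phi> m x) \<partial>\<rho>)"
      proof (rule nn_integral_monotone_convergence_SUP)
        show "incseq (\<lambda>m x. ennreal (\<phi> m x))"
          unfolding incseq_def le_fun_def \<phi>_def
          by (intro allI impI ennreal_leI min.mono mult_right_mono) (auto simp: infdist_nonneg)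
      qed measurable
      finally show ?thesis .
    qed
    have "(\<integral>\<^sup>+x. ennreal (\<phi> m x) \<partial>\<mu>) = (\<integral>\<^sup>+x. ennreal (\<phi> m x) \<partial>\<nu>)" for m
      by (intro cont c\<phi>) (auto simp: \<phi>_def infdist_nonneg)
    then show ?thesis using *[OF \<mu>(2)] *[OF \<nu>(2)] by simp
  qed
  show ?thesis
  proof (rule measure_eqI_generator_eq[where E="{S. open S}" and \<Omega>=UNIV and A="\<lambda>_. UNIV"])
    show "Int_stable {S::'a set. open S}" by (auto simp: Int_stable_def)
    show "sets \<mu> = sigma_sets UNIV {S. open S}" "sets \<nu> = sigma_sets UNIV {S. open S}"
      using \<mu> \<nu> by (simp_all add: borel_def)
    show "emeasure \<mu> UNIV \<noteq> \<infinity>" for i :: nat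
      using prob_space.emeasure_space_1[OF \<mu>(1)] sets_eq_imp_space_eq[OF \<mu>(2)] by simp
  qed (use op in auto)
qed

text \<open>
  The Gaussian \<open>exp (- n \<bar>x - y\<bar>\<^sup>2)\<close> is itself the characteristic function at \<open>x - y\<close> of a
  Gaussian vector, so by Fubini its integral against \<open>\<mu>\<close> is an average of values of the
  characteristic function of \<open>\<mu>\<close>. The Brownian motion in the hypotheses serves only as a supply of
  Gaussian vectors, namely its increments over intervals of length \<open>n\<close>.
\<close>
lemma characteristic_function_determines_measure:
  fixes \<mu> \<nu> :: "'a::euclidean_space measure" and W :: "real \<Rightarrow> 'w \<Rightarrow> 'a"
  assumes \<mu>: "prob_space \<mu>" "sets \<mu> = sets borel" and \<nu>: "prob_space \<nu>" "sets \<nu> = sets borel"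
    and bm: "brownian_motion N x0 W"
    and eq: "\<And>\<xi>. (CLINT x|\<mu>. exp (- (\<i> * complex_of_real (\<xi> \<bullet> x)))) = (CLINT x|\<nu>. exp (- (\<i> * complex_of_real (\<xi> \<bullet> x))))"
  shows "\<mu> = \<nu>"
proof (rule gaussian_smoothing_determines_measure[OF \<mu> \<nu>])
  fix n :: nat and y :: 'a assume n: "n > 0"
  interpret N: prob_space N using bm by (simp add: brownian_motion_def)
  define Z where "Z \<omega> = W (real n) \<omega> - W 0 \<omega>" for \<omega>
  have [measurable]: "Z \<in> borel_measurable N" using bm unfolding Z_def brownian_motion_def by (intro borel_measurable_diff) auto
  have Z: "(CLINT \<omega>|N. exp (- (\<i> * complex_of_real (\<xi> \<bullet> Z \<omega>)))) = complex_of_real (exp (- (real n * (norm \<xi>)\<^sup>2)))" for \<xi>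
  proof -
    have "(CLINT \<omega>|N. exp (- (\<i> * complex_of_real (\<xi> \<bullet> (W (real n) \<omega> - W 0 \<omega>))))) = complex_of_real (exp (- ((real n - 0) * (norm \<xi>)\<^sup>2)))"
    proof -
      have "\<forall>s t. 0 \<le> s \<and> s \<le> t \<longrightarrow>
        (\<forall>\<xi>. (CLINT \<omega>|N. exp (- (\<i> * complex_of_real (\<xi> \<bullet> (W t \<omega> - W s \<omega>)))))
            = complex_of_real (exp (- ((t - s) * (norm \<xi>)\<^sup>2))))"
        using bm unfolding brownian_motion_def by blast
      from this[rule_format, of 0 "real n" \<xi>] show ?thesis by simp
    qed
    then show ?thesis by (simp add: Z_def)
  qed
  have key: "complex_of_real (\<integral>x. exp (- (real n * (norm (x - y))\<^sup>2)) \<partial>\<rho>)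
     = (CLINT \<omega>|N. exp (\<i> * complex_of_real (y \<bullet> Z \<omega>)) * (CLINT x|\<rho>. exp (- (\<i> * complex_of_real (Z \<omega> \<bullet> x)))))"
    if \<rho>: "prob_space \<rho>" and [measurable_cong]: "sets \<rho> = sets borel" for \<rho> :: "'a measure"
  proof -
    interpret R: prob_space \<rho> by fact
    interpret P: pair_prob_space \<rho> N ..
    have "complex_of_real (\<integral>x. exp (- (real n * (norm (x - y))\<^sup>2)) \<partial>\<rho>) = (CLINT x|\<rho>. complex_of_real (exp (- (real n * (norm (x - y))\<^sup>2))))"
      by (rule integral_complex_of_real[symmetric])
    also have "\<dots> = (CLINT x|\<rho>. (CLINT \<omega>|N. exp (- (\<i> * complex_of_real ((x - y) \<bullet> Z \<omega>)))))"
      by (simp only: Z)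
    also have "\<dots> = (CLINT \<omega>|N. (CLINT x|\<rho>. exp (- (\<i> * complex_of_real ((x - y) \<bullet> Z \<omega>)))))"
    proof (rule P.Fubini_integral[symmetric], rule P.integrable_const_bound[where B=1])
      show "(\<lambda>(x, \<omega>). exp (- (\<i> * complex_of_real ((x - y) \<bullet> Z \<omega>)))) \<in> borel_measurable (\<rho> \<Otimes>\<^sub>M N)"
        by measurable
    qed (auto simp: norm_exp_eq_Re)
    also have "\<dots> = (CLINT \<omega>|N. (CLINT x|\<rho>. exp (\<i> * complex_of_real (y \<bullet> Z \<omega>)) * exp (- (\<i> * complex_of_real (Z \<omega> \<bullet> x)))))"
      by (simp add: exp_add[symmetric] inner_diff_left inner_commute algebra_simps)
    finally show ?thesis by simp
  qed
  have "complex_of_real (\<integral>x. exp (- (real n * (norm (x - y))\<^sup>2)) \<partial>\<mu>) = complex_of_real (\<integral>x. exp (- (real n * (norm (x - y))\<^sup>2)) \<partial>\<nu>)"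
    unfolding key[OF \<mu>] key[OF \<nu>] eq ..
  then have "(\<integral>x. exp (- (real n * (norm (x - y))\<^sup>2)) \<partial>\<mu>) = (\<integral>x. exp (- (real n * (norm (x - y))\<^sup>2)) \<partial>\<nu>)"
    by (simp only: of_real_eq_iff)
  moreover have "(\<integral>\<^sup>+x. ennreal (exp (- (real n * (norm (x - y))\<^sup>2))) \<partial>\<rho>) = ennreal (\<integral>x. exp (- (real n * (norm (x - y))\<^sup>2)) \<partial>\<rho>)"
    if \<rho>: "prob_space \<rho>" and [measurable_cong]: "sets \<rho> = sets borel" for \<rho> :: "'a measure"
  proof -
    interpret R: prob_space \<rho> by fact
    show ?thesis by (intro nn_integral_eq_integral R.integrable_const_bound[where B=1]) auto
  qed
  ultimately show "(\<integral>\<^sup>+x. ennreal (exp (- (real n * (norm (x - y))\<^sup>2))) \<partial>\<mu>) = (\<integral>\<^sup>+x. ennreal (exp (- (real n * (norm (x - y))\<^sup>2))) \<partial>\<nu>)"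
    using \<mu> \<nu> by simp
qed

lemma brownian_motionD:
  assumes "brownian_motion N x W"
  shows "prob_space N" "\<And>t. 0 \<le> t \<Longrightarrow> W t \<in> borel_measurable N" "AE \<omega> in N. W 0 \<omega> = x"
    "\<And>\<omega>. \<omega> \<in> space N \<Longrightarrow> continuous_on {0..} (\<lambda>t. W t \<omega>)"
    "\<And>(n::nat) T. 0 \<le> T 0 \<Longrightarrow> (\<And>i. i < n \<Longrightarrow> T i \<le> T (Suc i)) \<Longrightarrow>
        prob_space.indep_vars N (\<lambda>_. borel) (\<lambda>i \<omega>. W (T (Suc i)) \<omega> - W (T i) \<omega>) {..<n}"
    "\<And>s t \<xi>. 0 \<le> s \<Longrightarrow> s \<le> t \<Longrightarrow> (CLINT \<omega>|N. exp (- (\<i> * complex_of_real (\<xi> \<bullet> (W t \<omega> - W s \<omega>)))))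
            = complex_of_real (exp (- ((t - s) * (norm \<xi>)\<^sup>2)))"
  using assms unfolding brownian_motion_def by blast+

lemma brownian_increment_law:
  fixes W :: "real \<Rightarrow> 'w \<Rightarrow> 'a::euclidean_space" and W' :: "real \<Rightarrow> 'v \<Rightarrow> 'a"
  assumes bm: "brownian_motion N x W" and bm': "brownian_motion N' x' W'" and st: "0 \<le> s" "s \<le> t"
  shows "distr N borel (\<lambda>\<omega>. W t \<omega> - W s \<omega>) = distr N' borel (\<lambda>\<omega>. W' t \<omega> - W' s \<omega>)"
proof (rule characteristic_function_determines_measure[OF _ _ _ _ bm])
  have m: "(\<lambda>\<omega>. W t \<omega> - W s \<omega>) \<in> borel_measurable N" "(\<lambda>\<omega>. W' t \<omega> - W' s \<omega>) \<in> borel_measurable N'"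
    using st brownian_motionD(2)[OF bm] brownian_motionD(2)[OF bm'] by (auto intro!: borel_measurable_diff)
  show "prob_space (distr N borel (\<lambda>\<omega>. W t \<omega> - W s \<omega>))" "prob_space (distr N' borel (\<lambda>\<omega>. W' t \<omega> - W' s \<omega>))"
    using m brownian_motionD(1)[OF bm] brownian_motionD(1)[OF bm'] by (auto intro: prob_space.prob_space_distr)
  fix \<xi>
  show "(CLINT x|distr N borel (\<lambda>\<omega>. W t \<omega> - W s \<omega>). exp (- (\<i> * complex_of_real (\<xi> \<bullet> x)))) =
        (CLINT x|distr N' borel (\<lambda>\<omega>. W' t \<omega> - W' s \<omega>). exp (- (\<i> * complex_of_real (\<xi> \<bullet> x))))"
    using m brownian_motionD(6)[OF bm st] brownian_motionD(6)[OF bm' st]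
    by (subst (1 2) integral_distr) auto
qed auto

lemma brownian_increments_joint_law:
  fixes W :: "real \<Rightarrow> 'w \<Rightarrow> 'a::euclidean_space" and W' :: "real \<Rightarrow> 'v \<Rightarrow> 'a"
  assumes bm: "brownian_motion N x W" and bm': "brownian_motion N' x' W'"
    and T: "0 \<le> T 0" "\<And>i. i < n \<Longrightarrow> T i \<le> T (Suc i)" and n: "0 < n"
  shows "distr N (Pi\<^sub>M {..<n} (\<lambda>_. borel)) (\<lambda>\<omega>. \<lambda>i\<in>{..<n}. W (T (Suc i)) \<omega> - W (T i) \<omega>)
       = distr N' (Pi\<^sub>M {..<n} (\<lambda>_. borel)) (\<lambda>\<omega>. \<lambda>i\<in>{..<n}. W' (T (Suc i)) \<omega> - W' (T i) \<omega>)"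
proof -
  have T0: "0 \<le> T i" if "i \<le> n" for i
    using that
  proof (induction i)
    case (Suc i) then show ?case using T(2)[of i] by auto
  qed (rule T(1))
  have *: "distr K (Pi\<^sub>M {..<n} (\<lambda>_. borel)) (\<lambda>\<omega>. \<lambda>i\<in>{..<n}. V (T (Suc i)) \<omega> - V (T i) \<omega>)
     = Pi\<^sub>M {..<n} (\<lambda>i. distr K borel (\<lambda>\<omega>. V (T (Suc i)) \<omega> - V (T i) \<omega>))"
    if V: "brownian_motion K y V" for K :: "'k measure" and V :: "real \<Rightarrow> 'k \<Rightarrow> 'a" and y
  proof -
    interpret prob_space K by (rule brownian_motionD(1)[OF V])
    have "(\<lambda>\<omega>. V (T (Suc i)) \<omega> - V (T i) \<omega>) \<in> borel_measurable K" if "i \<in> {..<n}" for i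
      using that T0[of i] T0[of "Suc i"] brownian_motionD(2)[OF V] by (auto intro!: borel_measurable_diff)
    then show ?thesis
      using indep_vars_iff_distr_eq_PiM'[of "{..<n}" "\<lambda>i \<omega>. V (T (Suc i)) \<omega> - V (T i) \<omega>" "\<lambda>_. borel"] n
        brownian_motionD(5)[OF V T] by auto
  qed
  have "distr N borel (\<lambda>\<omega>. W (T (Suc i)) \<omega> - W (T i) \<omega>) = distr N' borel (\<lambda>\<omega>. W' (T (Suc i)) \<omega> - W' (T i) \<omega>)" if "i \<in> {..<n}" for i
    using that T T0[of i] by (intro brownian_increment_law[OF bm bm']) auto
  then show ?thesis unfolding *[OF bm] *[OF bm'] by (intro PiM_cong) auto
qed

text \<open>
  After sorting the times, the positions are partial sums of the increments between consecutive
  times, whose joint law is known.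
\<close>
lemma brownian_finite_dimensional_law:
  fixes W :: "real \<Rightarrow> 'w \<Rightarrow> 'a::euclidean_space" and W' :: "real \<Rightarrow> 'v \<Rightarrow> 'a"
  assumes bm: "brownian_motion N x W" and bm': "brownian_motion N' x' W'"
    and J: "finite J" "J \<subseteq> {0..}" and A: "\<And>t. t \<in> J \<Longrightarrow> A t \<in> sets borel"
  shows "emeasure N {\<omega>\<in>space N. \<forall>t\<in>J. y + (W t \<omega> - W 0 \<omega>) \<in> A t} = emeasure N' {\<omega>\<in>space N'. \<forall>t\<in>J. y + (W' t \<omega> - W' 0 \<omega>) \<in> A t}"
proof (cases "J = {}")
  case True
  then show ?thesis
    using prob_space.emeasure_space_1[OF brownian_motionD(1)[OF bm]] prob_space.emeasure_space_1[OF brownian_motionD(1)[OF bm']] by simp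
next
  case False
  define ts where "ts = sorted_list_of_set J"
  define n where "n = length ts"
  have ts: "set ts = J" "sorted ts" using J by (simp_all add: ts_def)
  have n: "0 < n" using False ts unfolding n_def by auto
  \<comment> \<open>Time \<open>0\<close> is put in front, so that the first increment starts there.\<close>
  define T where "T i = (if i = 0 then 0 else ts ! (i - 1))" for i
  have tsn: "ts ! i \<in> J" if "i < n" for i using that ts by (auto simp: n_def)
  have T: "0 \<le> T 0" "\<And>i. i < n \<Longrightarrow> T i \<le> T (Suc i)"
  proof -
    fix i assume i: "i < n"
    show "T i \<le> T (Suc i)"
    proof (cases "i = 0")
      case True then show ?thesis using tsn[OF i] J by (auto simp: T_def)
    next
      case False then show ?thesis using i ts(2) by (auto simp: T_def n_def sorted_iff_nth_mono)
    qed
  qed (simp add: T_def)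
  let ?P = "Pi\<^sub>M {..<n} (\<lambda>_. borel :: 'a measure)"
  define S where "S = {f \<in> space ?P. \<forall>i\<in>{..<n}. y + (\<Sum>j\<in>{..i}. f j) \<in> A (ts ! i)}"
  have S: "S \<in> sets ?P"
  proof -
    have "{f \<in> space ?P. y + (\<Sum>j\<in>{..i}. f j) \<in> A (ts ! i)} \<in> sets ?P" if "i \<in> {..<n}" for i
    proof -
      have [measurable]: "A (ts ! i) \<in> sets borel" using that tsn A by auto
      have [measurable]: "(\<lambda>f. f j) \<in> borel_measurable ?P" if "j \<in> {..i}" for j
        using that \<open>i \<in> {..<n}\<close> by (intro measurable_component_singleton) auto
      have "(\<lambda>f. y + (\<Sum>j\<in>{..i}. f j)) \<in> borel_measurable ?P" by measurable
      from measurable_sets[OF this \<open>A (ts ! i) \<in> sets borel\<close>] show ?thesis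
        by (simp add: vimage_def Int_def conj_commute)
    qed
    then show ?thesis unfolding S_def by (intro sets.sets_Collect_finite_All') (use n in auto)
  qed
  have *: "emeasure K {\<omega>\<in>space K. \<forall>t\<in>J. y + (V t \<omega> - V 0 \<omega>) \<in> A t} = emeasure (distr K ?P (\<lambda>\<omega>. \<lambda>i\<in>{..<n}. V (T (Suc i)) \<omega> - V (T i) \<omega>)) S"
    if V: "brownian_motion K z V" for K :: "'k measure" and V :: "real \<Rightarrow> 'k \<Rightarrow> 'a" and z
  proof -
    have "(\<lambda>\<omega>. V (T (Suc i)) \<omega> - V (T i) \<omega>) \<in> borel_measurable K" if "i \<in> {..<n}" for i
    proof -
      have "0 \<le> T i" "0 \<le> T (Suc i)" using that tsn[of i] tsn[OF less_imp_diff_less[of i n 1]] J by (auto simp: T_def)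
      then show ?thesis using brownian_motionD(2)[OF V] by (intro borel_measurable_diff) auto
    qed
    then have "(\<lambda>\<omega>. \<lambda>i\<in>{..<n}. V (T (Suc i)) \<omega> - V (T i) \<omega>) \<in> measurable K ?P"
      by (intro measurable_restrict)
    then have "emeasure (distr K ?P (\<lambda>\<omega>. \<lambda>i\<in>{..<n}. V (T (Suc i)) \<omega> - V (T i) \<omega>)) S
       = emeasure K ((\<lambda>\<omega>. \<lambda>i\<in>{..<n}. V (T (Suc i)) \<omega> - V (T i) \<omega>) -` S \<inter> space K)"
      using S by (rule emeasure_distr)
    also have "(\<lambda>\<omega>. \<lambda>i\<in>{..<n}. V (T (Suc i)) \<omega> - V (T i) \<omega>) -` S \<inter> space K = {\<omega>\<in>space K. \<forall>t\<in>J. y + (V t \<omega> - V 0 \<omega>) \<in> A t}"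
    proof -
      have sum: "(\<Sum>j\<in>{..i}. (\<lambda>i\<in>{..<n}. V (T (Suc i)) \<omega> - V (T i) \<omega>) j) = V (ts ! i) \<omega> - V 0 \<omega>" if "i < n" for i \<omega>
      proof -
        have "(\<Sum>j\<in>{..i}. (\<lambda>i\<in>{..<n}. V (T (Suc i)) \<omega> - V (T i) \<omega>) j) = (\<Sum>j\<in>{..i}. V (T (Suc j)) \<omega> - V (T j) \<omega>)"
          using that by (intro sum.cong) auto
        also have "\<dots> = (\<Sum>j<Suc i. V (T (Suc j)) \<omega> - V (T j) \<omega>)" by (simp only: lessThan_Suc_atMost)
        also have "\<dots> = V (T (Suc i)) \<omega> - V (T 0) \<omega>" by (rule sum_lessThan_telescope)
        finally show ?thesis by (simp add: T_def)
      qed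
      have "(\<forall>i\<in>{..<n}. y + (V (ts ! i) \<omega> - V 0 \<omega>) \<in> A (ts ! i)) \<longleftrightarrow> (\<forall>t\<in>J. y + (V t \<omega> - V 0 \<omega>) \<in> A t)" for \<omega>
        unfolding ts(1)[symmetric] all_set_conv_all_nth by (auto simp: n_def)
      then show ?thesis unfolding S_def by (auto simp: sum space_PiM simp del: restrict_apply)
    qed
    finally show ?thesis ..
  qed
  show ?thesis unfolding *[OF bm] *[OF bm'] by (simp only: brownian_increments_joint_law[OF bm bm' T n])
qed

text \<open>
  A law on path space is determined by its finite-dimensional marginals. The path on the left is
  first replaced by \<open>x + (W\<^sub>t - W\<^sub>0)\<close>, to which it is equal almost surely.
\<close>
lemma brownian_path_law:
  fixes W :: "real \<Rightarrow> 'w \<Rightarrow> 'a::euclidean_space" and W' :: "real \<Rightarrow> 'v \<Rightarrow> 'a"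
  assumes bm: "brownian_motion N x W" and bm': "brownian_motion N' x' W'"
  shows "distr N (Pi\<^sub>M {0..} (\<lambda>_. borel)) (\<lambda>\<omega>. \<lambda>t\<in>{0..}. W t \<omega>)
       = distr N' (Pi\<^sub>M {0..} (\<lambda>_. borel)) (\<lambda>\<omega>. \<lambda>t\<in>{0..}. x + (W' t \<omega> - W' 0 \<omega>))"
proof (rule measure_eqI_PiM_infinite)
  let ?M = "Pi\<^sub>M {0..} (\<lambda>_::real. borel :: 'a measure)"
  have m: "(\<lambda>\<omega>. \<lambda>t\<in>{0..}. W t \<omega>) \<in> measurable N ?M"
    using brownian_motionD(2)[OF bm] by (intro measurable_restrict) auto
  have m': "(\<lambda>\<omega>. \<lambda>t\<in>{0..}. x + (W' t \<omega> - W' 0 \<omega>)) \<in> measurable N' ?M"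
    using brownian_motionD(2)[OF bm'] by (intro measurable_restrict borel_measurable_add borel_measurable_diff) auto
  show "finite_measure (distr N ?M (\<lambda>\<omega>. \<lambda>t\<in>{0..}. W t \<omega>))"
    using m brownian_motionD(1)[OF bm] prob_space.prob_space_distr prob_space.finite_measure by blast
  fix A :: "real \<Rightarrow> 'a set" and J assume J: "finite J" "J \<subseteq> {0..}" and A: "\<And>t. t \<in> J \<Longrightarrow> A t \<in> sets borel"
  let ?E = "prod_emb {0..} (\<lambda>_. borel) J (Pi\<^sub>E J A)"
  have E: "?E \<in> sets ?M" using J A by (intro sets_PiM_I) auto
  have mem: "(\<lambda>t\<in>{0..}. f t) \<in> ?E \<longleftrightarrow> (\<forall>t\<in>J. f t \<in> A t)" for f
    using J(2) by (auto simp: prod_emb_def PiE_iff extensional_def restrict_def)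
  have "emeasure (distr N ?M (\<lambda>\<omega>. \<lambda>t\<in>{0..}. W t \<omega>)) ?E = emeasure N {\<omega>\<in>space N. \<forall>t\<in>J. W t \<omega> \<in> A t}"
    using emeasure_distr[OF m E] by (simp add: vimage_def mem Int_def conj_commute)
  also have "\<dots> = emeasure N {\<omega>\<in>space N. \<forall>t\<in>J. x + (W t \<omega> - W 0 \<omega>) \<in> A t}"
  proof (rule emeasure_eq_AE)
    show "AE \<omega> in N. \<omega> \<in> {\<omega> \<in> space N. \<forall>t\<in>J. W t \<omega> \<in> A t} \<longleftrightarrow> \<omega> \<in> {\<omega> \<in> space N. \<forall>t\<in>J. x + (W t \<omega> - W 0 \<omega>) \<in> A t}"
      using brownian_motionD(3)[OF bm] by eventually_elim auto
    have "{\<omega>\<in>space N. y + (W t \<omega> - z \<omega>) \<in> A t} \<in> sets N" if "t \<in> J" "z \<in> borel_measurable N" for y z t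
    proof -
      have "(\<lambda>\<omega>. y + (W t \<omega> - z \<omega>)) \<in> borel_measurable N"
        using that J brownian_motionD(2)[OF bm, of t] by (intro borel_measurable_add borel_measurable_diff) auto
      from measurable_sets[OF this A[OF that(1)]] show ?thesis by (simp add: vimage_def Int_def conj_commute)
    qed
    note mm = this
    show "{\<omega> \<in> space N. \<forall>t\<in>J. W t \<omega> \<in> A t} \<in> sets N"
      using mm[of _ "\<lambda>_. 0" 0] J(1) by (intro sets.sets_Collect_finite_All) auto
    show "{\<omega> \<in> space N. \<forall>t\<in>J. x + (W t \<omega> - W 0 \<omega>) \<in> A t} \<in> sets N"
      using mm[of _ "W 0" x] J(1) brownian_motionD(2)[OF bm, of 0] by (intro sets.sets_Collect_finite_All) auto
  qed
  also have "\<dots> = emeasure N' {\<omega>\<in>space N'. \<forall>t\<in>J. x + (W' t \<omega> - W' 0 \<omega>) \<in> A t}"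
    by (rule brownian_finite_dimensional_law[OF bm bm' J A])
  also have "\<dots> = emeasure (distr N' ?M (\<lambda>\<omega>. \<lambda>t\<in>{0..}. x + (W' t \<omega> - W' 0 \<omega>))) ?E"
    using emeasure_distr[OF m' E] by (simp add: vimage_def mem Int_def conj_commute)
  finally show "emeasure (distr N ?M (\<lambda>\<omega>. \<lambda>t\<in>{0..}. W t \<omega>)) ?E = emeasure (distr N' ?M (\<lambda>\<omega>. \<lambda>t\<in>{0..}. x + (W' t \<omega> - W' 0 \<omega>))) ?E" .
qed auto

section \<open>Exit times of the time-changed killed process\<close>

text \<open>
  The infimum of a set of times exceeds \<open>a\<close> when the path stays in \<open>D\<close> strictly beyond \<open>a\<close>, not
  merely up to \<open>a\<close>.
\<close>
lemma less_exit_time_iff: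
  "ereal a < exit_time D w \<longleftrightarrow> (\<exists>b>a. \<forall>s. 0 < s \<and> s < b \<longrightarrow> w s \<in> D)"
proof
  assume "ereal a < exit_time D w"
  then obtain b where b: "ereal a < ereal b" "ereal b < exit_time D w" using ereal_dense2 by blast
  have "w s \<in> D" if "0 < s" "s < b" for s
  proof (rule ccontr)
    assume "w s \<notin> D"
    then have "exit_time D w \<le> ereal s" unfolding exit_time_def using that by (intro Inf_lower) auto
    also have "\<dots> < ereal b" using that by simp
    finally show False using b by simp
  qed
  then show "\<exists>b>a. \<forall>s. 0 < s \<and> s < b \<longrightarrow> w s \<in> D" using b by auto
next
  assume "\<exists>b>a. \<forall>s. 0 < s \<and> s < b \<longrightarrow> w s \<in> D"
  then obtain b where b: "b > a" "\<And>s. 0 < s \<Longrightarrow> s < b \<Longrightarrow> w s \<in> D" by blast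
  have "ereal b \<le> exit_time D w" unfolding exit_time_def
  proof (rule Inf_greatest)
    fix y assume "y \<in> {ereal t |t. 0 < t \<and> w t \<notin> D}"
    then obtain t where t: "y = ereal t" "0 < t" "w t \<notin> D" by blast
    then have "b \<le> t" using b(2)[of t] by (meson not_le)
    then show "ereal b \<le> y" using t by simp
  qed
  moreover have "ereal a < ereal b" using b by simp
  ultimately show "ereal a < exit_time D w" by (rule less_le_trans[rotated])
qed

lemma stays_a_little_longer:
  fixes w :: "real \<Rightarrow> 'a::topological_space"
  assumes "open \<Omega>" "continuous_on {0..} w" "0 < u" "\<And>r. 0 < r \<Longrightarrow> r \<le> u \<Longrightarrow> w r \<in> \<Omega>"
  shows "\<exists>b>u. \<forall>r. 0 < r \<and> r < b \<longrightarrow> w r \<in> \<Omega>"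
proof -
  have "continuous (at u) w" using assms(2,3) by (intro continuous_on_interior[of "{0..}"]) auto
  then have "eventually (\<lambda>r. w r \<in> \<Omega>) (at u)"
    using assms(1,3,4) by (auto simp: continuous_at intro: topological_tendstoD)
  then obtain d where d: "d > 0" "\<And>r. r \<noteq> u \<Longrightarrow> dist r u < d \<Longrightarrow> w r \<in> \<Omega>"
    by (auto simp: eventually_at)
  have "w r \<in> \<Omega>" if "0 < r" "r < u + d" for r
    using assms(4)[of r] d(2)[of r] that by (cases "r \<le> u") (auto simp: dist_real_def)
  then show ?thesis using d(1) by (intro exI[of _ "u + d"]) auto
qed

text \<open>
  For the direction from right to left, \<open>w\<close> stays in the open set \<open>\<Omega>\<close> until some \<open>b > u t\<close> by
  continuity, and right-continuity of \<open>u\<close> keeps \<open>u s < b\<close> for a while after \<open>t\<close>; before \<open>t\<close>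
  monotonicity does.
\<close>
lemma time_changed_killed_alive_iff:
  fixes w :: "real \<Rightarrow> 'a::topological_space"
  assumes \<Omega>: "open \<Omega>" and w: "continuous_on {0..} w" and t: "0 < t"
    and u: "mono_on {0..} u" "cadlag u" "\<And>s. 0 < s \<Longrightarrow> 0 < u s"
  shows "ereal t < exit_time (Some ` \<Omega>) (\<lambda>s. killed \<Omega> w (u s)) \<longleftrightarrow> (\<forall>r. 0 < r \<and> r \<le> u t \<longrightarrow> w r \<in> \<Omega>)"
proof -
  have k: "killed \<Omega> w r \<in> Some ` \<Omega> \<longleftrightarrow> ereal r < exit_time \<Omega> w \<and> w r \<in> \<Omega>" for r
    by (auto simp: killed_def)
  show ?thesis
  proof
    assume "ereal t < exit_time (Some ` \<Omega>) (\<lambda>s. killed \<Omega> w (u s))"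
    then have "killed \<Omega> w (u t) \<in> Some ` \<Omega>" using t by (auto simp: less_exit_time_iff)
    then have "ereal (u t) < exit_time \<Omega> w" by (simp add: k)
    then show "\<forall>r. 0 < r \<and> r \<le> u t \<longrightarrow> w r \<in> \<Omega>" by (auto simp: less_exit_time_iff)
  next
    assume *: "\<forall>r. 0 < r \<and> r \<le> u t \<longrightarrow> w r \<in> \<Omega>"
    obtain b where b: "b > u t" "\<And>r. 0 < r \<Longrightarrow> r < b \<Longrightarrow> w r \<in> \<Omega>"
      using stays_a_little_longer[OF \<Omega> w u(3)[OF t]] * by blast
    have "continuous (at_right t) u" using u(2) t by (simp add: cadlag_def)
    then have "(u \<longlongrightarrow> u t) (at_right t)"
      by (simp add: continuous_within)
    then have "eventually (\<lambda>s. u s < b) (at_right t)" using b(1) by (rule order_tendstoD)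
    then obtain t' where t': "t' > t" "\<And>s. t < s \<Longrightarrow> s < t' \<Longrightarrow> u s < b"
      by (auto simp: eventually_at_right_field)
    have "killed \<Omega> w (u s) \<in> Some ` \<Omega>" if s: "0 < s" "s < t'" for s
    proof -
      have "u s < b"
      proof (cases "s \<le> t")
        case True
        then have "u s \<le> u t" using u(1) s t by (auto simp: mono_on_def)
        then show ?thesis using b(1) by simp
      next
        case False
        then show ?thesis using t' s by auto
      qed
      then show ?thesis unfolding k less_exit_time_iff using b(2) u(3)[OF s(1)] by blast
    qed
    then show "ereal t < exit_time (Some ` \<Omega>) (\<lambda>s. killed \<Omega> w (u s))"
      unfolding less_exit_time_iff using t'(1) by blast
  qed
qed

text \<open>
  A reformulation of \<open>\<forall>r. 0 < r \<and> r \<le> u \<longrightarrow> w r \<in> \<Omega>\<close> for continuous paths and \<open>u > 0\<close> that consists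
  of countably many conditions on the path at rational times, hence is jointly measurable in the
  path and in \<open>u\<close>. Membership at rational times alone would allow the path to touch the boundary
  at an irrational one, hence the positive distance from the complement, uniform on each interval
  \<open>[1/(n+1), v]\<close> with \<open>v\<close> beyond \<open>u\<close>.
\<close>
definition stays_inside :: "'a::metric_space set \<Rightarrow> (real \<Rightarrow> 'a) \<Rightarrow> real \<Rightarrow> bool" where
  "stays_inside \<Omega> w u \<longleftrightarrow> (\<exists>v\<in>\<rat>. u < v \<and> (\<forall>n::nat. \<exists>m::nat. \<forall>q\<in>\<rat>. 1 / real (Suc n) \<le> q \<and> q \<le> v \<longrightarrow> 1 / real (Suc m) \<le> infdist (w q) (- \<Omega>)))"

lemma stays_inside_iff:
  fixes w :: "real \<Rightarrow> 'a::metric_space"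
  assumes \<Omega>: "open \<Omega>" "- \<Omega> \<noteq> {}" and w: "continuous_on {0..} w" and u: "0 < u"
  shows "stays_inside \<Omega> w u \<longleftrightarrow> (\<forall>r. 0 < r \<and> r \<le> u \<longrightarrow> w r \<in> \<Omega>)"
proof
  assume "stays_inside \<Omega> w u"
  then obtain v where v: "v \<in> \<rat>" "u < v" and vm: "\<And>n::nat. \<exists>m::nat. \<forall>q\<in>\<rat>. 1 / real (Suc n) \<le> q \<and> q \<le> v \<longrightarrow> 1 / real (Suc m) \<le> infdist (w q) (- \<Omega>)"
    unfolding stays_inside_def by blast
  show "\<forall>r. 0 < r \<and> r \<le> u \<longrightarrow> w r \<in> \<Omega>"
  proof (intro allI impI)
    fix r assume r: "0 < r \<and> r \<le> u"
    obtain n :: nat where n: "1 / real (Suc n) < r" using r nat_approx_posE by (metis One_nat_def)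
    obtain m :: nat where m: "\<And>q. q \<in> \<rat> \<Longrightarrow> 1 / real (Suc n) \<le> q \<Longrightarrow> q \<le> v \<Longrightarrow> 1 / real (Suc m) \<le> infdist (w q) (- \<Omega>)"
      using vm[of n] by blast
    show "w r \<in> \<Omega>"
    proof (rule ccontr)
      assume "w r \<notin> \<Omega>"
      then have z: "infdist (w r) (- \<Omega>) = 0" by simp
      have "continuous (at r) w" using w r by (intro continuous_on_interior[of "{0..}"]) auto
      then have "continuous (at r) (\<lambda>t. infdist (w t) (- \<Omega>))" by (rule continuous_infdist)
      then have "((\<lambda>t. infdist (w t) (- \<Omega>)) \<longlongrightarrow> 0) (at r)" by (simp add: continuous_at z)
      then have "eventually (\<lambda>t. infdist (w t) (- \<Omega>) < 1 / real (Suc m)) (at r)" by (rule order_tendstoD) simp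
      then obtain d where d: "d > 0" "\<And>t. t \<noteq> r \<Longrightarrow> dist t r < d \<Longrightarrow> infdist (w t) (- \<Omega>) < 1 / real (Suc m)"
        by (auto simp: eventually_at)
      have "r < min v (r + d)" using r v d(1) by auto
      then obtain q where q: "q \<in> \<rat>" "r < q" "q < min v (r + d)" using Rats_dense_in_real by blast
      have "infdist (w q) (- \<Omega>) < 1 / real (Suc m)" using q by (intro d(2)) (auto simp: dist_real_def)
      moreover have "1 / real (Suc m) \<le> infdist (w q) (- \<Omega>)" using q n by (intro m) auto
      ultimately show False by simp
    qed
  qed
next
  assume *: "\<forall>r. 0 < r \<and> r \<le> u \<longrightarrow> w r \<in> \<Omega>"
  obtain b where b: "b > u" "\<And>r. 0 < r \<Longrightarrow> r < b \<Longrightarrow> w r \<in> \<Omega>"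
    using stays_a_little_longer[OF \<Omega>(1) w u] * by blast
  obtain v where v: "v \<in> \<rat>" "u < v" "v < b" using Rats_dense_in_real[OF b(1)] by blast
  have "\<exists>m::nat. \<forall>q\<in>\<rat>. 1 / real (Suc n) \<le> q \<and> q \<le> v \<longrightarrow> 1 / real (Suc m) \<le> infdist (w q) (- \<Omega>)" for n :: nat
  proof (cases "1 / real (Suc n) \<le> v")
    case False
    then show ?thesis by (intro exI[of _ 0]) auto
  next
    case True
    have n0: "0 < 1 / real (Suc n)" by simp
    have "{1 / real (Suc n)..v} \<subseteq> {0..}" using n0 by (auto simp del: of_nat_Suc)
    then have "continuous_on {1 / real (Suc n)..v} (\<lambda>t. infdist (w t) (- \<Omega>))"
      by (intro continuous_on_infdist continuous_on_subset[OF w])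
    \<comment> \<open>The distance to the complement attains a minimum on the compact interval, and the
       minimum is positive.\<close>
    then obtain q0 where q0: "q0 \<in> {1 / real (Suc n)..v}" "\<And>q. q \<in> {1 / real (Suc n)..v} \<Longrightarrow> infdist (w q0) (- \<Omega>) \<le> infdist (w q) (- \<Omega>)"
      using continuous_attains_inf[of "{1 / real (Suc n)..v}" "\<lambda>t. infdist (w t) (- \<Omega>)"] True by auto
    have "0 < q0" using q0(1) less_le_trans[OF n0, of q0] by simp
    then have "w q0 \<in> \<Omega>" using q0(1) v by (intro b(2)) auto
    then have "0 < infdist (w q0) (- \<Omega>)" using \<Omega> infdist_pos_not_in_closed[of "- \<Omega>" "w q0"] by auto
    then obtain m :: nat where "1 / real (Suc m) < infdist (w q0) (- \<Omega>)" using nat_approx_posE by (metis One_nat_def)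
    then have "1 / real (Suc m) \<le> infdist (w q) (- \<Omega>)" if "q \<in> {1 / real (Suc n)..v}" for q
      using q0(2)[OF that] by linarith
    then show ?thesis by (intro exI[of _ m]) auto
  qed
  then show "stays_inside \<Omega> w u" unfolding stays_inside_def using v by blast
qed

section \<open>The reflection principle\<close>

text \<open>
  The first passage over \<open>a\<close> at step \<open>k\<close> is determined by the first \<open>k\<close> steps, the remaining
  displacement by the other steps.
\<close>
lemma (in prob_space) first_passage_independent:
  fixes D :: "nat \<Rightarrow> 'a \<Rightarrow> real"
  assumes ind: "indep_vars (\<lambda>_. borel) D {..<n}" and k: "k \<in> {1..n}" and B: "B \<in> sets borel"
  shows "prob {\<omega>\<in>space M. (\<forall>m\<in>{1..<k}. (\<Sum>j<m. D j \<omega>) \<le> a) \<and> a < (\<Sum>j<k. D j \<omega>) \<and> (\<Sum>j\<in>{k..<n}. D j \<omega>) \<in> B}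
    = prob {\<omega>\<in>space M. (\<forall>m\<in>{1..<k}. (\<Sum>j<m. D j \<omega>) \<le> a) \<and> a < (\<Sum>j<k. D j \<omega>)} * prob {\<omega>\<in>space M. (\<Sum>j\<in>{k..<n}. D j \<omega>) \<in> B}"
proof -
  let ?P1 = "Pi\<^sub>M {..<k} (\<lambda>_::nat. borel :: real measure)" and ?P2 = "Pi\<^sub>M {k..<n} (\<lambda>_::nat. borel :: real measure)"
  let ?X = "\<lambda>\<omega>. restrict (\<lambda>i. D i \<omega>) {..<k}" and ?Y = "\<lambda>\<omega>. restrict (\<lambda>i. D i \<omega>) {k..<n}"
  have iv: "indep_var ?P1 ?X ?P2 ?Y"
    using k by (intro indep_var_restrict[OF ind]) auto
  define S1 where "S1 = {f\<in>space ?P1. (\<forall>m\<in>{1..<k}. (\<Sum>j<m. f j) \<le> a) \<and> a < (\<Sum>j<k. f j)}"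
  define S2 where "S2 = {f\<in>space ?P2. (\<Sum>j\<in>{k..<n}. f j) \<in> B}"
  have sm: "(\<lambda>f. \<Sum>j<m. f j) \<in> borel_measurable ?P1" if "m \<le> k" for m
    using that by (intro borel_measurable_sum measurable_component_singleton) auto
  have "S1 \<in> sets ?P1"
  proof -
    have [measurable]: "(\<lambda>f. \<Sum>j<k. f j) \<in> borel_measurable ?P1" by (rule sm) simp
    have "{f\<in>space ?P1. (\<Sum>j<m. f j) \<le> a} \<in> sets ?P1" if "m \<in> {1..<k}" for m
    proof -
      have [measurable]: "(\<lambda>f. \<Sum>j<m. f j) \<in> borel_measurable ?P1" by (rule sm) (use that in auto)
      show ?thesis by measurable
    qed
    then have "{f\<in>space ?P1. \<forall>m\<in>{1..<k}. (\<Sum>j<m. f j) \<le> a} \<in> sets ?P1" by (intro sets.sets_Collect_finite_All) auto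
    moreover have "{f\<in>space ?P1. a < (\<Sum>j<k. f j)} \<in> sets ?P1" by measurable
    ultimately show ?thesis unfolding S1_def by (intro sets.sets_Collect_conj)
  qed
  moreover have "S2 \<in> sets ?P2"
  proof -
    have "(\<lambda>f. \<Sum>j\<in>{k..<n}. f j) \<in> borel_measurable ?P2" by (intro borel_measurable_sum measurable_component_singleton)
    from measurable_sets[OF this B] show ?thesis by (simp add: S2_def vimage_def Int_def conj_commute)
  qed
  ultimately have "prob ((\<lambda>x. (?X x, ?Y x)) -` (S1 \<times> S2) \<inter> space M) = prob (?X -` S1 \<inter> space M) * prob (?Y -` S2 \<inter> space M)"
    by (rule indep_varD[OF iv])
  moreover have "?X -` S1 \<inter> space M = {\<omega>\<in>space M. (\<forall>m\<in>{1..<k}. (\<Sum>j<m. D j \<omega>) \<le> a) \<and> a < (\<Sum>j<k. D j \<omega>)}"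
    by (auto simp: S1_def space_PiM)
  moreover have "?Y -` S2 \<inter> space M = {\<omega>\<in>space M. (\<Sum>j\<in>{k..<n}. D j \<omega>) \<in> B}"
    by (auto simp: S2_def space_PiM)
  moreover have "(\<lambda>x. (?X x, ?Y x)) -` (S1 \<times> S2) \<inter> space M = (?X -` S1 \<inter> space M) \<inter> (?Y -` S2 \<inter> space M)"
    by auto
  moreover have "{\<omega>\<in>space M. (\<forall>m\<in>{1..<k}. (\<Sum>j<m. D j \<omega>) \<le> a) \<and> a < (\<Sum>j<k. D j \<omega>)} \<inter> {\<omega>\<in>space M. (\<Sum>j\<in>{k..<n}. D j \<omega>) \<in> B}
    = {\<omega>\<in>space M. (\<forall>m\<in>{1..<k}. (\<Sum>j<m. D j \<omega>) \<le> a) \<and> a < (\<Sum>j<k. D j \<omega>) \<and> (\<Sum>j\<in>{k..<n}. D j \<omega>) \<in> B}"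
    by auto
  ultimately show ?thesis by simp
qed

lemma ex_first_passage:
  fixes P :: "nat \<Rightarrow> bool"
  assumes "k \<in> {1..n}" "P k"
  shows "\<exists>k\<in>{1..n}. (\<forall>m\<in>{1..<k}. \<not> P m) \<and> P k"
proof -
  define j where "j = (LEAST k. k \<in> {1..n} \<and> P k)"
  have j: "j \<in> {1..n} \<and> P j" unfolding j_def by (rule LeastI[of _ k]) (use assms in auto)
  moreover have "\<not> P m" if "m \<in> {1..<j}" for m
    using not_less_Least[of m "\<lambda>k. k \<in> {1..n} \<and> P k"] that j unfolding j_def[symmetric] by auto
  ultimately show ?thesis by blast
qed

text \<open>
  Decompose according to the first passage over \<open>a\<close>. The remaining displacement is independent of
  it and symmetric. For the upper bound, the walk ends above \<open>a\<close> with conditional probability at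
  least \<open>1/2\<close>. For the lower bound, a discrete walk overshoots \<open>a\<close>, but by at most \<open>\<epsilon>\<close> unless some
  step is larger than \<open>\<epsilon>\<close>. Walks that end above \<open>a + 2\<epsilon>\<close> thus climb by at least \<open>\<epsilon>\<close> after the
  passage; reflected they fall by at least \<open>\<epsilon>\<close> and end at or below \<open>a\<close>, so they are passages in
  addition to those that end above \<open>a\<close>.
\<close>
lemma (in prob_space) random_walk_reflection:
  fixes D :: "nat \<Rightarrow> 'a \<Rightarrow> real"
  assumes ind: "indep_vars (\<lambda>_. borel) D {..<n}"
    and sym: "\<And>k c. k \<in> {1..n} \<Longrightarrow> prob {\<omega>\<in>space M. (\<Sum>j\<in>{k..<n}. D j \<omega>) \<le> - c} = prob {\<omega>\<in>space M. c \<le> (\<Sum>j\<in>{k..<n}. D j \<omega>)}"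
    and \<epsilon>: "0 < \<epsilon>"
  shows "prob {\<omega>\<in>space M. \<exists>k\<in>{1..n}. a < (\<Sum>j<k. D j \<omega>)} \<le> 2 * prob {\<omega>\<in>space M. a < (\<Sum>j<n. D j \<omega>)}" (is ?U)
    and "0 \<le> a \<Longrightarrow> 0 < n \<Longrightarrow> prob {\<omega>\<in>space M. a < (\<Sum>j<n. D j \<omega>)} + prob {\<omega>\<in>space M. a + 2 * \<epsilon> < (\<Sum>j<n. D j \<omega>)}
      - 2 * prob {\<omega>\<in>space M. \<exists>i<n. \<epsilon> < D i \<omega>} \<le> prob {\<omega>\<in>space M. \<exists>k\<in>{1..n}. a < (\<Sum>j<k. D j \<omega>)}"
proof -
  have Dm[measurable]: "D j \<in> borel_measurable M" if "j < n" for j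
    using ind that by (auto simp: indep_vars_def)
  have Sm: "(\<lambda>\<omega>. \<Sum>j<k. D j \<omega>) \<in> borel_measurable M" if "k \<le> n" for k
    using that by (intro borel_measurable_sum) auto
  have Rm[measurable]: "(\<lambda>\<omega>. \<Sum>j\<in>{k..<n}. D j \<omega>) \<in> borel_measurable M" for k
    by (intro borel_measurable_sum) auto
  \<comment> \<open>\<open>T k\<close> is first passage at step \<open>k\<close>, and \<open>E k B\<close> says that the displacement after step
     \<open>k\<close> lies in \<open>B\<close>.\<close>
  define T where "T k = {\<omega>\<in>space M. (\<forall>m\<in>{1..<k}. (\<Sum>j<m. D j \<omega>) \<le> a) \<and> a < (\<Sum>j<k. D j \<omega>)}" for k
  define E where "E k B = {\<omega>\<in>space M. (\<Sum>j\<in>{k..<n}. D j \<omega>) \<in> B}" for k B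
  have Tm: "T k \<in> events" if k: "k \<in> {1..n}" for k
  proof -
    have [measurable]: "(\<lambda>\<omega>. \<Sum>j<k. D j \<omega>) \<in> borel_measurable M" by (rule Sm) (use k in auto)
    have "{\<omega>\<in>space M. (\<Sum>j<m. D j \<omega>) \<le> a} \<in> sets M" if "m \<in> {1..<k}" for m
    proof -
      have [measurable]: "(\<lambda>\<omega>. \<Sum>j<m. D j \<omega>) \<in> borel_measurable M" by (rule Sm) (use that k in auto)
      show ?thesis by measurable
    qed
    then have "{\<omega>\<in>space M. \<forall>m\<in>{1..<k}. (\<Sum>j<m. D j \<omega>) \<le> a} \<in> sets M" by (intro sets.sets_Collect_finite_All) auto
    moreover have "{\<omega>\<in>space M. a < (\<Sum>j<k. D j \<omega>)} \<in> sets M" by measurable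
    ultimately show ?thesis unfolding T_def by (intro sets.sets_Collect_conj)
  qed
  have Em: "E k B \<in> events" if "B \<in> sets borel" for k B
    using measurable_sets[OF Rm[of k] that] by (simp add: E_def vimage_def Int_def conj_commute)
  have TE: "prob (T k \<inter> E k B) = prob (T k) * prob (E k B)" if "k \<in> {1..n}" "B \<in> sets borel" for k B
  proof -
    have "T k \<inter> E k B = {\<omega>\<in>space M. (\<forall>m\<in>{1..<k}. (\<Sum>j<m. D j \<omega>) \<le> a) \<and> a < (\<Sum>j<k. D j \<omega>) \<and> (\<Sum>j\<in>{k..<n}. D j \<omega>) \<in> B}"
      by (auto simp: T_def E_def)
    then show ?thesis using first_passage_independent[OF ind that, of a] by (simp add: T_def E_def)
  qed
  have disjT: "disjoint_family_on (\<lambda>k. T k \<inter> E k B) {1..n}" for B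
    unfolding disjoint_family_on_def
  proof (intro ballI impI)
    fix k l assume kl: "k \<in> {1..n}" "l \<in> {1..n}" "k \<noteq> l"
    { fix \<omega> assume w: "\<omega> \<in> T k" "\<omega> \<in> T l"
      have False
      proof (cases "k < l")
        case True
        then have "(\<Sum>j<k. D j \<omega>) \<le> a" using w kl by (auto simp: T_def)
        then show False using w by (simp add: T_def)
      next
        case False
        then have "l \<in> {1..<k}" using kl by auto
        then have "(\<Sum>j<l. D j \<omega>) \<le> a" using w by (auto simp: T_def)
        then show False using w by (simp add: T_def)
      qed }
    then show "T k \<inter> E k B \<inter> (T l \<inter> E l B) = {}" by auto
  qed
  have sumTE: "(\<Sum>k\<in>{1..n}. prob (T k) * prob (E k B)) = prob (\<Union>k\<in>{1..n}. T k \<inter> E k B)" if "B \<in> sets borel" for B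
    using TE[OF _ that] Tm Em[OF that] disjT[of B] by (subst finite_measure_finite_Union) auto
  have half: "1 / 2 \<le> prob (E k {0..})" if "k \<in> {1..n}" for k
  proof -
    have "space M = E k {0..} \<union> E k {..0}" by (auto simp: E_def)
    then have "1 \<le> prob (E k {0..}) + prob (E k {..0})"
      using measure_Un_le[of "E k {0..}" M "E k {..0}"] Em[of "{0..}" k] Em[of "{..0}" k] prob_space by simp
    also have "prob (E k {..0}) = prob (E k {0..})" using sym[OF that, of 0] by (simp add: E_def)
    finally show ?thesis by simp
  qed
  have split: "(\<Sum>j<k. D j \<omega>) + (\<Sum>j\<in>{k..<n}. D j \<omega>) = (\<Sum>j<n. D j \<omega>)" if "k \<le> n" for k \<omega>
    using that by (metis lessThan_atLeast0 sum.atLeastLessThan_concat zero_le)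
  have passage: "\<exists>k\<in>{1..n}. \<omega> \<in> T k" if "\<omega> \<in> space M" "k \<in> {1..n}" "a < (\<Sum>j<k. D j \<omega>)" for k \<omega>
    using ex_first_passage[of k n "\<lambda>k. a < (\<Sum>j<k. D j \<omega>)"] that by (auto simp: T_def not_less)
  let ?max = "{\<omega>\<in>space M. \<exists>k\<in>{1..n}. a < (\<Sum>j<k. D j \<omega>)}"
  have maxT: "?max = (\<Union>k\<in>{1..n}. T k)" using passage by (auto simp: T_def)
  then have maxm: "?max \<in> events" using Tm by (auto simp: maxT)
  have [measurable]: "(\<lambda>\<omega>. \<Sum>j<n. D j \<omega>) \<in> borel_measurable M" by (rule Sm) simp
  have EU: "E k UNIV = space M" for k by (auto simp: E_def)
  have maxs: "prob ?max = (\<Sum>k\<in>{1..n}. prob (T k))"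
  proof -
    have "(\<Union>k\<in>{1..n}. T k \<inter> E k UNIV) = ?max" unfolding maxT EU by (auto simp: T_def)
    then show ?thesis using sumTE[of UNIV] by (simp add: EU prob_space)
  qed
  show ?U
  proof -
    have "prob ?max \<le> (\<Sum>k\<in>{1..n}. 2 * (prob (T k) * prob (E k {0..})))"
      unfolding maxs
    proof (intro sum_mono)
      fix k assume "k \<in> {1..n}"
      then have "prob (T k) * (1 / 2) \<le> prob (T k) * prob (E k {0..})" by (intro mult_left_mono half) auto
      then show "prob (T k) \<le> 2 * (prob (T k) * prob (E k {0..}))" by simp
    qed
    also have "\<dots> = 2 * prob (\<Union>k\<in>{1..n}. T k \<inter> E k {0..})" using sumTE[of "{0..}"] by (simp add: sum_distrib_left[symmetric])
    also have "prob (\<Union>k\<in>{1..n}. T k \<inter> E k {0..}) \<le> prob {\<omega>\<in>space M. a < (\<Sum>j<n. D j \<omega>)}"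
    proof (rule finite_measure_mono)
      show "(\<Union>k\<in>{1..n}. T k \<inter> E k {0..}) \<subseteq> {\<omega>\<in>space M. a < (\<Sum>j<n. D j \<omega>)}"
      proof (clarsimp simp: T_def E_def)
        fix \<omega> k assume "k \<le> n" "a < (\<Sum>j<k. D j \<omega>)" "0 \<le> (\<Sum>j=k..<n. D j \<omega>)"
        then show "a < (\<Sum>j<n. D j \<omega>)" using split[of k \<omega>] by linarith
      qed
    qed measurable
    finally show ?thesis by simp
  qed
  assume a: "0 \<le> a" and n: "0 < n"
  let ?big = "{\<omega>\<in>space M. \<exists>i<n. \<epsilon> < D i \<omega>}"
  have bigm[measurable]: "?big \<in> events"
  proof -
    have "{\<omega>\<in>space M. \<epsilon> < D i \<omega>} \<in> events" if "i \<in> {..<n}" for i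
      using Dm[of i] that by (intro borel_measurable_less) auto
    then have "{\<omega>\<in>space M. \<exists>i\<in>{..<n}. \<epsilon> < D i \<omega>} \<in> events" by (intro sets.sets_Collect_finite_Ex) auto
    then show ?thesis by (simp add: Bex_def)
  qed
  have small: "(\<Sum>j<k. D j \<omega>) \<le> a + \<epsilon>" if tk: "\<omega> \<in> T k" "k \<in> {1..n}" "\<omega> \<notin> ?big" for \<omega> k
  proof -
    obtain m where m: "k = Suc m" using tk(2) by (cases k) auto
    have "(\<Sum>j<m. D j \<omega>) \<le> a" using tk(1) a m by (cases "m = 0") (auto simp: T_def)
    moreover have "m < n" using tk(2) m by auto
    then have "D m \<omega> \<le> \<epsilon>" using tk(1,3) by (auto simp: T_def not_less dest!: spec[of _ m])
    ultimately show ?thesis unfolding m by simp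
  qed
  have Eeq: "prob (E k {..-\<epsilon>}) = prob (E k {\<epsilon>..})" if "k \<in> {1..n}" for k
    using sym[OF that, of \<epsilon>] by (simp add: E_def)
  let ?up = "\<Union>k\<in>{1..n}. T k \<inter> E k {\<epsilon>..}" and ?dn = "\<Union>k\<in>{1..n}. T k \<inter> E k {..-\<epsilon>}"
  have upm: "?up \<in> events" "?dn \<in> events" using Tm Em by auto
  have updn: "prob ?up = prob ?dn"
  proof -
    have "prob ?up = (\<Sum>k\<in>{1..n}. prob (T k) * prob (E k {\<epsilon>..}))" using sumTE[of "{\<epsilon>..}"] by simp
    also have "\<dots> = (\<Sum>k\<in>{1..n}. prob (T k) * prob (E k {..-\<epsilon>}))" using Eeq by (intro sum.cong) auto
    also have "\<dots> = prob ?dn" using sumTE[of "{..-\<epsilon>}"] by simp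
    finally show ?thesis .
  qed
  have 1: "prob {\<omega>\<in>space M. a + 2 * \<epsilon> < (\<Sum>j<n. D j \<omega>)} \<le> prob ?up + prob ?big"
  proof -
    have "{\<omega>\<in>space M. a + 2 * \<epsilon> < (\<Sum>j<n. D j \<omega>)} \<subseteq> ?up \<union> ?big"
    proof
      fix \<omega> assume w: "\<omega> \<in> {\<omega>\<in>space M. a + 2 * \<epsilon> < (\<Sum>j<n. D j \<omega>)}"
      show "\<omega> \<in> ?up \<union> ?big"
      proof (cases "\<omega> \<in> ?big")
        case False
        obtain k where k: "k \<in> {1..n}" "\<omega> \<in> T k" using passage[of \<omega> n] w n \<epsilon> by auto
        have "\<epsilon> \<le> (\<Sum>j\<in>{k..<n}. D j \<omega>)" using small[OF k(2,1) False] split[of k \<omega>] w k by auto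
        then have "\<omega> \<in> E k {\<epsilon>..}" using w by (simp add: E_def)
        then show ?thesis using k by blast
      qed blast
    qed
    then have "prob {\<omega>\<in>space M. a + 2 * \<epsilon> < (\<Sum>j<n. D j \<omega>)} \<le> prob (?up \<union> ?big)"
      using upm bigm by (intro finite_measure_mono) auto
    also have "\<dots> \<le> prob ?up + prob ?big" using upm bigm by (intro measure_Un_le) auto
    finally show ?thesis .
  qed
  let ?end = "{\<omega>\<in>space M. a < (\<Sum>j<n. D j \<omega>)}"
  have endm: "?end \<in> events" by measurable
  have "?dn - ?big \<subseteq> ?max - ?end"
  proof
    fix \<omega> assume w: "\<omega> \<in> ?dn - ?big"
    then obtain k where k: "k \<in> {1..n}" "\<omega> \<in> T k" "\<omega> \<in> E k {..-\<epsilon>}" by blast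
    have "(\<Sum>j<n. D j \<omega>) \<le> a" using small[OF k(2,1)] w split[of k \<omega>] k by (auto simp: E_def)
    then show "\<omega> \<in> ?max - ?end" using k by (auto simp: T_def)
  qed
  then have "prob (?dn - ?big) \<le> prob (?max - ?end)" using maxm endm by (intro finite_measure_mono) auto
  also have "\<dots> = prob ?max - prob ?end"
    using maxm endm n by (intro finite_measure_Diff) auto
  finally have 2: "prob (?dn - ?big) \<le> prob ?max - prob ?end" .
  have "prob ?dn \<le> prob ((?dn - ?big) \<union> ?big)" using upm bigm by (intro finite_measure_mono) auto
  also have "\<dots> \<le> prob (?dn - ?big) + prob ?big" using upm bigm by (intro measure_Un_le) auto
  finally show "prob ?end + prob {\<omega>\<in>space M. a + 2 * \<epsilon> < (\<Sum>j<n. D j \<omega>)} - 2 * prob ?big \<le> prob ?max"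
    using 1 2 updn by linarith
qed

lemma sets_inequality_real:
  "{z::real. b \<le> c * \<bar>z\<bar>} \<in> sets borel" "{z::real. b < c * \<bar>z\<bar>} \<in> sets borel" "{z::real. b < c * z} \<in> sets borel" "{z::real. b \<le> c * z} \<in> sets borel"
proof -
  have "{z\<in>space borel. b \<le> c * \<bar>z\<bar>} \<in> sets borel" "{z\<in>space borel. b < c * \<bar>z\<bar>} \<in> sets borel"
    "{z\<in>space borel. b < c * z} \<in> sets borel" "{z\<in>space borel. b \<le> c * z} \<in> sets borel" by measurable
  then show "{z::real. b \<le> c * \<bar>z\<bar>} \<in> sets borel" "{z::real. b < c * \<bar>z\<bar>} \<in> sets borel" "{z::real. b < c * z} \<in> sets borel" "{z::real. b \<le> c * z} \<in> sets borel" by simp_all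
qed

lemma sqrt_pow4: "0 \<le> t \<Longrightarrow> sqrt t ^ 4 = t\<^sup>2"
proof -
  assume t: "0 \<le> t"
  have "sqrt t ^ 4 = ((sqrt t)\<^sup>2)\<^sup>2" by (simp flip: power_mult)
  then show ?thesis using t by simp
qed

text \<open>
  Markov's inequality for the fourth power. With \<open>c\<close> of order \<open>\<surd>t\<close> the bound is of order \<open>t\<^sup>2\<close>,
  small enough to be summed over the \<open>n\<close> steps of a grid of mesh \<open>1/n\<close> and to be negligible
  against \<open>\<surd>s\<close> at displacements of order \<open>s\<^sup>1\<^sup>/\<^sup>4\<close>; the second moment would not do.
\<close>
lemma std_normal_fourth_moment_tail:
  assumes "0 < \<epsilon>" "0 \<le> c"
  shows "measure std_normal_distribution {z. \<epsilon> < c * \<bar>z\<bar>} \<le> 3 * c ^ 4 / \<epsilon> ^ 4"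
proof -
  interpret prob_space std_normal_distribution by (rule prob_space_normal_density) simp
  have i4: "integrable std_normal_distribution (\<lambda>z::real. z ^ 4)"
    using integrable_std_normal_moment[of 4] by (subst integrable_density) (auto simp: normal_density_nonneg)
  have e4: "(\<integral>z. z ^ 4 \<partial>std_normal_distribution) = 3"
    using integral_std_normal_moment_even[of 2] by (subst integral_density) (auto simp: fact_numeral normal_density_nonneg)
  have "measure std_normal_distribution {z. \<epsilon> < c * \<bar>z\<bar>} \<le> measure std_normal_distribution {z\<in>space std_normal_distribution. \<epsilon> ^ 4 \<le> c ^ 4 * z ^ 4}"
  proof (rule finite_measure_mono)
    show "{z. \<epsilon> < c * \<bar>z\<bar>} \<subseteq> {z\<in>space std_normal_distribution. \<epsilon> ^ 4 \<le> c ^ 4 * z ^ 4}"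
    proof
      fix z assume "z \<in> {z. \<epsilon> < c * \<bar>z\<bar>}"
      then have "\<epsilon> ^ 4 \<le> (c * \<bar>z\<bar>) ^ 4" using assms by (intro power_mono) auto
      then show "z \<in> {z\<in>space std_normal_distribution. \<epsilon> ^ 4 \<le> c ^ 4 * z ^ 4}" by (simp add: power_mult_distrib power_even_abs)
    qed
  qed measurable
  also have "\<dots> \<le> (\<integral>z. c ^ 4 * z ^ 4 \<partial>std_normal_distribution) / \<epsilon> ^ 4"
    using i4 assms by (intro integral_Markov_inequality_measure[where A="{}"]) auto
  also have "(\<integral>z. c ^ 4 * z ^ 4 \<partial>std_normal_distribution) = c ^ 4 * 3" using i4 e4 by simp
  finally show ?thesis by (simp add: mult.commute)
qed

abbreviation std_normal :: "real measure" where
  "std_normal \<equiv> std_normal_distribution"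

lemma prob_space_std_normal: "prob_space std_normal"
  by (rule prob_space_normal_density) simp

lemma std_normal_symmetric:
  assumes "B \<in> sets borel"
  shows "measure std_normal {z. - z \<in> B} = measure std_normal B"
proof -
  note assms[measurable]
  have "{z \<in> space borel. - z \<in> B} \<in> sets borel" by measurable
  then have [measurable]: "{z. - z \<in> B} \<in> sets borel" by simp
  have "emeasure std_normal B = (\<integral>\<^sup>+x. ennreal (std_normal_density x) * indicator B x \<partial>lborel)"
    by (simp add: emeasure_density)
  also have "\<dots> = (\<integral>\<^sup>+x. ennreal (std_normal_density (0 + (-1) *\<^sub>R x)) * indicator B (0 + (-1) *\<^sub>R x) \<partial>lborel)"
    by (rule nn_integral_lborel_shift[symmetric]) auto
  also have "\<dots> = emeasure std_normal {z. - z \<in> B}"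
    by (simp add: emeasure_density std_normal_density_def indicator_def)
  finally show ?thesis by (simp add: measure_def)
qed

lemma std_normal_two_sided_tail:
  assumes "0 \<le> a" "0 \<le> c"
  shows "measure std_normal {z. a < c * \<bar>z\<bar>} = 2 * measure std_normal {z. a < c * z}"
proof -
  interpret prob_space std_normal by (rule prob_space_std_normal)
  have "{z. a < c * \<bar>z\<bar>} = {z. a < c * z} \<union> {z. - z \<in> {z. a < c * z}}"
  proof (intro set_eqI)
    fix z
    have "c * z \<le> 0" if "z < 0" using that assms by (simp add: mult_nonneg_nonpos)
    moreover have "c * - z \<le> 0" if "0 \<le> z" using that assms by simp
    ultimately show "z \<in> {z. a < c * \<bar>z\<bar>} \<longleftrightarrow> z \<in> {z. a < c * z} \<union> {z. - z \<in> {z. a < c * z}}"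
      using assms(1) by (auto simp: abs_if)
  qed
  moreover have "{z. a < c * z} \<inter> {z. - z \<in> {z. a < c * z}} = {}" using assms by auto
  moreover have m: "{z. a < c * z} \<in> sets borel" "{z. - z \<in> {z. a < c * z}} \<in> sets borel"
  proof -
    have "{z \<in> space borel. a < c * z} \<in> sets borel" "{z \<in> space borel. a < c * (- z)} \<in> sets borel" by measurable
    then show "{z. a < c * z} \<in> sets borel" "{z. - z \<in> {z. a < c * z}} \<in> sets borel" by simp_all
  qed
  ultimately have "measure std_normal {z. a < c * \<bar>z\<bar>} = measure std_normal {z. a < c * z} + measure std_normal {z. - z \<in> {z. a < c * z}}"
    using finite_measure_Union[of "{z. a < c * z}" "{z. - z \<in> {z. a < c * z}}"] by simp
  then show ?thesis using std_normal_symmetric[OF m(1)] by simp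
qed

lemma brownian_component_law:
  fixes W :: "real \<Rightarrow> 'w \<Rightarrow> 'a::euclidean_space"
  assumes bm: "brownian_motion N x W" and \<nu>: "norm \<nu> = 1" and st: "0 \<le> s" "s \<le> t"
  shows "distr N borel (\<lambda>\<omega>. \<nu> \<bullet> (W t \<omega> - W s \<omega>)) = distr std_normal borel (\<lambda>z. sqrt (2 * (t - s)) * z)"
proof (rule Levy_uniqueness)
  let ?c = "sqrt (2 * (t - s))"
  have m[measurable]: "(\<lambda>\<omega>. W t \<omega> - W s \<omega>) \<in> borel_measurable N"
    using st brownian_motionD(2)[OF bm] by (intro borel_measurable_diff) auto
  interpret N: prob_space N by (rule brownian_motionD(1)[OF bm])
  interpret G: prob_space std_normal by (rule prob_space_std_normal)
  show "real_distribution (distr N borel (\<lambda>\<omega>. \<nu> \<bullet> (W t \<omega> - W s \<omega>)))" by (intro N.real_distribution_distr) measurable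
  show "real_distribution (distr std_normal borel (\<lambda>z. ?c * z))" by (intro G.real_distribution_distr) measurable
  show "char (distr N borel (\<lambda>\<omega>. \<nu> \<bullet> (W t \<omega> - W s \<omega>))) = char (distr std_normal borel (\<lambda>z. ?c * z))"
  proof
    fix \<theta>
    have "char (distr N borel (\<lambda>\<omega>. \<nu> \<bullet> (W t \<omega> - W s \<omega>))) \<theta> = (CLINT \<omega>|N. exp (- (\<i> * complex_of_real ((- \<theta> *\<^sub>R \<nu>) \<bullet> (W t \<omega> - W s \<omega>)))))"
      unfolding char_def by (subst integral_distr) auto
    also have "\<dots> = complex_of_real (exp (- ((t - s) * (norm (- \<theta> *\<^sub>R \<nu>))\<^sup>2)))"
      by (rule brownian_motionD(6)[OF bm st])
    also have "(t - s) * (norm (- \<theta> *\<^sub>R \<nu>))\<^sup>2 = (?c * \<theta>)\<^sup>2 / 2" using \<nu> st by (simp add: power_mult_distrib)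
    also have "complex_of_real (exp (- ((?c * \<theta>)\<^sup>2 / 2))) = char std_normal (?c * \<theta>)"
      by (simp add: char_std_normal_distribution)
    also have "\<dots> = char (distr std_normal borel (\<lambda>z. ?c * z)) \<theta>"
      unfolding char_def by (subst integral_distr) (auto simp: mult_ac)
    finally show "char (distr N borel (\<lambda>\<omega>. \<nu> \<bullet> (W t \<omega> - W s \<omega>))) \<theta> = char (distr std_normal borel (\<lambda>z. ?c * z)) \<theta>" .
  qed
qed

lemma brownian_component_prob:
  fixes W :: "real \<Rightarrow> 'w \<Rightarrow> 'a::euclidean_space"
  assumes bm: "brownian_motion N x W" and \<nu>: "norm \<nu> = 1" and st: "0 \<le> s" "s \<le> t" and B: "B \<in> sets borel"
  shows "measure N {\<omega>\<in>space N. \<nu> \<bullet> (W t \<omega> - W s \<omega>) \<in> B} = measure std_normal {z. sqrt (2 * (t - s)) * z \<in> B}"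
proof -
  have [measurable]: "(\<lambda>\<omega>. W t \<omega> - W s \<omega>) \<in> borel_measurable N"
    using st brownian_motionD(2)[OF bm] by (intro borel_measurable_diff) auto
  have "measure N {\<omega>\<in>space N. \<nu> \<bullet> (W t \<omega> - W s \<omega>) \<in> B} = measure (distr N borel (\<lambda>\<omega>. \<nu> \<bullet> (W t \<omega> - W s \<omega>))) B"
    using B by (subst measure_distr) (auto simp: vimage_def Int_def conj_commute)
  also have "\<dots> = measure std_normal {z. sqrt (2 * (t - s)) * z \<in> B}"
    unfolding brownian_component_law[OF bm \<nu> st] using B by (subst measure_distr) (auto simp: vimage_def)
  finally show ?thesis .
qed

text \<open>
  Reflection for the walk of the positions at multiples of \<open>s/n\<close>. An increment exceeds \<open>\<epsilon>\<close> with
  probability of order \<open>(s/n)\<^sup>2 / \<epsilon>\<^sup>4\<close>, so that one of the \<open>n\<close> increments does so with probability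
  of order \<open>1/n\<close>.
\<close>
lemma brownian_grid_reflection:
  fixes W :: "real \<Rightarrow> 'w \<Rightarrow> 'a::euclidean_space" and a :: real
  assumes bm: "brownian_motion N x W" and \<nu>: "norm \<nu> = 1" and s: "0 < s" and n: "0 < (n::nat)" and \<epsilon>: "0 < \<epsilon>"
  defines "G \<equiv> {\<omega>\<in>space N. \<exists>k\<in>{1..n}. a < \<nu> \<bullet> (W (real k * s / real n) \<omega> - W 0 \<omega>)}"
  shows "G \<in> sets N"
    and "measure N G \<le> 2 * measure std_normal {z. a < sqrt (2 * s) * z}"
    and "0 \<le> a \<Longrightarrow> measure std_normal {z. a < sqrt (2 * s) * z} + measure std_normal {z. a + 2 * \<epsilon> < sqrt (2 * s) * z} - 24 * s\<^sup>2 / (real n * \<epsilon> ^ 4) \<le> measure N G"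
proof -
  interpret N: prob_space N by (rule brownian_motionD(1)[OF bm])
  interpret SN: prob_space std_normal by (rule prob_space_std_normal)
  define T where "T i = real i * s / real n" for i
  have T0: "0 \<le> T i" for i using s by (simp add: T_def)
  have Tle: "T i \<le> T (Suc i)" for i using s n by (simp add: T_def divide_right_mono mult_right_mono)
  have Tn: "T n = s" "T 0 = 0" using n by (simp_all add: T_def)
  have Ts: "T k \<le> s" if "k \<le> n" for k using that s n by (simp add: T_def divide_le_eq mult.commute)
  define D where "D i \<omega> = \<nu> \<bullet> (W (T (Suc i)) \<omega> - W (T i) \<omega>)" for i \<omega>
  have Wm[measurable]: "W t \<in> borel_measurable N" if "0 \<le> t" for t using brownian_motionD(2)[OF bm that] .
  have "N.indep_vars (\<lambda>_. borel) (\<lambda>i \<omega>. W (T (Suc i)) \<omega> - W (T i) \<omega>) {..<n}"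
    using brownian_motionD(5)[OF bm, of T n] T0 Tle by blast
  then have ind: "N.indep_vars (\<lambda>_. borel) D {..<n}"
    unfolding D_def by (rule N.indep_vars_compose2[where Y="\<lambda>_ y. \<nu> \<bullet> y"]) measurable
  have S: "(\<Sum>j<k. D j \<omega>) = \<nu> \<bullet> (W (T k) \<omega> - W 0 \<omega>)" for k \<omega>
    using sum_lessThan_telescope[of "\<lambda>i. \<nu> \<bullet> W (T i) \<omega>" k] by (simp add: D_def inner_diff_right Tn)
  have R: "(\<Sum>j\<in>{k..<n}. D j \<omega>) = \<nu> \<bullet> (W s \<omega> - W (T k) \<omega>)" if "k \<le> n" for k \<omega>
    using sum_Suc_diff'[OF that, of "\<lambda>i. \<nu> \<bullet> W (T i) \<omega>"] by (simp add: D_def inner_diff_right Tn)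
  have sym: "N.prob {\<omega>\<in>space N. (\<Sum>j\<in>{k..<n}. D j \<omega>) \<le> - c} = N.prob {\<omega>\<in>space N. c \<le> (\<Sum>j\<in>{k..<n}. D j \<omega>)}"
    if "k \<in> {1..n}" for k c
  proof -
    have k: "k \<le> n" using that by simp
    have "measure std_normal {z. - z \<in> {z. c \<le> sqrt (2 * (s - T k)) * z}} = measure std_normal {z. c \<le> sqrt (2 * (s - T k)) * z}"
    proof (rule std_normal_symmetric)
      have "{z \<in> space borel. c \<le> sqrt (2 * (s - T k)) * z} \<in> sets borel" by measurable
      then show "{z. c \<le> sqrt (2 * (s - T k)) * z} \<in> sets borel" by simp
    qed
    then show ?thesis
      using brownian_component_prob[OF bm \<nu> T0 Ts[OF k], of "{..- c}"] brownian_component_prob[OF bm \<nu> T0 Ts[OF k], of "{c..}"]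
      by (simp add: R[OF k] le_minus_iff)
  qed
  have Geq: "G = {\<omega>\<in>space N. \<exists>k\<in>{1..n}. a < (\<Sum>j<k. D j \<omega>)}" by (simp add: G_def S T_def)
  have "{\<omega>\<in>space N. a < (\<Sum>j<k. D j \<omega>)} \<in> sets N" for k
    unfolding S using Wm[OF T0, of k] Wm[of 0] by measurable
  then show "G \<in> sets N" unfolding Geq by (intro sets.sets_Collect_finite_Ex) auto
  have law: "N.prob {\<omega>\<in>space N. b < (\<Sum>j<n. D j \<omega>)} = measure std_normal {z. b < sqrt (2 * s) * z}" for b
    using brownian_component_prob[OF bm \<nu>, of 0 s "{b<..}"] s by (simp add: S Tn)
  note refl = N.random_walk_reflection[OF ind sym \<epsilon>]
  show "measure N G \<le> 2 * measure std_normal {z. a < sqrt (2 * s) * z}"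
    using refl(1)[of a] unfolding Geq law .
  assume a: "0 \<le> a"
  have big: "N.prob {\<omega>\<in>space N. \<exists>i<n. \<epsilon> < D i \<omega>} \<le> 12 * s\<^sup>2 / (real n * \<epsilon> ^ 4)"
  proof -
    have Dm: "{\<omega>\<in>space N. \<epsilon> < D i \<omega>} \<in> sets N" for i
      unfolding D_def using Wm[OF T0, of i] Wm[OF T0, of "Suc i"] by measurable
    have one: "N.prob {\<omega>\<in>space N. \<epsilon> < D i \<omega>} \<le> 12 * s\<^sup>2 / ((real n)\<^sup>2 * \<epsilon> ^ 4)" for i
    proof -
      have dT: "T (Suc i) - T i = s / real n" by (simp add: T_def add_divide_distrib algebra_simps)
      have "N.prob {\<omega>\<in>space N. \<epsilon> < D i \<omega>} = measure std_normal {z. \<epsilon> < sqrt (2 * (s / real n)) * z}"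
        using brownian_component_prob[OF bm \<nu> T0 Tle, of "{\<epsilon><..}" i] by (simp add: D_def dT)
      also have "\<dots> \<le> measure std_normal {z. \<epsilon> < sqrt (2 * (s / real n)) * \<bar>z\<bar>}"
      proof (rule SN.finite_measure_mono)
        show "{z. \<epsilon> < sqrt (2 * (s / real n)) * z} \<subseteq> {z. \<epsilon> < sqrt (2 * (s / real n)) * \<bar>z\<bar>}"
        proof
          fix z assume z: "z \<in> {z. \<epsilon> < sqrt (2 * (s / real n)) * z}"
          have "sqrt (2 * (s / real n)) * z \<le> sqrt (2 * (s / real n)) * \<bar>z\<bar>" using s by (intro mult_left_mono) auto
          with z show "z \<in> {z. \<epsilon> < sqrt (2 * (s / real n)) * \<bar>z\<bar>}" by (auto intro: less_le_trans)
        qed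
        have "{z \<in> space borel. \<epsilon> < sqrt (2 * (s / real n)) * \<bar>z\<bar>} \<in> sets borel" by measurable
        then show "{z. \<epsilon> < sqrt (2 * (s / real n)) * \<bar>z\<bar>} \<in> sets std_normal" by simp
      qed
      also have "\<dots> \<le> 3 * sqrt (2 * (s / real n)) ^ 4 / \<epsilon> ^ 4"
        using s by (intro std_normal_fourth_moment_tail \<epsilon>) auto
      also have "sqrt (2 * (s / real n)) ^ 4 = (2 * (s / real n))\<^sup>2"
        using s by (simp add: sqrt_pow4)
      also have "3 * (2 * (s / real n))\<^sup>2 / \<epsilon> ^ 4 = 12 * s\<^sup>2 / ((real n)\<^sup>2 * \<epsilon> ^ 4)"
        by (simp add: power_mult_distrib power_divide)
      finally show ?thesis .
    qed
    have "{\<omega>\<in>space N. \<exists>i<n. \<epsilon> < D i \<omega>} = (\<Union>i\<in>{..<n}. {\<omega>\<in>space N. \<epsilon> < D i \<omega>})" by auto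
    then have "N.prob {\<omega>\<in>space N. \<exists>i<n. \<epsilon> < D i \<omega>} \<le> (\<Sum>i<n. N.prob {\<omega>\<in>space N. \<epsilon> < D i \<omega>})"
      using Dm by (simp only:) (intro N.finite_measure_subadditive_finite, auto)
    also have "\<dots> \<le> (\<Sum>i<n. 12 * s\<^sup>2 / ((real n)\<^sup>2 * \<epsilon> ^ 4))" by (intro sum_mono one)
    also have "\<dots> = 12 * s\<^sup>2 / (real n * \<epsilon> ^ 4)" using n by (simp add: power2_eq_square)
    finally show ?thesis .
  qed
  show "measure std_normal {z. a < sqrt (2 * s) * z} + measure std_normal {z. a + 2 * \<epsilon> < sqrt (2 * s) * z} - 24 * s\<^sup>2 / (real n * \<epsilon> ^ 4) \<le> measure N G"
    using refl(2)[OF _ a n] big unfolding Geq law by simp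
qed

text \<open>
  By continuity the path exceeds \<open>a\<close> on a neighbourhood of \<open>u\<close>, which contains the next point at
  or after \<open>u\<close> of every fine enough dyadic grid. Dyadic grids are nested, so that the events of
  exceeding \<open>a\<close> on the \<open>p\<close>-th grid will increase with \<open>p\<close>.
\<close>
lemma brownian_sup_as_grid:
  fixes X :: "real \<Rightarrow> real"
  assumes X: "continuous_on {0..} X" and s: "0 < s" and u: "0 < u" "u \<le> s" "a < X u"
  shows "\<exists>p::nat. \<exists>k\<in>{1..2^p::nat}. a < X (real k * s / real (2^p))"
proof -
  have "continuous (at u) X" using X u by (intro continuous_on_interior[of "{0..}"]) auto
  then have "eventually (\<lambda>r. a < X r) (at u)" using u(3) by (auto simp: continuous_at intro: order_tendstoD)
  then obtain d where d: "d > 0" "\<And>r. r \<noteq> u \<Longrightarrow> dist r u < d \<Longrightarrow> a < X r" by (auto simp: eventually_at)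
  obtain p :: nat where p: "s / d < 2 ^ p" using real_arch_pow[of 2 "s / d"] by auto
  define k where "k = nat \<lceil>u * 2 ^ p / s\<rceil>"
  have pos: "0 < u * 2 ^ p / s" using u s by simp
  have k1: "u * 2 ^ p / s \<le> real k" "real k < u * 2 ^ p / s + 1" using pos unfolding k_def by linarith+
  have "u * 2 ^ p / s \<le> 2 ^ p" using u s by (simp add: divide_le_eq)
  then have "real k < 2 ^ p + 1" using k1 by linarith
  then have "real k < real (2 ^ p + 1)" by simp
  then have "k < 2 ^ p + 1" by (simp only: of_nat_less_iff)
  then have k: "k \<in> {1..2^p}" using k1 pos by (auto simp: Suc_le_eq)
  have "u \<le> real k * s / 2 ^ p" using k1(1) s by (simp add: field_simps)
  moreover have "real k * s / 2 ^ p < u + s / 2 ^ p" using k1(2) s by (simp add: field_simps)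
  moreover have "s / 2 ^ p < d" using p d s by (simp add: field_simps)
  ultimately have "dist (real k * s / 2 ^ p) u < d" by (simp add: dist_real_def)
  then have "a < X (real k * s / 2 ^ p)" using d(2) u(3) by (cases "real k * s / 2 ^ p = u") auto
  then have "a < X (real k * s / real (2 ^ p))" by simp
  then show ?thesis using k by blast
qed

text \<open>
  The upper bound holds for every level, also for negative ones, where the right-hand side is \<open>1\<close>.
  For nonnegative levels the grid estimates are passed to the limit, first in the mesh and then in
  the overshoot \<open>\<epsilon>\<close>.
\<close>
lemma brownian_reflection:
  fixes W :: "real \<Rightarrow> 'w \<Rightarrow> 'a::euclidean_space"
  assumes bm: "brownian_motion N x W" and \<nu>: "norm \<nu> = 1" and s: "0 < s"
  defines "E \<equiv> \<lambda>a. {\<omega>\<in>space N. \<exists>u. 0 < u \<and> u \<le> s \<and> a < \<nu> \<bullet> (W u \<omega> - W 0 \<omega>)}"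
  shows "E a \<in> sets N"
    and "measure N (E a) \<le> measure std_normal {z. a \<le> sqrt (2 * s) * \<bar>z\<bar>}"
    and "0 \<le> a \<Longrightarrow> measure N (E a) = measure std_normal {z. a < sqrt (2 * s) * \<bar>z\<bar>}"
proof -
  interpret N: prob_space N by (rule brownian_motionD(1)[OF bm])
  interpret SN: prob_space std_normal by (rule prob_space_std_normal)
  define G where "G p = {\<omega>\<in>space N. \<exists>k\<in>{1..2^p::nat}. a < \<nu> \<bullet> (W (real k * s / real (2^p)) \<omega> - W 0 \<omega>)}" for p :: nat
  have p2: "0 < (2::nat)^p" for p by simp
  note g = brownian_grid_reflection[OF bm \<nu> s p2, where a=a, folded G_def]
  have Gm: "G p \<in> sets N" for p by (rule g(1)[of 1]) simp
  have EG: "E a = (\<Union>p. G p)"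
  proof (intro set_eqI iffI)
    fix \<omega> assume w: "\<omega> \<in> E a"
    have "continuous_on {0..} (\<lambda>u. \<nu> \<bullet> (W u \<omega> - W 0 \<omega>))"
      using w brownian_motionD(4)[OF bm, of \<omega>] by (intro continuous_intros) (auto simp: E_def)
    moreover obtain u where "0 < u" "u \<le> s" "a < \<nu> \<bullet> (W u \<omega> - W 0 \<omega>)" using w by (auto simp: E_def)
    ultimately have "\<exists>p::nat. \<exists>k\<in>{1..2^p::nat}. a < \<nu> \<bullet> (W (real k * s / real (2^p)) \<omega> - W 0 \<omega>)"
      by (intro brownian_sup_as_grid[OF _ s])
    then show "\<omega> \<in> (\<Union>p. G p)" using w by (auto simp: G_def E_def)
  next
    fix \<omega> assume "\<omega> \<in> (\<Union>p. G p)"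
    then obtain p k where w: "\<omega> \<in> space N" "k \<in> {1..2^p::nat}" "a < \<nu> \<bullet> (W (real k * s / real (2^p)) \<omega> - W 0 \<omega>)"
      by (auto simp: G_def)
    have "real k \<le> real (2 ^ p)" using w(2) by (simp only: of_nat_le_iff) simp
    then have "0 < real k * s / real (2^p)" "real k * s / real (2^p) \<le> s"
      using w(2) s by (auto simp: divide_le_eq)
    then show "\<omega> \<in> E a" using w by (auto simp: E_def)
  qed
  show Em: "E a \<in> sets N" unfolding EG using Gm by auto
  have inc: "incseq G"
  proof (rule incseq_SucI)
    fix p
    show "G p \<subseteq> G (Suc p)"
    proof
      fix \<omega> assume "\<omega> \<in> G p"
      then obtain k where w: "\<omega> \<in> space N" "k \<in> {1..2^p::nat}" "a < \<nu> \<bullet> (W (real k * s / real (2^p)) \<omega> - W 0 \<omega>)"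
        by (auto simp: G_def)
      have "real (2 * k) * s / real (2 ^ Suc p) = real k * s / real (2 ^ p)" by simp
      then show "\<omega> \<in> G (Suc p)" unfolding G_def using w by (auto intro!: bexI[of _ "2 * k"])
    qed
  qed
  have lim: "(\<lambda>p. measure N (G p)) \<longlonglongrightarrow> measure N (E a)"
    unfolding EG using Gm inc by (intro N.finite_Lim_measure_incseq) auto
  have up: "measure N (E a) \<le> 2 * measure std_normal {z. a < sqrt (2 * s) * z}"
    using lim g(2)[of 1] by (intro tendsto_upperbound[OF lim]) auto
  note m2 = sets_inequality_real[where c="sqrt (2 * s)"]
  show "measure N (E a) \<le> measure std_normal {z. a \<le> sqrt (2 * s) * \<bar>z\<bar>}"
  proof (cases "0 \<le> a")
    case True
    have "measure N (E a) \<le> measure std_normal {z. a < sqrt (2 * s) * \<bar>z\<bar>}"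
      using up std_normal_two_sided_tail[OF True, of "sqrt (2 * s)"] s by simp
    also have "\<dots> \<le> measure std_normal {z. a \<le> sqrt (2 * s) * \<bar>z\<bar>}"
      using m2 by (intro SN.finite_measure_mono) auto
    finally show ?thesis .
  next
    case False
    then have "{z. a \<le> sqrt (2 * s) * \<bar>z\<bar>} = space std_normal" using s
      by (auto intro: order_trans[of a 0])
    then show ?thesis using SN.prob_space N.prob_le_1 by simp
  qed
  assume a: "0 \<le> a"
  have low: "measure std_normal {z. a < sqrt (2 * s) * z} + measure std_normal {z. a + 2 * \<epsilon> < sqrt (2 * s) * z} \<le> measure N (E a)" if \<epsilon>: "0 < \<epsilon>" for \<epsilon>
  proof (rule LIMSEQ_le)
    show "(\<lambda>p. measure N (G p)) \<longlonglongrightarrow> measure N (E a)" by (rule lim)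
    have "(\<lambda>p. measure std_normal {z. a < sqrt (2 * s) * z} + measure std_normal {z. a + 2 * \<epsilon> < sqrt (2 * s) * z} - 24 * s\<^sup>2 / \<epsilon> ^ 4 * (1 / 2) ^ p)
      \<longlonglongrightarrow> measure std_normal {z. a < sqrt (2 * s) * z} + measure std_normal {z. a + 2 * \<epsilon> < sqrt (2 * s) * z} - 24 * s\<^sup>2 / \<epsilon> ^ 4 * 0"
      by (intro tendsto_intros LIMSEQ_power_zero) auto
    then show "(\<lambda>p. measure std_normal {z. a < sqrt (2 * s) * z} + measure std_normal {z. a + 2 * \<epsilon> < sqrt (2 * s) * z} - 24 * s\<^sup>2 / \<epsilon> ^ 4 * (1 / 2) ^ p)
      \<longlonglongrightarrow> measure std_normal {z. a < sqrt (2 * s) * z} + measure std_normal {z. a + 2 * \<epsilon> < sqrt (2 * s) * z}" by simp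
    show "\<exists>M. \<forall>p\<ge>M. measure std_normal {z. a < sqrt (2 * s) * z} + measure std_normal {z. a + 2 * \<epsilon> < sqrt (2 * s) * z} - 24 * s\<^sup>2 / \<epsilon> ^ 4 * (1 / 2) ^ p \<le> measure N (G p)"
      using g(3)[OF \<epsilon> a] by (auto simp: power_divide mult.commute)
  qed
  have "(\<lambda>m. measure std_normal {z. a + 2 * (1 / real (Suc m)) < sqrt (2 * s) * z}) \<longlonglongrightarrow> measure std_normal (\<Union>m. {z. a + 2 * (1 / real (Suc m)) < sqrt (2 * s) * z})"
  proof (rule SN.finite_Lim_measure_incseq)
    show "range (\<lambda>m. {z. a + 2 * (1 / real (Suc m)) < sqrt (2 * s) * z}) \<subseteq> SN.events" using m2(3) by auto
    show "incseq (\<lambda>m. {z. a + 2 * (1 / real (Suc m)) < sqrt (2 * s) * z})"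
      by (rule incseq_SucI) (auto simp: frac_le elim!: le_less_trans[rotated])
  qed
  also have "(\<Union>m. {z. a + 2 * (1 / real (Suc m)) < sqrt (2 * s) * z}) = {z. a < sqrt (2 * s) * z}"
  proof (intro set_eqI iffI)
    fix z assume "z \<in> {z. a < sqrt (2 * s) * z}"
    then obtain m :: nat where "1 / real (Suc m) < (sqrt (2 * s) * z - a) / 2"
      using nat_approx_posE[of "(sqrt (2 * s) * z - a) / 2"] by auto
    then show "z \<in> (\<Union>m. {z. a + 2 * (1 / real (Suc m)) < sqrt (2 * s) * z})" by (intro UN_I[of m]) (auto simp del: of_nat_Suc)
  next
    fix z assume "z \<in> (\<Union>m. {z. a + 2 * (1 / real (Suc m)) < sqrt (2 * s) * z})"
    then obtain m where "a + 2 * (1 / real (Suc m)) < sqrt (2 * s) * z" by blast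
    moreover have "0 < 1 / real (Suc m)" by simp
    ultimately have "a < sqrt (2 * s) * z" by linarith
    then show "z \<in> {z. a < sqrt (2 * s) * z}" by simp
  qed
  finally have "(\<lambda>m. measure std_normal {z. a < sqrt (2 * s) * z} + measure std_normal {z. a + 2 * (1 / real (Suc m)) < sqrt (2 * s) * z})
    \<longlonglongrightarrow> measure std_normal {z. a < sqrt (2 * s) * z} + measure std_normal {z. a < sqrt (2 * s) * z}"
    by (intro tendsto_intros)
  then have "measure std_normal {z. a < sqrt (2 * s) * z} + measure std_normal {z. a < sqrt (2 * s) * z} \<le> measure N (E a)"
  proof (rule LIMSEQ_le_const2)
    show "\<exists>M. \<forall>m\<ge>M. measure std_normal {z. a < sqrt (2 * s) * z} + measure std_normal {z. a + 2 * (1 / real (Suc m)) < sqrt (2 * s) * z} \<le> measure N (E a)"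
      by (intro exI allI impI low) simp
  qed
  then show "measure N (E a) = measure std_normal {z. a < sqrt (2 * s) * \<bar>z\<bar>}"
    using up std_normal_two_sided_tail[OF a, of "sqrt (2 * s)"] s by simp
qed

section \<open>Half-space comparison near the boundary\<close>

text \<open>
  Within distance \<open>R\<close> of each boundary point the boundary is enclosed between two paraboloids,
  with opposite curvature, that touch there; \<open>\<nu>\<close> is the inner normal.
\<close>
definition tangent_parabolas :: "'a::real_inner set \<Rightarrow> real \<Rightarrow> real \<Rightarrow> bool" where
  "tangent_parabolas \<Omega> R \<Lambda> \<longleftrightarrow> (\<forall>z\<in>frontier \<Omega>. \<exists>\<nu>. norm \<nu> = 1 \<and> (\<forall>y\<in>ball z R.
     (\<Lambda> * (norm (y - z))\<^sup>2 < (y - z) \<bullet> \<nu> \<longrightarrow> y \<in> \<Omega>) \<and> ((y - z) \<bullet> \<nu> < - \<Lambda> * (norm (y - z))\<^sup>2 \<longrightarrow> y \<notin> \<Omega>)))"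

lemma graph_charts_tangent_parabolas:
  fixes \<Omega> :: "'a::euclidean_space set"
  assumes "\<Lambda> > 0" and charts: "\<And>z. z \<in> frontier \<Omega> \<Longrightarrow> \<exists>\<nu> \<phi>. graph_chart \<Omega> R \<Lambda> z \<nu> \<phi>"
  shows "tangent_parabolas \<Omega> R \<Lambda>"
  unfolding tangent_parabolas_def
proof
  fix z assume "z \<in> frontier \<Omega>"
  then obtain \<nu> \<phi> where ch: "graph_chart \<Omega> R \<Lambda> z \<nu> \<phi>" using charts by blast
  have \<nu>: "norm \<nu> = 1" and \<phi>0: "\<phi> 0 = 0" and lip: "\<And>D y y'. y \<bullet> \<nu> = 0 \<Longrightarrow> y' \<bullet> \<nu> = 0 \<Longrightarrow> norm y \<le> D \<Longrightarrow> norm y' \<le> D \<Longrightarrow> \<bar>\<phi> y - \<phi> y'\<bar> \<le> \<Lambda> * D * norm (y - y')"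
    and mem: "\<And>y. y \<in> ball z R \<Longrightarrow> y \<in> \<Omega> \<longleftrightarrow> \<phi> (tangential \<nu> (y - z)) < (y - z) \<bullet> \<nu>"
    using ch unfolding graph_chart_def by blast+
  have b: "\<bar>\<phi> (tangential \<nu> h)\<bar> \<le> \<Lambda> * (norm h)\<^sup>2" for h
  proof -
    let ?b = "tangential \<nu> h"
    have "\<bar>\<phi> ?b - \<phi> 0\<bar> \<le> \<Lambda> * norm ?b * norm (?b - 0)"
      by (rule lip) (simp_all add: tangential_simps(1)[OF \<nu>])
    also have "\<dots> = \<Lambda> * (norm ?b)\<^sup>2" by (simp add: power2_eq_square)
    also have "\<dots> \<le> \<Lambda> * (norm h)\<^sup>2"
      using assms(1) tangential_simps(4)[OF \<nu>, of h] by (intro mult_left_mono power_mono) auto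
    finally show ?thesis by (simp add: \<phi>0)
  qed
  show "\<exists>\<nu>. norm \<nu> = 1 \<and> (\<forall>y\<in>ball z R.
     (\<Lambda> * (norm (y - z))\<^sup>2 < (y - z) \<bullet> \<nu> \<longrightarrow> y \<in> \<Omega>) \<and> ((y - z) \<bullet> \<nu> < - \<Lambda> * (norm (y - z))\<^sup>2 \<longrightarrow> y \<notin> \<Omega>))"
  proof (intro exI[of _ \<nu>] conjI ballI impI)
    fix y assume y: "y \<in> ball z R"
    { assume "\<Lambda> * (norm (y - z))\<^sup>2 < (y - z) \<bullet> \<nu>"
      then show "y \<in> \<Omega>" using mem[OF y] b[of "y - z"] by linarith }
    { assume "(y - z) \<bullet> \<nu> < - \<Lambda> * (norm (y - z))\<^sup>2"
      then have "(y - z) \<bullet> \<nu> < \<phi> (tangential \<nu> (y - z))" using b[of "y - z"] by (simp add: abs_le_iff)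
      then show "y \<notin> \<Omega>" using mem[OF y] by simp }
  qed (rule \<nu>)
qed

text \<open>
  For a ball of radius \<open>\<rho>\<close> membership is equivalent to the parabolic inequality with constant
  \<open>1 / (2\<rho>)\<close>. In dimension one this is the case of an interval.
\<close>
lemma ball_tangent_parabolas:
  fixes c :: "'a::euclidean_space"
  assumes "\<rho> > 0"
  shows "tangent_parabolas (ball c \<rho>) R (1 / (2 * \<rho>))"
  unfolding tangent_parabolas_def
proof
  fix z assume "z \<in> frontier (ball c \<rho>)"
  then have z: "norm (c - z) = \<rho>" using assms by (simp add: frontier_ball dist_norm)
  define \<nu> where "\<nu> = (1 / \<rho>) *\<^sub>R (c - z)"
  have \<nu>: "norm \<nu> = 1" using z assms by (simp add: \<nu>_def)
  have "y \<in> ball c \<rho> \<longleftrightarrow> 1 / (2 * \<rho>) * (norm (y - z))\<^sup>2 < (y - z) \<bullet> \<nu>" for y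
  proof -
    have "y \<in> ball c \<rho> \<longleftrightarrow> (norm (y - c))\<^sup>2 < \<rho>\<^sup>2"
      using assms power2_less_imp_less[of "norm (y - c)" \<rho>] power_strict_mono[of "norm (y - c)" \<rho> 2]
      by (auto simp: dist_norm norm_minus_commute)
    also have "(norm (y - c))\<^sup>2 = (norm (y - z))\<^sup>2 - 2 * ((y - z) \<bullet> (c - z)) + \<rho>\<^sup>2"
      unfolding z[symmetric] power2_norm_eq_inner by (simp add: inner_diff_left inner_diff_right inner_commute)
    also have "(y - z) \<bullet> (c - z) = \<rho> * ((y - z) \<bullet> \<nu>)" using assms by (simp add: \<nu>_def)
    finally show ?thesis using assms by (simp add: field_simps)
  qed
  note mem = this
  show "\<exists>\<nu>. norm \<nu> = 1 \<and> (\<forall>y\<in>ball z R.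
     (1 / (2 * \<rho>) * (norm (y - z))\<^sup>2 < (y - z) \<bullet> \<nu> \<longrightarrow> y \<in> ball c \<rho>) \<and> ((y - z) \<bullet> \<nu> < - (1 / (2 * \<rho>)) * (norm (y - z))\<^sup>2 \<longrightarrow> y \<notin> ball c \<rho>))"
  proof (intro exI[of _ \<nu>] conjI ballI impI)
    fix y assume "1 / (2 * \<rho>) * (norm (y - z))\<^sup>2 < (y - z) \<bullet> \<nu>"
    then show "y \<in> ball c \<rho>" by (simp only: mem)
  next
    fix y assume y: "(y - z) \<bullet> \<nu> < - (1 / (2 * \<rho>)) * (norm (y - z))\<^sup>2"
    have "0 \<le> 1 / (2 * \<rho>) * (norm (y - z))\<^sup>2" using assms by simp
    then have "\<not> 1 / (2 * \<rho>) * (norm (y - z))\<^sup>2 < (y - z) \<bullet> \<nu>" using y by simp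
    then show "y \<notin> ball c \<rho>" using mem[of y] by blast
  qed (rule \<nu>)
qed

text \<open>
  The open ball about \<open>x\<close> that touches the complement at \<open>z\<close> must have \<open>\<nu>\<close> as its inner normal at
  \<open>z\<close>. Otherwise, with \<open>u\<close> the unit vector from \<open>z\<close> to \<open>x\<close>, a short move from \<open>z\<close> in the direction
  \<open>u - \<nu>\<close> enters the ball, hence \<open>\<Omega>\<close>; but it also goes below the outer paraboloid, that is, out of
  \<open>\<Omega>\<close>.
\<close>
lemma nearest_point_along_normal:
  fixes \<Omega> :: "'a::euclidean_space set"
  assumes R: "0 < R" "0 < \<Lambda>" and \<nu>: "norm \<nu> = 1"
    and outside: "\<And>y. y \<in> ball z R \<Longrightarrow> (y - z) \<bullet> \<nu> < - \<Lambda> * (norm (y - z))\<^sup>2 \<Longrightarrow> y \<notin> \<Omega>"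
    and z: "dist x z = infdist x (- \<Omega>)" and \<delta>: "0 < dist x z"
  shows "x - z = dist x z *\<^sub>R \<nu>"
proof -
  define \<delta> where "\<delta> = dist x z"
  have \<delta>0: "0 < \<delta>" using assms by (simp add: \<delta>_def)
  define u where "u = (1 / \<delta>) *\<^sub>R (x - z)"
  have u: "norm u = 1" using \<delta>0 by (simp add: u_def \<delta>_def dist_norm)
  have xz: "x - z = \<delta> *\<^sub>R u" using \<delta>0 by (simp add: u_def)
  have inside: "y \<in> \<Omega>" if "dist x y < \<delta>" for y
  proof (rule ccontr)
    assume "y \<notin> \<Omega>"
    then have "infdist x (- \<Omega>) \<le> dist x y" by (intro infdist_le) auto
    then show False using that z by (simp add: \<delta>_def)
  qed
  have "u = \<nu>"
  proof (rule ccontr)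
    assume ne: "u \<noteq> \<nu>"
    define m where "m = 1 - u \<bullet> \<nu>"
    define v where "v = u - \<nu>"
    have uu: "u \<bullet> u = 1" "\<nu> \<bullet> \<nu> = 1" using u \<nu> by (simp_all add: dot_square_norm)
    have v: "v \<bullet> u = m" "v \<bullet> \<nu> = - m" "v \<bullet> v = 2 * m"
      by (simp_all add: v_def m_def inner_diff_left inner_diff_right uu inner_commute)
    have m: "0 < m" using ne v(3) by (metis inner_gt_zero_iff v_def eq_iff_diff_eq_0 zero_less_mult_pos zero_less_numeral)
    have nv: "norm v \<le> 2" using norm_triangle_ineq4[of u \<nu>] u \<nu> by (simp add: v_def)
    \<comment> \<open>The step \<open>t\<close> must stay within the ball about \<open>x\<close>, dominate the quadratic term
       \<open>\<Lambda> t\<^sup>2 \<bar>v\<bar>\<^sup>2\<close>, and keep \<open>y\<close> within distance \<open>R\<close>, where \<open>\<bar>v\<bar> \<le> 2\<close>.\<close>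
    define t where "t = min (\<delta> / 2) (min (1 / (4 * \<Lambda>)) (R / 4))"
    have t: "0 < t" "t < \<delta>" "t * (2 * \<Lambda>) < 1" "t * 2 < R"
    proof -
      show "0 < t" "t < \<delta>" using \<delta>0 R by (auto simp: t_def)
      have "t * (2 * \<Lambda>) \<le> 1 / (4 * \<Lambda>) * (2 * \<Lambda>)" using R by (intro mult_right_mono) (auto simp: t_def)
      then show "t * (2 * \<Lambda>) < 1" using R by simp
      have "t \<le> R / 4" unfolding t_def by linarith
      then show "t * 2 < R" using R by simp
    qed
    define y where "y = z + t *\<^sub>R v"
    have "(dist x y)\<^sup>2 = (\<delta> *\<^sub>R u - t *\<^sub>R v) \<bullet> (\<delta> *\<^sub>R u - t *\<^sub>R v)"
      using xz by (simp add: dist_norm power2_norm_eq_inner y_def algebra_simps)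
    also have "\<dots> = \<delta>\<^sup>2 - 2 * t * m * (\<delta> - t)"
      using uu v by (simp add: inner_diff_left inner_diff_right inner_commute power2_eq_square algebra_simps)
    also have "\<dots> < \<delta>\<^sup>2" using t m by simp
    finally have "dist x y < \<delta>" using \<delta>0 by (simp add: power2_less_imp_less)
    then have "y \<in> \<Omega>" by (rule inside)
    moreover have "y \<notin> \<Omega>"
    proof (rule outside)
      have "t * norm v \<le> t * 2" using t nv by (intro mult_left_mono) auto
      then have "t * norm v < R" using t by linarith
      then show "y \<in> ball z R" using t by (simp add: y_def dist_norm)
      have "(norm (y - z))\<^sup>2 = t\<^sup>2 * (2 * m)" using v(3) by (simp add: y_def power_mult_distrib power2_norm_eq_inner)
      then have q: "- \<Lambda> * (norm (y - z))\<^sup>2 = - ((t * m) * (t * (2 * \<Lambda>)))" by (simp add: power2_eq_square)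
      have "(t * m) * (t * (2 * \<Lambda>)) < (t * m) * 1" using t m by (intro mult_strict_left_mono) auto
      moreover have "(y - z) \<bullet> \<nu> = - (t * m)" using v(2) by (simp add: y_def)
      ultimately show "(y - z) \<bullet> \<nu> < - \<Lambda> * (norm (y - z))\<^sup>2" unfolding q by simp
    qed
    ultimately show False by simp
  qed
  then show ?thesis using xz by (simp add: \<delta>_def)
qed

text \<open>
  A displacement larger than \<open>\<eta>\<close> has a coordinate larger than \<open>\<eta>/d\<close> in absolute value, and
  reflection bounds the maximum of each of the \<open>2d\<close> signed coordinates.
\<close>
lemma brownian_large_displacement:
  fixes W :: "real \<Rightarrow> 'w \<Rightarrow> 'a::euclidean_space"
  assumes bm: "brownian_motion N x W" and s: "0 < s" and \<eta>: "0 < \<eta>"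
  shows "\<exists>F\<in>sets N. {\<omega>\<in>space N. \<exists>u. 0 < u \<and> u \<le> s \<and> \<eta> < norm (W u \<omega> - W 0 \<omega>)} \<subseteq> F \<and> measure N F \<le> 24 * real DIM('a) ^ 5 * s\<^sup>2 / \<eta> ^ 4"
proof -
  interpret N: prob_space N by (rule brownian_motionD(1)[OF bm])
  let ?d = "real DIM('a)"
  have d: "1 \<le> ?d" using DIM_positive[where 'a='a] by linarith
  define E where "E \<nu> = {\<omega>\<in>space N. \<exists>u. 0 < u \<and> u \<le> s \<and> \<eta> / ?d < \<nu> \<bullet> (W u \<omega> - W 0 \<omega>)}" for \<nu>
  have E: "E \<nu> \<in> sets N" "measure N (E \<nu>) \<le> 12 * ?d ^ 4 * s\<^sup>2 / \<eta> ^ 4" if \<nu>: "norm \<nu> = 1" for \<nu>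
  proof -
    show "E \<nu> \<in> sets N" unfolding E_def by (rule brownian_reflection(1)[OF bm \<nu> s])
    have pos: "0 < \<eta> / ?d" using \<eta> d by simp
    have "measure N (E \<nu>) = measure std_normal {z. \<eta> / ?d < sqrt (2 * s) * \<bar>z\<bar>}"
      unfolding E_def by (rule brownian_reflection(3)[OF bm \<nu> s]) (use pos in simp)
    also have "\<dots> \<le> 3 * sqrt (2 * s) ^ 4 / (\<eta> / ?d) ^ 4"
      using s by (intro std_normal_fourth_moment_tail pos) auto
    also have "\<dots> = 12 * ?d ^ 4 * s\<^sup>2 / \<eta> ^ 4" using s by (simp add: sqrt_pow4 power_divide power_mult_distrib)
    finally show "measure N (E \<nu>) \<le> 12 * ?d ^ 4 * s\<^sup>2 / \<eta> ^ 4" .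
  qed
  let ?F = "\<Union>b\<in>Basis. E b \<union> E (- b)"
  show ?thesis
  proof (intro bexI conjI)
    show "{\<omega>\<in>space N. \<exists>u. 0 < u \<and> u \<le> s \<and> \<eta> < norm (W u \<omega> - W 0 \<omega>)} \<subseteq> ?F"
    proof
      fix \<omega> assume "\<omega> \<in> {\<omega>\<in>space N. \<exists>u. 0 < u \<and> u \<le> s \<and> \<eta> < norm (W u \<omega> - W 0 \<omega>)}"
      then obtain u where u: "\<omega> \<in> space N" "0 < u" "u \<le> s" "\<eta> < norm (W u \<omega> - W 0 \<omega>)" by blast
      let ?h = "W u \<omega> - W 0 \<omega>"
      have "\<exists>b\<in>Basis. \<eta> / ?d < \<bar>?h \<bullet> b\<bar>"
      proof (rule ccontr)
        assume "\<not> (\<exists>b\<in>Basis. \<eta> / ?d < \<bar>?h \<bullet> b\<bar>)"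
        then have "(\<Sum>b\<in>Basis. \<bar>?h \<bullet> b\<bar>) \<le> (\<Sum>b\<in>(Basis::'a set). \<eta> / ?d)" by (intro sum_mono) (auto simp: not_less)
        also have "\<dots> = \<eta>" using d by simp
        finally show False using norm_le_l1[of ?h] u(4) by linarith
      qed
      then obtain b where b: "b \<in> Basis" "\<eta> / ?d < \<bar>?h \<bullet> b\<bar>" by blast
      have "\<eta> / ?d < b \<bullet> ?h \<or> \<eta> / ?d < (- b) \<bullet> ?h"
        using b(2) by (simp add: inner_commute[of b] abs_if split: if_splits)
      then have "\<omega> \<in> E b \<union> E (- b)" unfolding E_def using u by blast
      then show "\<omega> \<in> ?F" using b(1) by blast
    qed
    show "?F \<in> sets N" using E(1) by (intro sets.finite_UN sets.Un) auto
    have "measure N ?F \<le> (\<Sum>b\<in>Basis. measure N (E b \<union> E (- b)))"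
      using E(1) by (intro N.finite_measure_subadditive_finite) auto
    also have "\<dots> \<le> (\<Sum>b\<in>(Basis::'a set). 24 * ?d ^ 4 * s\<^sup>2 / \<eta> ^ 4)"
    proof (intro sum_mono)
      fix b :: 'a assume "b \<in> Basis"
      then have "norm b = 1" "norm (- b) = 1" by auto
      then have "measure N (E b \<union> E (- b)) \<le> 12 * ?d ^ 4 * s\<^sup>2 / \<eta> ^ 4 + 12 * ?d ^ 4 * s\<^sup>2 / \<eta> ^ 4"
        using E by (intro order_trans[OF measure_Un_le] add_mono) auto
      also have "12 * ?d ^ 4 * s\<^sup>2 / \<eta> ^ 4 + 12 * ?d ^ 4 * s\<^sup>2 / \<eta> ^ 4 = 24 * ?d ^ 4 * s\<^sup>2 / \<eta> ^ 4" by simp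
      finally show "measure N (E b \<union> E (- b)) \<le> 24 * ?d ^ 4 * s\<^sup>2 / \<eta> ^ 4" .
    qed
    also have "\<dots> = 24 * ?d ^ 5 * s\<^sup>2 / \<eta> ^ 4" by (simp add: eval_nat_numeral)
    finally show "measure N ?F \<le> 24 * ?d ^ 5 * s\<^sup>2 / \<eta> ^ 4" .
  qed
qed

text \<open>
  By \<open>\<bar>\<delta> \<nu> + h\<bar>\<^sup>2 \<le> 2\<delta>\<^sup>2 + 2\<bar>h\<bar>\<^sup>2\<close> the curvature changes the half-space criterion \<open>- \<nu> \<bullet> h < \<delta>\<close> by
  at most \<open>\<epsilon>\<delta> + e\<close>.
\<close>
lemma parabolic_position:
  fixes h :: "'a::euclidean_space"
  assumes \<Lambda>: "0 < \<Lambda>" and par: "\<And>y. y \<in> ball z R \<Longrightarrow> (\<Lambda> * (norm (y - z))\<^sup>2 < (y - z) \<bullet> \<nu> \<longrightarrow> y \<in> \<Omega>) \<and> ((y - z) \<bullet> \<nu> < - \<Lambda> * (norm (y - z))\<^sup>2 \<longrightarrow> y \<notin> \<Omega>)"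
    and \<nu>: "norm \<nu> = 1" and x: "x - z = \<delta> *\<^sub>R \<nu>" "0 < \<delta>" "2 * \<Lambda> * \<delta> \<le> \<epsilon>" "\<delta> + norm h < R"
    and h: "2 * \<Lambda> * (norm h)\<^sup>2 \<le> e"
  shows "(- \<nu>) \<bullet> h < (1 - \<epsilon>) * \<delta> - e \<Longrightarrow> x + h \<in> \<Omega>" "(1 + \<epsilon>) * \<delta> + e < (- \<nu>) \<bullet> h \<Longrightarrow> x + h \<notin> \<Omega>"
proof -
  have yz: "x + h - z = \<delta> *\<^sub>R \<nu> + h" using x(1) by (simp add: algebra_simps)
  have n1: "\<nu> \<bullet> \<nu> = 1" using \<nu> by (simp add: dot_square_norm)
  have nle: "norm (x + h - z) \<le> \<delta> + norm h" unfolding yz using norm_triangle_ineq[of "\<delta> *\<^sub>R \<nu>" h] \<nu> x(2) by simp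
  then have ball: "x + h \<in> ball z R" using x(4) by (simp add: dist_norm norm_minus_commute)
  have "(norm (x + h - z))\<^sup>2 \<le> (\<delta> + norm h)\<^sup>2" using nle by (intro power_mono) auto
  also have "\<dots> \<le> 2 * \<delta>\<^sup>2 + 2 * (norm h)\<^sup>2" using sum_squares_bound[of \<delta> "norm h"] by (simp add: power2_sum)
  finally have "\<Lambda> * (norm (x + h - z))\<^sup>2 \<le> \<Lambda> * (2 * \<delta>\<^sup>2 + 2 * (norm h)\<^sup>2)" using \<Lambda> by (intro mult_left_mono) auto
  also have "\<dots> = (2 * \<Lambda> * \<delta>) * \<delta> + 2 * \<Lambda> * (norm h)\<^sup>2" by (simp add: power2_eq_square algebra_simps)
  also have "\<dots> \<le> \<epsilon> * \<delta> + e" using x h by (intro add_mono mult_right_mono) auto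
  finally have q: "\<Lambda> * (norm (x + h - z))\<^sup>2 \<le> \<epsilon> * \<delta> + e" .
  have i: "(x + h - z) \<bullet> \<nu> = \<delta> + \<nu> \<bullet> h" unfolding yz by (simp add: inner_add_left n1 inner_commute[of h])
  { assume "(- \<nu>) \<bullet> h < (1 - \<epsilon>) * \<delta> - e"
    then have "\<Lambda> * (norm (x + h - z))\<^sup>2 < (x + h - z) \<bullet> \<nu>" unfolding i using q by (simp add: algebra_simps)
    then show "x + h \<in> \<Omega>" using par[OF ball] by blast }
  { assume "(1 + \<epsilon>) * \<delta> + e < (- \<nu>) \<bullet> h"
    then have "(x + h - z) \<bullet> \<nu> < - \<Lambda> * (norm (x + h - z))\<^sup>2" unfolding i using q by (simp add: algebra_simps)
    then show "x + h \<notin> \<Omega>" using par[OF ball] by blast }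
qed

section \<open>Integration over the boundary layer\<close>

lemma integral_level_sets_swap:
  fixes \<Omega> :: "'a::euclidean_space set"
  assumes \<Omega>[measurable]: "\<Omega> \<in> sets borel" and bdd: "bounded \<Omega>"
    and P[measurable]: "Measurable.pred (borel \<Otimes>\<^sub>M borel) (\<lambda>(x, z). P x z)"
  shows "(LINT x:\<Omega>|lborel. measure std_normal {z. P x z}) = (\<integral>z. measure lborel {x\<in>\<Omega>. P x z} \<partial>std_normal)"
    and "integrable std_normal (\<lambda>z. measure lborel {x\<in>\<Omega>. P x z})"
    and "set_integrable lborel \<Omega> (\<lambda>x. measure std_normal {z. P x z})"
proof -
  interpret G: prob_space std_normal by (rule prob_space_std_normal)
  interpret pair_sigma_finite "lborel :: 'a measure" std_normal ..
  have P': "Measurable.pred (lborel \<Otimes>\<^sub>M std_normal) (\<lambda>(x, z). P x z)"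
    by measurable
  define S where "S = {p \<in> space (lborel \<Otimes>\<^sub>M std_normal). fst p \<in> \<Omega> \<and> P (fst p) (snd p)}"
  have S[measurable]: "S \<in> sets (lborel \<Otimes>\<^sub>M std_normal)"
    unfolding S_def using P' by measurable
  have "emeasure (lborel \<Otimes>\<^sub>M std_normal) S \<le> emeasure (lborel \<Otimes>\<^sub>M std_normal) (\<Omega> \<times> UNIV)"
    by (intro emeasure_mono) (auto simp: S_def)
  also have "\<dots> = emeasure lborel \<Omega> * emeasure std_normal UNIV"
    by (rule G.emeasure_pair_measure_Times) auto
  also have "\<dots> < \<infinity>" using emeasure_bounded_finite[OF bdd] G.emeasure_space_1 by simp
  finally have fin: "emeasure (lborel \<Otimes>\<^sub>M std_normal) S < \<infinity>" .
  have int: "integrable (lborel \<Otimes>\<^sub>M std_normal) (\<lambda>(x, z). indicator S (x, z) :: real)"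
    using fin S by (simp add: integrable_indicator_iff)
  have 1: "(\<integral>z. indicator S (x, z) \<partial>std_normal) = indicator \<Omega> x * measure std_normal {z. P x z}" for x
  proof -
    have "(\<lambda>z. indicator S (x, z) :: real) = (\<lambda>z. indicator \<Omega> x * indicator {z. P x z} z)"
      by (auto simp: S_def space_pair_measure indicator_def)
    moreover have "{z. P x z} \<in> sets borel"
    proof -
      have "{z \<in> space borel. P x z} \<in> sets borel" by measurable
      then show ?thesis by simp
    qed
    ultimately show ?thesis by simp
  qed
  have 2: "(\<integral>x. indicator S (x, z) \<partial>lborel) = measure lborel {x\<in>\<Omega>. P x z}" for z
  proof -
    have "(\<lambda>x. indicator S (x, z) :: real) = indicator {x\<in>\<Omega>. P x z}"
      by (auto simp: S_def space_pair_measure indicator_def)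
    moreover have "{x\<in>\<Omega>. P x z} \<in> sets borel"
    proof -
      have "{x \<in> space borel. x \<in> \<Omega> \<and> P x z} \<in> sets borel" by measurable
      then show ?thesis by simp
    qed
    ultimately show ?thesis by simp
  qed
  define F where "F x z = (indicator S (x, z) :: real)" for x z
  have int: "integrable (lborel \<Otimes>\<^sub>M std_normal) (case_prod F)" using int by (simp add: F_def[abs_def])
  note 1 = 1[folded F_def] and 2 = 2[folded F_def]
  show "(LINT x:\<Omega>|lborel. measure std_normal {z. P x z}) = (\<integral>z. measure lborel {x\<in>\<Omega>. P x z} \<partial>std_normal)"
    using Fubini_integral[OF int] by (simp add: 1 2 set_lebesgue_integral_def)
  show "integrable std_normal (\<lambda>z. measure lborel {x\<in>\<Omega>. P x z})"
    using integrable_snd[OF int] by (simp add: 2)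
  show "set_integrable lborel \<Omega> (\<lambda>x. measure std_normal {z. P x z})"
    using integrable_fst[OF int] by (simp add: 1 set_integrable_def)
qed

text \<open>
  The asymptotics of the volume of the tube turned into bounds for all real \<open>r\<close>, as needed to
  integrate over a random width. The quadratic term absorbs widths beyond \<open>r0\<close>, where the
  asymptotics give nothing.
\<close>
lemma inner_content_bounds:
  fixes \<Omega> :: "'a::euclidean_space set"
  assumes \<Omega>: "open \<Omega>" "bounded \<Omega>" "- \<Omega> \<noteq> {}"
    and L: "((\<lambda>r. measure lborel (inner_tube \<Omega> r) / r) \<longlongrightarrow> L) (at_right 0)" and \<epsilon>: "0 < \<epsilon>"
  shows "\<exists>C\<ge>0. \<forall>r. measure lborel {x\<in>\<Omega>. infdist x (- \<Omega>) \<le> r} \<le> (L + \<epsilon>) * max 0 r + C * r\<^sup>2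
     \<and> (L - \<epsilon>) * max 0 r - C * r\<^sup>2 \<le> measure lborel {x\<in>\<Omega>. infdist x (- \<Omega>) < r}"
proof -
  let ?a = "\<lambda>r. measure lborel (inner_tube \<Omega> r)"
  let ?b = "\<lambda>r. measure lborel {x\<in>\<Omega>. infdist x (- \<Omega>) \<le> r}"
  have aeq: "{x\<in>\<Omega>. infdist x (- \<Omega>) < r} = inner_tube \<Omega> r" for r by (simp add: inner_tube_def)
  have pos: "infdist x (- \<Omega>) > 0" if "x \<in> \<Omega>" for x
    using \<Omega> infdist_pos_not_in_closed[of "- \<Omega>" x] that by auto
  have bm: "{x\<in>\<Omega>. infdist x (- \<Omega>) \<le> r} \<in> sets lborel" for r
  proof -
    have "closed {x. infdist x (- \<Omega>) \<le> r}" by (intro closed_Collect_le continuous_intros)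
    then show ?thesis using \<Omega> by (simp add: Collect_conj_eq)
  qed
  have am: "inner_tube \<Omega> r \<in> sets lborel" for r using open_inner_tube[OF \<Omega>(1)] by simp
  have fin: "\<Omega> \<in> fmeasurable lborel" using \<Omega> emeasure_bounded_finite[OF \<Omega>(2)] by (intro fmeasurableI) auto
  have b\<Omega>: "?b r \<le> measure lborel \<Omega>" for r using bm fin by (intro measure_mono_fmeasurable) auto
  have "eventually (\<lambda>r. ?a r / r < L + \<epsilon>) (at_right 0)" using L \<epsilon> by (intro order_tendstoD) auto
  moreover have "eventually (\<lambda>r. L - \<epsilon> < ?a r / r) (at_right 0)" using L \<epsilon> by (intro order_tendstoD) auto
  ultimately have "eventually (\<lambda>r. ?a r / r < L + \<epsilon> \<and> L - \<epsilon> < ?a r / r) (at_right 0)" by eventually_elim auto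
  then obtain r0 where r0: "r0 > 0" "\<And>r. 0 < r \<Longrightarrow> r < r0 \<Longrightarrow> ?a r / r < L + \<epsilon> \<and> L - \<epsilon> < ?a r / r"
    by (auto simp: eventually_at_right_field)
  have a1: "?a r \<le> (L + \<epsilon>) * r" "(L - \<epsilon>) * r \<le> ?a r" if "0 < r" "r < r0" for r
    using r0(2)[OF that] that by (auto simp: field_simps)
  have L0: "0 \<le> L"
  proof (rule tendsto_lowerbound[OF L])
    have "eventually (\<lambda>r::real. 0 < r) (at_right 0)" by (rule eventually_at_right_less)
    then show "eventually (\<lambda>r. 0 \<le> ?a r / r) (at_right 0)" by eventually_elim simp
  qed simp
  define C where "C = measure lborel \<Omega> / r0\<^sup>2 + L / r0"
  have C0: "0 \<le> C" using L0 r0(1) by (simp add: C_def)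
  have Cb: "measure lborel \<Omega> \<le> C * r\<^sup>2" "L * r \<le> C * r\<^sup>2" if "r0 \<le> r" for r
  proof -
    have "measure lborel \<Omega> = measure lborel \<Omega> / r0\<^sup>2 * r0\<^sup>2" using r0(1) by simp
    also have "\<dots> \<le> C * r\<^sup>2" using that r0(1) L0 by (intro mult_mono power_mono) (auto simp: C_def)
    finally show "measure lborel \<Omega> \<le> C * r\<^sup>2" .
    have "L * r = (L / r0) * (r0 * r)" using r0(1) by simp
    also have "\<dots> \<le> C * (r * r)" using that r0(1) L0 by (intro mult_mono) (auto simp: C_def)
    finally show "L * r \<le> C * r\<^sup>2" by (simp add: power2_eq_square)
  qed
  have "?b r \<le> (L + \<epsilon>) * max 0 r + C * r\<^sup>2 \<and> (L - \<epsilon>) * max 0 r - C * r\<^sup>2 \<le> ?a r" for r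
  proof (cases "r \<le> 0")
    case True
    then have "{x\<in>\<Omega>. infdist x (- \<Omega>) \<le> r} = {}" using pos by fastforce
    then have "?b r = 0" by (simp only: measure_empty)
    moreover have "- (C * r\<^sup>2) \<le> ?a r" by (rule order_trans[of _ 0]) (use C0 in auto)
    moreover have "0 \<le> C * r\<^sup>2" using C0 by simp
    ultimately show ?thesis using True by (simp add: max_absorb1)
  next
    case False
    show ?thesis
    proof (cases "r < r0")
      case True
      have "?b r \<le> (L + \<epsilon>) * r"
      \<comment> \<open>The closed tube of width \<open>r\<close> is contained in the open tube of each slightly larger
         width.\<close>
      proof (rule dense_ge)
        fix y assume y: "(L + \<epsilon>) * r < y"
        have Le: "0 < L + \<epsilon>" using L0 \<epsilon> by simp
        define r' where "r' = min (y / (L + \<epsilon>)) ((r + r0) / 2)"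
        have "r < y / (L + \<epsilon>)" using y Le by (simp add: field_simps)
        then have "r < r'" using True by (simp add: r'_def)
        moreover have "r' \<le> (r + r0) / 2" unfolding r'_def by (rule min.cobounded2)
        moreover have "(r + r0) / 2 < r0" using True by (simp add: field_simps)
        ultimately have "r < r'" "r' < r0" by auto
        moreover have "r' \<le> y / (L + \<epsilon>)" unfolding r'_def by (rule min.cobounded1)
        ultimately have r': "r < r'" "r' < r0" "r' \<le> y / (L + \<epsilon>)" by auto
        have "?b r \<le> ?a r'" using r' bm am \<Omega> fin
          by (intro measure_mono_fmeasurable) (auto simp: inner_tube_def intro: fmeasurableI2[OF fin])
        also have "\<dots> \<le> (L + \<epsilon>) * r'" using a1(1)[of r'] r' False by simp
        also have "\<dots> \<le> y" using r'(3) Le by (simp add: field_simps)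
        finally show "?b r \<le> y" .
      qed
      moreover have "(L - \<epsilon>) * r \<le> ?a r" using a1(2)[of r] True False by simp
      moreover have "0 \<le> C * r\<^sup>2" using C0 by simp
      ultimately show ?thesis using False by simp
    next
      case b: False
      have "0 \<le> (L + \<epsilon>) * r" using L0 \<epsilon> False by simp
      moreover have "0 \<le> \<epsilon> * r" using \<epsilon> False by simp
      ultimately have "(L - \<epsilon>) * r - C * r\<^sup>2 \<le> 0" using Cb(2)[of r] b by (simp add: left_diff_distrib)
      then have "(L - \<epsilon>) * r - C * r\<^sup>2 \<le> ?a r" by (rule order_trans) simp
      then show ?thesis using b\<Omega>[of r] Cb(1)[of r] b False \<open>0 \<le> (L + \<epsilon>) * r\<close> by simp
    qed
  qed
  then show ?thesis using C0 unfolding aeq by blast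
qed

text \<open>
  Up to relative errors \<open>\<epsilon>\<close> in the distance, errors of order \<open>\<epsilon> \<surd>s\<close> in the width of the layer and
  an error of order \<open>s\<close>, \<open>p s x\<close> is the probability that \<open>\<surd>s Y\<close> exceeds the distance of \<open>x\<close> from
  the complement, uniformly in \<open>x\<close>. The factor \<open>2\<close> in the upper bound leaves room to pass from a
  non-strict to a strict inequality.
\<close>
definition boundary_layer_profile :: "'a::metric_space set \<Rightarrow> (real \<Rightarrow> 'a \<Rightarrow> real) \<Rightarrow> (real \<Rightarrow> real) \<Rightarrow> bool" where
  "boundary_layer_profile \<Omega> p Y \<longleftrightarrow> (\<forall>\<epsilon>. 0 < \<epsilon> \<longrightarrow> \<epsilon> < 1 \<longrightarrow> (\<exists>K\<ge>0. \<exists>s0>0. \<forall>s x. 0 < s \<and> s < s0 \<and> x \<in> \<Omega> \<longrightarrow>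
     p s x \<le> measure std_normal {z. (1 - \<epsilon>) * infdist x (- \<Omega>) - 2 * \<epsilon> * sqrt s \<le> sqrt s * Y z} + K * s \<and>
     measure std_normal {z. (1 + \<epsilon>) * infdist x (- \<Omega>) + \<epsilon> * sqrt s < sqrt s * Y z} - K * s \<le> p s x))"

lemma boundary_layer_profile_cong:
  assumes "\<And>s x. 0 < s \<Longrightarrow> p s x = q s x"
  shows "boundary_layer_profile \<Omega> p Y \<longleftrightarrow> boundary_layer_profile \<Omega> q Y"
  unfolding boundary_layer_profile_def by (simp add: assms cong: conj_cong)

text \<open>
  Exchange the integrals over \<open>x\<close> and \<open>z\<close>. For fixed \<open>z\<close> the points \<open>x\<close> that count form a tube of
  width about \<open>\<surd>s Y z\<close>, with volume about \<open>L \<surd>s max 0 (Y z)\<close>; the quadratic corrections are of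
  order \<open>s\<close> because \<open>Y\<close> is square integrable.
\<close>
lemma boundary_layer_integral_tendsto:
  fixes \<Omega> :: "'a::euclidean_space set" and p :: "real \<Rightarrow> 'a \<Rightarrow> real" and Y :: "real \<Rightarrow> real"
  assumes \<Omega>: "open \<Omega>" "bounded \<Omega>" "- \<Omega> \<noteq> {}"
    and L: "((\<lambda>r. measure lborel (inner_tube \<Omega> r) / r) \<longlongrightarrow> L) (at_right 0)"
    and Y[measurable]: "Y \<in> borel_measurable borel" and Y2: "integrable std_normal (\<lambda>z. (Y z)\<^sup>2)"
    and m: "(\<integral>z. max 0 (Y z) \<partial>std_normal) = m"
    and p: "\<And>s. 0 < s \<Longrightarrow> set_integrable lborel \<Omega> (p s)"
    and b: "boundary_layer_profile \<Omega> p Y"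
  shows "((\<lambda>s. (LINT x:\<Omega>|lborel. p s x) / sqrt s) \<longlongrightarrow> L * m) (at_right 0)"
proof -
  interpret G: prob_space std_normal by (rule prob_space_std_normal)
  let ?d = "\<lambda>x. infdist x (- \<Omega>)"
  have dm[measurable]: "(\<lambda>x. infdist x (- \<Omega>)) \<in> borel_measurable borel"
    by (intro borel_measurable_continuous_onI continuous_intros)
  have \<Omega>m[measurable]: "\<Omega> \<in> sets borel" using \<Omega> by simp
  have fin: "\<Omega> \<in> fmeasurable lborel" using \<Omega> emeasure_bounded_finite[OF \<Omega>(2)] by (intro fmeasurableI) auto
  let ?V = "measure lborel \<Omega>"
  have iY: "integrable std_normal (\<lambda>z. max 0 (Y z))"
  proof (rule Bochner_Integration.integrable_bound)
    show "integrable std_normal (\<lambda>z. 1 + (Y z)\<^sup>2)" using Y2 by simp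
    show "AE z in std_normal. norm (max 0 (Y z)) \<le> norm (1 + (Y z)\<^sup>2)"
    proof (intro AE_I2)
      fix z
      have "0 \<le> (Y z - 1)\<^sup>2" by simp
      then have "2 * Y z \<le> 1 + (Y z)\<^sup>2" by (simp add: power2_diff)
      moreover have "0 \<le> (Y z)\<^sup>2" by simp
      ultimately show "norm (max 0 (Y z)) \<le> norm (1 + (Y z)\<^sup>2)" by (auto simp: max_def)
    qed
  qed measurable
  define q where "q = (\<integral>z. (Y z)\<^sup>2 \<partial>std_normal)"
  have m0: "0 \<le> m" unfolding m[symmetric] by (rule integral_nonneg_AE) auto
  have constint: "set_integrable lborel \<Omega> (\<lambda>x. c)" for c :: real
    using fin by (simp add: set_integrable_def fmeasurable_def)
  have constval: "(LINT x:\<Omega>|lborel. c) = c * ?V" for c :: real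
    by (simp add: set_lebesgue_integral_def)
  have L0: "0 \<le> L"
  proof (rule tendsto_lowerbound[OF L])
    have "eventually (\<lambda>r::real. 0 < r) (at_right 0)" by (rule eventually_at_right_less)
    then show "eventually (\<lambda>r. 0 \<le> measure lborel (inner_tube \<Omega> r) / r) (at_right 0)" by eventually_elim simp
  qed simp
  have main: "\<exists>B. \<exists>s0>0. \<forall>s. 0 < s \<and> s < s0 \<longrightarrow>
      (LINT x:\<Omega>|lborel. p s x) / sqrt s \<le> (L + \<epsilon>) * ((m + 2 * \<epsilon>) / (1 - \<epsilon>)) + B * sqrt s \<and>
      L * ((m - \<epsilon>) / (1 + \<epsilon>)) - \<epsilon> * m - B * sqrt s \<le> (LINT x:\<Omega>|lborel. p s x) / sqrt s"
    if \<epsilon>: "0 < \<epsilon>" "\<epsilon> < 1" for \<epsilon>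
  proof -
    obtain K s0 where K: "0 \<le> K" "0 < s0" and up: "\<And>s x. 0 < s \<Longrightarrow> s < s0 \<Longrightarrow> x \<in> \<Omega> \<Longrightarrow>
       p s x \<le> measure std_normal {z. (1 - \<epsilon>) * ?d x - 2 * \<epsilon> * sqrt s \<le> sqrt s * Y z} + K * s"
      and lo: "\<And>s x. 0 < s \<Longrightarrow> s < s0 \<Longrightarrow> x \<in> \<Omega> \<Longrightarrow>
       measure std_normal {z. (1 + \<epsilon>) * ?d x + \<epsilon> * sqrt s < sqrt s * Y z} - K * s \<le> p s x"
      using b[unfolded boundary_layer_profile_def, rule_format, OF \<epsilon>] by blast
    obtain C where C: "0 \<le> C" "\<And>r. measure lborel {x\<in>\<Omega>. ?d x \<le> r} \<le> (L + \<epsilon>) * max 0 r + C * r\<^sup>2"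
      "\<And>r. (L - \<epsilon>) * max 0 r - C * r\<^sup>2 \<le> measure lborel {x\<in>\<Omega>. ?d x < r}"
      using inner_content_bounds[OF \<Omega> L \<epsilon>(1)] by blast
    \<comment> \<open>\<open>B\<close> collects everything of order \<open>s\<close>: the quadratic terms of the upper and of the
       lower bound on the tube, and \<open>K s\<close> integrated over \<open>\<Omega>\<close>.\<close>
    define B where "B = C * (2 * q + 8) / (1 - \<epsilon>)\<^sup>2 + C * (2 * q + 2) + K * ?V"
    have "(LINT x:\<Omega>|lborel. p s x) / sqrt s \<le> (L + \<epsilon>) * ((m + 2 * \<epsilon>) / (1 - \<epsilon>)) + B * sqrt s \<and>
      L * ((m - \<epsilon>) / (1 + \<epsilon>)) - \<epsilon> * m - B * sqrt s \<le> (LINT x:\<Omega>|lborel. p s x) / sqrt s" if s: "0 < s" "s < s0" for s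
    proof -
      have sq: "0 < sqrt s" "sqrt s * sqrt s = s" using s by auto
      have q0: "0 \<le> q" unfolding q_def by (rule integral_nonneg_AE) auto
      have U: "(LINT x:\<Omega>|lborel. p s x) \<le> sqrt s * ((L + \<epsilon>) * ((m + 2 * \<epsilon>) / (1 - \<epsilon>))) + (C * (2 * q + 8) / (1 - \<epsilon>)\<^sup>2) * s + K * s * ?V"
      proof -
        let ?P = "\<lambda>x z. (1 - \<epsilon>) * ?d x - 2 * \<epsilon> * sqrt s \<le> sqrt s * Y z"
        have Pm: "Measurable.pred (borel \<Otimes>\<^sub>M borel) (\<lambda>(x, z). ?P x z)" by measurable
        note sw = integral_level_sets_swap[OF \<Omega>m \<Omega>(2) Pm]
        have "(LINT x:\<Omega>|lborel. p s x) \<le> (LINT x:\<Omega>|lborel. measure std_normal {z. ?P x z} + K * s)"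
          by (rule set_integral_mono[OF p[OF s(1)] set_integral_add(1)[OF sw(3) constint]]) (use up s in auto)
        also have "\<dots> = (LINT x:\<Omega>|lborel. measure std_normal {z. ?P x z}) + K * s * ?V"
          using set_integral_add(2)[OF sw(3) constint] by (simp add: constval)
        also have "(LINT x:\<Omega>|lborel. measure std_normal {z. ?P x z}) = (\<integral>z. measure lborel {x\<in>\<Omega>. ?P x z} \<partial>std_normal)" by (rule sw(1))
        also have "\<dots> \<le> (\<integral>z. (L + \<epsilon>) * (sqrt s * (max 0 (Y z) + 2 * \<epsilon>) / (1 - \<epsilon>)) + C * (s * (2 * (Y z)\<^sup>2 + 8) / (1 - \<epsilon>)\<^sup>2) \<partial>std_normal)"
        proof (rule integral_mono[OF sw(2)])
          show "integrable std_normal (\<lambda>z. (L + \<epsilon>) * (sqrt s * (max 0 (Y z) + 2 * \<epsilon>) / (1 - \<epsilon>)) + C * (s * (2 * (Y z)\<^sup>2 + 8) / (1 - \<epsilon>)\<^sup>2))"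
            using iY Y2 by simp
          fix z
          define r where "r = sqrt s * (Y z + 2 * \<epsilon>) / (1 - \<epsilon>)"
          have "?P x z \<longleftrightarrow> ?d x \<le> r" for x using \<epsilon> by (simp add: r_def field_simps)
          then have "measure lborel {x\<in>\<Omega>. ?P x z} \<le> (L + \<epsilon>) * max 0 r + C * r\<^sup>2" using C(2)[of r] by simp
          also have "max 0 r \<le> sqrt s * (max 0 (Y z) + 2 * \<epsilon>) / (1 - \<epsilon>)"
            unfolding r_def using \<epsilon> sq by (intro max.boundedI divide_right_mono mult_left_mono) auto
          also have "r\<^sup>2 \<le> s * (2 * (Y z)\<^sup>2 + 8) / (1 - \<epsilon>)\<^sup>2"
          proof -
            have "0 \<le> (Y z - 2 * \<epsilon>)\<^sup>2" by simp
            then have "(Y z + 2 * \<epsilon>)\<^sup>2 \<le> 2 * (Y z)\<^sup>2 + 8 * \<epsilon>\<^sup>2" by (simp add: power2_eq_square algebra_simps)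
            also have "\<epsilon>\<^sup>2 \<le> 1" using \<epsilon> by (simp add: power_le_one)
            finally have "(Y z + 2 * \<epsilon>)\<^sup>2 \<le> 2 * (Y z)\<^sup>2 + 8" by simp
            then show ?thesis unfolding r_def using s \<epsilon>
              by (simp add: power_divide power_mult_distrib) (intro divide_right_mono mult_left_mono, auto)
          qed
          finally show "measure lborel {x\<in>\<Omega>. ?P x z} \<le> (L + \<epsilon>) * (sqrt s * (max 0 (Y z) + 2 * \<epsilon>) / (1 - \<epsilon>)) + C * (s * (2 * (Y z)\<^sup>2 + 8) / (1 - \<epsilon>)\<^sup>2)"
            using L0 \<epsilon> C(1) by (simp add: mult_left_mono)
        qed
        also have "\<dots> = (L + \<epsilon>) * (sqrt s * (m + 2 * \<epsilon>) / (1 - \<epsilon>)) + C * (s * (2 * q + 8) / (1 - \<epsilon>)\<^sup>2)"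
          using iY Y2 G.prob_space by (simp add: m[symmetric] q_def)
        finally show ?thesis by (simp add: mult_ac)
      qed
      have Lw: "sqrt s * (L * ((m - \<epsilon>) / (1 + \<epsilon>)) - \<epsilon> * m) - (C * (2 * q + 2)) * s - K * s * ?V \<le> (LINT x:\<Omega>|lborel. p s x)"
      proof -
        let ?P = "\<lambda>x z. (1 + \<epsilon>) * ?d x + \<epsilon> * sqrt s < sqrt s * Y z"
        have Pm: "Measurable.pred (borel \<Otimes>\<^sub>M borel) (\<lambda>(x, z). ?P x z)" by measurable
        note sw = integral_level_sets_swap[OF \<Omega>m \<Omega>(2) Pm]
        have "sqrt s * (L * ((m - \<epsilon>) / (1 + \<epsilon>)) - \<epsilon> * m) - (C * (2 * q + 2)) * s
           = (\<integral>z. sqrt s * (L * ((max 0 (Y z) - \<epsilon>) / (1 + \<epsilon>)) - \<epsilon> * max 0 (Y z)) - C * (s * (2 * (Y z)\<^sup>2 + 2)) \<partial>std_normal)"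
          using iY Y2 G.prob_space by (simp add: m[symmetric] q_def)
        also have "\<dots> \<le> (\<integral>z. measure lborel {x\<in>\<Omega>. ?P x z} \<partial>std_normal)"
        proof (rule integral_mono[OF _ sw(2)])
          show "integrable std_normal (\<lambda>z. sqrt s * (L * ((max 0 (Y z) - \<epsilon>) / (1 + \<epsilon>)) - \<epsilon> * max 0 (Y z)) - C * (s * (2 * (Y z)\<^sup>2 + 2)))"
            using iY Y2 by simp
          fix z
          define r where "r = sqrt s * (Y z - \<epsilon>) / (1 + \<epsilon>)"
          have Pr: "?P x z \<longleftrightarrow> ?d x < r" for x using \<epsilon> by (simp add: r_def field_simps)
          have r1: "sqrt s * ((max 0 (Y z) - \<epsilon>) / (1 + \<epsilon>)) \<le> max 0 r"
          proof (cases "0 \<le> Y z")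
            case True then show ?thesis by (simp add: r_def)
          next
            case False
            then have "sqrt s * ((max 0 (Y z) - \<epsilon>) / (1 + \<epsilon>)) \<le> 0" using \<epsilon> sq by (simp add: mult_nonneg_nonpos divide_nonpos_pos)
            then show ?thesis by simp
          qed
          have r2: "max 0 r \<le> sqrt s * max 0 (Y z)"
          proof -
            have "r \<le> sqrt s * max 0 (Y z)"
            proof (cases "Y z \<le> \<epsilon>")
              case True
              then have "r \<le> 0" unfolding r_def using \<epsilon> sq by (simp add: mult_nonneg_nonpos divide_nonpos_pos)
              also have "0 \<le> sqrt s * max 0 (Y z)" using sq by simp
              finally show ?thesis .
            next
              case False
              then have "r \<le> sqrt s * (Y z - \<epsilon>) / 1" unfolding r_def using \<epsilon> sq by (intro divide_left_mono) auto
              also have "\<dots> \<le> sqrt s * max 0 (Y z)" using \<epsilon> sq by simp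
              finally show ?thesis .
            qed
            then show ?thesis using sq by simp
          qed
          have r3: "r\<^sup>2 \<le> s * (2 * (Y z)\<^sup>2 + 2)"
          proof -
            have "0 \<le> (Y z + \<epsilon>)\<^sup>2" by simp
            then have "(Y z - \<epsilon>)\<^sup>2 \<le> 2 * (Y z)\<^sup>2 + 2 * \<epsilon>\<^sup>2" by (simp add: power2_eq_square algebra_simps)
            also have "\<epsilon>\<^sup>2 \<le> 1" using \<epsilon> by (simp add: power_le_one)
            finally have "(Y z - \<epsilon>)\<^sup>2 \<le> 2 * (Y z)\<^sup>2 + 2" by simp
            then have "s * (Y z - \<epsilon>)\<^sup>2 \<le> s * (2 * (Y z)\<^sup>2 + 2)" using s by (intro mult_left_mono) auto
            moreover have "r\<^sup>2 \<le> s * (Y z - \<epsilon>)\<^sup>2"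
            proof -
              have "1 \<le> (1 + \<epsilon>)\<^sup>2" using \<epsilon> by (intro one_le_power) auto
              then have "s * (Y z - \<epsilon>)\<^sup>2 / (1 + \<epsilon>)\<^sup>2 \<le> s * (Y z - \<epsilon>)\<^sup>2 / 1" using s by (intro divide_left_mono) auto
              then show ?thesis using s by (simp add: r_def power_divide power_mult_distrib)
            qed
            ultimately show ?thesis by linarith
          qed
          have "sqrt s * (L * ((max 0 (Y z) - \<epsilon>) / (1 + \<epsilon>)) - \<epsilon> * max 0 (Y z)) - C * (s * (2 * (Y z)\<^sup>2 + 2))
            = L * (sqrt s * ((max 0 (Y z) - \<epsilon>) / (1 + \<epsilon>))) - \<epsilon> * (sqrt s * max 0 (Y z)) - C * (s * (2 * (Y z)\<^sup>2 + 2))"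
            by (simp add: right_diff_distrib mult_ac)
          also have "\<dots> \<le> L * max 0 r - \<epsilon> * max 0 r - C * r\<^sup>2"
            using r1 r2 r3 L0 \<epsilon> C(1) by (intro diff_mono mult_left_mono) auto
          also have "\<dots> \<le> measure lborel {x\<in>\<Omega>. ?P x z}" using C(3)[of r] unfolding Pr by (simp add: left_diff_distrib)
          finally show "sqrt s * (L * ((max 0 (Y z) - \<epsilon>) / (1 + \<epsilon>)) - \<epsilon> * max 0 (Y z)) - C * (s * (2 * (Y z)\<^sup>2 + 2)) \<le> measure lborel {x\<in>\<Omega>. ?P x z}" .
        qed
        also have "\<dots> = (LINT x:\<Omega>|lborel. measure std_normal {z. ?P x z})" by (rule sw(1)[symmetric])
        also have "\<dots> - K * s * ?V = (LINT x:\<Omega>|lborel. measure std_normal {z. ?P x z} - K * s)"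
          using set_integral_diff(2)[OF sw(3) constint] by (simp add: constval)
        also have "\<dots> \<le> (LINT x:\<Omega>|lborel. p s x)"
          by (rule set_integral_mono[OF set_integral_diff(1)[OF sw(3) constint] p[OF s(1)]]) (use lo s in auto)
        finally show ?thesis by simp
      qed
      have B1: "C * (2 * q + 8) / (1 - \<epsilon>)\<^sup>2 + K * ?V \<le> B" "C * (2 * q + 2) + K * ?V \<le> B"
        using C(1) q0 by (auto simp: B_def)
      have "(C * (2 * q + 8) / (1 - \<epsilon>)\<^sup>2 + K * ?V) * s \<le> B * s" "(C * (2 * q + 2) + K * ?V) * s \<le> B * s"
        using B1 s by (auto intro!: mult_right_mono)
      then have "(LINT x:\<Omega>|lborel. p s x) \<le> sqrt s * ((L + \<epsilon>) * ((m + 2 * \<epsilon>) / (1 - \<epsilon>))) + B * s"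
        "sqrt s * (L * ((m - \<epsilon>) / (1 + \<epsilon>)) - \<epsilon> * m) - B * s \<le> (LINT x:\<Omega>|lborel. p s x)"
        using U Lw by (simp_all add: algebra_simps)
      moreover have "B * s = sqrt s * (B * sqrt s)" using sq(2) by (metis mult.left_commute)
      ultimately have "(LINT x:\<Omega>|lborel. p s x) \<le> sqrt s * ((L + \<epsilon>) * ((m + 2 * \<epsilon>) / (1 - \<epsilon>)) + B * sqrt s)"
        "sqrt s * (L * ((m - \<epsilon>) / (1 + \<epsilon>)) - \<epsilon> * m - B * sqrt s) \<le> (LINT x:\<Omega>|lborel. p s x)"
        by (simp_all only: distrib_left right_diff_distrib)
      then show ?thesis using sq(1) by (simp add: pos_divide_le_eq pos_le_divide_eq mult.commute)
    qed
    then show ?thesis using K(2) by blast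
  qed
  show ?thesis
  proof (rule order_tendstoI)
    fix a assume a: "L * m < a"
    have "((\<lambda>\<epsilon>. (L + \<epsilon>) * ((m + 2 * \<epsilon>) / (1 - \<epsilon>))) \<longlongrightarrow> (L + 0) * ((m + 2 * 0) / (1 - 0))) (at_right 0)"
      by (intro tendsto_intros) auto
    then have "eventually (\<lambda>\<epsilon>. (L + \<epsilon>) * ((m + 2 * \<epsilon>) / (1 - \<epsilon>)) < a) (at_right 0)"
      by (rule order_tendstoD) (use a in simp)
    moreover have "eventually (\<lambda>\<epsilon>::real. \<epsilon> < 1) (at_right 0)" by (auto simp: eventually_at_right_field intro!: exI[of _ 1])
    moreover have "eventually (\<lambda>\<epsilon>::real. 0 < \<epsilon>) (at_right 0)" by (rule eventually_at_right_less)
    ultimately have "eventually (\<lambda>\<epsilon>. (L + \<epsilon>) * ((m + 2 * \<epsilon>) / (1 - \<epsilon>)) < a \<and> \<epsilon> < 1 \<and> 0 < \<epsilon>) (at_right 0)" by eventually_elim auto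
    then obtain \<epsilon> where \<epsilon>: "(L + \<epsilon>) * ((m + 2 * \<epsilon>) / (1 - \<epsilon>)) < a" "\<epsilon> < 1" "0 < \<epsilon>"
      using eventually_happens'[of "at_right (0::real)"] by auto
    obtain B s0 where s0: "0 < s0" and bound: "\<And>s. 0 < s \<Longrightarrow> s < s0 \<Longrightarrow> (LINT x:\<Omega>|lborel. p s x) / sqrt s \<le> (L + \<epsilon>) * ((m + 2 * \<epsilon>) / (1 - \<epsilon>)) + B * sqrt s"
      using main[OF \<epsilon>(3,2)] by blast
    have "((\<lambda>s. (L + \<epsilon>) * ((m + 2 * \<epsilon>) / (1 - \<epsilon>)) + B * sqrt s) \<longlongrightarrow> (L + \<epsilon>) * ((m + 2 * \<epsilon>) / (1 - \<epsilon>)) + B * sqrt 0) (at_right 0)"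
      by (intro tendsto_intros)
    then have "eventually (\<lambda>s. (L + \<epsilon>) * ((m + 2 * \<epsilon>) / (1 - \<epsilon>)) + B * sqrt s < a) (at_right 0)"
      by (rule order_tendstoD) (use \<epsilon> in simp)
    moreover have "eventually (\<lambda>s. s < s0) (at_right 0)" using s0 by (auto simp: eventually_at_right_field intro!: exI[of _ s0])
    moreover have "eventually (\<lambda>s::real. 0 < s) (at_right 0)" by (rule eventually_at_right_less)
    ultimately show "eventually (\<lambda>s. (LINT x:\<Omega>|lborel. p s x) / sqrt s < a) (at_right 0)"
      by eventually_elim (use bound le_less_trans in blast)
  next
    fix a assume a: "a < L * m"
    have "((\<lambda>\<epsilon>. L * ((m - \<epsilon>) / (1 + \<epsilon>)) - \<epsilon> * m) \<longlongrightarrow> L * ((m - 0) / (1 + 0)) - 0 * m) (at_right 0)"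
      by (intro tendsto_intros) auto
    then have "eventually (\<lambda>\<epsilon>. a < L * ((m - \<epsilon>) / (1 + \<epsilon>)) - \<epsilon> * m) (at_right 0)"
      by (rule order_tendstoD) (use a in simp)
    moreover have "eventually (\<lambda>\<epsilon>::real. \<epsilon> < 1) (at_right 0)" by (auto simp: eventually_at_right_field intro!: exI[of _ 1])
    moreover have "eventually (\<lambda>\<epsilon>::real. 0 < \<epsilon>) (at_right 0)" by (rule eventually_at_right_less)
    ultimately have "eventually (\<lambda>\<epsilon>. a < L * ((m - \<epsilon>) / (1 + \<epsilon>)) - \<epsilon> * m \<and> \<epsilon> < 1 \<and> 0 < \<epsilon>) (at_right 0)" by eventually_elim auto
    then obtain \<epsilon> where \<epsilon>: "a < L * ((m - \<epsilon>) / (1 + \<epsilon>)) - \<epsilon> * m" "\<epsilon> < 1" "0 < \<epsilon>"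
      using eventually_happens'[of "at_right (0::real)"] by auto
    obtain B s0 where s0: "0 < s0" and bound: "\<And>s. 0 < s \<Longrightarrow> s < s0 \<Longrightarrow> L * ((m - \<epsilon>) / (1 + \<epsilon>)) - \<epsilon> * m - B * sqrt s \<le> (LINT x:\<Omega>|lborel. p s x) / sqrt s"
      using main[OF \<epsilon>(3,2)] by blast
    have "((\<lambda>s. L * ((m - \<epsilon>) / (1 + \<epsilon>)) - \<epsilon> * m - B * sqrt s) \<longlongrightarrow> L * ((m - \<epsilon>) / (1 + \<epsilon>)) - \<epsilon> * m - B * sqrt 0) (at_right 0)"
      by (intro tendsto_intros)
    then have "eventually (\<lambda>s. a < L * ((m - \<epsilon>) / (1 + \<epsilon>)) - \<epsilon> * m - B * sqrt s) (at_right 0)"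
      by (rule order_tendstoD) (use \<epsilon> in simp)
    moreover have "eventually (\<lambda>s. s < s0) (at_right 0)" using s0 by (auto simp: eventually_at_right_field intro!: exI[of _ s0])
    moreover have "eventually (\<lambda>s::real. 0 < s) (at_right 0)" by (rule eventually_at_right_less)
    ultimately show "eventually (\<lambda>s. a < (LINT x:\<Omega>|lborel. p s x) / sqrt s) (at_right 0)"
      by eventually_elim (use bound less_le_trans in blast)
  qed
qed

text \<open>
  If \<open>g u\<close> is within \<open>e \<surd>u\<close> of \<open>c \<surd>u\<close> for \<open>u \<le> d\<close>, then \<open>E[g(U\<^sub>t)]\<close> differs from \<open>c\<close> times the
  mean truncated at \<open>d\<close> by at most \<open>e\<close> times that mean plus \<open>V\<close> times the tail probability. The
  ratio hypothesis also excludes that the truncated means vanish for small \<open>t\<close>, as \<open>0/0 = 0\<close>.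
\<close>
lemma time_change_asymptotics:
  fixes g :: "real \<Rightarrow> real" and U :: "real \<Rightarrow> 'u \<Rightarrow> real"
  assumes U: "time_change M U" and g[measurable]: "g \<in> borel_measurable borel" and bdd: "\<And>u. \<bar>g u\<bar> \<le> V"
    and lim: "((\<lambda>u. g u / sqrt u) \<longlongrightarrow> c) (at_right 0)"
    and tail: "\<And>\<delta>. \<delta> > 0 \<Longrightarrow>
       (\<lambda>t. measure M {\<omega>\<in>space M. U t \<omega> > \<delta>}) \<in> o[at_right 0](truncated_sqrt_mean M U \<delta>)"
    and ratio: "\<And>\<delta>1 \<delta>2. \<delta>1 > 0 \<Longrightarrow> \<delta>2 > 0 \<Longrightarrow>
       ((\<lambda>t. truncated_sqrt_mean M U \<delta>1 t / truncated_sqrt_mean M U \<delta>2 t) \<longlongrightarrow> 1) (at_right 0)"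
    and \<delta>: "\<delta> > 0"
  shows "((\<lambda>t. (\<integral>\<omega>. g (U t \<omega>) \<partial>M) / truncated_sqrt_mean M U \<delta> t) \<longlongrightarrow> c) (at_right 0)"
proof -
  interpret M: prob_space M using U by (simp add: time_change_def)
  have Um: "U t \<in> borel_measurable M" if "0 \<le> t" for t using U that by (simp add: time_change_def)
  have Upos: "0 < U t \<omega>" if "0 < t" "\<omega> \<in> space M" for t \<omega> using U that by (simp add: time_change_def)
  have V0: "0 \<le> V" using bdd[of 0] by linarith
  let ?T = "truncated_sqrt_mean M U"
  have T0: "0 \<le> ?T d t" if "0 < t" for d t
    unfolding truncated_sqrt_mean_def
    by (rule integral_nonneg_AE) (auto simp: indicator_def less_imp_le[OF Upos[OF that]])
  have key: "\<bar>(\<integral>\<omega>. g (U t \<omega>) \<partial>M) - c * ?T d t\<bar> \<le> e * ?T d t + V * measure M {\<omega>\<in>space M. U t \<omega> > d}"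
    if t: "0 < t" and d: "0 < d" and e: "\<And>u. 0 < u \<Longrightarrow> u \<le> d \<Longrightarrow> \<bar>g u - c * sqrt u\<bar> \<le> e * sqrt u" for t d e
  proof -
    have [measurable]: "U t \<in> borel_measurable M" using Um t by simp
    have isq: "integrable M (\<lambda>\<omega>. sqrt (U t \<omega>) * indicator {..d} (U t \<omega>))"
      by (rule M.integrable_const_bound[where B="sqrt d"])
        (auto simp: indicator_def less_imp_le[OF Upos[OF t]] d less_imp_le intro!: AE_I2)
    have ig: "integrable M (\<lambda>\<omega>. g (U t \<omega>))"
      by (rule M.integrable_const_bound[where B=V]) (use bdd in auto)
    have ii: "integrable M (\<lambda>\<omega>. indicator {\<omega>\<in>space M. U t \<omega> > d} \<omega> :: real)" by (simp add: M.emeasure_eq_measure)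
    have "\<bar>(\<integral>\<omega>. g (U t \<omega>) \<partial>M) - c * ?T d t\<bar> = \<bar>\<integral>\<omega>. g (U t \<omega>) - c * (sqrt (U t \<omega>) * indicator {..d} (U t \<omega>)) \<partial>M\<bar>"
      unfolding truncated_sqrt_mean_def using isq ig by simp
    also have "\<dots> \<le> (\<integral>\<omega>. \<bar>g (U t \<omega>) - c * (sqrt (U t \<omega>) * indicator {..d} (U t \<omega>))\<bar> \<partial>M)"
      by (rule integral_abs_bound)
    also have "\<dots> \<le> (\<integral>\<omega>. e * (sqrt (U t \<omega>) * indicator {..d} (U t \<omega>)) + V * indicator {\<omega>\<in>space M. U t \<omega> > d} \<omega> \<partial>M)"
    proof (rule integral_mono)
      fix \<omega> assume w: "\<omega> \<in> space M"
      show "\<bar>g (U t \<omega>) - c * (sqrt (U t \<omega>) * indicator {..d} (U t \<omega>))\<bar> \<le> e * (sqrt (U t \<omega>) * indicator {..d} (U t \<omega>)) + V * indicator {\<omega>\<in>space M. U t \<omega> > d} \<omega>"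
        using e[of "U t \<omega>"] Upos[OF t w] bdd[of "U t \<omega>"] w by (auto simp: indicator_def)
    qed (use isq ig ii in auto)
    also have "\<dots> = e * ?T d t + V * measure M {\<omega>\<in>space M. U t \<omega> > d}"
      unfolding truncated_sqrt_mean_def using isq ii by simp
    finally show ?thesis .
  qed
  have Tne: "eventually (\<lambda>t. 0 < ?T d t) (at_right 0)" if "0 < d" for d
  proof -
    have "eventually (\<lambda>t. 0 < ?T d t / ?T d t) (at_right 0)"
      using ratio[OF that that] by (rule order_tendstoD) simp
    moreover have "eventually (\<lambda>t::real. 0 < t) (at_right 0)" by (rule eventually_at_right_less)
    ultimately show ?thesis
    proof eventually_elim
      case (elim t)
      then have "?T d t \<noteq> 0" by auto
      then show ?case using T0[OF elim(2), of d] by simp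
    qed
  qed
  have near: "eventually (\<lambda>t. \<bar>(\<integral>\<omega>. g (U t \<omega>) \<partial>M) / ?T \<delta> t - c * (?T d t / ?T \<delta> t)\<bar> \<le> 2 * e * (?T d t / ?T \<delta> t)) (at_right 0)"
    if d: "0 < d" and e0: "0 < e" and e: "\<And>u. 0 < u \<Longrightarrow> u \<le> d \<Longrightarrow> \<bar>g u - c * sqrt u\<bar> \<le> e * sqrt u" for d e
  proof -
    have "eventually (\<lambda>t. norm (measure M {\<omega>\<in>space M. U t \<omega> > d}) \<le> (e / (V + 1)) * norm (?T d t)) (at_right 0)"
      using tail[OF d] by (rule landau_o.smallD) (use e0 V0 in simp)
    moreover have "eventually (\<lambda>t::real. 0 < t) (at_right 0)" by (rule eventually_at_right_less)
    ultimately show ?thesis using Tne[OF d] Tne[OF \<delta>]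
    proof eventually_elim
      case (elim t)
      have "V * measure M {\<omega>\<in>space M. U t \<omega> > d} \<le> (V + 1) * ((e / (V + 1)) * ?T d t)"
        using elim V0 by (intro mult_mono) auto
      also have "\<dots> = e * ?T d t" using V0 by simp
      finally have "\<bar>(\<integral>\<omega>. g (U t \<omega>) \<partial>M) - c * ?T d t\<bar> \<le> 2 * e * ?T d t"
        using key[OF elim(2) d e] by linarith
      then have "\<bar>(\<integral>\<omega>. g (U t \<omega>) \<partial>M) - c * ?T d t\<bar> / ?T \<delta> t \<le> 2 * e * ?T d t / ?T \<delta> t"
        using elim(4) by (intro divide_right_mono) auto
      moreover have "\<bar>(\<integral>\<omega>. g (U t \<omega>) \<partial>M) - c * ?T d t\<bar> / ?T \<delta> t = \<bar>(\<integral>\<omega>. g (U t \<omega>) \<partial>M) / ?T \<delta> t - c * (?T d t / ?T \<delta> t)\<bar>"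
      proof -
        have "(\<integral>\<omega>. g (U t \<omega>) \<partial>M) / ?T \<delta> t - c * (?T d t / ?T \<delta> t) = ((\<integral>\<omega>. g (U t \<omega>) \<partial>M) - c * ?T d t) / ?T \<delta> t"
          by (simp add: diff_divide_distrib)
        then show ?thesis using elim(4) by (simp add: abs_divide)
      qed
      ultimately show ?case by simp
    qed
  qed
  show ?thesis
  proof (rule tendstoI)
    fix r :: real assume r: "0 < r"
    define e where "e = r / 8"
    have e: "0 < e" using r by (simp add: e_def)
    have "eventually (\<lambda>u. dist (g u / sqrt u) c < e) (at_right 0)" using lim e by (rule tendstoD)
    then obtain d0 where d0: "0 < d0" "\<And>u. 0 < u \<Longrightarrow> u < d0 \<Longrightarrow> \<bar>g u / sqrt u - c\<bar> < e"
      by (auto simp: eventually_at_right_field dist_real_def)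
    define d where "d = d0 / 2"
    have d: "0 < d" using d0 by (simp add: d_def)
    have bnd: "\<bar>g u - c * sqrt u\<bar> \<le> e * sqrt u" if "0 < u" "u \<le> d" for u
    proof -
      have "\<bar>g u / sqrt u - c\<bar> * sqrt u \<le> e * sqrt u" using d0(2)[of u] that d0(1) by (intro mult_right_mono) (auto simp: d_def)
      moreover have "\<bar>g u / sqrt u - c\<bar> * sqrt u = \<bar>(g u / sqrt u - c) * sqrt u\<bar>" using that by (simp add: abs_mult)
      moreover have "(g u / sqrt u - c) * sqrt u = g u - c * sqrt u" using that by (simp add: left_diff_distrib)
      ultimately show ?thesis by simp
    qed
    define k where "k = min 1 (r / (4 * (\<bar>c\<bar> + 1)))"
    have k: "0 < k" "k \<le> 1" "\<bar>c\<bar> * k \<le> r / 4"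
    proof -
      show "0 < k" "k \<le> 1" using r by (auto simp: k_def)
      have "\<bar>c\<bar> * k \<le> (\<bar>c\<bar> + 1) * (r / (4 * (\<bar>c\<bar> + 1)))" using r by (intro mult_mono) (auto simp: k_def)
      also have "\<dots> = r / 4" by (simp add: field_simps)
      finally show "\<bar>c\<bar> * k \<le> r / 4" .
    qed
    have "eventually (\<lambda>t. dist (?T d t / ?T \<delta> t) 1 < k) (at_right 0)"
      using ratio[OF d \<delta>] k(1) by (rule tendstoD)
    moreover have "eventually (\<lambda>t. \<bar>(\<integral>\<omega>. g (U t \<omega>) \<partial>M) / ?T \<delta> t - c * (?T d t / ?T \<delta> t)\<bar> \<le> 2 * e * (?T d t / ?T \<delta> t)) (at_right 0)"
      by (rule near[OF d e]) (rule bnd)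
    ultimately show "eventually (\<lambda>t. dist ((\<integral>\<omega>. g (U t \<omega>) \<partial>M) / ?T \<delta> t) c < r) (at_right 0)"
    proof eventually_elim
      case (elim t)
      define \<rho> where "\<rho> = ?T d t / ?T \<delta> t"
      have \<rho>: "\<bar>\<rho> - 1\<bar> < k" using elim(1) by (simp add: \<rho>_def dist_real_def)
      have "2 * e * \<rho> \<le> 2 * e * 2" using \<rho> k(2) e by (intro mult_left_mono) auto
      then have 1: "\<bar>(\<integral>\<omega>. g (U t \<omega>) \<partial>M) / ?T \<delta> t - c * \<rho>\<bar> \<le> r / 2" using elim(2) by (simp add: \<rho>_def e_def)
      have "\<bar>c * \<rho> - c\<bar> = \<bar>c\<bar> * \<bar>\<rho> - 1\<bar>" by (simp add: abs_mult[symmetric] right_diff_distrib)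
      also have "\<dots> \<le> \<bar>c\<bar> * k" using \<rho> by (intro mult_left_mono) auto
      finally have 2: "\<bar>c * \<rho> - c\<bar> \<le> r / 4" using k(3) by linarith
      show ?case using 1 2 r unfolding dist_real_def by linarith
    qed
  qed
qed

text \<open>
  On the scale \<open>\<eta>\<close> of order \<open>s\<^sup>1\<^sup>/\<^sup>4\<close> the path up to time \<open>s\<close> is confined except with probability
  of order \<open>s\<close>, while the curvature contributes \<open>2\<Lambda>\<eta>\<^sup>2 = \<epsilon> \<surd>s\<close>, as little as desired compared with
  the width of the layer. For points within \<open>\<delta>0\<close> of the complement, leaving \<open>\<Omega>\<close> is thereby
  compared with passing a level in the normal direction, and the reflection principle applies. For
  points further away all probabilities involved are of order \<open>s\<close>.
\<close>
lemma brownian_boundary_layer_profile: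
  fixes W :: "real \<Rightarrow> 'w \<Rightarrow> 'a::euclidean_space"
  assumes bm: "brownian_motion N x0 W" and \<Omega>: "open \<Omega>" "bounded \<Omega>"
    and tp: "tangent_parabolas \<Omega> R \<Lambda>" "0 < R" "0 < \<Lambda>"
  defines "A \<equiv> \<lambda>x s. {\<omega>\<in>space N. \<not> (\<forall>r. 0 < r \<and> r \<le> s \<longrightarrow> x + (W r \<omega> - W 0 \<omega>) \<in> \<Omega>)}"
    and "B \<equiv> \<lambda>x s. {\<omega>\<in>space N. x + (W s \<omega> - W 0 \<omega>) \<notin> \<Omega>}"
  assumes meas: "\<And>x s. 0 < s \<Longrightarrow> A x s \<in> sets N" "\<And>x s. 0 < s \<Longrightarrow> B x s \<in> sets N"
  shows "boundary_layer_profile \<Omega> (\<lambda>s x. measure N (A x s)) (\<lambda>z. sqrt 2 * \<bar>z\<bar>)"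
    and "boundary_layer_profile \<Omega> (\<lambda>s x. measure N (B x s)) (\<lambda>z. sqrt 2 * z)"
proof -
  interpret N: prob_space N by (rule brownian_motionD(1)[OF bm])
  interpret SN: prob_space std_normal by (rule prob_space_std_normal)
  let ?d = "real DIM('a)"
  let ?up = "\<lambda>\<epsilon> K p s x Y. p \<le> measure std_normal {z. (1 - \<epsilon>) * infdist x (- \<Omega>) - 2 * \<epsilon> * sqrt s \<le> Y z} + K * s"
  let ?lo = "\<lambda>\<epsilon> K p s x Y. measure std_normal {z. (1 + \<epsilon>) * infdist x (- \<Omega>) + \<epsilon> * sqrt s < Y z} - K * s \<le> p"
  have both: "\<exists>K\<ge>0. \<exists>s0>0. \<forall>s x. 0 < s \<and> s < s0 \<and> x \<in> \<Omega> \<longrightarrow>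
     (?up \<epsilon> K (measure N (A x s)) s x (\<lambda>z. sqrt (2 * s) * \<bar>z\<bar>) \<and> ?lo \<epsilon> K (measure N (A x s)) s x (\<lambda>z. sqrt (2 * s) * \<bar>z\<bar>)) \<and>
     (?up \<epsilon> K (measure N (B x s)) s x (\<lambda>z. sqrt (2 * s) * z) \<and> ?lo \<epsilon> K (measure N (B x s)) s x (\<lambda>z. sqrt (2 * s) * z))"
    if \<epsilon>: "0 < \<epsilon>" "\<epsilon> < 1" for \<epsilon>
  proof -
    have d1: "1 \<le> ?d" using DIM_positive[where 'a='a] by linarith
    \<comment> \<open>\<open>\<delta>0\<close> makes the relative error \<open>2\<Lambda>\<delta>\<close> of the distance at most \<open>\<epsilon>\<close> and leaves \<open>R / 2\<close> for
       the displacement.\<close>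
    define \<delta>0 where "\<delta>0 = min (\<epsilon> / (2 * \<Lambda>)) (R / 2)"
    have \<delta>0: "0 < \<delta>0" "2 * \<Lambda> * \<delta>0 \<le> \<epsilon>" "2 * \<delta>0 \<le> R"
    proof -
      show "0 < \<delta>0" using tp \<epsilon> by (simp add: \<delta>0_def)
      have "2 * \<Lambda> * \<delta>0 \<le> 2 * \<Lambda> * (\<epsilon> / (2 * \<Lambda>))" using tp by (intro mult_left_mono) (auto simp: \<delta>0_def)
      then show "2 * \<Lambda> * \<delta>0 \<le> \<epsilon>" using tp by simp
      have "\<delta>0 \<le> R / 2" unfolding \<delta>0_def by linarith
      then show "2 * \<delta>0 \<le> R" by simp
    qed
    \<comment> \<open>\<open>s0\<close> is the time at which \<open>\<eta> = \<delta>0\<close>, and \<open>K s\<close> is the bound \<open>24 d\<^sup>5 s\<^sup>2 / \<eta>\<^sup>4\<close> on the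
       probability of a displacement beyond \<open>\<eta>\<close>.\<close>
    define s0 where "s0 = (2 * \<Lambda> * \<delta>0\<^sup>2 / \<epsilon>)\<^sup>2"
    define K where "K = 96 * \<Lambda>\<^sup>2 * ?d ^ 5 / \<epsilon>\<^sup>2"
    have K0: "0 \<le> K" by (simp add: K_def)
    have s0: "0 < s0" using tp \<epsilon> \<delta>0 by (simp add: s0_def)
    have main: "(?up \<epsilon> K (measure N (A x s)) s x (\<lambda>z. sqrt (2 * s) * \<bar>z\<bar>) \<and> ?lo \<epsilon> K (measure N (A x s)) s x (\<lambda>z. sqrt (2 * s) * \<bar>z\<bar>)) \<and>
       (?up \<epsilon> K (measure N (B x s)) s x (\<lambda>z. sqrt (2 * s) * z) \<and> ?lo \<epsilon> K (measure N (B x s)) s x (\<lambda>z. sqrt (2 * s) * z))"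
      if s: "0 < s" "s < s0" and x: "x \<in> \<Omega>" for s x
    proof -
      define \<eta> where "\<eta> = sqrt (\<epsilon> * sqrt s / (2 * \<Lambda>))"
      have ss: "0 < sqrt s" using s by simp
      have \<eta>0: "0 < \<eta>" using ss tp \<epsilon> by (simp add: \<eta>_def)
      have \<eta>2: "\<eta>\<^sup>2 = \<epsilon> * sqrt s / (2 * \<Lambda>)" using ss tp \<epsilon> by (simp add: \<eta>_def)
      have \<eta>4: "\<eta> ^ 4 = \<epsilon>\<^sup>2 * s / (4 * \<Lambda>\<^sup>2)"
      proof -
        have "\<eta> ^ 4 = (\<eta>\<^sup>2)\<^sup>2" by (simp flip: power_mult)
        then show ?thesis unfolding \<eta>2 using s by (simp add: power_divide power_mult_distrib)
      qed
      have \<eta>\<delta>: "\<eta> < \<delta>0"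
      proof (rule power2_less_imp_less)
        have "sqrt s < sqrt s0" using s by simp
        also have "sqrt s0 = 2 * \<Lambda> * \<delta>0\<^sup>2 / \<epsilon>" using tp \<epsilon> by (simp add: s0_def)
        finally show "\<eta>\<^sup>2 < \<delta>0\<^sup>2" unfolding \<eta>2 using tp \<epsilon> by (simp add: field_simps)
      qed (use \<delta>0 in simp)
      have Ks: "24 * ?d ^ 5 * s\<^sup>2 / \<eta> ^ 4 = K * s" unfolding \<eta>4 K_def using s tp \<epsilon> by (simp add: field_simps power2_eq_square)
      obtain F where F: "F \<in> sets N" "{\<omega>\<in>space N. \<exists>u. 0 < u \<and> u \<le> s \<and> \<eta> < norm (W u \<omega> - W 0 \<omega>)} \<subseteq> F" "measure N F \<le> K * s"
        using brownian_large_displacement[OF bm s(1) \<eta>0] unfolding Ks by blast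
      have Fsmall: "norm (W u \<omega> - W 0 \<omega>) \<le> \<eta>" if "\<omega> \<in> space N" "\<omega> \<notin> F" "0 < u" "u \<le> s" for \<omega> u
      proof (rule ccontr)
        assume "\<not> norm (W u \<omega> - W 0 \<omega>) \<le> \<eta>"
        then have "\<omega> \<in> {\<omega>\<in>space N. \<exists>u. 0 < u \<and> u \<le> s \<and> \<eta> < norm (W u \<omega> - W 0 \<omega>)}"
          using that(1,3,4) by auto
        then show False using F(2) that(2) by blast
      qed
      have BA: "B x s \<subseteq> A x s" using s by (auto simp: A_def B_def)
      define \<delta> where "\<delta> = infdist x (- \<Omega>)"
      obtain z where z: "z \<in> frontier \<Omega>" "z \<notin> \<Omega>" "dist x z = \<delta>"
        using nearest_complement_point[OF \<Omega> x] unfolding \<delta>_def by blast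
      have \<delta>p: "0 < \<delta>" using z x by (metis zero_less_dist_iff)
      \<comment> \<open>Upper and lower comparison of events that agree off the event \<open>F\<close> of a large
         displacement.\<close>
      have rs: "measure N X \<le> measure std_normal S + K * s" if "X \<subseteq> F \<union> E" "E \<in> sets N" "measure N E \<le> measure std_normal S" for X E S
      proof -
        have "F \<union> E \<in> sets N" using F(1) that(2) by (rule sets.Un)
        then have "measure N X \<le> measure N (F \<union> E)" by (rule N.finite_measure_mono[OF that(1)])
        also have "\<dots> \<le> measure N F + measure N E" by (rule measure_Un_le[OF F(1) that(2)])
        finally show ?thesis using that(3) F(3) by linarith
      qed
      have rl: "measure std_normal S - K * s \<le> measure N X" if "E \<subseteq> X \<union> F" "X \<in> sets N" "measure N E = measure std_normal S" for X E S
      proof -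
        have "X \<union> F \<in> sets N" using that(2) F(1) by (rule sets.Un)
        then have "measure N E \<le> measure N (X \<union> F)" by (rule N.finite_measure_mono[OF that(1)])
        also have "\<dots> \<le> measure N X + measure N F" by (rule measure_Un_le[OF that(2) F(1)])
        finally show ?thesis using that(3) F(3) by linarith
      qed
      show ?thesis
      proof (cases "\<delta> < \<delta>0")
        case True
        obtain \<nu> where \<nu>: "norm \<nu> = 1" and par: "\<And>y. y \<in> ball z R \<Longrightarrow> (\<Lambda> * (norm (y - z))\<^sup>2 < (y - z) \<bullet> \<nu> \<longrightarrow> y \<in> \<Omega>) \<and> ((y - z) \<bullet> \<nu> < - \<Lambda> * (norm (y - z))\<^sup>2 \<longrightarrow> y \<notin> \<Omega>)"
          using tp(1) z(1) unfolding tangent_parabolas_def by blast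
        have xz: "x - z = \<delta> *\<^sub>R \<nu>"
          using nearest_point_along_normal[OF tp(2,3) \<nu>, of z \<Omega> x] par z \<delta>p by (simp add: \<delta>_def)
        have n\<nu>: "norm (- \<nu>) = 1" using \<nu> by simp
        have "2 * \<Lambda> * \<delta> \<le> 2 * \<Lambda> * \<delta>0" using True tp by (intro mult_left_mono) auto
        then have \<Lambda>\<delta>: "2 * \<Lambda> * \<delta> \<le> \<epsilon>" using \<delta>0 by linarith
        have pos: "((- \<nu>) \<bullet> h < (1 - \<epsilon>) * \<delta> - \<epsilon> * sqrt s \<longrightarrow> x + h \<in> \<Omega>) \<and> ((1 + \<epsilon>) * \<delta> + \<epsilon> * sqrt s < (- \<nu>) \<bullet> h \<longrightarrow> x + h \<notin> \<Omega>)"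
          if h: "norm h \<le> \<eta>" for h
        proof -
          have "2 * \<Lambda> * (norm h)\<^sup>2 \<le> 2 * \<Lambda> * \<eta>\<^sup>2" using h tp by (intro mult_left_mono power_mono) auto
          also have "\<dots> = \<epsilon> * sqrt s" unfolding \<eta>2 using tp by simp
          finally have h2: "2 * \<Lambda> * (norm h)\<^sup>2 \<le> \<epsilon> * sqrt s" .
          have hR: "\<delta> + norm h < R" using h \<eta>\<delta> True \<delta>0 by linarith
          show ?thesis using parabolic_position[OF tp(3) par \<nu> xz \<delta>p \<Lambda>\<delta> hR h2] by blast
        qed
        define a where "a = (1 - \<epsilon>) * \<delta> - 2 * \<epsilon> * sqrt s"
        define b where "b = (1 + \<epsilon>) * \<delta> + \<epsilon> * sqrt s"
        have a: "a < (1 - \<epsilon>) * \<delta> - \<epsilon> * sqrt s" using \<epsilon> ss by (simp add: a_def)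
        have b0: "0 \<le> b" using \<epsilon> ss \<delta>p by (simp add: b_def)
        note refl = brownian_reflection[OF bm n\<nu> s(1)]
        have "A x s \<subseteq> F \<union> {\<omega>\<in>space N. \<exists>u. 0 < u \<and> u \<le> s \<and> a < - \<nu> \<bullet> (W u \<omega> - W 0 \<omega>)}"
        proof
          fix \<omega> assume w: "\<omega> \<in> A x s"
          show "\<omega> \<in> F \<union> {\<omega>\<in>space N. \<exists>u. 0 < u \<and> u \<le> s \<and> a < - \<nu> \<bullet> (W u \<omega> - W 0 \<omega>)}"
          proof (cases "\<omega> \<in> F")
            case False
            obtain u where u: "\<omega> \<in> space N" "0 < u" "u \<le> s" "x + (W u \<omega> - W 0 \<omega>) \<notin> \<Omega>" using w by (auto simp: A_def)
            have "\<not> - \<nu> \<bullet> (W u \<omega> - W 0 \<omega>) < (1 - \<epsilon>) * \<delta> - \<epsilon> * sqrt s" using pos[OF Fsmall[OF u(1) False u(2,3)]] u(4) by blast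
            then have "a < - \<nu> \<bullet> (W u \<omega> - W 0 \<omega>)" using a by linarith
            then show ?thesis using u by blast
          qed simp
        qed
        then have A1: "measure N (A x s) \<le> measure std_normal {z. a \<le> sqrt (2 * s) * \<bar>z\<bar>} + K * s"
          by (rule rs[OF _ refl(1,2)])
        have "{\<omega>\<in>space N. \<exists>u. 0 < u \<and> u \<le> s \<and> b < - \<nu> \<bullet> (W u \<omega> - W 0 \<omega>)} \<subseteq> A x s \<union> F"
        proof
          fix \<omega> assume "\<omega> \<in> {\<omega>\<in>space N. \<exists>u. 0 < u \<and> u \<le> s \<and> b < - \<nu> \<bullet> (W u \<omega> - W 0 \<omega>)}"
          then obtain u where u: "\<omega> \<in> space N" "0 < u" "u \<le> s" "b < - \<nu> \<bullet> (W u \<omega> - W 0 \<omega>)" by blast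
          show "\<omega> \<in> A x s \<union> F"
          proof (cases "\<omega> \<in> F")
            case False
            then have "x + (W u \<omega> - W 0 \<omega>) \<notin> \<Omega>" using pos[OF Fsmall[OF u(1) False u(2,3)]] u(4) unfolding b_def by blast
            then show ?thesis using u by (auto simp: A_def)
          qed simp
        qed
        then have A2: "measure std_normal {z. b < sqrt (2 * s) * \<bar>z\<bar>} - K * s \<le> measure N (A x s)"
          by (rule rl[OF _ meas(1)[OF s(1)] refl(3)[OF b0]])
        have law: "measure N {\<omega>\<in>space N. - \<nu> \<bullet> (W s \<omega> - W 0 \<omega>) \<in> X} = measure std_normal {z. sqrt (2 * s) * z \<in> X}" if "X \<in> sets borel" for X
          using brownian_component_prob[OF bm n\<nu>, of 0 s X] s that by simp
        have Ws: "(\<lambda>\<omega>. - \<nu> \<bullet> (W s \<omega> - W 0 \<omega>)) \<in> borel_measurable N"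
          using brownian_motionD(2)[OF bm, of s] brownian_motionD(2)[OF bm, of 0] s by simp
        have Bs: "\<omega> \<in> F \<or> (\<not> - \<nu> \<bullet> (W s \<omega> - W 0 \<omega>) < (1 - \<epsilon>) * \<delta> - \<epsilon> * sqrt s)" if "\<omega> \<in> B x s" for \<omega>
          using pos[OF Fsmall[of \<omega> s]] that s by (auto simp: B_def)
        have "B x s \<subseteq> F \<union> {\<omega>\<in>space N. - \<nu> \<bullet> (W s \<omega> - W 0 \<omega>) \<in> {a..}}"
        proof
          fix \<omega> assume w: "\<omega> \<in> B x s"
          then have "\<omega> \<in> space N" by (simp add: B_def)
          then show "\<omega> \<in> F \<union> {\<omega>\<in>space N. - \<nu> \<bullet> (W s \<omega> - W 0 \<omega>) \<in> {a..}}" using Bs[OF w] a by auto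
        qed
        then have B1: "measure N (B x s) \<le> measure std_normal {z. sqrt (2 * s) * z \<in> {a..}} + K * s"
          by (rule rs) (use law[of "{a..}"] measurable_sets[OF Ws, of "{a..}"] in \<open>auto simp: vimage_def Int_def conj_commute\<close>)
        have "{\<omega>\<in>space N. - \<nu> \<bullet> (W s \<omega> - W 0 \<omega>) \<in> {b<..}} \<subseteq> B x s \<union> F"
        proof
          fix \<omega> assume w: "\<omega> \<in> {\<omega>\<in>space N. - \<nu> \<bullet> (W s \<omega> - W 0 \<omega>) \<in> {b<..}}"
          show "\<omega> \<in> B x s \<union> F"
          proof (cases "\<omega> \<in> F")
            case False
            have "x + (W s \<omega> - W 0 \<omega>) \<notin> \<Omega>" using pos[OF Fsmall[of \<omega> s]] w False s unfolding b_def by auto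
            then show ?thesis using w by (auto simp: B_def)
          qed simp
        qed
        then have B2: "measure std_normal {z. sqrt (2 * s) * z \<in> {b<..}} - K * s \<le> measure N (B x s)"
          by (rule rl[OF _ meas(2)[OF s(1)] law]) simp
        show ?thesis using A1 A2 B1 B2 unfolding a_def b_def \<delta>_def by simp
      next
        case False
        have "A x s \<subseteq> F"
        proof
          fix \<omega> assume w: "\<omega> \<in> A x s"
          show "\<omega> \<in> F"
          proof (rule ccontr)
            assume nF: "\<omega> \<notin> F"
            obtain u where u: "\<omega> \<in> space N" "0 < u" "u \<le> s" "x + (W u \<omega> - W 0 \<omega>) \<notin> \<Omega>" using w by (auto simp: A_def)
            have "infdist x (- \<Omega>) \<le> dist x (x + (W u \<omega> - W 0 \<omega>))" using u by (intro infdist_le) auto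
            then have "\<delta> \<le> norm (W u \<omega> - W 0 \<omega>)" by (simp add: \<delta>_def dist_norm norm_minus_commute)
            then show False using Fsmall[OF u(1) nF u(2,3)] \<eta>\<delta> False by linarith
          qed
        qed
        then have AF: "measure N (A x s) \<le> K * s" "measure N (B x s) \<le> K * s"
          using N.finite_measure_mono[OF _ F(1)] F(3) order_trans[OF BA] by (meson order_trans)+
        have "measure std_normal {z. \<eta> < sqrt (2 * s) * \<bar>z\<bar>} \<le> 3 * sqrt (2 * s) ^ 4 / \<eta> ^ 4"
          using s by (intro std_normal_fourth_moment_tail \<eta>0) auto
        also have "\<dots> = 12 * 1 * s\<^sup>2 / \<eta> ^ 4" using s by (simp add: sqrt_pow4)
        also have "\<dots> \<le> 24 * ?d ^ 5 * s\<^sup>2 / \<eta> ^ 4"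
          using d1 \<eta>0 by (intro divide_right_mono mult_right_mono mult_mono one_le_power) auto
        finally have far: "measure std_normal {z. \<eta> < sqrt (2 * s) * \<bar>z\<bar>} \<le> K * s" unfolding Ks .
        have bb: "\<eta> \<le> (1 + \<epsilon>) * \<delta> + \<epsilon> * sqrt s"
        proof -
          have "0 \<le> \<epsilon> * \<delta>" "0 \<le> \<epsilon> * sqrt s" using \<epsilon> \<delta>p ss by auto
          then show ?thesis using False \<eta>\<delta> by (simp add: distrib_right)
        qed
        have "measure std_normal {z. (1 + \<epsilon>) * \<delta> + \<epsilon> * sqrt s < sqrt (2 * s) * \<bar>z\<bar>} \<le> K * s"
          using bb sets_inequality_real by (intro order_trans[OF _ far] SN.finite_measure_mono) auto
        moreover have "measure std_normal {z. (1 + \<epsilon>) * \<delta> + \<epsilon> * sqrt s < sqrt (2 * s) * z} \<le> K * s"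
        proof (intro order_trans[OF _ far] SN.finite_measure_mono)
          show "{z. (1 + \<epsilon>) * \<delta> + \<epsilon> * sqrt s < sqrt (2 * s) * z} \<subseteq> {z. \<eta> < sqrt (2 * s) * \<bar>z\<bar>}"
          proof
            fix z assume z: "z \<in> {z. (1 + \<epsilon>) * \<delta> + \<epsilon> * sqrt s < sqrt (2 * s) * z}"
            have "sqrt (2 * s) * z \<le> sqrt (2 * s) * \<bar>z\<bar>" using s by (intro mult_left_mono) auto
            with z bb show "z \<in> {z. \<eta> < sqrt (2 * s) * \<bar>z\<bar>}" by auto
          qed
        qed (use sets_inequality_real in auto)
        moreover have "0 \<le> measure N (A x s)" "0 \<le> measure N (B x s)"
          "0 \<le> measure std_normal {z. (1 - \<epsilon>) * \<delta> - 2 * \<epsilon> * sqrt s \<le> sqrt (2 * s) * \<bar>z\<bar>}"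
          "0 \<le> measure std_normal {z. (1 - \<epsilon>) * \<delta> - 2 * \<epsilon> * sqrt s \<le> sqrt (2 * s) * z}" by simp_all
        ultimately show ?thesis using AF unfolding \<delta>_def[symmetric] by linarith
      qed
    qed
    show ?thesis using main K0 s0 by blast
  qed
  have eq: "sqrt s * (sqrt 2 * y) = sqrt (2 * s) * y" for s y by (simp add: real_sqrt_mult)
  show "boundary_layer_profile \<Omega> (\<lambda>s x. measure N (A x s)) (\<lambda>z. sqrt 2 * \<bar>z\<bar>)"
    unfolding boundary_layer_profile_def eq using both by meson
  show "boundary_layer_profile \<Omega> (\<lambda>s x. measure N (B x s)) (\<lambda>z. sqrt 2 * z)"
    unfolding boundary_layer_profile_def eq using both by meson
qed

section \<open>Measurability and transport of the starting point\<close>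

lemma stays_inside_cong:
  assumes "\<And>q. 0 < q \<Longrightarrow> w q = w' q"
  shows "stays_inside \<Omega> w u \<longleftrightarrow> stays_inside \<Omega> w' u"
proof -
  have eq: "1 / real (Suc n) \<le> q \<Longrightarrow> w q = w' q" for n q
    by (rule assms) (rule less_le_trans[of 0 "1 / real (Suc n)"], simp_all)
  have "(1 / real (Suc n) \<le> q \<and> q \<le> v \<longrightarrow> 1 / real (Suc m) \<le> infdist (w q) (- \<Omega>)) \<longleftrightarrow>
    (1 / real (Suc n) \<le> q \<and> q \<le> v \<longrightarrow> 1 / real (Suc m) \<le> infdist (w' q) (- \<Omega>))" for n m q v
    using eq[of n q] by (cases "1 / real (Suc n) \<le> q") (simp_all only: simp_thms)
  then show ?thesis unfolding stays_inside_def by (simp only:)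
qed

lemma measurable_stays_inside:
  fixes v :: "real \<Rightarrow> 'k \<Rightarrow> 'a::euclidean_space"
  assumes u[measurable]: "u \<in> borel_measurable K" and v: "\<And>q. 0 < q \<Longrightarrow> v q \<in> borel_measurable K"
  shows "Measurable.pred K (\<lambda>k. stays_inside \<Omega> (\<lambda>q. v q k) (u k))"
proof -
  have ball_rat: "(\<forall>q\<in>\<rat>. Q q) \<longleftrightarrow> (\<forall>i::rat. Q (of_rat i))" for Q :: "real \<Rightarrow> bool"
    by (auto elim: Rats_cases)
  have bex_rat: "(\<exists>q\<in>\<rat>. Q q) \<longleftrightarrow> (\<exists>i::rat. Q (of_rat i))" for Q :: "real \<Rightarrow> bool"
    by (auto elim: Rats_cases)
  have dm[measurable]: "(\<lambda>x::'a. infdist x (- \<Omega>)) \<in> borel_measurable borel"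
    by (intro borel_measurable_continuous_onI continuous_intros)
  have "Measurable.pred K (\<lambda>k. 1 / real (Suc n) \<le> q \<and> q \<le> c \<longrightarrow> 1 / real (Suc m) \<le> infdist (v q k) (- \<Omega>))" for n m :: nat and q c
  proof (cases "1 / real (Suc n) \<le> q")
    case True
    then have "0 < q" by (rule less_le_trans[rotated]) simp
    from v[OF this] have [measurable]: "v q \<in> borel_measurable K" .
    show ?thesis by measurable
  qed simp
  then have "Measurable.pred K (\<lambda>k. \<forall>q\<in>\<rat>. 1 / real (Suc n) \<le> q \<and> q \<le> c \<longrightarrow> 1 / real (Suc m) \<le> infdist (v q k) (- \<Omega>))" for n m :: nat and c
    unfolding ball_rat by (intro pred_intros_countable)
  then have all [measurable]: "Measurable.pred K (\<lambda>k. \<forall>n::nat. \<exists>m::nat. \<forall>q\<in>\<rat>. 1 / real (Suc n) \<le> q \<and> q \<le> c \<longrightarrow> 1 / real (Suc m) \<le> infdist (v q k) (- \<Omega>))" for c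
    by (intro pred_intros_countable)
  have "Measurable.pred K (\<lambda>k. u k < c \<and> (\<forall>n::nat. \<exists>m::nat. \<forall>q\<in>\<rat>. 1 / real (Suc n) \<le> q \<and> q \<le> c \<longrightarrow> 1 / real (Suc m) \<le> infdist (v q k) (- \<Omega>)))" for c
    by (rule pred_intros_logic) measurable
  then show ?thesis unfolding stays_inside_def bex_rat
    by (intro pred_intros_countable)
qed

text \<open>
  Approximate \<open>u\<close> by \<open>\<lfloor>(n+1)u\<rfloor> / (n+1)\<close>, which takes countably many values, and use continuity of
  the path.
\<close>
lemma measurable_continuous_process:
  fixes W :: "real \<Rightarrow> 'w \<Rightarrow> 'a::euclidean_space"
  assumes W: "\<And>t. 0 \<le> t \<Longrightarrow> W t \<in> borel_measurable K" and c: "\<And>\<omega>. \<omega> \<in> space K \<Longrightarrow> continuous_on {0..} (\<lambda>t. W t \<omega>)"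
  shows "(\<lambda>(u, \<omega>). W (max 0 u) \<omega>) \<in> borel_measurable (borel \<Otimes>\<^sub>M K)"
proof (rule borel_measurable_LIMSEQ_metric)
  fix n :: nat
  have "(\<lambda>p. W (max 0 (real_of_int \<lfloor>real (Suc n) * fst p\<rfloor> / real (Suc n))) (snd p)) \<in> borel_measurable (borel \<Otimes>\<^sub>M K)"
  proof (rule measurable_compose_countable[where f="\<lambda>i p. W (max 0 (real_of_int i / real (Suc n))) (snd p)" and g="\<lambda>p. \<lfloor>real (Suc n) * fst p\<rfloor>"])
    fix i :: int
    have [measurable]: "W (max 0 (real_of_int i / real (Suc n))) \<in> borel_measurable K" by (rule W) simp
    show "(\<lambda>p. W (max 0 (real_of_int i / real (Suc n))) (snd p)) \<in> borel_measurable (borel \<Otimes>\<^sub>M K)" by measurable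
  qed measurable
  then show "(\<lambda>(u, \<omega>). W (max 0 (real_of_int \<lfloor>real (Suc n) * u\<rfloor> / real (Suc n))) \<omega>) \<in> borel_measurable (borel \<Otimes>\<^sub>M K)"
    by (simp add: case_prod_unfold)
next
  fix p :: "real \<times> 'w" assume p: "p \<in> space (borel \<Otimes>\<^sub>M K)"
  obtain u \<omega> where p': "p = (u, \<omega>)" "\<omega> \<in> space K" using p by (cases p) (auto simp: space_pair_measure)
  have "(\<lambda>n. real_of_int \<lfloor>real (Suc n) * u\<rfloor> / real (Suc n)) \<longlonglongrightarrow> u"
  proof (rule tendsto_sandwich)
    show "eventually (\<lambda>n. u - 1 / real (Suc n) \<le> real_of_int \<lfloor>real (Suc n) * u\<rfloor> / real (Suc n)) sequentially"
    proof (intro always_eventually allI)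
      fix n
      have "real (Suc n) * u - 1 \<le> real_of_int \<lfloor>real (Suc n) * u\<rfloor>" by linarith
      then have "(real (Suc n) * u - 1) / real (Suc n) \<le> real_of_int \<lfloor>real (Suc n) * u\<rfloor> / real (Suc n)" by (rule divide_right_mono) simp
      then show "u - 1 / real (Suc n) \<le> real_of_int \<lfloor>real (Suc n) * u\<rfloor> / real (Suc n)" by (simp add: diff_divide_distrib)
    qed
    show "eventually (\<lambda>n. real_of_int \<lfloor>real (Suc n) * u\<rfloor> / real (Suc n) \<le> u) sequentially"
    proof (intro always_eventually allI)
      fix n
      have "real_of_int \<lfloor>real (Suc n) * u\<rfloor> \<le> real (Suc n) * u" by linarith
      then have "real_of_int \<lfloor>real (Suc n) * u\<rfloor> / real (Suc n) \<le> real (Suc n) * u / real (Suc n)" by (rule divide_right_mono) simp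
      then show "real_of_int \<lfloor>real (Suc n) * u\<rfloor> / real (Suc n) \<le> u" by simp
    qed
    show "(\<lambda>n. u - 1 / real (Suc n)) \<longlonglongrightarrow> u" using tendsto_diff[OF tendsto_const LIMSEQ_inverse_real_of_nat, of u] by (simp add: inverse_eq_divide)
  qed simp
  then have "(\<lambda>n. max 0 (real_of_int \<lfloor>real (Suc n) * u\<rfloor> / real (Suc n))) \<longlonglongrightarrow> max 0 u" by (intro tendsto_intros)
  then have "(\<lambda>n. W (max 0 (real_of_int \<lfloor>real (Suc n) * u\<rfloor> / real (Suc n))) \<omega>) \<longlonglongrightarrow> W (max 0 u) \<omega>"
    by (intro continuous_on_tendsto_compose[OF c[OF p'(2)]]) auto
  then show "(\<lambda>n. case p of (u, \<omega>) \<Rightarrow> W (max 0 (real_of_int \<lfloor>real (Suc n) * u\<rfloor> / real (Suc n))) \<omega>) \<longlonglongrightarrow> (case p of (u, \<omega>) \<Rightarrow> W (max 0 u) \<omega>)"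
    by (simp add: p')
qed

text \<open>
  Both events are measurable conditions on the whole path, so the equality of path laws carries
  them over.
\<close>
lemma brownian_law_transfer:
  fixes W :: "real \<Rightarrow> 'w \<Rightarrow> 'a::euclidean_space" and W' :: "real \<Rightarrow> 'v \<Rightarrow> 'a"
  assumes bm: "brownian_motion N x W" and bm': "brownian_motion N' x' W'"
  shows "measure N {\<omega>\<in>space N. stays_inside \<Omega> (\<lambda>r. W r \<omega>) u} = measure N' {\<omega>\<in>space N'. stays_inside \<Omega> (\<lambda>r. x + (W' r \<omega> - W' 0 \<omega>)) u}"
    and "0 \<le> u \<Longrightarrow> \<Omega> \<in> sets borel \<Longrightarrow> measure N {\<omega>\<in>space N. W u \<omega> \<in> \<Omega>} = measure N' {\<omega>\<in>space N'. x + (W' u \<omega> - W' 0 \<omega>) \<in> \<Omega>}"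
proof -
  let ?M = "Pi\<^sub>M {0..} (\<lambda>_::real. borel :: 'a measure)"
  have m: "(\<lambda>\<omega>. \<lambda>t\<in>{0..}. W t \<omega>) \<in> measurable N ?M"
    using brownian_motionD(2)[OF bm] by (intro measurable_restrict) auto
  have m': "(\<lambda>\<omega>. \<lambda>t\<in>{0..}. x + (W' t \<omega> - W' 0 \<omega>)) \<in> measurable N' ?M"
    using brownian_motionD(2)[OF bm'] by (intro measurable_restrict borel_measurable_add borel_measurable_diff) auto
  have tr: "measure N {\<omega>\<in>space N. (\<lambda>t\<in>{0..}. W t \<omega>) \<in> S} = measure N' {\<omega>\<in>space N'. (\<lambda>t\<in>{0..}. x + (W' t \<omega> - W' 0 \<omega>)) \<in> S}"
    if S: "S \<in> sets ?M" for S
  proof -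
    have "measure N {\<omega>\<in>space N. (\<lambda>t\<in>{0..}. W t \<omega>) \<in> S} = measure (distr N ?M (\<lambda>\<omega>. \<lambda>t\<in>{0..}. W t \<omega>)) S"
      using measure_distr[OF m S] by (simp add: vimage_def Int_def conj_commute)
    also have "\<dots> = measure (distr N' ?M (\<lambda>\<omega>. \<lambda>t\<in>{0..}. x + (W' t \<omega> - W' 0 \<omega>))) S"
      by (simp only: brownian_path_law[OF bm bm'])
    also have "\<dots> = measure N' {\<omega>\<in>space N'. (\<lambda>t\<in>{0..}. x + (W' t \<omega> - W' 0 \<omega>)) \<in> S}"
      using measure_distr[OF m' S] by (simp add: vimage_def Int_def conj_commute)
    finally show ?thesis .
  qed
  have sp: "(\<lambda>t\<in>{0..}. f t) \<in> space ?M" for f by (simp add: space_PiM)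
  have "Measurable.pred ?M (\<lambda>f. stays_inside \<Omega> (\<lambda>q. f q) u)"
    by (rule measurable_stays_inside) (auto intro: measurable_component_singleton)
  then have "{f\<in>space ?M. stays_inside \<Omega> f u} \<in> sets ?M" by simp
  from tr[OF this]
  have "measure N {\<omega>\<in>space N. stays_inside \<Omega> (\<lambda>t\<in>{0..}. W t \<omega>) u} = measure N' {\<omega>\<in>space N'. stays_inside \<Omega> (\<lambda>t\<in>{0..}. x + (W' t \<omega> - W' 0 \<omega>)) u}"
    by (simp only: mem_Collect_eq sp simp_thms)
  moreover have "stays_inside \<Omega> (\<lambda>t\<in>{0..}. w t) u \<longleftrightarrow> stays_inside \<Omega> w u" for w
    by (rule stays_inside_cong) simp
  ultimately show "measure N {\<omega>\<in>space N. stays_inside \<Omega> (\<lambda>r. W r \<omega>) u} = measure N' {\<omega>\<in>space N'. stays_inside \<Omega> (\<lambda>r. x + (W' r \<omega> - W' 0 \<omega>)) u}"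
    by (simp only:)
  assume u: "0 \<le> u" and \<Omega>: "\<Omega> \<in> sets borel"
  have "(\<lambda>f. f u) \<in> measurable ?M borel" using u by (intro measurable_component_singleton) auto
  from measurable_sets[OF this \<Omega>] have "{f\<in>space ?M. f u \<in> \<Omega>} \<in> sets ?M" by (simp add: vimage_def Int_def conj_commute)
  from tr[OF this] show "measure N {\<omega>\<in>space N. W u \<omega> \<in> \<Omega>} = measure N' {\<omega>\<in>space N'. x + (W' u \<omega> - W' 0 \<omega>) \<in> \<Omega>}"
    using u by (simp only: mem_Collect_eq sp simp_thms restrict_apply atLeast_iff if_True)
qed

section \<open>Heat losses as averages over the time change\<close>

lemma measure_pair_sections:
  assumes A: "prob_space A" and B: "prob_space B" and E: "E \<in> sets (A \<Otimes>\<^sub>M B)"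
  shows "measure (A \<Otimes>\<^sub>M B) E = (\<integral>y. measure A {x\<in>space A. (x, y) \<in> E} \<partial>B)"
proof -
  interpret A: prob_space A by fact
  interpret B: prob_space B by fact
  interpret pair_prob_space A B ..
  have sec: "(\<lambda>x. (x, y)) -` E = {x\<in>space A. (x, y) \<in> E}" for y
    using sets.sets_into_space[OF E] by (auto simp: space_pair_measure)
  have "emeasure (A \<Otimes>\<^sub>M B) E = (\<integral>\<^sup>+y. ennreal (measure A ((\<lambda>x. (x, y)) -` E)) \<partial>B)"
    using emeasure_pair_measure_alt2[OF E] by (simp add: A.emeasure_eq_measure)
  moreover have "(\<lambda>y. measure A ((\<lambda>x. (x, y)) -` E)) \<in> borel_measurable B"
    unfolding measure_def using measurable_emeasure_Pair2[OF E] by measurable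
  ultimately show ?thesis
    by (simp add: measure_def[of "A \<Otimes>\<^sub>M B"] integral_eq_nn_integral sec)
qed

lemma measurable_section_prob:
  assumes G: "prob_space G" and P: "Measurable.pred (L \<Otimes>\<^sub>M G) (\<lambda>(k, \<omega>). P k \<omega>)"
  shows "(\<lambda>k. measure G {\<omega>\<in>space G. P k \<omega>}) \<in> borel_measurable L"
proof -
  interpret G: prob_space G by fact
  define E where "E = {q\<in>space (L \<Otimes>\<^sub>M G). P (fst q) (snd q)}"
  have E: "E \<in> sets (L \<Otimes>\<^sub>M G)" unfolding E_def using P by (simp add: case_prod_unfold)
  have "(\<lambda>k. enn2real (emeasure G (Pair k -` E))) \<in> borel_measurable L"
    using G.measurable_emeasure_Pair[OF E] by measurable
  moreover have "enn2real (emeasure G (Pair k -` E)) = measure G {\<omega>\<in>space G. P k \<omega>}" if "k \<in> space L" for k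
  proof -
    have "Pair k -` E = {\<omega>\<in>space G. P k \<omega>}" using that by (auto simp: E_def space_pair_measure)
    then show ?thesis by (simp add: measure_def)
  qed
  ultimately show ?thesis by (simp cong: measurable_cong)
qed

text \<open>
  For \<open>p u x\<close> the probability of loss from \<open>x\<close> at time \<open>u\<close>, the last part says that the heat lost
  at the random time \<open>V\<close> is the mean of the heat lost at time \<open>u\<close>, taken at \<open>u = V\<close>.
\<close>
lemma heat_loss_average:
  fixes \<Omega> :: "'a::euclidean_space set" and p :: "real \<Rightarrow> 'a \<Rightarrow> real"
  assumes p[measurable]: "(\<lambda>(u, x). p u x) \<in> borel_measurable (borel \<Otimes>\<^sub>M borel)" and p01: "\<And>u x. 0 \<le> p u x" "\<And>u x. p u x \<le> 1"
    and \<Omega>[measurable]: "\<Omega> \<in> sets borel" and bdd: "bounded \<Omega>"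
  shows "set_integrable lborel \<Omega> (p u)"
    and "(\<lambda>u. LINT x:\<Omega>|lborel. p u x) \<in> borel_measurable borel"
    and "\<bar>LINT x:\<Omega>|lborel. p u x\<bar> \<le> measure lborel \<Omega>"
    and "prob_space M \<Longrightarrow> V \<in> borel_measurable M \<Longrightarrow>
      measure lborel \<Omega> - (LINT x:\<Omega>|lborel. (\<integral>m. 1 - p (V m) x \<partial>M)) = (\<integral>m. (LINT x:\<Omega>|lborel. p (V m) x) \<partial>M)"
proof -
  have fin: "emeasure lborel \<Omega> < \<infinity>" using bdd by (rule emeasure_bounded_finite)
  have i\<Omega>: "integrable lborel (indicator \<Omega> :: 'a \<Rightarrow> real)" using fin by simp
  have pu[measurable]: "p u \<in> borel_measurable borel" for u by measurable
  show int: "set_integrable lborel \<Omega> (p u)" for u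
    unfolding set_integrable_def
    by (rule Bochner_Integration.integrable_bound[OF i\<Omega>]) (auto simp: p01 indicator_def)
  show "(\<lambda>u. LINT x:\<Omega>|lborel. p u x) \<in> borel_measurable borel"
    unfolding set_lebesgue_integral_def by measurable
  have one: "set_integrable lborel \<Omega> (\<lambda>_. 1::real)" "(LINT x:\<Omega>|lborel. (1::real)) = measure lborel \<Omega>"
    using i\<Omega> by (simp_all add: set_integrable_def set_lebesgue_integral_def)
  have "0 \<le> (LINT x:\<Omega>|lborel. p u x)" unfolding set_lebesgue_integral_def by (intro integral_nonneg_AE AE_I2) (simp add: p01)
  moreover have "(LINT x:\<Omega>|lborel. p u x) \<le> (LINT x:\<Omega>|lborel. (1::real))"
    by (rule set_integral_mono[OF int one(1)]) (rule p01)
  ultimately show "\<bar>LINT x:\<Omega>|lborel. p u x\<bar> \<le> measure lborel \<Omega>" using one by simp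
  assume M: "prob_space M" and V[measurable]: "V \<in> borel_measurable M"
  interpret M: prob_space M by fact
  interpret pair_sigma_finite "lborel :: 'a measure" M ..
  define f where "f x m = indicator \<Omega> x * p (V m) x" for x m
  have fm: "(\<lambda>(x, m). f x m) \<in> borel_measurable (lborel \<Otimes>\<^sub>M M)" unfolding f_def by measurable
  have fi: "integrable (lborel \<Otimes>\<^sub>M M) (case_prod f)"
  proof (rule Bochner_Integration.integrable_bound)
    have "emeasure (lborel \<Otimes>\<^sub>M M) (\<Omega> \<times> space M) = emeasure lborel \<Omega> * emeasure M (space M)"
      by (rule M.emeasure_pair_measure_Times) auto
    then have "emeasure (lborel \<Otimes>\<^sub>M M) (\<Omega> \<times> space M) < \<infinity>" using fin M.emeasure_space_1 by simp
    then show "integrable (lborel \<Otimes>\<^sub>M M) (indicator (\<Omega> \<times> space M) :: _ \<Rightarrow> real)" by (intro integrable_real_indicator) auto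
    show "case_prod f \<in> borel_measurable (lborel \<Otimes>\<^sub>M M)" using fm by simp
    show "AE q in lborel \<Otimes>\<^sub>M M. norm (case_prod f q) \<le> norm (indicator (\<Omega> \<times> space M) q :: real)"
      by (intro AE_I2) (auto simp: f_def indicator_def p01 space_pair_measure)
  qed
  have ip: "integrable M (\<lambda>m. p (V m) x)" for x
    by (rule M.integrable_const_bound[where B=1]) (auto simp: p01)
  have "(LINT x:\<Omega>|lborel. (\<integral>m. 1 - p (V m) x \<partial>M)) = (LINT x:\<Omega>|lborel. 1 - (\<integral>m. p (V m) x \<partial>M))"
    using ip by (simp add: M.prob_space)
  also have "\<dots> = measure lborel \<Omega> - (LINT x:\<Omega>|lborel. (\<integral>m. p (V m) x \<partial>M))"
  proof (subst set_integral_diff(2)[OF one(1)])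
    show "set_integrable lborel \<Omega> (\<lambda>x. \<integral>m. p (V m) x \<partial>M)"
      using integrable_fst[OF fi] by (simp add: set_integrable_def f_def)
  qed (simp add: one)
  also have "(LINT x:\<Omega>|lborel. (\<integral>m. p (V m) x \<partial>M)) = (\<integral>m. (LINT x:\<Omega>|lborel. p (V m) x) \<partial>M)"
    using Fubini_integral[OF fi] by (simp add: set_lebesgue_integral_def f_def)
  finally show "measure lborel \<Omega> - (LINT x:\<Omega>|lborel. (\<integral>m. 1 - p (V m) x \<partial>M)) = (\<integral>m. (LINT x:\<Omega>|lborel. p (V m) x) \<partial>M)" by simp
qed

text \<open>
  The starting point enters through translation, so that one law \<open>G\<close> serves all \<open>x\<close>.
\<close>
definition exit_probability :: "'w measure \<Rightarrow> (real \<Rightarrow> 'w \<Rightarrow> 'a::real_normed_vector) \<Rightarrow> 'a set \<Rightarrow> real \<Rightarrow> 'a \<Rightarrow> real" where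
  "exit_probability G W \<Omega> u x = measure G {\<omega>\<in>space G. \<not> stays_inside \<Omega> (\<lambda>r. x + (W r \<omega> - W 0 \<omega>)) u}"

text \<open>
  The maximum with \<open>0\<close> gives a value at negative times, where the process is not known to be
  measurable, so that the function is measurable on the whole line.
\<close>
definition outside_probability :: "'w measure \<Rightarrow> (real \<Rightarrow> 'w \<Rightarrow> 'a::real_normed_vector) \<Rightarrow> 'a set \<Rightarrow> real \<Rightarrow> 'a \<Rightarrow> real" where
  "outside_probability G W \<Omega> u x = measure G {\<omega>\<in>space G. x + (W (max 0 u) \<omega> - W 0 \<omega>) \<notin> \<Omega>}"

lemma exit_probability_measurable:
  fixes W :: "real \<Rightarrow> 'w \<Rightarrow> 'a::euclidean_space"
  assumes bm: "brownian_motion G x0 W"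
  shows "Measurable.pred G (\<lambda>\<omega>. stays_inside \<Omega> (\<lambda>r. x + (W r \<omega> - W 0 \<omega>)) u)"
    and "(\<lambda>(u, x). exit_probability G W \<Omega> u x) \<in> borel_measurable (borel \<Otimes>\<^sub>M borel)"
proof -
  have WG[measurable]: "W t \<in> borel_measurable G" if "0 \<le> t" for t using brownian_motionD(2)[OF bm that] .
  show "Measurable.pred G (\<lambda>\<omega>. stays_inside \<Omega> (\<lambda>r. x + (W r \<omega> - W 0 \<omega>)) u)"
    by (rule measurable_stays_inside) measurable
  have "Measurable.pred ((borel \<Otimes>\<^sub>M borel) \<Otimes>\<^sub>M G) (\<lambda>q. stays_inside \<Omega> (\<lambda>r. snd (fst q) + (W r (snd q) - W 0 (snd q))) (fst (fst q)))"
    by (rule measurable_stays_inside) measurable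
  then have "Measurable.pred ((borel \<Otimes>\<^sub>M borel) \<Otimes>\<^sub>M G) (\<lambda>(k, \<omega>). \<not> stays_inside \<Omega> (\<lambda>r. snd k + (W r \<omega> - W 0 \<omega>)) (fst k))"
    by (simp add: case_prod_unfold pred_intros_logic)
  from measurable_section_prob[OF brownian_motionD(1)[OF bm] this]
  show "(\<lambda>(u, x). exit_probability G W \<Omega> u x) \<in> borel_measurable (borel \<Otimes>\<^sub>M borel)"
    by (simp add: exit_probability_def case_prod_unfold)
qed

lemma outside_probability_measurable:
  fixes W :: "real \<Rightarrow> 'w \<Rightarrow> 'a::euclidean_space"
  assumes bm: "brownian_motion G x0 W" and \<Omega>[measurable]: "\<Omega> \<in> sets borel"
  shows "0 \<le> s \<Longrightarrow> {\<omega>\<in>space G. x + (W s \<omega> - W 0 \<omega>) \<notin> \<Omega>} \<in> sets G"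
    and "(\<lambda>(u, x). outside_probability G W \<Omega> u x) \<in> borel_measurable (borel \<Otimes>\<^sub>M borel)"
proof -
  have WG[measurable]: "W t \<in> borel_measurable G" if "0 \<le> t" for t using brownian_motionD(2)[OF bm that] .
  have W0[measurable]: "W 0 \<in> borel_measurable G" by (rule WG) simp
  show "{\<omega>\<in>space G. x + (W s \<omega> - W 0 \<omega>) \<notin> \<Omega>} \<in> sets G" if "0 \<le> s"
    using WG[OF that] by measurable
  have [measurable]: "(\<lambda>(u, \<omega>). W (max 0 u) \<omega>) \<in> borel_measurable (borel \<Otimes>\<^sub>M G)"
    by (rule measurable_continuous_process) (use WG brownian_motionD(4)[OF bm] in auto)
  have "(\<lambda>q. (case (fst (fst q), snd q) of (u, \<omega>) \<Rightarrow> W (max 0 u) \<omega>)) \<in> borel_measurable ((borel \<Otimes>\<^sub>M borel) \<Otimes>\<^sub>M G)"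
    by measurable
  then have [measurable]: "(\<lambda>q. W (max 0 (fst (fst q))) (snd q)) \<in> borel_measurable ((borel \<Otimes>\<^sub>M borel) \<Otimes>\<^sub>M G)" by simp
  have "Measurable.pred ((borel \<Otimes>\<^sub>M borel) \<Otimes>\<^sub>M G) (\<lambda>q. snd (fst q) + (W (max 0 (fst (fst q))) (snd q) - W 0 (snd q)) \<notin> \<Omega>)"
    by measurable
  then have "Measurable.pred ((borel \<Otimes>\<^sub>M borel) \<Otimes>\<^sub>M G) (\<lambda>(k, \<omega>). snd k + (W (max 0 (fst k)) \<omega> - W 0 \<omega>) \<notin> \<Omega>)"
    by (simp add: case_prod_unfold)
  from measurable_section_prob[OF brownian_motionD(1)[OF bm] this]
  show "(\<lambda>(u, x). outside_probability G W \<Omega> u x) \<in> borel_measurable (borel \<Otimes>\<^sub>M borel)"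
    by (simp add: outside_probability_def case_prod_unfold)
qed

lemma time_changed_survival_probability:
  fixes W :: "real \<Rightarrow> 'w \<Rightarrow> 'a::euclidean_space" and W' :: "real \<Rightarrow> 'v \<Rightarrow> 'a"
  assumes W: "brownian_motion N x W" and bm: "brownian_motion G x0 W'" and U: "time_change M U"
    and \<Omega>: "open \<Omega>" "- \<Omega> \<noteq> {}" and t: "0 < t"
  shows "\<P>(p in N \<Otimes>\<^sub>M M. exit_time (Some ` \<Omega>) (\<lambda>s. killed \<Omega> (\<lambda>r. W r (fst p)) (U s (snd p))) > ereal t)
    = (\<integral>m. 1 - exit_probability G W' \<Omega> (U t m) x \<partial>M)"
proof -
  interpret N: prob_space N by (rule brownian_motionD(1)[OF W])
  interpret G: prob_space G by (rule brownian_motionD(1)[OF bm])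
  interpret M: prob_space M using U by (simp add: time_change_def)
  have Wm[measurable]: "W t \<in> borel_measurable N" if "0 \<le> t" for t using brownian_motionD(2)[OF W that] .
  have [measurable]: "U t \<in> borel_measurable M" using U t by (simp add: time_change_def)
  have Upos: "0 < U s m" if "0 < s" "m \<in> space M" for s m using U that by (simp add: time_change_def)
  define E where "E = {p\<in>space (N \<Otimes>\<^sub>M M). stays_inside \<Omega> (\<lambda>r. W r (fst p)) (U t (snd p))}"
  have "Measurable.pred (N \<Otimes>\<^sub>M M) (\<lambda>p. stays_inside \<Omega> (\<lambda>r. W r (fst p)) (U t (snd p)))"
    by (rule measurable_stays_inside) measurable
  then have Em: "E \<in> sets (N \<Otimes>\<^sub>M M)" by (simp add: E_def)
  have "exit_time (Some ` \<Omega>) (\<lambda>s. killed \<Omega> (\<lambda>r. W r (fst p)) (U s (snd p))) > ereal t \<longleftrightarrow> stays_inside \<Omega> (\<lambda>r. W r (fst p)) (U t (snd p))"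
    if p: "p \<in> space (N \<Otimes>\<^sub>M M)" for p
  proof -
    have f: "fst p \<in> space N" "snd p \<in> space M" using p by (auto simp: space_pair_measure)
    have mono: "mono_on {0..} (\<lambda>s. U s (snd p))" "cadlag (\<lambda>s. U s (snd p))" using U f(2) by (auto simp: time_change_def)
    show ?thesis
      using time_changed_killed_alive_iff[OF \<Omega>(1) brownian_motionD(4)[OF W f(1)] t mono Upos[OF _ f(2)]]
        stays_inside_iff[OF \<Omega> brownian_motionD(4)[OF W f(1)] Upos[OF t f(2)]] by blast
  qed
  then have "{p\<in>space (N \<Otimes>\<^sub>M M). exit_time (Some ` \<Omega>) (\<lambda>s. killed \<Omega> (\<lambda>r. W r (fst p)) (U s (snd p))) > ereal t} = E"
    unfolding E_def by blast
  then have "\<P>(p in N \<Otimes>\<^sub>M M. exit_time (Some ` \<Omega>) (\<lambda>s. killed \<Omega> (\<lambda>r. W r (fst p)) (U s (snd p))) > ereal t) = measure (N \<Otimes>\<^sub>M M) E"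
    by simp
  also have "\<dots> = (\<integral>m. measure N {\<omega>\<in>space N. (\<omega>, m) \<in> E} \<partial>M)"
    by (rule measure_pair_sections[OF N.prob_space_axioms M.prob_space_axioms Em])
  also have "\<dots> = (\<integral>m. 1 - exit_probability G W' \<Omega> (U t m) x \<partial>M)"
  proof (rule Bochner_Integration.integral_cong[OF refl])
    fix m assume "m \<in> space M"
    then have "measure N {\<omega>\<in>space N. (\<omega>, m) \<in> E} = measure N {\<omega>\<in>space N. stays_inside \<Omega> (\<lambda>r. W r \<omega>) (U t m)}"
      by (intro arg_cong[where f="measure N"]) (auto simp: E_def space_pair_measure)
    also have "\<dots> = measure G {\<omega>\<in>space G. stays_inside \<Omega> (\<lambda>r. x + (W' r \<omega> - W' 0 \<omega>)) (U t m)}"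
      by (rule brownian_law_transfer(1)[OF W bm])
    also have "\<dots> = 1 - exit_probability G W' \<Omega> (U t m) x"
      unfolding exit_probability_def
      using G.prob_neg[of "\<lambda>\<omega>. stays_inside \<Omega> (\<lambda>r. x + (W' r \<omega> - W' 0 \<omega>)) (U t m)"] exit_probability_measurable(1)[OF bm, of \<Omega> x "U t m"] by simp
    finally show "measure N {\<omega>\<in>space N. (\<omega>, m) \<in> E} = 1 - exit_probability G W' \<Omega> (U t m) x" .
  qed
  finally show ?thesis .
qed

lemma time_changed_position_probability:
  fixes W :: "real \<Rightarrow> 'w \<Rightarrow> 'a::euclidean_space" and W' :: "real \<Rightarrow> 'v \<Rightarrow> 'a"
  assumes W: "brownian_motion N x W" and bm: "brownian_motion G x0 W'" and U: "time_change M U"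
    and \<Omega>[measurable]: "\<Omega> \<in> sets borel" and t: "0 < t"
  shows "\<P>(p in N \<Otimes>\<^sub>M M. W (U t (snd p)) (fst p) \<in> \<Omega>) = (\<integral>m. 1 - outside_probability G W' \<Omega> (U t m) x \<partial>M)"
proof -
  interpret N: prob_space N by (rule brownian_motionD(1)[OF W])
  interpret G: prob_space G by (rule brownian_motionD(1)[OF bm])
  interpret M: prob_space M using U by (simp add: time_change_def)
  have [measurable]: "U t \<in> borel_measurable M" using U t by (simp add: time_change_def)
  have Upos: "0 < U t m" if "m \<in> space M" for m using U t that by (simp add: time_change_def)
  define E where "E = {p\<in>space (N \<Otimes>\<^sub>M M). W (max 0 (U t (snd p))) (fst p) \<in> \<Omega>}"
  have [measurable]: "(\<lambda>(u, \<omega>). W (max 0 u) \<omega>) \<in> borel_measurable (borel \<Otimes>\<^sub>M N)"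
    by (rule measurable_continuous_process) (use brownian_motionD(2,4)[OF W] in auto)
  have "(\<lambda>p. (case (U t (snd p), fst p) of (u, \<omega>) \<Rightarrow> W (max 0 u) \<omega>)) \<in> borel_measurable (N \<Otimes>\<^sub>M M)"
    by measurable
  then have [measurable]: "(\<lambda>p. W (max 0 (U t (snd p))) (fst p)) \<in> borel_measurable (N \<Otimes>\<^sub>M M)" by simp
  have Em: "E \<in> sets (N \<Otimes>\<^sub>M M)" unfolding E_def by measurable
  have "{p\<in>space (N \<Otimes>\<^sub>M M). W (U t (snd p)) (fst p) \<in> \<Omega>} = E"
    using Upos by (auto simp: E_def space_pair_measure max_absorb2 less_imp_le)
  then have "\<P>(p in N \<Otimes>\<^sub>M M. W (U t (snd p)) (fst p) \<in> \<Omega>) = measure (N \<Otimes>\<^sub>M M) E" by simp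
  also have "\<dots> = (\<integral>m. measure N {\<omega>\<in>space N. (\<omega>, m) \<in> E} \<partial>M)"
    by (rule measure_pair_sections[OF N.prob_space_axioms M.prob_space_axioms Em])
  also have "\<dots> = (\<integral>m. 1 - outside_probability G W' \<Omega> (U t m) x \<partial>M)"
  proof (rule Bochner_Integration.integral_cong[OF refl])
    fix m assume m: "m \<in> space M"
    have u: "0 \<le> U t m" using Upos[OF m] by simp
    have "measure N {\<omega>\<in>space N. (\<omega>, m) \<in> E} = measure N {\<omega>\<in>space N. W (U t m) \<omega> \<in> \<Omega>}"
      using m u by (intro arg_cong[where f="measure N"]) (auto simp: E_def space_pair_measure max_absorb2)
    also have "\<dots> = measure G {\<omega>\<in>space G. x + (W' (U t m) \<omega> - W' 0 \<omega>) \<in> \<Omega>}"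
      by (rule brownian_law_transfer(2)[OF W bm u \<Omega>])
    also have "\<dots> = 1 - outside_probability G W' \<Omega> (U t m) x"
      using G.prob_neg[of "\<lambda>\<omega>. x + (W' (U t m) \<omega> - W' 0 \<omega>) \<notin> \<Omega>"] outside_probability_measurable(1)[OF bm \<Omega> u, of x] u
      by (simp add: outside_probability_def max_absorb2)
    finally show "measure N {\<omega>\<in>space N. (\<omega>, m) \<in> E} = 1 - outside_probability G W' \<Omega> (U t m) x" .
  qed
  finally show ?thesis .
qed

text \<open>
  The constants \<open>2 / \<surd>\<pi>\<close> and \<open>1 / \<surd>\<pi>\<close> are \<open>\<surd>2 E\<bar>Z\<bar>\<close> and, by symmetry, half of it, where
  \<open>E\<bar>Z\<bar> = \<surd>(2 / \<pi>)\<close>.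
\<close>
lemma std_normal_positive_parts:
  "integrable std_normal (\<lambda>z. (sqrt 2 * \<bar>z\<bar>)\<^sup>2)" "integrable std_normal (\<lambda>z. (sqrt 2 * z)\<^sup>2)"
  "(\<integral>z. max 0 (sqrt 2 * \<bar>z\<bar>) \<partial>std_normal) = 2 / sqrt pi" "(\<integral>z. max 0 (sqrt 2 * z) \<partial>std_normal) = 1 / sqrt pi"
proof -
  have ik: "integrable std_normal (\<lambda>z. z ^ k)" for k
    using integrable_std_normal_moment[of k] by (subst integrable_density) (auto simp: normal_density_nonneg)
  have ia: "integrable std_normal (\<lambda>z. \<bar>z\<bar>)"
    using integrable_std_normal_moment_abs[of 1] by (subst integrable_density) (auto simp: normal_density_nonneg)
  have ea: "(\<integral>z. \<bar>z\<bar> \<partial>std_normal) = sqrt (2 / pi)"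
    using integral_std_normal_moment_abs_odd[of 0] by (subst integral_density) (auto simp: normal_density_nonneg)
  have e1: "(\<integral>z. z \<partial>std_normal) = 0"
    using integral_std_normal_moment_odd[of 0] by (subst integral_density) (auto simp: normal_density_nonneg)
  show "integrable std_normal (\<lambda>z. (sqrt 2 * \<bar>z\<bar>)\<^sup>2)" "integrable std_normal (\<lambda>z. (sqrt 2 * z)\<^sup>2)"
    using ik[of 2] by (simp_all add: power_mult_distrib)
  have "(\<integral>z. max 0 (sqrt 2 * \<bar>z\<bar>) \<partial>std_normal) = (\<integral>z. sqrt 2 * \<bar>z\<bar> \<partial>std_normal)" by (simp add: max_absorb2)
  also have "\<dots> = sqrt 2 * sqrt (2 / pi)" using ia ea by simp
  also have "\<dots> = 2 / sqrt pi" by (simp add: real_sqrt_divide)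
  finally show a: "(\<integral>z. max 0 (sqrt 2 * \<bar>z\<bar>) \<partial>std_normal) = 2 / sqrt pi" .
  have "(\<integral>z. max 0 (sqrt 2 * z) \<partial>std_normal) = (\<integral>z. sqrt 2 / 2 * \<bar>z\<bar> + sqrt 2 / 2 * z \<partial>std_normal)"
    by (intro Bochner_Integration.integral_cong) (auto simp: max_def abs_if mult_le_0_iff zero_le_mult_iff)
  also have "\<dots> = sqrt 2 / 2 * sqrt (2 / pi)" using ia ik[of 1] ea e1 by simp
  also have "\<dots> = 1 / sqrt pi" by (simp add: real_sqrt_divide)
  finally show "(\<integral>z. max 0 (sqrt 2 * z) \<partial>std_normal) = 1 / sqrt pi" .
qed

section \<open>Intervals and smooth domains\<close>

lemma ex_basis_vector_DIM_1:
  assumes "DIM('a::euclidean_space) = 1"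
  obtains e :: "'a::euclidean_space" where "Basis = {e}" "norm e = 1" "\<And>x. x = (x \<bullet> e) *\<^sub>R e"
proof -
  obtain e :: 'a where e: "Basis = {e}" using assms card_1_singletonE by blast
  have "x = (x \<bullet> e) *\<^sub>R e" for x
  proof -
    have "(\<Sum>b\<in>{e}. (x \<bullet> b) *\<^sub>R b) = x" unfolding e[symmetric] by (rule euclidean_representation)
    then show ?thesis by simp
  qed
  moreover have "norm e = 1" using e by (metis insertI1 norm_Basis)
  ultimately show ?thesis using that e by blast
qed

lemma sphere_card_DIM_1:
  fixes c :: "'a::euclidean_space"
  assumes "DIM('a) = 1" "0 < \<rho>"
  shows "card (sphere c \<rho>) = 2"
proof -
  obtain e :: 'a where ne: "norm e = 1" and x: "\<And>x. x = (x \<bullet> e) *\<^sub>R e"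
    using ex_basis_vector_DIM_1[OF assms(1)] by metis
  have "sphere c \<rho> = {c + \<rho> *\<^sub>R e, c - \<rho> *\<^sub>R e}"
  proof (intro set_eqI iffI)
    fix y assume "y \<in> sphere c \<rho>"
    then have n: "norm (y - c) = \<rho>" by (simp add: dist_norm norm_minus_commute)
    have yc: "y - c = ((y - c) \<bullet> e) *\<^sub>R e" by (rule x)
    then have "norm (y - c) = \<bar>(y - c) \<bullet> e\<bar>" using ne by (metis mult.right_neutral norm_scaleR)
    then have "(y - c) \<bullet> e = \<rho> \<or> (y - c) \<bullet> e = - \<rho>" using n by linarith
    then have "y - c = \<rho> *\<^sub>R e \<or> y - c = (- \<rho>) *\<^sub>R e" using yc by metis
    then show "y \<in> {c + \<rho> *\<^sub>R e, c - \<rho> *\<^sub>R e}" by (auto simp: algebra_simps)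
  next
    fix y assume "y \<in> {c + \<rho> *\<^sub>R e, c - \<rho> *\<^sub>R e}"
    then show "y \<in> sphere c \<rho>" using assms(2) ne by (auto simp: dist_norm)
  qed
  moreover have "c + \<rho> *\<^sub>R e \<noteq> c - \<rho> *\<^sub>R e"
  proof
    assume "c + \<rho> *\<^sub>R e = c - \<rho> *\<^sub>R e"
    then have "(2 * \<rho>) *\<^sub>R e = 0" by (simp add: algebra_simps scaleR_2[symmetric])
    then show False using assms(2) ne by auto
  qed
  ultimately show ?thesis by simp
qed

lemma inner_tube_ball:
  fixes c :: "'a::euclidean_space"
  assumes "0 < r" "r < \<rho>"
  shows "inner_tube (ball c \<rho>) r = ball c \<rho> - cball c (\<rho> - r)"
proof (intro set_eqI)
  fix x :: 'a
  have "infdist x (- ball c \<rho>) < r \<longleftrightarrow> \<rho> - r < dist c x" if x: "x \<in> ball c \<rho>"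
  proof
    assume i: "infdist x (- ball c \<rho>) < r"
    obtain z where "z \<notin> ball c \<rho>" "dist x z = infdist x (- ball c \<rho>)"
      using nearest_complement_point[of "ball c \<rho>" x] x by auto
    then show "\<rho> - r < dist c x" using i dist_triangle[of c z x] by auto
  next
    assume d: "\<rho> - r < dist c x"
    define y where "y = c + (\<rho> / norm (x - c)) *\<^sub>R (x - c)"
    have n: "norm (x - c) > \<rho> - r" "norm (x - c) < \<rho>" using d x by (auto simp: dist_norm norm_minus_commute)
    have n0: "norm (x - c) > 0" using n assms by linarith
    have "dist c y = \<rho>" using n0 assms by (simp add: y_def dist_norm)
    then have "y \<in> - ball c \<rho>" by simp
    then have "infdist x (- ball c \<rho>) \<le> dist x y" by (rule infdist_le)
    also have "x - y = (1 - \<rho> / norm (x - c)) *\<^sub>R (x - c)" by (simp add: y_def algebra_simps)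
    then have "dist x y = \<bar>1 - \<rho> / norm (x - c)\<bar> * norm (x - c)" by (simp add: dist_norm)
    also have "\<dots> = \<bar>(1 - \<rho> / norm (x - c)) * norm (x - c)\<bar>" by (simp add: abs_mult)
    also have "(1 - \<rho> / norm (x - c)) * norm (x - c) = norm (x - c) - \<rho>" using n0 by (simp add: left_diff_distrib)
    also have "\<bar>norm (x - c) - \<rho>\<bar> < r" using n by auto
    finally show "infdist x (- ball c \<rho>) < r" .
  qed
  then show "x \<in> inner_tube (ball c \<rho>) r \<longleftrightarrow> x \<in> ball c \<rho> - cball c (\<rho> - r)"
    by (auto simp: inner_tube_def)
qed

text \<open>
  The tube consists of two intervals of length \<open>r\<close>, one at each of the two boundary points.
\<close>
lemma interval_content_tendsto:
  fixes c :: "'a::euclidean_space"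
  assumes d: "DIM('a) = 1" and \<rho>: "0 < \<rho>"
  shows "((\<lambda>r. measure lborel (inner_tube (ball c \<rho>) r) / r) \<longlongrightarrow> boundary_measure (ball c \<rho>)) (at_right 0)"
proof -
  have b: "boundary_measure (ball c \<rho>) = 2"
    using sphere_card_DIM_1[OF d \<rho>, of c] \<rho> by (simp add: boundary_measure_def d frontier_ball)
  have "measure lborel (inner_tube (ball c \<rho>) r) / r = 2" if r: "0 < r" "r < \<rho>" for r
  proof -
    have "measure lborel (ball c \<rho> - cball c (\<rho> - r)) = measure lborel (ball c \<rho>) - measure lborel (cball c (\<rho> - r))"
      using r emeasure_bounded_finite[OF bounded_ball, of c \<rho>] by (intro measure_Diff) auto
    also have "\<dots> = 2 * \<rho> - 2 * (\<rho> - r)" using r \<rho> d by (simp add: content_ball content_cball)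
    finally show ?thesis using r inner_tube_ball[OF r, of c] by simp
  qed
  then have "eventually (\<lambda>r. measure lborel (inner_tube (ball c \<rho>) r) / r = 2) (at_right 0)"
    using \<rho> by (auto simp: eventually_at_right_field intro!: exI[of _ \<rho>])
  then show ?thesis unfolding b by (rule tendsto_eventually)
qed

text \<open>
  An interval is a one-dimensional ball; an empty one has neither boundary nor tube. The
  paraboloids at a point of a sphere enclose it at every distance, so that any positive number can
  be taken for \<open>R\<close>.
\<close>
lemma domain_boundary_layer:
  fixes \<Omega> :: "'a::euclidean_space set"
  assumes dom: "(DIM('a) = 1 \<and> (\<exists>a b. \<Omega> = box a b)) \<or>
              (DIM('a) \<ge> 2 \<and> bounded \<Omega> \<and> connected \<Omega> \<and> C11_open_set \<Omega>)"
  shows "open \<Omega>" "bounded \<Omega>" "\<exists>R \<Lambda>. 0 < R \<and> 0 < \<Lambda> \<and> tangent_parabolas \<Omega> R \<Lambda>"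
    "((\<lambda>r. measure lborel (inner_tube \<Omega> r) / r) \<longlongrightarrow> boundary_measure \<Omega>) (at_right 0)"
proof -
  have "open \<Omega> \<and> bounded \<Omega> \<and> (\<exists>R \<Lambda>. 0 < R \<and> 0 < \<Lambda> \<and> tangent_parabolas \<Omega> R \<Lambda>) \<and>
    ((\<lambda>r. measure lborel (inner_tube \<Omega> r) / r) \<longlongrightarrow> boundary_measure \<Omega>) (at_right 0)"
    using dom
  proof
    assume "DIM('a) = 1 \<and> (\<exists>a b. \<Omega> = box a b)"
    then obtain a b where d: "DIM('a) = 1" and \<Omega>: "\<Omega> = box a b" by blast
    show ?thesis
    proof (cases "\<Omega> = {}")
      case True
      have "tangent_parabolas \<Omega> 1 1" using True by (simp add: tangent_parabolas_def)
      moreover have "inner_tube \<Omega> r = {}" for r using True by (simp add: inner_tube_def)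
      ultimately show ?thesis using True d by (auto simp: boundary_measure_def intro!: exI[of _ 1])
    next
      case False
      obtain e :: 'a where e: "Basis = {e}" and ne: "norm e = 1" and x: "\<And>x. x = (x \<bullet> e) *\<^sub>R e"
        using ex_basis_vector_DIM_1[OF d] by metis
      define c where "c = (1 / 2) *\<^sub>R (a + b)"
      define \<rho> where "\<rho> = (b \<bullet> e - a \<bullet> e) / 2"
      have \<rho>: "0 < \<rho>" using False \<Omega> e by (auto simp: \<rho>_def box_ne_empty)
      have "\<Omega> = ball c \<rho>"
      proof (intro set_eqI)
        fix y
        have "norm (y - c) = \<bar>(y - c) \<bullet> e\<bar>" using x[of "y - c"] ne by (metis mult.right_neutral norm_scaleR)
        also have "(y - c) \<bullet> e = y \<bullet> e - (a \<bullet> e + b \<bullet> e) / 2" by (simp add: c_def inner_diff_left inner_add_left)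
        finally have "y \<in> ball c \<rho> \<longleftrightarrow> \<bar>y \<bullet> e - (a \<bullet> e + b \<bullet> e) / 2\<bar> < (b \<bullet> e - a \<bullet> e) / 2"
          by (simp add: dist_norm norm_minus_commute \<rho>_def)
        also have "\<dots> \<longleftrightarrow> a \<bullet> e < y \<bullet> e \<and> y \<bullet> e < b \<bullet> e" by (auto simp: abs_less_iff field_simps)
        finally show "y \<in> \<Omega> \<longleftrightarrow> y \<in> ball c \<rho>" by (simp add: \<Omega> mem_box e)
      qed
      then show ?thesis using ball_tangent_parabolas[OF \<rho>, of c "1 / (2 * \<rho>)"] interval_content_tendsto[OF d \<rho>, of c] \<rho>
        by (auto intro!: exI[of _ "1 / (2 * \<rho>)"])
    qed
  next
    assume *: "DIM('a) \<ge> 2 \<and> bounded \<Omega> \<and> connected \<Omega> \<and> C11_open_set \<Omega>"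
    obtain R \<Lambda> where R: "0 < R" "0 < \<Lambda>" and ch: "\<And>z. z \<in> frontier \<Omega> \<Longrightarrow> \<exists>\<nu> \<phi>. graph_chart \<Omega> R \<Lambda> z \<nu> \<phi>"
      using C11_open_set_charts * by blast
    have "tangent_parabolas \<Omega> R \<Lambda>" by (rule graph_charts_tangent_parabolas[OF R(2) ch])
    moreover have "boundary_measure \<Omega> = enn2real (hausdorff_measure (DIM('a) - 1) (frontier \<Omega>))"
      using * by (simp add: boundary_measure_def)
    moreover have "open \<Omega>" using * by (simp add: C11_open_set_def)
    ultimately show ?thesis using inner_tube_content_tendsto[of \<Omega>] * R by auto
  qed
  then show "open \<Omega>" "bounded \<Omega>" "\<exists>R \<Lambda>. 0 < R \<and> 0 < \<Lambda> \<and> tangent_parabolas \<Omega> R \<Lambda>"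
    "((\<lambda>r. measure lborel (inner_tube \<Omega> r) / r) \<longlongrightarrow> boundary_measure \<Omega>) (at_right 0)" by blast+
qed

section \<open>The heat content asymptotics\<close>

theorem proposition2p2:
  fixes N :: "'a::euclidean_space \<Rightarrow> 'w measure"
    and W :: "real \<Rightarrow> 'w \<Rightarrow> 'a"
    and M :: "'u measure"
    and U :: "real \<Rightarrow> 'u \<Rightarrow> real"
    and \<Omega> :: "'a set"
  assumes W: "\<And>x. brownian_motion (N x) x W"
    and U: "time_change M U"
    and dom: "(DIM('a) = 1 \<and> (\<exists>a b. \<Omega> = box a b)) \<or>
              (DIM('a) \<ge> 2 \<and> bounded \<Omega> \<and> connected \<Omega> \<and> C11_open_set \<Omega>)"
    and tail: "\<And>\<delta>. \<delta> > 0 \<Longrightarrow>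
       (\<lambda>t. \<P>(\<omega> in M. U t \<omega> > \<delta>)) \<in> o[at_right 0](truncated_sqrt_mean M U \<delta>)"
    and ratio: "\<And>\<delta>1 \<delta>2. \<delta>1 > 0 \<Longrightarrow> \<delta>2 > 0 \<Longrightarrow>
       ((\<lambda>t. truncated_sqrt_mean M U \<delta>1 t / truncated_sqrt_mean M U \<delta>2 t) \<longlongrightarrow> 1) (at_right 0)"
  shows "\<forall>\<delta>>0.
       ((\<lambda>t. (measure lborel \<Omega> - spectral_heat_content N W M U \<Omega> t) / truncated_sqrt_mean M U \<delta> t)
          \<longlongrightarrow> 2 * boundary_measure \<Omega> / sqrt pi) (at_right 0) \<and>
       ((\<lambda>t. (measure lborel \<Omega> - regular_heat_content N W M U \<Omega> t) / truncated_sqrt_mean M U \<delta> t)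
          \<longlongrightarrow> boundary_measure \<Omega> / sqrt pi) (at_right 0)"
proof -
  define G where "G = N 0"
  have bm: "brownian_motion G 0 W" unfolding G_def by (rule W)
  have M: "prob_space M" using U by (simp add: time_change_def)
  have \<Omega>: "open \<Omega>" "bounded \<Omega>" and L: "((\<lambda>r. measure lborel (inner_tube \<Omega> r) / r) \<longlongrightarrow> boundary_measure \<Omega>) (at_right 0)"
    using domain_boundary_layer[OF dom] by auto
  obtain R \<Lambda> where R: "0 < R" "0 < \<Lambda>" "tangent_parabolas \<Omega> R \<Lambda>" using domain_boundary_layer(3)[OF dom] by blast
  have ne: "- \<Omega> \<noteq> {}" using \<Omega>(2) not_bounded_UNIV by (metis Compl_UNIV_eq double_complement)
  have \<Omega>m: "\<Omega> \<in> sets borel" using \<Omega> by simp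
  let ?p1 = "exit_probability G W \<Omega>" and ?p2 = "outside_probability G W \<Omega>"
  have "0 \<le> ?p1 u x" "?p1 u x \<le> 1" "0 \<le> ?p2 u x" "?p2 u x \<le> 1" for u x
    using prob_space.prob_le_1[OF brownian_motionD(1)[OF bm]] by (simp_all add: exit_probability_def outside_probability_def)
  note p01 = this
  have contG: "continuous_on {0..} (\<lambda>r. x + (W r \<omega> - W 0 \<omega>))" if "\<omega> \<in> space G" for \<omega> x
    using brownian_motionD(4)[OF bm that] by (intro continuous_intros)
  \<comment> \<open>The exit event is rewritten in the form whose measurability is known.\<close>
  have A: "{\<omega>\<in>space G. \<not> (\<forall>r. 0 < r \<and> r \<le> s \<longrightarrow> x + (W r \<omega> - W 0 \<omega>) \<in> \<Omega>)} = {\<omega>\<in>space G. \<not> stays_inside \<Omega> (\<lambda>r. x + (W r \<omega> - W 0 \<omega>)) s}"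
    if "0 < s" for x s
    using stays_inside_iff[OF \<Omega>(1) ne contG that] by blast
  have Am: "{\<omega>\<in>space G. \<not> (\<forall>r. 0 < r \<and> r \<le> s \<longrightarrow> x + (W r \<omega> - W 0 \<omega>) \<in> \<Omega>)} \<in> sets G" if "0 < s" for x s
    unfolding A[OF that] using exit_probability_measurable(1)[OF bm, of \<Omega> x s] by measurable
  have Bm: "{\<omega>\<in>space G. x + (W s \<omega> - W 0 \<omega>) \<notin> \<Omega>} \<in> sets G" if "0 < s" for x s
    using that by (intro outside_probability_measurable(1)[OF bm \<Omega>m]) simp
  note profile = brownian_boundary_layer_profile[OF bm \<Omega> R(3,1,2) Am Bm]
  have prof1: "boundary_layer_profile \<Omega> ?p1 (\<lambda>z. sqrt 2 * \<bar>z\<bar>)"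
    by (rule boundary_layer_profile_cong[THEN iffD1, OF _ profile(1)]) (simp_all only: A exit_probability_def)
  have prof2: "boundary_layer_profile \<Omega> ?p2 (\<lambda>z. sqrt 2 * z)"
    by (rule boundary_layer_profile_cong[THEN iffD1, OF _ profile(2)]) (simp_all add: outside_probability_def max_absorb2)
  note i1 = heat_loss_average[OF exit_probability_measurable(2)[OF bm] p01(1,2) \<Omega>m \<Omega>(2)]
    and i2 = heat_loss_average[OF outside_probability_measurable(2)[OF bm \<Omega>m] p01(3,4) \<Omega>m \<Omega>(2)]
  have lim1: "((\<lambda>s. (LINT x:\<Omega>|lborel. ?p1 s x) / sqrt s) \<longlongrightarrow> boundary_measure \<Omega> * (2 / sqrt pi)) (at_right 0)"
    by (rule boundary_layer_integral_tendsto[OF \<Omega> ne L _ std_normal_positive_parts(1,3) i1(1) prof1]) measurable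
  have lim2: "((\<lambda>s. (LINT x:\<Omega>|lborel. ?p2 s x) / sqrt s) \<longlongrightarrow> boundary_measure \<Omega> * (1 / sqrt pi)) (at_right 0)"
    by (rule boundary_layer_integral_tendsto[OF \<Omega> ne L _ std_normal_positive_parts(2,4) i2(1) prof2]) measurable
  have spectral: "measure lborel \<Omega> - spectral_heat_content N W M U \<Omega> t = (\<integral>m. (LINT x:\<Omega>|lborel. ?p1 (U t m) x) \<partial>M)" if t: "0 < t" for t
    unfolding spectral_heat_content_def time_changed_survival_probability[OF W bm U \<Omega>(1) ne t]
    using U t by (intro i1(4)[OF M]) (simp add: time_change_def)
  have regular: "measure lborel \<Omega> - regular_heat_content N W M U \<Omega> t = (\<integral>m. (LINT x:\<Omega>|lborel. ?p2 (U t m) x) \<partial>M)" if t: "0 < t" for t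
    unfolding regular_heat_content_def time_changed_position_probability[OF W bm U \<Omega>m t]
    using U t by (intro i2(4)[OF M]) (simp add: time_change_def)
  have pos: "eventually (\<lambda>t::real. 0 < t) (at_right 0)" by (rule eventually_at_right_less)
  show ?thesis
  proof (intro allI impI conjI)
    fix \<delta> :: real assume \<delta>: "0 < \<delta>"
    let ?T = "truncated_sqrt_mean M U \<delta>"
    have "((\<lambda>t. (\<integral>m. (LINT x:\<Omega>|lborel. ?p1 (U t m) x) \<partial>M) / ?T t) \<longlongrightarrow> boundary_measure \<Omega> * (2 / sqrt pi)) (at_right 0)"
      by (rule time_change_asymptotics[OF U i1(2,3) lim1 tail ratio \<delta>])
    moreover have "eventually (\<lambda>t. (\<integral>m. (LINT x:\<Omega>|lborel. ?p1 (U t m) x) \<partial>M) / ?T t =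
        (measure lborel \<Omega> - spectral_heat_content N W M U \<Omega> t) / ?T t) (at_right 0)"
      using pos by eventually_elim (simp add: spectral)
    ultimately have "((\<lambda>t. (measure lborel \<Omega> - spectral_heat_content N W M U \<Omega> t) / ?T t)
          \<longlongrightarrow> boundary_measure \<Omega> * (2 / sqrt pi)) (at_right 0)" by (rule Lim_transform_eventually)
    then show "((\<lambda>t. (measure lborel \<Omega> - spectral_heat_content N W M U \<Omega> t) / ?T t)
          \<longlongrightarrow> 2 * boundary_measure \<Omega> / sqrt pi) (at_right 0)" by (simp add: mult.commute)
    have "((\<lambda>t. (\<integral>m. (LINT x:\<Omega>|lborel. ?p2 (U t m) x) \<partial>M) / ?T t) \<longlongrightarrow> boundary_measure \<Omega> * (1 / sqrt pi)) (at_right 0)"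
      by (rule time_change_asymptotics[OF U i2(2,3) lim2 tail ratio \<delta>])
    moreover have "eventually (\<lambda>t. (\<integral>m. (LINT x:\<Omega>|lborel. ?p2 (U t m) x) \<partial>M) / ?T t =
        (measure lborel \<Omega> - regular_heat_content N W M U \<Omega> t) / ?T t) (at_right 0)"
      using pos by eventually_elim (simp add: regular)
    ultimately have "((\<lambda>t. (measure lborel \<Omega> - regular_heat_content N W M U \<Omega> t) / ?T t)
          \<longlongrightarrow> boundary_measure \<Omega> * (1 / sqrt pi)) (at_right 0)" by (rule Lim_transform_eventually)
    then show "((\<lambda>t. (measure lborel \<Omega> - regular_heat_content N W M U \<Omega> t) / ?T t)
          \<longlongrightarrow> boundary_measure \<Omega> / sqrt pi) (at_right 0)" by simp
  qed
qed

end
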